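(* Let $c\in\mathbb R$, $\varepsilon>0$, $\sigma\in\{-1,1\}$. Consider unit-speed harmonic products $G_\gamma$, $\gamma=(ae^{is_1},be^{is_2})$ with $a,b>0$, $a^2+b^2=1$, whose conserved phase momenta are normalized by $$\bigl(Fa^2s_1',Fb^2s_2'\bigr)=\sigma\sqrt{\varepsilon}\,(1,c),\qquad F=\ell_1^{k_1}\ell_2^{k_2}.$$ 1. Let $I$ be an interval. If $a:I\to(0,1)$ is smooth and $R=1-a^2-(a')^2>0$, then (for the fixed $c,\varepsilon,\sigma$) $a$ determines the other magnitude $b$, both source warps $\ell_1,\ell_2$, and the phases $s_1,s_2$ up to constant rotations, of such a unit-speed harmonic product. With $Q=1+(c^2-1)a^2$ and $T=d_2/\ell_2^2-d_1/\ell_1^2$, the reconstruction is governed by $$F^2=\frac{\varepsilon Q}{a^2R},\qquad T=\frac1{a^2Q}-\frac{a+a''}{aR}.$$ Zeros of $a'$ (turns) and intervals on which $a$ is constant are allowed. 2. Suppose one source warp $\ell_j$ ($j=1$ or $j=2$) is prescribed as a positive smooth function on $\mathbb R$ and both phase momenta are nonzero (that is, $c\neq0$). Then for every $t_0\in\mathbb R$ and every initial position and direction $(a_0,p_0)$ with $0<a_0<1$ and $1-a_0^2-p_0^2>0$ there is a unique global reconstruction: a unique smooth $a:\mathbb R\to(0,1)$ with $1-a^2-(a')^2>0$, $a(t_0)=a_0$, $a'(t_0)=p_0$, whose reconstruction as in (1) has the prescribed warp $\ell_j$. The source metric $g_\gamma$ is complete when $(M_1,g_1)$ and $(M_2,g_2)$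 are complete. 3. Let a positive smooth function $F$ on $\mathbb R$ be prescribed with $F'$ nowhere zero and $\inf_{\mathbb R}F>0$. Then a global reconstruction on $\mathbb R$ (a unit-speed harmonic product on $\mathbb R\times M_1\times M_2$ with $a,b>0$, the given momenta, and volume factor $\ell_1^{k_1}\ell_2^{k_2}=F$) exists if and only if $$\sqrt\varepsilon\,(1+|c|)\le\inf_{\mathbb R}F.$$
   Context: Setting. For $i=1,2$, $(M_i,g_i)$ is a Riemannian manifold of dimension $k_i>0$, and $f_i:(M_i,g_i)\to\mathbb S^{2n_i+1}\subset\mathbb C^{n_i+1}$ (unit round sphere) is an eigenmap: a smooth map with $\Delta f_i=-d_if_i$, where $d_i=|df_i|^2>0$ is constant. A map $f$ into a unit sphere is harmonic iff $\Delta f=-|df|^2f$. For an interval $I$, a smooth curve $\gamma=(z_1,z_2):I\to\mathbb S^3\subset\mathbb C^2$ and smooth positive functions $\ell_1,\ell_2$ on $I$ (source warps) set $$G_\gamma(t,x,y)=(z_1(t)f_1(x),z_2(t)f_2(y))\in\mathbb S^{2n_1+2n_2+3},\qquad g_\gamma=dt^2+\ell_1^2g_1+\ell_2^2g_2 .$$ When $G_\gamma$ is harmonic for $g_\gamma$ it is called a harmonic (spiral) product; it is unit-speed if $|\gamma'|=1$. If $\gamma=(ae^{is_1},be^{is_2})$ with $a,b>0$, then $a,b$ are the magnitudes and $s_1,s_2$ the phases; for a harmonic product $Fa^2s_1'$ and $Fb^2s_2'$ are constant (the phase momenta). For every $F>0$ and $T\in\mathbb R$ there is a unique positive pair $(\ell_1,\ell_2)$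 with $\ell_1^{k_1}\ell_2^{k_2}=F$ and $d_2/\ell_2^2-d_1/\ell_1^2=T$, depending smoothly on $(F,T)$. By the reconstruction from $a$ (with $c,\varepsilon,\sigma$ fixed) one means: $b=\sqrt{1-a^2}$, $F>0$ and $T$ as in the formulas of (1), $(\ell_1,\ell_2)$ the corresponding pair, and phases with $s_1'=\sigma\sqrt\varepsilon/(Fa^2)$, $s_2'=\sigma c\sqrt\varepsilon/(Fb^2)$. *)

theory Defs
  imports "HOL-Analysis.Analysis"
begin

section \<open>Smooth maps\<close>

(* All derivatives are taken within the given set.  The sets used below are open sets,
   nondegenerate intervals I, and products of I with open sets; on these the derivative within
   the set is unique, and it is the ordinary one on open sets.  At an endpoint of I belonging
   to I it is one-sided. *)
primrec Ck_on ::
  "nat \<Rightarrow> 'a::real_normed_vector set \<Rightarrow> ('a \<Rightarrow> 'b::real_normed_vector) \<Rightarrow> bool" where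
  "Ck_on 0 S f \<longleftrightarrow> continuous_on S f"
| "Ck_on (Suc n) S f \<longleftrightarrow>
     f differentiable_on S \<and> (\<forall>v. Ck_on n S (\<lambda>x. frechet_derivative f (at x within S) v))"

definition smooth_on ::
  "'a::real_normed_vector set \<Rightarrow> ('a \<Rightarrow> 'b::real_normed_vector) \<Rightarrow> bool" where
  "smooth_on S f \<longleftrightarrow> (\<forall>n. Ck_on n S f)"

definition dder ::
  "'a::real_normed_vector set \<Rightarrow> 'a \<Rightarrow> ('a \<Rightarrow> 'b::real_normed_vector) \<Rightarrow> 'a \<Rightarrow> 'b" where
  "dder S v f x = frechet_derivative f (at x within S) v"

definition cder :: "real set \<Rightarrow> (real \<Rightarrow> 'b::real_normed_vector) \<Rightarrow> real \<Rightarrow> 'b" where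
  "cder I f t = vector_derivative f (at t within I)"


section \<open>Riemannian manifolds\<close>

(* A patch is a local parametrization pmap of a piece of the manifold by a subset pdom of the
   model space 'e, together with the coordinate expression of the metric:
   pmet p x v w = g(d(pmap p)_x v, d(pmap p)_x w).  A Riemannian manifold is given by an atlas
   of such patches; its dimension is DIM('e) > 0. *)
record ('e, 'm) patch =
  pdom :: "'e set"
  pmap :: "'e \<Rightarrow> 'm"
  pmet :: "'e \<Rightarrow> 'e \<Rightarrow> 'e \<Rightarrow> real"

type_synonym ('e, 'm) riem = "('e, 'm) patch set"

definition carr :: "('e, 'm) riem \<Rightarrow> 'm set" where
  "carr M = (\<Union>p\<in>M. pmap p ` pdom p)"

definition overlap :: "('e, 'm) patch \<Rightarrow> ('e, 'm) patch \<Rightarrow> 'e set" where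
  "overlap p q = {x \<in> pdom p. pmap p x \<in> pmap q ` pdom q}"

definition transition :: "('e, 'm) patch \<Rightarrow> ('e, 'm) patch \<Rightarrow> 'e \<Rightarrow> 'e" where
  "transition p q x = inv_into (pdom q) (pmap q) (pmap p x)"

definition riemannian_manifold ::
  "('e::euclidean_space, 'm::{t2_space, second_countable_topology}) riem \<Rightarrow> bool" where
  "riemannian_manifold M \<longleftrightarrow>
     carr M \<noteq> {} \<and>
     (\<forall>p\<in>M. open (pdom p)
        \<and> openin (top_of_set (carr M)) (pmap p ` pdom p)
        \<and> (\<exists>h. homeomorphism (pdom p) (pmap p ` pdom p) (pmap p) h)) \<and>
     (\<forall>p\<in>M. \<forall>q\<in>M. smooth_on (overlap p q) (transition p q)) \<and>
     (\<forall>p\<in>M. \<forall>x\<in>pdom p.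
        bilinear (pmet p x)
        \<and> (\<forall>v w. pmet p x v w = pmet p x w v)
        \<and> (\<forall>v. v \<noteq> 0 \<longrightarrow> 0 < pmet p x v v)) \<and>
     (\<forall>p\<in>M. \<forall>v w. smooth_on (pdom p) (\<lambda>x. pmet p x v w)) \<and>
     (\<forall>p\<in>M. \<forall>q\<in>M. \<forall>x\<in>overlap p q. \<forall>v w.
        pmet p x v w =
        pmet q (transition p q x)
          (frechet_derivative (transition p q) (at x) v)
          (frechet_derivative (transition p q) (at x) w))"


subsection \<open>Laplace-Beltrami operator, energy density, harmonic maps into spheres\<close>

(* The g-dual of the covector (\<lambda>z. z \<bullet> e); for basis vectors,
   dual_vec p x e_i = (\<Sum>j. g^{ij} e_j). *)
definition dual_vec :: "('e::euclidean_space, 'm) patch \<Rightarrow> 'e \<Rightarrow> 'e \<Rightarrow> 'e" where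
  "dual_vec p x e = (THE y. \<forall>z. pmet p x y z = z \<bullet> e)"

(* The Levi-Civita connection on constant vector fields, by the Koszul formula. *)
definition christoffel :: "('e::euclidean_space, 'm) patch \<Rightarrow> 'e \<Rightarrow> 'e \<Rightarrow> 'e \<Rightarrow> 'e" where
  "christoffel p x v w =
     (\<Sum>e\<in>Basis.
        ((dder (pdom p) v (\<lambda>y. pmet p y w e) x
          + dder (pdom p) w (\<lambda>y. pmet p y v e) x
          - dder (pdom p) e (\<lambda>y. pmet p y v w) x) / 2) *\<^sub>R dual_vec p x e)"

definition hess ::
  "('e::euclidean_space, 'm) patch \<Rightarrow> ('m \<Rightarrow> 'b::real_normed_vector) \<Rightarrow> 'e \<Rightarrow> 'e \<Rightarrow> 'e \<Rightarrow> 'b" where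
  "hess p u x v w =
     dder (pdom p) v (dder (pdom p) w (u \<circ> pmap p)) x
     - dder (pdom p) (christoffel p x v w) (u \<circ> pmap p) x"

(* The metric trace of the Hessian, at the point pmap p x. *)
definition laplacian ::
  "('e::euclidean_space, 'm) patch \<Rightarrow> ('m \<Rightarrow> 'b::real_normed_vector) \<Rightarrow> 'e \<Rightarrow> 'b" where
  "laplacian p u x = (\<Sum>e\<in>Basis. hess p u x e (dual_vec p x e))"

(* |du|^2 at the point pmap p x. *)
definition energy_density ::
  "('e::euclidean_space, 'm) patch \<Rightarrow> ('m \<Rightarrow> 'b::real_inner) \<Rightarrow> 'e \<Rightarrow> real" where
  "energy_density p u x =
     (\<Sum>e\<in>Basis. dder (pdom p) e (u \<circ> pmap p) x
               \<bullet> dder (pdom p) (dual_vec p x e) (u \<circ> pmap p) x)"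

definition smooth_map ::
  "('e::euclidean_space, 'm) riem \<Rightarrow> ('m \<Rightarrow> 'b::real_normed_vector) \<Rightarrow> bool" where
  "smooth_map M u \<longleftrightarrow> (\<forall>p\<in>M. smooth_on (pdom p) (u \<circ> pmap p))"

definition sphere_map ::
  "('e::euclidean_space, 'm) riem \<Rightarrow> ('m \<Rightarrow> 'b::real_inner) \<Rightarrow> bool" where
  "sphere_map M u \<longleftrightarrow> smooth_map M u \<and> (\<forall>x\<in>carr M. norm (u x) = 1)"

definition harmonic_sphere_map ::
  "('e::euclidean_space, 'm) riem \<Rightarrow> ('m \<Rightarrow> 'b::real_inner) \<Rightarrow> bool" where
  "harmonic_sphere_map M u \<longleftrightarrow>
     sphere_map M u \<and>
     (\<forall>p\<in>M. \<forall>x\<in>pdom p. laplacian p u x = - (energy_density p u x *\<^sub>R u (pmap p x)))"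

definition eigenmap ::
  "('e::euclidean_space, 'm) riem \<Rightarrow> ('m \<Rightarrow> 'b::real_inner) \<Rightarrow> real \<Rightarrow> bool" where
  "eigenmap M f d \<longleftrightarrow>
     sphere_map M f \<and> 0 < d \<and>
     (\<forall>p\<in>M. \<forall>x\<in>pdom p.
        energy_density p f x = d \<and> laplacian p f x = - (d *\<^sub>R f (pmap p x)))"


subsection \<open>Riemannian distance and completeness\<close>

(* path_length M x y L: some piecewise smooth curve from x to y has length L.  The curve is
   subdivided so finely that each segment lies in one patch. *)
inductive path_length ::
  "('e::euclidean_space, 'm) riem \<Rightarrow> 'm \<Rightarrow> 'm \<Rightarrow> real \<Rightarrow> bool" for M where
  start: "x \<in> carr M \<Longrightarrow> path_length M x x 0"
| segment:
    "\<lbrakk>path_length M x (pmap p (c 0)) L; p \<in> M; smooth_on {0..1} c; c ` {0..1} \<subseteq> pdom p\<rbrakk>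
     \<Longrightarrow> path_length M x (pmap p (c 1))
           (L + integral {0..1} (\<lambda>s. sqrt (pmet p (c s) (cder {0..1} c s) (cder {0..1} c s))))"

(* The distance is \<infinity> between different components. *)
definition riem_dist :: "('e::euclidean_space, 'm) riem \<Rightarrow> 'm \<Rightarrow> 'm \<Rightarrow> ereal" where
  "riem_dist M x y = Inf (ereal ` {L. path_length M x y L})"

definition complete_riem :: "('e::euclidean_space, 'm) riem \<Rightarrow> bool" where
  "complete_riem M \<longleftrightarrow>
     (\<forall>X. (\<forall>n. X n \<in> carr M) \<and>
          (\<forall>e>0. \<exists>N::nat. \<forall>m\<ge>N. \<forall>n\<ge>N. riem_dist M (X m) (X n) < ereal e)
        \<longrightarrow> (\<exists>x\<in>carr M. (\<lambda>n. riem_dist M (X n) x) \<longlonglongrightarrow> 0))"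


section \<open>Warped products and harmonic products\<close>

definition warped_patch ::
  "real set \<Rightarrow> (real \<Rightarrow> real) \<Rightarrow> (real \<Rightarrow> real) \<Rightarrow> ('e1, 'm1) patch \<Rightarrow> ('e2, 'm2) patch
   \<Rightarrow> (real \<times> 'e1 \<times> 'e2, real \<times> 'm1 \<times> 'm2) patch" where
  "warped_patch I l1 l2 p q =
     \<lparr>pdom = I \<times> pdom p \<times> pdom q,
      pmap = (\<lambda>(t, x, y). (t, pmap p x, pmap q y)),
      pmet = (\<lambda>(t, x, y) (r, v, w) (r', v', w').
                r * r' + (l1 t)\<^sup>2 * pmet p x v v' + (l2 t)\<^sup>2 * pmet q y w w')\<rparr>"

(* I \<times> M1 \<times> M2 with the metric dt^2 + l1^2 g1 + l2^2 g2 *)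
definition warped_product ::
  "real set \<Rightarrow> (real \<Rightarrow> real) \<Rightarrow> (real \<Rightarrow> real) \<Rightarrow> ('e1, 'm1) riem \<Rightarrow> ('e2, 'm2) riem
   \<Rightarrow> (real \<times> 'e1 \<times> 'e2, real \<times> 'm1 \<times> 'm2) riem" where
  "warped_product I l1 l2 M1 M2 = {warped_patch I l1 l2 p q |p q. p \<in> M1 \<and> q \<in> M2}"

(* The pair of C^m and C^n is identified with C^(m+n). *)
definition product_map ::
  "(real \<Rightarrow> complex) \<Rightarrow> (real \<Rightarrow> complex) \<Rightarrow> ('m1 \<Rightarrow> complex ^ 'n1) \<Rightarrow> ('m2 \<Rightarrow> complex ^ 'n2)
   \<Rightarrow> real \<times> 'm1 \<times> 'm2 \<Rightarrow> (complex ^ 'n1) \<times> (complex ^ 'n2)" where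
  "product_map z1 z2 f1 f2 = (\<lambda>(t, x, y). (z1 t *s f1 x, z2 t *s f2 y))"

definition harmonic_product ::
  "('e1::euclidean_space, 'm1) riem \<Rightarrow> ('e2::euclidean_space, 'm2) riem
   \<Rightarrow> ('m1 \<Rightarrow> complex ^ 'n1) \<Rightarrow> ('m2 \<Rightarrow> complex ^ 'n2)
   \<Rightarrow> real set \<Rightarrow> (real \<Rightarrow> complex) \<Rightarrow> (real \<Rightarrow> complex)
   \<Rightarrow> (real \<Rightarrow> real) \<Rightarrow> (real \<Rightarrow> real) \<Rightarrow> bool" where
  "harmonic_product M1 M2 f1 f2 I z1 z2 l1 l2 \<longleftrightarrow>
     smooth_on I z1 \<and> smooth_on I z2 \<and> smooth_on I l1 \<and> smooth_on I l2 \<and>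
     (\<forall>t\<in>I. 0 < l1 t \<and> 0 < l2 t \<and> (norm (z1 t))\<^sup>2 + (norm (z2 t))\<^sup>2 = 1) \<and>
     harmonic_sphere_map (warped_product I l1 l2 M1 M2) (product_map z1 z2 f1 f2)"

definition unit_speed :: "real set \<Rightarrow> (real \<Rightarrow> complex) \<Rightarrow> (real \<Rightarrow> complex) \<Rightarrow> bool" where
  "unit_speed I z1 z2 \<longleftrightarrow> (\<forall>t\<in>I. (norm (cder I z1 t))\<^sup>2 + (norm (cder I z2 t))\<^sup>2 = 1)"

definition polar :: "(real \<Rightarrow> real) \<Rightarrow> (real \<Rightarrow> real) \<Rightarrow> real \<Rightarrow> complex" where
  "polar a s t = complex_of_real (a t) * exp (\<i> * complex_of_real (s t))"

definition volume_factor ::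
  "nat \<Rightarrow> nat \<Rightarrow> (real \<Rightarrow> real) \<Rightarrow> (real \<Rightarrow> real) \<Rightarrow> real \<Rightarrow> real" where
  "volume_factor k1 k2 l1 l2 t = l1 t ^ k1 * l2 t ^ k2"

(* Unit-speed harmonic products with positive magnitudes a, b, phases s1, s2 and phase
   momenta \<sigma> sqrt \<epsilon> (1, c). *)
definition normalized_product ::
  "('e1::euclidean_space, 'm1) riem \<Rightarrow> ('e2::euclidean_space, 'm2) riem
   \<Rightarrow> ('m1 \<Rightarrow> complex ^ 'n1) \<Rightarrow> ('m2 \<Rightarrow> complex ^ 'n2) \<Rightarrow> real \<Rightarrow> real \<Rightarrow> real
   \<Rightarrow> real set \<Rightarrow> (real \<Rightarrow> real) \<Rightarrow> (real \<Rightarrow> real) \<Rightarrow> (real \<Rightarrow> real) \<Rightarrow> (real \<Rightarrow> real)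
   \<Rightarrow> (real \<Rightarrow> real) \<Rightarrow> (real \<Rightarrow> real) \<Rightarrow> bool" where
  "normalized_product M1 M2 f1 f2 c \<epsilon> \<sigma> I a b s1 s2 l1 l2 \<longleftrightarrow>
     smooth_on I a \<and> smooth_on I b \<and> smooth_on I s1 \<and> smooth_on I s2 \<and>
     (\<forall>t\<in>I. 0 < a t \<and> 0 < b t \<and> (a t)\<^sup>2 + (b t)\<^sup>2 = 1) \<and>
     harmonic_product M1 M2 f1 f2 I (polar a s1) (polar b s2) l1 l2 \<and>
     unit_speed I (polar a s1) (polar b s2) \<and>
     (\<forall>t\<in>I.
        volume_factor DIM('e1) DIM('e2) l1 l2 t * (a t)\<^sup>2 * cder I s1 t = \<sigma> * sqrt \<epsilon> \<and>
        volume_factor DIM('e1) DIM('e2) l1 l2 t * (b t)\<^sup>2 * cder I s2 t = \<sigma> * sqrt \<epsilon> * c)"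


section \<open>Reconstruction from one magnitude\<close>

definition R_of :: "real set \<Rightarrow> (real \<Rightarrow> real) \<Rightarrow> real \<Rightarrow> real" where
  "R_of I a t = 1 - (a t)\<^sup>2 - (cder I a t)\<^sup>2"

definition Q_of :: "real \<Rightarrow> (real \<Rightarrow> real) \<Rightarrow> real \<Rightarrow> real" where
  "Q_of c a t = 1 + (c\<^sup>2 - 1) * (a t)\<^sup>2"

definition T_of :: "real \<Rightarrow> real set \<Rightarrow> (real \<Rightarrow> real) \<Rightarrow> real \<Rightarrow> real" where
  "T_of c I a t =
     1 / ((a t)\<^sup>2 * Q_of c a t) - (a t + cder I (cder I a) t) / (a t * R_of I a t)"

definition admissible :: "real set \<Rightarrow> (real \<Rightarrow> real) \<Rightarrow> bool" where
  "admissible I a \<longleftrightarrow> smooth_on I a \<and> (\<forall>t\<in>I. 0 < a t \<and> a t < 1 \<and> 0 < R_of I a t)"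

definition reconstruction ::
  "nat \<Rightarrow> nat \<Rightarrow> real \<Rightarrow> real \<Rightarrow> real \<Rightarrow> real \<Rightarrow> real
   \<Rightarrow> real set \<Rightarrow> (real \<Rightarrow> real) \<Rightarrow> (real \<Rightarrow> real) \<Rightarrow> (real \<Rightarrow> real) \<Rightarrow> (real \<Rightarrow> real)
   \<Rightarrow> (real \<Rightarrow> real) \<Rightarrow> (real \<Rightarrow> real) \<Rightarrow> bool" where
  "reconstruction k1 k2 d1 d2 c \<epsilon> \<sigma> I a b s1 s2 l1 l2 \<longleftrightarrow>
     (\<forall>t\<in>I.
        b t = sqrt (1 - (a t)\<^sup>2) \<and> 0 < l1 t \<and> 0 < l2 t \<and>
        (volume_factor k1 k2 l1 l2 t)\<^sup>2 = \<epsilon> * Q_of c a t / ((a t)\<^sup>2 * R_of I a t) \<and>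
        d2 / (l2 t)\<^sup>2 - d1 / (l1 t)\<^sup>2 = T_of c I a t \<and>
        (s1 has_real_derivative
           \<sigma> * sqrt \<epsilon> / (volume_factor k1 k2 l1 l2 t * (a t)\<^sup>2)) (at t within I) \<and>
        (s2 has_real_derivative
           \<sigma> * c * sqrt \<epsilon> / (volume_factor k1 k2 l1 l2 t * (b t)\<^sup>2)) (at t within I))"

end

theory Submission
  imports Defs
begin

text \<open>Separating variables in the warped product turns harmonicity into two second-order equations for
  \<^term>\<open>z1\<close> and \<^term>\<open>z2\<close>. Their angular parts are the conservation of the phase momenta; their radial parts are
  linearly dependent because \<^term>\<open>a\<^sup>2 + b\<^sup>2 = 1\<close>, so a single equation remains, which fixes \<^term>\<open>T\<close>. Unit speed
  fixes \<^term>\<open>F\<close>. Conversely, differentiating the formula for \<^term>\<open>F\<^sup>2\<close> gives \<^term>\<open>F' = - F * a * a' * T\<close>,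
  which is what the radial equation needs in order to hold also at turns.

  Prescribing a warp makes \<^term>\<open>T\<close> a function of \<^term>\<open>t\<close> and \<^term>\<open>F\<close>, so the formula for \<^term>\<open>T\<close> becomes a
  second-order equation for \<^term>\<open>a\<close>. Along a solution \<^term>\<open>ln F\<close> grows at most at a bounded rate, while
  \<^term>\<open>F\<close> is infinite on the boundary of the phase space, so solutions are global.

  If \<^term>\<open>F\<close> is prescribed, \<^term>\<open>F\<^sup>2 * a\<^sup>2 * b\<^sup>2 \<ge> \<epsilon> * Q\<close> and \<^term>\<open>Q = b\<^sup>2 + c\<^sup>2 * a\<^sup>2\<close> force
  \<^term>\<open>F \<ge> sqrt \<epsilon> * (1 + \<bar>c\<bar>)\<close>. For increasing \<^term>\<open>F\<close> above this bound a magnitude is found from a first-order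
  equation for the angle \<^term>\<open>arccos a\<close>, by exhaustion of the real line; reversal of time covers decreasing \<^term>\<open>F\<close>.\<close>

section \<open>Maps with derivatives of all orders\<close>

text \<open>The usual energy argument gives the radial equation only after multiplication by
  \<open>a'\<close>, hence nothing at turns or where \<open>a\<close> is constant. Here
  \<open>T\<close> is a formula in \<open>a\<close>, \<open>a'\<close> and \<open>a''\<close>, and
  the logarithmic derivative of \<open>Q / (a\<^sup>2 * R)\<close> carries the factor
  \<open>a'\<close> explicitly, so \<open>F'\<close> is found without dividing by \<open>a'\<close>.
  For a prescribed warp, \<open>c \<noteq> 0\<close> enters through \<open>Q\<close>, a convex
  combination of 1 and \<open>c\<^sup>2\<close>: it stays above \<open>min 1 (c\<^sup>2)\<close>, so
  \<open>F\<close> is bounded below and the negative power of \<open>F\<close> in \<open>T\<close>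
  is bounded. For a prescribed \<open>F\<close>, the radicand of the angle equation can become
  negative when a solution is followed backwards. Forwards it cannot: where it vanishes the angle is
  stationary, and the decrease of \<open>x\<close> alone makes the radicand grow. Hence initial
  times are sent to minus infinity, starting at the angle that makes the radicand largest. It is
  positive there because \<open>F\<close>, having no critical point, lies strictly above its
  infimum, so the bound on the infimum is strict at each time.\<close>

text \<open>In a set that accumulates at each of its points along every axis, the derivative within the set is
  unique, so the iterated derivatives behave as on open sets. Nondegenerate intervals and their products
  with open sets qualify.\<close>

definition dense_axes :: "'a::euclidean_space set \<Rightarrow> bool" where
  "dense_axes S \<longleftrightarrow> (\<forall>x\<in>S. \<forall>i\<in>Basis. \<forall>e>0. \<exists>d. 0 < \<bar>d\<bar> \<and> \<bar>d\<bar> < e \<and> x + d *\<^sub>R i \<in> S)"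

lemma dense_axes_open:
  assumes "open S"
  shows "dense_axes S"
  unfolding dense_axes_def
proof (intro ballI allI impI)
  fix x i :: 'a and e :: real
  assume x: "x \<in> S" and i: "i \<in> Basis" and e: "0 < e"
  obtain r where r: "r > 0" "ball x r \<subseteq> S"
    using assms x open_contains_ball by blast
  define d where "d = min e r / 2"
  have "0 < d" "d < e" "d < r" using e r by (auto simp: d_def)
  moreover have "x + d *\<^sub>R i \<in> ball x r"
    using i \<open>0 < d\<close> \<open>d < r\<close> by (simp add: dist_norm)
  ultimately show "\<exists>d. 0 < \<bar>d\<bar> \<and> \<bar>d\<bar> < e \<and> x + d *\<^sub>R i \<in> S"
    using r by (intro exI[of _ d]) auto
qed

lemma dense_axes_interval:
  fixes I :: "real set"
  assumes "is_interval I" "interior I \<noteq> {}"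
  shows "dense_axes I"
  unfolding dense_axes_def
proof (intro ballI allI impI)
  fix x i e :: real
  assume x: "x \<in> I" and i: "i \<in> Basis" and e: "0 < e"
  obtain w r where r: "r > 0" "ball w r \<subseteq> I"
    using assms(2) by (metis ex_in_conv mem_interior)
  have "w + r/2 \<in> ball w r" "w \<in> ball w r"
    using r by (auto simp: dist_real_def)
  with r obtain y where y: "y \<in> I" "y \<noteq> x"
    by (metis add_cancel_right_right divide_eq_0_iff less_irrefl subsetD zero_neq_numeral)
  \<comment> \<open>With this weight the convex combination with \<open>y\<close> moves
    \<open>x\<close> by at most \<open>e / 2\<close>.\<close>
  define s where "s = min (1/2) (e / (2 * \<bar>y - x\<bar>))"
  have s: "0 < s" "s < 1" "s * \<bar>y - x\<bar> < e"
    using e y by (auto simp: s_def min_def field_simps)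
  have "(1 - s) *\<^sub>R x + s *\<^sub>R y \<in> I"
    using s x y is_interval_convex[OF assms(1)] by (intro convexD) auto
  moreover have "(1 - s) *\<^sub>R x + s *\<^sub>R y = x + (s * (y - x)) *\<^sub>R i"
    using i by (simp add: algebra_simps)
  ultimately show "\<exists>d. 0 < \<bar>d\<bar> \<and> \<bar>d\<bar> < e \<and> x + d *\<^sub>R i \<in> I"
    using s y by (intro exI[of _ "s * (y - x)"]) (auto simp: abs_mult)
qed

lemma dense_axes_Times:
  assumes "dense_axes S" "dense_axes T"
  shows "dense_axes (S \<times> T)"
  unfolding dense_axes_def
proof (intro ballI allI impI)
  fix x i :: "'a \<times> 'b" and e :: real
  assume x: "x \<in> S \<times> T" and i: "i \<in> Basis" and e: "0 < e"
  from i consider j where "j \<in> Basis" "i = (j, 0)" | j where "j \<in> Basis" "i = (0, j)"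
    by (auto simp: Basis_prod_def)
  then show "\<exists>d. 0 < \<bar>d\<bar> \<and> \<bar>d\<bar> < e \<and> x + d *\<^sub>R i \<in> S \<times> T"
  proof cases
    case 1
    then show ?thesis
      using assms(1) x e unfolding dense_axes_def by (cases x) force
  next
    case 2
    then show ?thesis
      using assms(2) x e unfolding dense_axes_def by (cases x) force
  qed
qed

lemma has_derivative_unique_dense_axes:
  assumes "dense_axes S" "x \<in> S"
    "(f has_derivative f') (at x within S)" "(f has_derivative f'') (at x within S)"
  shows "f' = f''"
  by (rule frechet_derivative_unique_within[OF assms(3,4)])
    (use assms(1,2) in \<open>auto simp: dense_axes_def\<close>)

lemma frechet_derivative_eqI:
  assumes "dense_axes S" "x \<in> S" "(f has_derivative f') (at x within S)"
  shows "frechet_derivative f (at x within S) = f'"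
  using assms has_derivative_unique_dense_axes frechet_derivative_works differentiableI by metis

lemma cder_eqI:
  assumes "dense_axes I" "t \<in> I" "(f has_vector_derivative f') (at t within I)"
  shows "cder I f t = f'"
proof -
  have "(f has_vector_derivative cder I f t) (at t within I)"
    unfolding cder_def using assms(3)
    by (metis differentiableI_vector vector_derivative_works)
  then have "(\<lambda>h. h *\<^sub>R cder I f t) = (\<lambda>h. h *\<^sub>R f')"
    using assms has_derivative_unique_dense_axes unfolding has_vector_derivative_def by blast
  from fun_cong[OF this, of 1] show ?thesis by simp
qed

text \<open>The derivative within \<open>S\<close> at a point of \<open>S\<close> sees only values
  on \<open>S\<close>, so \<open>frechet_derivative\<close> makes the same choice for both
  functions. Both functions are generalized because their derivatives again agree only on
  \<open>S\<close>.\<close>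

lemma Ck_on_congD:
  "\<forall>x\<in>S. f x = g x \<Longrightarrow> Ck_on n S f \<Longrightarrow> Ck_on n S g"
proof (induction n arbitrary: f g)
  case 0
  then show ?case by (simp cong: continuous_on_cong)
next
  case (Suc n)
  have e: "(f has_derivative D) (at x within S) \<longleftrightarrow> (g has_derivative D) (at x within S)"
    if "x \<in> S" for D x
    using Suc.prems(1) that has_derivative_transform[of x S f g] has_derivative_transform[of x S g f]
    by auto
  have "g differentiable_on S"
    using Suc.prems e by (auto simp: differentiable_on_def differentiable_def)
  moreover have "\<forall>v. Ck_on n S (\<lambda>x. frechet_derivative g (at x within S) v)"
  proof
    fix v
    have "\<forall>x\<in>S. frechet_derivative f (at x within S) v = frechet_derivative g (at x within S) v"
      using e by (simp add: frechet_derivative_def)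
    then show "Ck_on n S (\<lambda>x. frechet_derivative g (at x within S) v)"
      using Suc.IH Suc.prems(2) by auto
  qed
  ultimately show ?case by simp
qed

lemma Ck_on_cong:
  assumes "\<And>x. x \<in> S \<Longrightarrow> f x = g x"
  shows "Ck_on n S f \<longleftrightarrow> Ck_on n S g"
  using Ck_on_congD[of S f g n] Ck_on_congD[of S g f n] assms by auto

text \<open>Uniqueness of derivatives lets an explicit derivative replace the one chosen by
  \<open>frechet_derivative\<close>. The closure rules below induct on the order through this
  rule.\<close>

lemma Ck_on_SucI:
  assumes "dense_axes S" "\<And>x. x \<in> S \<Longrightarrow> (f has_derivative f' x) (at x within S)"
    "\<And>v. Ck_on n S (\<lambda>x. f' x v)"
  shows "Ck_on (Suc n) S f"
proof -
  have "f differentiable_on S"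
    using assms(2) by (auto simp: differentiable_on_def differentiable_def)
  moreover have "Ck_on n S (\<lambda>x. frechet_derivative f (at x within S) v)" for v
    using assms(3)[of v] Ck_on_cong[of S "\<lambda>x. frechet_derivative f (at x within S) v" "\<lambda>x. f' x v"]
      frechet_derivative_eqI[OF assms(1) _ assms(2)] by simp
  ultimately show ?thesis by simp
qed

lemma Ck_on_SucE:
  assumes "Ck_on (Suc n) S f"
  obtains f' where "\<And>x. x \<in> S \<Longrightarrow> (f has_derivative f' x) (at x within S)"
    "\<And>v. Ck_on n S (\<lambda>x. f' x v)"
  using assms that[of "\<lambda>x. frechet_derivative f (at x within S)"]
  by (auto simp: differentiable_on_def frechet_derivative_works)

lemma Ck_on_Suc_imp: "Ck_on (Suc n) S f \<Longrightarrow> Ck_on n S f"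
proof (induction n arbitrary: f)
  case 0
  then show ?case by (auto intro: differentiable_imp_continuous_on)
next
  case (Suc n)
  have "f differentiable_on S"
    "Ck_on (Suc n) S (\<lambda>x. frechet_derivative f (at x within S) v)" for v
    using Suc.prems by auto
  then show ?case using Suc.IH by auto
qed

lemma Ck_on_imp_continuous_on: "Ck_on n S f \<Longrightarrow> continuous_on S f"
proof (induction n)
  case (Suc n)
  then show ?case using Ck_on_Suc_imp[of n S f] by blast
qed simp

section \<open>Closure of the classes C^n under algebraic operations, composition and elementary
  functions\<close>

lemma Ck_on_const:
  assumes "dense_axes S"
  shows "Ck_on n S (\<lambda>x. k)"
proof (induction n arbitrary: k)
  case (Suc n)
  show ?case by (rule Ck_on_SucI[OF assms, where f' = "\<lambda>x v. 0"]) (auto intro: Suc)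
qed simp

lemma Ck_on_bounded_linear:
  assumes "dense_axes S" "bounded_linear h"
  shows "Ck_on n S f \<Longrightarrow> Ck_on n S (\<lambda>x. h (f x))"
proof (induction n arbitrary: f)
  case 0
  then show ?case
    using bounded_linear.continuous_on[OF assms(2)] by auto
next
  case (Suc n)
  obtain f' where f': "\<And>x. x \<in> S \<Longrightarrow> (f has_derivative f' x) (at x within S)"
    "\<And>v. Ck_on n S (\<lambda>x. f' x v)"
    using Ck_on_SucE[OF Suc.prems] by metis
  show ?case
    by (rule Ck_on_SucI[OF assms(1), where f' = "\<lambda>x v. h (f' x v)"])
      (auto intro: Suc.IH f' bounded_linear.has_derivative[OF assms(2)])
qed

lemma Ck_on_add:
  assumes "dense_axes S"
  shows "Ck_on n S f \<Longrightarrow> Ck_on n S g \<Longrightarrow> Ck_on n S (\<lambda>x. f x + g x)"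
proof (induction n arbitrary: f g)
  case 0
  then show ?case by (auto intro: continuous_intros)
next
  case (Suc n)
  obtain f' where f': "\<And>x. x \<in> S \<Longrightarrow> (f has_derivative f' x) (at x within S)"
    "\<And>v. Ck_on n S (\<lambda>x. f' x v)"
    using Ck_on_SucE[OF Suc.prems(1)] by metis
  obtain g' where g': "\<And>x. x \<in> S \<Longrightarrow> (g has_derivative g' x) (at x within S)"
    "\<And>v. Ck_on n S (\<lambda>x. g' x v)"
    using Ck_on_SucE[OF Suc.prems(2)] by metis
  show ?case
    by (rule Ck_on_SucI[OF assms(1), where f' = "\<lambda>x v. f' x v + g' x v"])
      (auto intro!: Suc.IH f' g' derivative_intros)
qed

lemma Ck_on_minus:
  assumes "dense_axes S" "Ck_on n S f"
  shows "Ck_on n S (\<lambda>x. - f x)"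
  by (rule Ck_on_bounded_linear[OF assms(1) bounded_linear_minus[OF bounded_linear_ident] assms(2)])

lemma Ck_on_diff:
  assumes "dense_axes S" "Ck_on n S f" "Ck_on n S g"
  shows "Ck_on n S (\<lambda>x. f x - g x)"
  using Ck_on_add[OF assms(1,2) Ck_on_minus[OF assms(1,3)]] by simp

text \<open>One Leibniz rule serves products, real scaling and complex scalars acting on complex
  vectors. The derivative contains \<open>f\<close> and \<open>g\<close> themselves, hence the use
  of \<open>Ck_on_Suc_imp\<close>.\<close>

lemma Ck_on_bilinear:
  assumes "dense_axes S" "bounded_bilinear h"
  shows "Ck_on n S f \<Longrightarrow> Ck_on n S g \<Longrightarrow> Ck_on n S (\<lambda>x. h (f x) (g x))"
proof (induction n arbitrary: f g)
  case 0
  then show ?case using bounded_bilinear.continuous_on[OF assms(2)] by auto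
next
  case (Suc n)
  note fg = Ck_on_Suc_imp[OF Suc.prems(1)] Ck_on_Suc_imp[OF Suc.prems(2)]
  obtain f' where f': "\<And>x. x \<in> S \<Longrightarrow> (f has_derivative f' x) (at x within S)"
    "\<And>v. Ck_on n S (\<lambda>x. f' x v)"
    using Ck_on_SucE[OF Suc.prems(1)] by metis
  obtain g' where g': "\<And>x. x \<in> S \<Longrightarrow> (g has_derivative g' x) (at x within S)"
    "\<And>v. Ck_on n S (\<lambda>x. g' x v)"
    using Ck_on_SucE[OF Suc.prems(2)] by metis
  show ?case
    by (rule Ck_on_SucI[OF assms(1), where f' = "\<lambda>x v. h (f x) (g' x v) + h (f' x v) (g x)"])
      (auto intro!: Suc.IH f' g' fg Ck_on_add assms bounded_bilinear.FDERIV[OF assms(2)])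
qed

lemmas Ck_on_scaleR = Ck_on_bilinear[OF _ bounded_bilinear_scaleR]
lemmas Ck_on_mult = Ck_on_bilinear[OF _ bounded_bilinear_mult]

lemma Ck_on_power:
  fixes f :: "_ \<Rightarrow> 'a::real_normed_field"
  assumes "dense_axes S" "Ck_on n S f"
  shows "Ck_on n S (\<lambda>x. f x ^ k)"
  by (induction k) (auto intro: Ck_on_const Ck_on_mult assms)

text \<open>Covers the coordinate projections of a product and the reversal of time, where the inner
  map is linear.\<close>

lemma Ck_on_comp_linear:
  assumes "dense_axes S" "bounded_linear h" "h ` S \<subseteq> T"
  shows "Ck_on n T f \<Longrightarrow> Ck_on n S (\<lambda>x. f (h x))"
proof (induction n arbitrary: f)
  case 0
  have "continuous_on S h" using assms(2) linear_continuous_on by blast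
  then show ?case using 0 assms(3) continuous_on_compose2 by auto
next
  case (Suc n)
  obtain f' where f': "\<And>x. x \<in> T \<Longrightarrow> (f has_derivative f' x) (at x within T)"
    "\<And>v. Ck_on n T (\<lambda>x. f' x v)"
    using Ck_on_SucE[OF Suc.prems(1)] by metis
  have "((\<lambda>x. f (h x)) has_derivative (\<lambda>v. f' (h x) (h v))) (at x within S)" if "x \<in> S" for x
  proof -
    have "h x \<in> T" using that assms(3) by auto
    then have "(f has_derivative f' (h x)) (at (h x) within h ` S)"
      using f'(1) assms(3) has_derivative_subset by blast
    from diff_chain_within[OF bounded_linear_imp_has_derivative[OF assms(2)] this]
    show ?thesis by (simp add: o_def)
  qed
  then show ?case
    by (rule Ck_on_SucI[OF assms(1)]) (auto intro: Suc.IH f')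
qed

lemma Ck_on_ident:
  assumes "dense_axes S"
  shows "Ck_on n S (\<lambda>x. x)"
proof (cases n)
  case (Suc m)
  show ?thesis unfolding Suc
    by (rule Ck_on_SucI[OF assms, where f' = "\<lambda>x v. v"])
      (auto intro: Ck_on_const assms has_derivative_ident)
qed simp

text \<open>The step by which regularity is bootstrapped: a derivative expressed through functions
  of class C^n raises the order by one.\<close>

lemma Ck_on_vector_SucI:
  fixes f :: "real \<Rightarrow> 'b::real_normed_vector"
  assumes "dense_axes I" "\<And>t. t \<in> I \<Longrightarrow> (f has_vector_derivative g t) (at t within I)"
    "Ck_on n I g"
  shows "Ck_on (Suc n) I f"
  by (rule Ck_on_SucI[OF assms(1), where f' = "\<lambda>x v. v *\<^sub>R g x"])
    (use assms(2) in \<open>auto simp: has_vector_derivative_def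
      intro: Ck_on_scaleR[OF assms(1) Ck_on_const[OF assms(1)] assms(3)]\<close>)

lemma Ck_on_vector_SucE:
  fixes f :: "real \<Rightarrow> 'b::real_normed_vector"
  assumes "dense_axes I" "Ck_on (Suc n) I f"
  shows "\<And>t. t \<in> I \<Longrightarrow> (f has_vector_derivative cder I f t) (at t within I)"
    "Ck_on n I (cder I f)"
proof -
  obtain f' where f': "\<And>x. x \<in> I \<Longrightarrow> (f has_derivative f' x) (at x within I)"
    "\<And>v. Ck_on n I (\<lambda>x. f' x v)"
    using Ck_on_SucE[OF assms(2)] by metis
  show 1: "(f has_vector_derivative cder I f t) (at t within I)" if "t \<in> I" for t
    unfolding cder_def
    using f'(1)[OF that] differentiableI vector_derivative_works by metis
  have "cder I f t = f' t 1" if "t \<in> I" for t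
  proof -
    have "(f has_derivative (\<lambda>h. h *\<^sub>R cder I f t)) (at t within I)"
      using 1[OF that] by (simp add: has_vector_derivative_def)
    then have "(\<lambda>h. h *\<^sub>R cder I f t) = f' t"
      using f'(1)[OF that] has_derivative_unique_dense_axes assms(1) that by blast
    from fun_cong[OF this, of 1] show ?thesis by simp
  qed
  then show "Ck_on n I (cder I f)"
    using f'(2)[of 1] Ck_on_cong[of I "cder I f" "\<lambda>x. f' x 1" n] by simp
qed

lemma Ck_on_compose:
  fixes \<phi> :: "real \<Rightarrow> 'c::real_normed_vector"
  assumes "dense_axes S" "dense_axes J" "f ` S \<subseteq> J"
  shows "Ck_on n J \<phi> \<Longrightarrow> Ck_on n S f \<Longrightarrow> Ck_on n S (\<lambda>x. \<phi> (f x))"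
proof (induction n arbitrary: \<phi>)
  case 0
  then show ?case using assms(3) continuous_on_compose2 by fastforce
next
  case (Suc n)
  note f0 = Ck_on_Suc_imp[OF Suc.prems(2)]
  obtain f' where f': "\<And>x. x \<in> S \<Longrightarrow> (f has_derivative f' x) (at x within S)"
    "\<And>v. Ck_on n S (\<lambda>x. f' x v)"
    using Ck_on_SucE[OF Suc.prems(2)] by metis
  note \<phi>' = Ck_on_vector_SucE[OF assms(2) Suc.prems(1)]
  have "((\<lambda>x. \<phi> (f x)) has_derivative (\<lambda>v. f' x v *\<^sub>R cder J \<phi> (f x))) (at x within S)"
    if "x \<in> S" for x
  proof -
    have "(\<phi> has_derivative (\<lambda>h. h *\<^sub>R cder J \<phi> (f x))) (at (f x) within J)"
      using \<phi>'(1)[of "f x"] that assms(3) by (auto simp: has_vector_derivative_def)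
    then have "(\<phi> has_derivative (\<lambda>h. h *\<^sub>R cder J \<phi> (f x))) (at (f x) within f ` S)"
      using assms(3) has_derivative_subset by blast
    from diff_chain_within[OF f'(1)[OF that] this] show ?thesis by (simp add: o_def)
  qed
  then show ?case
    by (rule Ck_on_SucI[OF assms(1)])
      (auto intro!: Ck_on_scaleR assms f' Suc.IH \<phi>'(2) f0)
qed

lemma Ck_on_inverse:
  fixes f :: "'a::euclidean_space \<Rightarrow> real"
  assumes "dense_axes S" "Ck_on n S f" "\<And>x. x \<in> S \<Longrightarrow> f x \<noteq> 0"
  shows "Ck_on n S (\<lambda>x. inverse (f x))"
proof -
  have o: "dense_axes (-{0::real})" by (intro dense_axes_open) auto
  have c: "Ck_on n (-{0::real}) inverse"
  proof (induction n)
    case 0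
    show ?case by (auto intro!: continuous_intros)
  next
    case (Suc n)
    show ?case
      by (rule Ck_on_vector_SucI[OF o, where g = "\<lambda>x. - (inverse x * inverse x)"])
        (auto intro!: Ck_on_minus o Ck_on_mult Suc derivative_eq_intros
          simp: has_real_derivative_iff_has_vector_derivative[symmetric])
  qed
  show ?thesis
    by (rule Ck_on_compose[OF assms(1) o _ c assms(2)]) (use assms(3) in auto)
qed

lemma Ck_on_divide:
  fixes f g :: "'a::euclidean_space \<Rightarrow> real"
  assumes "dense_axes S" "Ck_on n S f" "Ck_on n S g" "\<And>x. x \<in> S \<Longrightarrow> g x \<noteq> 0"
  shows "Ck_on n S (\<lambda>x. f x / g x)"
  unfolding divide_inverse by (intro Ck_on_mult Ck_on_inverse assms)

lemma Ck_on_powr: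
  fixes f :: "'a::euclidean_space \<Rightarrow> real"
  assumes "dense_axes S" "Ck_on n S f" "\<And>x. x \<in> S \<Longrightarrow> 0 < f x"
  shows "Ck_on n S (\<lambda>x. f x powr r)"
proof -
  have o: "dense_axes {0::real<..}" by (intro dense_axes_open) auto
  have c: "Ck_on n {0<..} (\<lambda>x. x powr r)"
  \<comment> \<open>Each differentiation lowers the exponent by one, so the exponent is
    generalized.\<close>
  proof (induction n arbitrary: r)
    case 0
    show ?case by (auto intro!: continuous_intros)
  next
    case (Suc n)
    show ?case
      by (rule Ck_on_vector_SucI[OF o, where g = "\<lambda>x. r * x powr (r - 1)"])
        (auto intro!: o Ck_on_mult Ck_on_const Suc derivative_eq_intros
          simp: has_real_derivative_iff_has_vector_derivative[symmetric])
  qed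
  show ?thesis
    by (rule Ck_on_compose[OF assms(1) o _ c assms(2)]) (use assms(3) in auto)
qed

lemma Ck_on_sqrt:
  fixes f :: "'a::euclidean_space \<Rightarrow> real"
  assumes "dense_axes S" "Ck_on n S f" "\<And>x. x \<in> S \<Longrightarrow> 0 < f x"
  shows "Ck_on n S (\<lambda>x. sqrt (f x))"
  using Ck_on_powr[OF assms, of "1/2"] assms(3)
    Ck_on_cong[of S "\<lambda>x. sqrt (f x)" "\<lambda>x. f x powr (1/2)" n]
  by (simp add: powr_half_sqrt less_imp_le)

text \<open>\<open>cis\<close> reproduces itself under differentiation up to the factor
  \<open>\<i>\<close>, so cosine and sine follow as real and imaginary part without a simultaneous
  induction.\<close>

lemma Ck_on_cis:
  fixes f :: "'a::euclidean_space \<Rightarrow> real"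
  assumes "dense_axes S" "Ck_on n S f"
  shows "Ck_on n S (\<lambda>x. cis (f x))"
proof -
  have o: "dense_axes (UNIV::real set)" by (intro dense_axes_open) auto
  have c: "Ck_on n UNIV cis"
  proof (induction n)
    case 0
    show ?case by (auto intro!: continuous_intros)
  next
    case (Suc n)
    have "(cis has_vector_derivative \<i> * cis t) (at t)" for t
    proof -
      have "((\<lambda>s. exp (\<i> * of_real s)) has_vector_derivative \<i> * exp (\<i> * of_real t)) (at t)"
        by (rule has_vector_derivative_real_field) (auto intro!: derivative_eq_intros)
      moreover have "cis = (\<lambda>s. exp (\<i> * of_real s))" by (auto simp: cis_conv_exp)
      ultimately show ?thesis by (metis cis_conv_exp)
    qed
    then show ?case
      by (intro Ck_on_vector_SucI[OF o, where g = "\<lambda>x. \<i> * cis x"] Ck_on_mult o Ck_on_const Suc) auto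
  qed
  show ?thesis
    by (rule Ck_on_compose[OF assms(1) o _ c assms(2)]) auto
qed

lemma Ck_on_cos:
  fixes f :: "'a::euclidean_space \<Rightarrow> real"
  assumes "dense_axes S" "Ck_on n S f"
  shows "Ck_on n S (\<lambda>x. cos (f x))"
  using Ck_on_bounded_linear[OF assms(1) bounded_linear_Re Ck_on_cis[OF assms]] by simp

lemma Ck_on_sin:
  fixes f :: "'a::euclidean_space \<Rightarrow> real"
  assumes "dense_axes S" "Ck_on n S f"
  shows "Ck_on n S (\<lambda>x. sin (f x))"
  using Ck_on_bounded_linear[OF assms(1) bounded_linear_Im Ck_on_cis[OF assms]] by simp

lemma Ck_on_of_real:
  assumes "dense_axes S" "Ck_on n S f"
  shows "Ck_on n S (\<lambda>x. of_real (f x) :: 'a::{real_normed_algebra_1,real_inner})"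
  using Ck_on_bounded_linear[OF assms(1) bounded_linear_of_real assms(2)] .

lemma Ck_on_Pair:
  assumes "dense_axes S" "Ck_on n S f" "Ck_on n S g"
  shows "Ck_on n S (\<lambda>x. (f x, g x))"
proof -
  have "bounded_linear (\<lambda>x. (x, 0) :: 'b \<times> 'c)" "bounded_linear (\<lambda>x. (0, x) :: 'b \<times> 'c)"
    by (auto intro!: bounded_linear_intros)
  from Ck_on_add[OF assms(1) Ck_on_bounded_linear[OF assms(1) this(1) assms(2)]
      Ck_on_bounded_linear[OF assms(1) this(2) assms(3)]]
  show ?thesis by simp
qed

lemmas Ck_intros = Ck_on_const Ck_on_add Ck_on_minus Ck_on_diff Ck_on_mult Ck_on_scaleR
  Ck_on_power Ck_on_divide Ck_on_powr Ck_on_sqrt Ck_on_cis Ck_on_cos Ck_on_sin Ck_on_of_real Ck_on_Pair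
  Ck_on_ident

section \<open>Smooth functions and their derivatives in one variable\<close>

lemma smooth_on_cong:
  assumes "\<And>x. x \<in> S \<Longrightarrow> f x = g x"
  shows "smooth_on S f \<longleftrightarrow> smooth_on S g"
  using Ck_on_cong[of S f g] assms by (simp add: smooth_on_def)

lemma smooth_on_has_vector_derivative:
  fixes f :: "real \<Rightarrow> 'b::real_normed_vector"
  assumes "dense_axes I" "smooth_on I f"
  shows "t \<in> I \<Longrightarrow> (f has_vector_derivative cder I f t) (at t within I)"
    "smooth_on I (cder I f)"
  using assms Ck_on_vector_SucE[OF assms(1)] unfolding smooth_on_def by blast+

lemma smooth_on_has_real_derivative:
  fixes f :: "real \<Rightarrow> real"
  assumes "dense_axes I" "smooth_on I f" "t \<in> I"
  shows "(f has_real_derivative cder I f t) (at t within I)"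
  using smooth_on_has_vector_derivative(1)[OF assms]
  by (simp add: has_real_derivative_iff_has_vector_derivative)

lemma smooth_on_vectorI:
  fixes f :: "real \<Rightarrow> 'b::real_normed_vector"
  assumes "dense_axes I" "\<And>t. t \<in> I \<Longrightarrow> (f has_vector_derivative g t) (at t within I)"
    "smooth_on I g"
  shows "smooth_on I f"
  unfolding smooth_on_def
proof
  fix n
  show "Ck_on n I f"
    using Ck_on_vector_SucI[OF assms(1,2), of n] assms(3) Ck_on_Suc_imp by (auto simp: smooth_on_def)
qed

lemma smooth_on_imp_continuous_on: "smooth_on S f \<Longrightarrow> continuous_on S f"
  using Ck_on_imp_continuous_on by (auto simp: smooth_on_def)


section \<open>Ordinary differential equations\<close>

text \<open>\<open>I\<close> may be open, half-open or unbounded. The fundamental theorem is applied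
  on a compact subinterval that is a neighbourhood of \<open>t\<close> relative to \<open>I\<close>,
  where both one-sided and two-sided derivatives are seen correctly.\<close>

lemma continuous_antiderivative_interval:
  fixes g :: "real \<Rightarrow> 'b::banach"
  assumes I: "is_interval I" "t0 \<in> I" and g: "continuous_on I g"
  obtains G where "G t0 = y0" "\<And>t. t \<in> I \<Longrightarrow> (G has_vector_derivative g t) (at t within I)"
proof -
  \<comment> \<open>Away from \<open>t0\<close> one of the two intervals is empty and contributes 0,
    so the difference is the oriented integral from \<open>t0\<close> to \<open>t\<close>.\<close>
  define G where "G t = y0 + (integral {t0..t} g - integral {t..t0} g)" for t
  have G0: "G t0 = y0" by (simp add: G_def)
  have seg: "{\<alpha>..\<beta>} \<subseteq> I" if "\<alpha> \<in> I" "\<beta> \<in> I" for \<alpha> \<beta>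
    using I(1) that by (meson atLeastAtMost_iff mem_is_interval_1_I subsetI)
  have der: "(G has_vector_derivative g t) (at t within {\<alpha>..\<beta>})"
    if "\<alpha> \<in> I" "\<beta> \<in> I" "t \<in> {\<alpha>..\<beta>}" "t0 \<in> {\<alpha>..\<beta>}" for \<alpha> \<beta> t
  proof -
    have c: "continuous_on {\<alpha>..\<beta>} g" using seg[OF that(1,2)] g continuous_on_subset by blast
    have eq: "G s = y0 - integral {\<alpha>..t0} g + integral {\<alpha>..s} g" if s: "s \<in> {\<alpha>..\<beta>}" for s
    proof (cases "t0 \<le> s")
      case True
      have "integral {\<alpha>..t0} g + integral {t0..s} g = integral {\<alpha>..s} g"
        using True s \<open>t0 \<in> {\<alpha>..\<beta>}\<close> c
        by (intro Henstock_Kurzweil_Integration.integral_combine integrable_continuous_real)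
          (auto intro: continuous_on_subset)
      moreover have "integral {s..t0} g = 0" using True by (cases "s = t0") auto
      ultimately show ?thesis by (simp add: G_def algebra_simps)
    next
      case False
      have "integral {\<alpha>..s} g + integral {s..t0} g = integral {\<alpha>..t0} g"
        using False s \<open>t0 \<in> {\<alpha>..\<beta>}\<close> c
        by (intro Henstock_Kurzweil_Integration.integral_combine integrable_continuous_real)
          (auto intro: continuous_on_subset)
      then show ?thesis using False by (simp add: G_def algebra_simps)
    qed
    have "((\<lambda>s. y0 - integral {\<alpha>..t0} g + integral {\<alpha>..s} g) has_vector_derivative g t)
      (at t within {\<alpha>..\<beta>})"
      by (auto intro!: derivative_eq_intros integral_has_vector_derivative c that)
    then show ?thesis
      by (rule has_vector_derivative_transform[OF that(3), rotated]) (use eq in auto)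
  qed
  have "(G has_vector_derivative g t) (at t within I)" if t: "t \<in> I" for t
  proof -
    \<comment> \<open>\<open>\<alpha>\<close> is strictly left of \<open>t\<close> unless
      \<open>t\<close> is the left end of \<open>I\<close>; \<open>\<beta>\<close> is chosen
      likewise on the right. Both also enclose \<open>t0\<close>, the base point of the
      integral.\<close>
    obtain \<alpha> where \<alpha>: "\<alpha> \<in> I" "\<alpha> \<le> t" "\<alpha> \<le> t0" "(\<exists>s\<in>I. s < t) \<Longrightarrow> \<alpha> < t"
    proof (cases "\<exists>s\<in>I. s < t")
      case True
      then obtain s where "s \<in> I" "s < t" by auto
      then show ?thesis using that[of "min s t0"] I(2) by (auto simp: min_def)
    next
      case False
      then show ?thesis using that[of t] t I(2) by (force simp: not_less)
    qed
    obtain \<beta> where \<beta>: "\<beta> \<in> I" "t \<le> \<beta>" "t0 \<le> \<beta>" "(\<exists>s\<in>I. t < s) \<Longrightarrow> t < \<beta>"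
    proof (cases "\<exists>s\<in>I. t < s")
      case True
      then obtain s where "s \<in> I" "t < s" by auto
      then show ?thesis using that[of "max s t0"] I(2) by (auto simp: max_def)
    next
      case False
      then show ?thesis using that[of t] t I(2) by (force simp: not_less)
    qed
    \<comment> \<open>Cuts only on the sides where \<open>I\<close> continues past \<open>t\<close>.
      Inside \<open>U\<close> the sets \<open>I\<close> and \<open>{\<alpha>..\<beta>}\<close>
      agree, hence so do the two filters at \<open>t\<close>.\<close>
    define U where "U = (if \<exists>s\<in>I. s < t then {\<alpha><..} else UNIV) \<inter> (if \<exists>s\<in>I. t < s then {..<\<beta>} else UNIV)"
    have "open U" "t \<in> U" using \<alpha> \<beta> by (auto simp: U_def)
    moreover have "I \<inter> U - {t} = {\<alpha>..\<beta>} \<inter> U - {t}"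
      using seg[OF \<alpha>(1) \<beta>(1)] \<alpha> \<beta> by (auto simp: U_def) (meson linorder_neqE not_less less_imp_le)+
    ultimately have "at t within I = at t within {\<alpha>..\<beta>}" by (intro at_within_nhd) auto
    then show ?thesis using der[OF \<alpha>(1) \<beta>(1)] \<alpha> \<beta> by simp
  qed
  with that G0 show ?thesis by blast
qed

text \<open>Integration of the exponential bound, on the left of \<open>t0\<close> after reflecting
  time. It places the Picard images in the weighted space and also gives their contraction
  factor.\<close>

lemma norm_diff_le_exp_weight:
  fixes W :: "real \<Rightarrow> 'b::real_normed_vector"
  assumes W: "\<And>t. (W has_vector_derivative w t) (at t)" and W0: "W t0 = 0"
    and w: "\<And>t. norm (w t) \<le> D * exp (K * \<bar>t - t0\<bar>)" and K: "K > 0" and D: "D \<ge> 0"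
  shows "norm (W t) \<le> D / K * exp (K * \<bar>t - t0\<bar>)"
proof -
  have *: "norm (V b) \<le> D / K * exp (K * b)"
    if V: "\<And>t. (V has_vector_derivative v t) (at t)" and V0: "V 0 = 0"
      and v: "\<And>t. t \<ge> 0 \<Longrightarrow> norm (v t) \<le> D * exp (K * t)" and b: "b \<ge> 0"
    for V v :: "real \<Rightarrow> 'b" and b
  proof (cases "b = 0")
    case True then show ?thesis using V0 K D by simp
  next
    case False
    have "norm (V b - V 0) \<le> D / K * exp (K * b) - D / K * exp (K * 0)"
    proof (rule differentiable_bound_general[where f' = v and \<phi>' = "\<lambda>t. D * exp (K * t)"])
      show "0 < b" using b False by simp
      show "continuous_on {0..b} V"
        using V has_vector_derivative_continuous by (blast intro: continuous_at_imp_continuous_on)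
      show "((\<lambda>t. D / K * exp (K * t)) has_vector_derivative D * exp (K * x)) (at x)" for x
        using K by (auto intro!: derivative_eq_intros
            simp: has_real_derivative_iff_has_vector_derivative[symmetric])
    qed (use K in \<open>auto intro!: continuous_intros V v\<close>)
    moreover have "0 \<le> D / K" using K D by simp
    ultimately show ?thesis using V0 by simp
  qed
  show ?thesis
  proof (cases "t \<ge> t0")
    case True
    have "((\<lambda>s. W (t0 + s)) has_vector_derivative w (t0 + s)) (at s)" for s
    proof -
      have "((\<lambda>s. t0 + s) has_vector_derivative 1) (at s)"
        by (auto intro!: derivative_eq_intros)
      from vector_diff_chain_at[OF this W] show ?thesis by (simp add: o_def)
    qed
    moreover have "norm (w (t0 + s)) \<le> D * exp (K * s)" if "s \<ge> 0" for s
      using w[of "t0 + s"] that by simp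
    ultimately show ?thesis using *[of "\<lambda>s. W (t0 + s)" "\<lambda>s. w (t0 + s)" "t - t0"] True W0
      by simp
  next
    case False
    have "((\<lambda>s. W (t0 - s)) has_vector_derivative - w (t0 - s)) (at s)" for s
    proof -
      have "((\<lambda>s. t0 - s) has_vector_derivative - 1) (at s)"
        by (auto intro!: derivative_eq_intros)
      from vector_diff_chain_at[OF this W] show ?thesis by (simp add: o_def)
    qed
    moreover have "norm (- w (t0 - s)) \<le> D * exp (K * s)" if "s \<ge> 0" for s
      using w[of "t0 - s"] that by simp
    ultimately show ?thesis using *[of "\<lambda>s. W (t0 - s)" "\<lambda>s. - w (t0 - s)" "t0 - t"] False W0
      by simp
  qed
qed

text \<open>The Picard operator is a contraction for the weighted norm
  \<^term>\<open>SUP t. exp (- K * \<bar>t - t0\<bar>) * norm (y t)\<close> with \<^term>\<open>K = 2 * L\<close>.\<close>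

lemma ode_global_solution:
  fixes f :: "real \<Rightarrow> 'b::banach \<Rightarrow> 'b"
  assumes cont: "continuous_on UNIV (\<lambda>(t, x). f t x)"
    and bdd: "\<And>t x. norm (f t x) \<le> M"
    and lip: "\<And>t x y. norm (f t x - f t y) \<le> L * norm (x - y)"
  obtains y where "y t0 = y0" "\<And>t. (y has_vector_derivative f t (y t)) (at t)"
proof -
  \<comment> \<open>The maximum keeps the exponent positive for \<open>L \<le> 0\<close>; the
    inequality \<open>L \<le> K / 2\<close> is what makes the contraction factor
    \<open>1/2\<close>.\<close>
  define K where "K = 2 * max L 1"
  have K: "K > 0" "L \<le> K / 2" by (auto simp: K_def)
  have M: "M \<ge> 0" using bdd norm_ge_zero order_trans by blast
  let ?e = "\<lambda>t. exp (K * \<bar>t - t0\<bar>)"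
  have fc: "continuous_on UNIV (\<lambda>t. f t (u t))" if "continuous_on UNIV u" for u
    using continuous_on_compose2[OF cont continuous_on_Pair[OF continuous_on_id that]] by simp
  \<comment> \<open>The unknown of the fixed point problem is the bounded function \<open>z\<close>
    with \<open>y t = exp (K * \<bar>t - t0\<bar>) *\<^sub>R z t\<close>, so that the weighted norm
    of \<open>y\<close> is the supremum norm of \<open>z\<close>.\<close>
  have "\<exists>W. W t0 = y0 \<and> (\<forall>t. (W has_vector_derivative f t (?e t *\<^sub>R z t)) (at t))"
    for z :: "real \<Rightarrow>\<^sub>C 'b"
  proof -
    have c: "continuous_on UNIV (\<lambda>t. f t (?e t *\<^sub>R z t))"
      by (intro fc continuous_intros continuous_on_apply_bcontfun)
    from continuous_antiderivative_interval[OF is_interval_univ UNIV_I c]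
    show ?thesis by (metis UNIV_I)
  qed
  then obtain P where P0: "\<And>z. P z t0 = y0"
    and P: "\<And>z t. (P z has_vector_derivative f t (?e t *\<^sub>R apply_bcontfun z t)) (at t)"
    by metis
  have Pc: "continuous_on UNIV (P z)" for z
    using P continuous_on_eq_continuous_at has_vector_derivative_continuous by blast
  have mem: "(\<lambda>t. exp (- K * \<bar>t - t0\<bar>) *\<^sub>R P z t) \<in> bcontfun" for z
  proof (rule bcontfun_normI)
    show "continuous_on UNIV (\<lambda>t. exp (- K * \<bar>t - t0\<bar>) *\<^sub>R P z t)"
      by (intro continuous_intros Pc)
    fix t
    have "norm (P z t - y0) \<le> M / K * ?e t"
    proof (rule norm_diff_le_exp_weight[where w = "\<lambda>t. f t (?e t *\<^sub>R apply_bcontfun z t)"])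
      show "((\<lambda>a. P z a - y0) has_vector_derivative f t (?e t *\<^sub>R apply_bcontfun z t)) (at t)" for t
        using P by (auto intro!: derivative_eq_intros)
      show "norm (f t (?e t *\<^sub>R apply_bcontfun z t)) \<le> M * ?e t" for t
        using bdd[of t "?e t *\<^sub>R apply_bcontfun z t"] M K one_le_exp_iff[of "K * \<bar>t - t0\<bar>"]
        by (smt (verit) mult_nonneg_nonneg mult_le_cancel_left1)
    qed (use P0 K M in auto)
    then have "exp (- K * \<bar>t - t0\<bar>) * norm (P z t - y0) \<le> M / K"
      by (simp add: exp_minus field_simps)
    moreover have "exp (- K * \<bar>t - t0\<bar>) * norm y0 \<le> norm y0"
      using K by (simp add: mult_left_le_one_le)
    moreover have "norm (P z t) \<le> norm (P z t - y0) + norm y0" by norm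
    then have "exp (- K * \<bar>t - t0\<bar>) * norm (P z t)
      \<le> exp (- K * \<bar>t - t0\<bar>) * (norm (P z t - y0) + norm y0)"
      by (intro mult_left_mono) auto
    ultimately show "norm (exp (- K * \<bar>t - t0\<bar>) *\<^sub>R P z t) \<le> M / K + norm y0"
      by (simp add: algebra_simps)
  qed
  define Z where "Z z = Bcontfun (\<lambda>t. exp (- K * \<bar>t - t0\<bar>) *\<^sub>R P z t)" for z
  have Z: "apply_bcontfun (Z z) t = exp (- K * \<bar>t - t0\<bar>) *\<^sub>R P z t" for z t
    unfolding Z_def using mem by (simp add: Bcontfun_inverse)
  have "dist (Z z) (Z z') \<le> 1/2 * dist z z'" for z z'
  proof (rule dist_bound)
    fix t
    have "norm (P z t - P z' t) \<le> (K/2 * dist z z') / K * ?e t"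
    proof (rule norm_diff_le_exp_weight
        [where w = "\<lambda>t. f t (?e t *\<^sub>R apply_bcontfun z t) - f t (?e t *\<^sub>R apply_bcontfun z' t)"])
      fix t
      show "((\<lambda>a. P z a - P z' a) has_vector_derivative
         f t (?e t *\<^sub>R apply_bcontfun z t) - f t (?e t *\<^sub>R apply_bcontfun z' t)) (at t)"
        using P by (auto intro!: derivative_eq_intros)
      have "norm (f t (?e t *\<^sub>R apply_bcontfun z t) - f t (?e t *\<^sub>R apply_bcontfun z' t))
        \<le> L * norm (?e t *\<^sub>R apply_bcontfun z t - ?e t *\<^sub>R apply_bcontfun z' t)"
        by (rule lip)
      also have "\<dots> = L * (?e t * dist (apply_bcontfun z t) (apply_bcontfun z' t))"
        by (simp add: dist_norm flip: scaleR_diff_right)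
      also have "\<dots> \<le> K/2 * (?e t * dist z z')"
        by (intro mult_mono K dist_bounded) (use K in auto)
      finally show "norm (f t (?e t *\<^sub>R apply_bcontfun z t) - f t (?e t *\<^sub>R apply_bcontfun z' t))
        \<le> K / 2 * dist z z' * ?e t" by (simp add: mult_ac)
    qed (use P0 K in auto)
    then show "dist (apply_bcontfun (Z z) t) (apply_bcontfun (Z z') t) \<le> 1/2 * dist z z'"
      using K by (simp add: Z dist_norm flip: scaleR_diff_right) (simp add: exp_minus field_simps)
  qed
  then have "\<exists>!z. Z z = z" by (intro banach_fix_type[where c = "1/2"]) auto
  then obtain z where z: "Z z = z" by auto
  have "?e t *\<^sub>R apply_bcontfun z t = P z t" for t
    using Z[of z t] by (simp add: z exp_minus)
  then have "(P z has_vector_derivative f t (P z t)) (at t)" for t using P[of z t] by simp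
  with that P0 show ?thesis by blast
qed

text \<open>Gronwall's argument for the squared distance \<open>u \<bullet> u\<close>: its
  derivative is at most \<open>2 * L * (u \<bullet> u)\<close> in absolute value. Multiplied by an
  exponential with rate \<open>-2 * L\<close> to the right of \<open>t0\<close>, or
  \<open>2 * L\<close> to the left, it is monotone and vanishes at \<open>t0\<close>.\<close>

lemma ode_unique_Lipschitz:
  fixes y z :: "real \<Rightarrow> 'b::real_inner"
  assumes y: "\<And>t. t \<in> {\<alpha>..\<beta>} \<Longrightarrow> (y has_vector_derivative y' t) (at t)"
    and z: "\<And>t. t \<in> {\<alpha>..\<beta>} \<Longrightarrow> (z has_vector_derivative z' t) (at t)"
    and lip: "\<And>t. t \<in> {\<alpha>..\<beta>} \<Longrightarrow> norm (y' t - z' t) \<le> L * norm (y t - z t)"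
    and t0: "t0 \<in> {\<alpha>..\<beta>}" "y t0 = z t0" and t: "t \<in> {\<alpha>..\<beta>}"
  shows "y t = z t"
proof -
  define u where "u s = y s - z s" for s
  have u: "((\<lambda>s. u s \<bullet> u s) has_real_derivative 2 * (u s \<bullet> (y' s - z' s))) (at s)" if "s \<in> {\<alpha>..\<beta>}" for s
    using y[OF that] z[OF that] unfolding u_def has_vector_derivative_def has_field_derivative_def
    by (auto intro!: derivative_eq_intros simp: fun_eq_iff inner_commute algebra_simps)
  have bnd: "\<bar>u s \<bullet> (y' s - z' s)\<bar> \<le> L * (u s \<bullet> u s)" if "s \<in> {\<alpha>..\<beta>}" for s
  proof -
    have "\<bar>u s \<bullet> (y' s - z' s)\<bar> \<le> norm (u s) * norm (y' s - z' s)" by (rule Cauchy_Schwarz_ineq2)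
    also have "\<dots> \<le> norm (u s) * (L * norm (u s))"
      by (intro mult_left_mono) (use lip[OF that] in \<open>auto simp: u_def\<close>)
    finally show ?thesis by (simp add: dot_square_norm power2_eq_square mult_ac)
  qed
  have "u t \<bullet> u t \<le> 0"
  proof (cases "t0 \<le> t")
    case True
    have "exp (- (2 * L) * t) * (u t \<bullet> u t) \<le> exp (- (2 * L) * t0) * (u t0 \<bullet> u t0)"
    proof (rule DERIV_nonpos_imp_nonincreasing[OF True])
      fix s assume "t0 \<le> s" "s \<le> t"
      then have s: "s \<in> {\<alpha>..\<beta>}" using t0 t by auto
      have "((\<lambda>s. exp (- (2 * L) * s) * (u s \<bullet> u s)) has_real_derivative
          2 * exp (- (2 * L) * s) * (u s \<bullet> (y' s - z' s) - L * (u s \<bullet> u s))) (at s)"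
        by (auto intro!: derivative_eq_intros u[OF s] simp: algebra_simps)
      moreover have "2 * exp (- (2 * L) * s) * (u s \<bullet> (y' s - z' s) - L * (u s \<bullet> u s)) \<le> 0"
        using bnd[OF s] by (intro mult_nonneg_nonpos) auto
      ultimately show "\<exists>d. ((\<lambda>s. exp (- (2 * L) * s) * (u s \<bullet> u s)) has_real_derivative d) (at s) \<and> d \<le> 0"
        by blast
    qed
    then show ?thesis using t0 by (simp add: u_def mult_le_0_iff)
  next
    case False
    then have le: "t \<le> t0" by simp
    have "exp (2 * L * t) * (u t \<bullet> u t) \<le> exp (2 * L * t0) * (u t0 \<bullet> u t0)"
    proof (rule DERIV_nonneg_imp_nondecreasing[OF le])
      fix s assume "t \<le> s" "s \<le> t0"
      then have s: "s \<in> {\<alpha>..\<beta>}" using t0 t by auto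
      have "((\<lambda>s. exp (2 * L * s) * (u s \<bullet> u s)) has_real_derivative
          2 * exp (2 * L * s) * (u s \<bullet> (y' s - z' s) + L * (u s \<bullet> u s))) (at s)"
        by (auto intro!: derivative_eq_intros u[OF s] simp: algebra_simps)
      moreover have "2 * exp (2 * L * s) * (u s \<bullet> (y' s - z' s) + L * (u s \<bullet> u s)) \<ge> 0"
        using bnd[OF s] by (intro mult_nonneg_nonneg) auto
      ultimately show "\<exists>d. ((\<lambda>s. exp (2 * L * s) * (u s \<bullet> u s)) has_real_derivative d) (at s) \<and> 0 \<le> d"
        by blast
    qed
    then show ?thesis using t0 by (simp add: u_def mult_le_0_iff)
  qed
  then have "u t \<bullet> u t = 0" using inner_ge_zero[of "u t"] by linarith
  then show ?thesis by (simp add: u_def)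
qed

text \<open>Time is clamped to \<open>{\<alpha>..\<beta>}\<close> and the state is replaced by its
  closest point in the convex set \<open>K\<close>. This retraction is 1-Lipschitz, so the field
  becomes bounded and globally Lipschitz. A solution of the extended equation is a genuine one as
  long as it stays in \<open>K\<close>; that it does so is the business of
  \<open>trapped\<close>.\<close>

lemma ode_solution_while_in_compact:
  fixes X :: "real \<Rightarrow> 'b::euclidean_space \<Rightarrow> 'b"
  assumes K: "compact K" "convex K" "K \<noteq> {}"
    and cont: "continuous_on ({\<alpha>..\<beta>} \<times> K) (\<lambda>(t, x). X t x)"
    and lip: "\<And>t x y. t \<in> {\<alpha>..\<beta>} \<Longrightarrow> x \<in> K \<Longrightarrow> y \<in> K \<Longrightarrow> norm (X t x - X t y) \<le> L * norm (x - y)"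
    and ab: "\<alpha> \<le> \<beta>"
  obtains y where "y t0 = y0" "continuous_on UNIV y"
    "\<And>t. t \<in> {\<alpha>..\<beta>} \<Longrightarrow> y t \<in> K \<Longrightarrow> (y has_vector_derivative X t (y t)) (at t)"
proof -
  define \<tau> where "\<tau> t = max \<alpha> (min \<beta> t)" for t :: real
  have \<tau>: "\<tau> t \<in> {\<alpha>..\<beta>}" for t using ab by (auto simp: \<tau>_def)
  define f where "f t x = X (\<tau> t) (closest_point K x)" for t x
  have Kc: "closed K" using K compact_imp_closed by blast
  have cK: "closest_point K x \<in> K" for x using closest_point_in_set Kc K by blast
  have L: "norm (f t x - f t y) \<le> max L 0 * norm (x - y)" for t x y
  proof -
    have "norm (f t x - f t y) \<le> L * norm (closest_point K x - closest_point K y)"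
      unfolding f_def using lip \<tau> cK by blast
    also have "\<dots> \<le> max L 0 * norm (closest_point K x - closest_point K y)"
      by (intro mult_right_mono) auto
    also have "\<dots> \<le> max L 0 * norm (x - y)"
      using closest_point_lipschitz[OF K(2) Kc K(3), of x y]
      by (intro mult_left_mono) (auto simp: dist_norm)
    finally show ?thesis .
  qed
  have "compact (({\<alpha>..\<beta>} \<times> K))" using K by (intro compact_Times) auto
  then have "bounded ((\<lambda>(t, x). X t x) ` ({\<alpha>..\<beta>} \<times> K))"
    using compact_continuous_image[OF cont] compact_imp_bounded by blast
  then obtain M where M: "\<And>t x. t \<in> {\<alpha>..\<beta>} \<Longrightarrow> x \<in> K \<Longrightarrow> norm (X t x) \<le> M"
    unfolding bounded_iff by fastforce
  have c: "continuous_on UNIV (\<lambda>(t, x). f t x)"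
  proof -
    have "continuous_on UNIV (\<lambda>p. (\<tau> (fst p), closest_point K (snd p)))"
      unfolding \<tau>_def
      by (intro continuous_intros continuous_on_compose2[OF continuous_on_closest_point[OF K(2) Kc K(3)]]) auto
    moreover have "(\<lambda>p. (\<tau> (fst p), closest_point K (snd p))) ` UNIV \<subseteq> {\<alpha>..\<beta>} \<times> K"
      using \<tau> cK by auto
    ultimately show ?thesis
      using continuous_on_compose2[OF cont, of UNIV "\<lambda>p. (\<tau> (fst p), closest_point K (snd p))"]
      by (simp add: f_def case_prod_beta)
  qed
  obtain y where y: "y t0 = y0" "\<And>t. (y has_vector_derivative f t (y t)) (at t)"
    using ode_global_solution[OF c, of M "max L 0"] L M \<tau> cK unfolding f_def by metis
  have "continuous_on UNIV y"
    using y(2) continuous_on_eq_continuous_at has_vector_derivative_continuous by blast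
  moreover have "f t (y t) = X t (y t)" if "t \<in> {\<alpha>..\<beta>}" "y t \<in> K" for t
    using that by (simp add: f_def \<tau>_def closest_point_self)
  ultimately show ?thesis using that y by metis
qed

text \<open>At the first time outside the interior of \<open>K\<close>, closedness still gives
  \<open>y \<in> K\<close> up to and including that time. The step hypothesis then moves the point
  into \<open>K'\<close>, inside the interior, a contradiction.\<close>

lemma trapped_forward:
  fixes y :: "real \<Rightarrow> 'b::metric_space"
  assumes y: "continuous_on {0..\<beta>} y" and K: "closed K" and K': "K' \<subseteq> interior K"
    and y0: "y 0 \<in> K"
    and step: "\<And>t. t \<in> {0..\<beta>} \<Longrightarrow> (\<forall>s\<in>{0..t}. y s \<in> K) \<Longrightarrow> y t \<in> K'"
    and t: "t \<in> {0..\<beta>}"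
  shows "y t \<in> K"
proof (rule ccontr)
  assume nt: "y t \<notin> K"
  define S where "S = {s \<in> {0..t}. y s \<notin> interior K}"
  have "continuous_on {0..t} y" using y t continuous_on_subset by fastforce
  then have "closed {s \<in> {0..t}. y s \<in> - interior K}"
    by (intro continuous_closed_preimage[unfolded vimage_def Int_def mem_Collect_eq]) auto
  then have "compact S" unfolding S_def
    by (auto simp: compact_eq_bounded_closed intro: bounded_subset[OF bounded_closed_interval[of 0 t]])
  moreover have "t \<in> S" using nt t interior_subset by (auto simp: S_def)
  ultimately obtain s where s: "s \<in> S" "\<And>r. r \<in> S \<Longrightarrow> s \<le> r"
    using compact_attains_inf[of S] by blast
  have in_int: "y r \<in> interior K" if "0 \<le> r" "r < s" for r
    using s that by (force simp: S_def)
  have "y s \<in> K"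
  proof (cases "s = 0")
    case False
    then have s0: "0 < s" using s by (auto simp: S_def)
    have "continuous_on {0..s} y" using y t s(1) continuous_on_subset by (fastforce simp: S_def)
    then have "closed {r \<in> {0..s}. y r \<in> K}"
      using K by (intro continuous_closed_preimage[unfolded vimage_def Int_def mem_Collect_eq]) auto
    moreover have "{0..<s} \<subseteq> {r \<in> {0..s}. y r \<in> K}"
      using in_int interior_subset by fastforce
    ultimately have "closure {0..<s} \<subseteq> {r \<in> {0..s}. y r \<in> K}" by (rule closure_minimal[rotated])
    moreover have "s \<in> closure {0..<s}" using s0 by simp
    ultimately show ?thesis by blast
  qed (use y0 in simp)
  moreover have "y r \<in> K" if "0 \<le> r" "r < s" for r using in_int[OF that] interior_subset by blast
  ultimately have "\<forall>r\<in>{0..s}. y r \<in> K" by (metis atLeastAtMost_iff order_le_less)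
  then have "y s \<in> K'" using step[of s] s(1) t by (auto simp: S_def)
  then show False using K' s(1) by (auto simp: S_def)
qed

lemma trapped:
  fixes y :: "real \<Rightarrow> 'b::metric_space"
  assumes y: "continuous_on UNIV y" and K: "closed K" and K': "K' \<subseteq> interior K"
    and y0: "y t0 \<in> K" and t0: "t0 \<in> {\<alpha>..\<beta>}"
    and step: "\<And>t. t \<in> {\<alpha>..\<beta>} \<Longrightarrow> (\<forall>s\<in>closed_segment t0 t. y s \<in> K) \<Longrightarrow> y t \<in> K'"
    and t: "t \<in> {\<alpha>..\<beta>}"
  shows "y t \<in> K"
proof (cases "t0 \<le> t")
  case True
  have "y (t0 + (t - t0)) \<in> K"
  proof (rule trapped_forward[where \<beta> = "\<beta> - t0" and K' = K' and y = "\<lambda>s. y (t0 + s)"])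
    show "continuous_on {0..\<beta> - t0} (\<lambda>s. y (t0 + s))"
      by (intro continuous_on_compose2[OF y] continuous_intros) auto
    fix s assume s: "s \<in> {0..\<beta> - t0}" "\<forall>r\<in>{0..s}. y (t0 + r) \<in> K"
    have "\<forall>r\<in>closed_segment t0 (t0 + s). y r \<in> K"
      using s(1) s(2)[rule_format, of "_ - t0"] by (auto simp: closed_segment_eq_real_ivl)
    then show "y (t0 + s) \<in> K'" using step[of "t0 + s"] s(1) t0 by auto
  qed (use assms True in auto)
  then show ?thesis by simp
next
  case False
  have "y (t0 - (t0 - t)) \<in> K"
  proof (rule trapped_forward[where \<beta> = "t0 - \<alpha>" and K' = K' and y = "\<lambda>s. y (t0 - s)"])
    show "continuous_on {0..t0 - \<alpha>} (\<lambda>s. y (t0 - s))"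
      by (intro continuous_on_compose2[OF y] continuous_intros) auto
    fix s assume s: "s \<in> {0..t0 - \<alpha>}" "\<forall>r\<in>{0..s}. y (t0 - r) \<in> K"
    have "\<forall>r\<in>closed_segment t0 (t0 - s). y r \<in> K"
      using s(1) s(2)[rule_format, of "t0 - _"] by (auto simp: closed_segment_eq_real_ivl)
    then show "y (t0 - s) \<in> K'" using step[of "t0 - s"] s(1) t0 by auto
  qed (use assms False in auto)
  then show ?thesis by simp
qed


section \<open>Geometry of warped patches\<close>

text \<open>The pointwise requirement that \<open>riemannian_manifold\<close> puts on
  \<open>pmet p x\<close>.\<close>

definition metric_form :: "('e::euclidean_space \<Rightarrow> 'e \<Rightarrow> real) \<Rightarrow> bool" where
  "metric_form g \<longleftrightarrow> bilinear g \<and> (\<forall>v w. g v w = g w v) \<and> (\<forall>v. v \<noteq> 0 \<longrightarrow> 0 < g v v)"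

lemma metric_form_simps:
  assumes "metric_form g"
  shows "g (v + v') w = g v w + g v' w" "g v (w + w') = g v w + g v w'"
    "g (s *\<^sub>R v) w = s * g v w" "g v (s *\<^sub>R w) = s * g v w" "g 0 w = 0" "g v 0 = 0"
    "g (v - v') w = g v w - g v' w"
proof -
  have "bilinear g" using assms by (simp add: metric_form_def)
  then show "g (v + v') w = g v w + g v' w" "g v (w + w') = g v w + g v w'"
    "g (s *\<^sub>R v) w = s * g v w" "g v (s *\<^sub>R w) = s * g v w" "g 0 w = 0" "g v 0 = 0"
    "g (v - v') w = g v w - g v' w"
    by (simp_all add: bilinear_ladd bilinear_radd bilinear_lmul bilinear_rmul bilinear_lzero
        bilinear_rzero bilinear_lsub)
qed

lemma metric_form_nonneg: "metric_form g \<Longrightarrow> 0 \<le> g v v"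
  using metric_form_simps(5)[of g v] by (cases "v = 0") (auto simp: metric_form_def less_imp_le)

text \<open>Lowering an index is linear, and injective by positive definiteness, hence surjective in
  finite dimension. This gives the definite description in \<open>dual_vec\<close> its
  meaning.\<close>

lemma metric_form_dual_ex1:
  fixes g :: "'e::euclidean_space \<Rightarrow> 'e \<Rightarrow> real"
  assumes g: "metric_form g"
  shows "\<exists>!y. \<forall>z. g y z = z \<bullet> e"
proof -
  note s = metric_form_simps[OF g]
  define A where "A y = (\<Sum>b\<in>Basis. g y b *\<^sub>R b)" for y
  have Ab: "A y \<bullet> b = g y b" if "b \<in> Basis" for y b
    using that by (simp add: A_def inner_sum_left inner_Basis if_distrib cong: if_cong)
  have A: "A y \<bullet> z = g y z" for y z
  proof -
    have lin: "linear (g y)" using g by (simp add: metric_form_def bilinear_def)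
    have "g y z = g y (\<Sum>b\<in>Basis. (z \<bullet> b) *\<^sub>R b)" by (simp add: euclidean_representation)
    also have "\<dots> = (\<Sum>b\<in>Basis. (z \<bullet> b) * g y b)"
      by (simp add: linear_sum[OF lin] linear_scale[OF lin])
    also have "\<dots> = A y \<bullet> z"
      by (subst (2) euclidean_inner) (simp add: Ab mult.commute cong: sum.cong)
    finally show ?thesis ..
  qed
  have lin: "linear A"
    by (rule linearI) (simp_all add: A_def s scaleR_add_left sum.distrib scaleR_sum_right)
  have inj: "inj A"
    unfolding linear_injective_0[OF lin]
  proof (intro allI impI)
    fix y assume "A y = 0"
    then have "g y y = 0" using A[of y y] by simp
    then show "y = 0" using g unfolding metric_form_def by force
  qed
  then have "surj A" using lin linear_injective_imp_surjective by blast
  then obtain y where y: "A y = e" by (metis surj_def)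
  show ?thesis
  proof (rule ex1I[of _ y])
    show "\<forall>z. g y z = z \<bullet> e" using A[of y] y by (simp add: inner_commute)
    fix y' assume "\<forall>z. g y' z = z \<bullet> e"
    then have "A y' = e" using A[of y'] by (metis inner_commute vector_eq_rdot)
    with y inj show "y' = y" by (metis injD)
  qed
qed

lemma dual_vec_works:
  assumes "metric_form (pmet p x)"
  shows "pmet p x (dual_vec p x e) z = z \<bullet> e"
  unfolding dual_vec_def using theI'[OF metric_form_dual_ex1[OF assms]] by blast

lemma dual_vec_eqI:
  assumes "metric_form (pmet p x)" "\<And>z. pmet p x y z = z \<bullet> e"
  shows "dual_vec p x e = y"
  unfolding dual_vec_def using metric_form_dual_ex1[OF assms(1)] assms(2) by (intro the1_equality) auto

section \<open>Directional derivatives within a set\<close>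

lemma dder_eqI:
  assumes "dense_axes S" "x \<in> S" "(f has_derivative f') (at x within S)"
  shows "dder S v f x = f' v"
  using frechet_derivative_eqI[OF assms] by (simp add: dder_def)

lemma dder_cong:
  assumes "\<And>y. y \<in> S \<Longrightarrow> f y = g y" "x \<in> S"
  shows "dder S v f x = dder S v g x"
proof -
  have "(f has_derivative D) (at x within S) \<longleftrightarrow> (g has_derivative D) (at x within S)" for D
    using assms has_derivative_transform[of x S f g] has_derivative_transform[of x S g f] by auto
  then show ?thesis by (simp add: dder_def frechet_derivative_def)
qed

lemma differentiable_on_has_dder:
  assumes "f differentiable_on S" "x \<in> S"
  shows "(f has_derivative (\<lambda>v. dder S v f x)) (at x within S)"
  using assms by (simp add: dder_def differentiable_on_def frechet_derivative_works)

lemma smooth_on_has_dder: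
  assumes "smooth_on S f" "x \<in> S"
  shows "(f has_derivative (\<lambda>v. dder S v f x)) (at x within S)"
proof -
  have "Ck_on (Suc 0) S f" using assms(1) unfolding smooth_on_def by blast
  then show ?thesis using differentiable_on_has_dder assms(2) by auto
qed

lemma smooth_on_dder: "smooth_on S f \<Longrightarrow> smooth_on S (dder S v f)"
proof -
  assume f: "smooth_on S f"
  have "Ck_on n S (dder S v f)" for n
  proof -
    have "Ck_on (Suc n) S f" using f by (auto simp only: smooth_on_def)
    then show ?thesis by (auto simp: dder_def[abs_def])
  qed
  then show ?thesis by (simp add: smooth_on_def)
qed

lemma dder_zero:
  fixes f :: "'a::euclidean_space \<Rightarrow> real"
  assumes "dense_axes S" "x \<in> S" "\<forall>y\<in>S. f y = 0"
  shows "dder S v f x = 0"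
proof -
  have "dder S v f x = dder S v (\<lambda>_. 0) x" using assms by (intro dder_cong) auto
  also have "\<dots> = 0" by (simp add: dder_eqI[OF assms(1,2) has_derivative_const])
  finally show ?thesis .
qed

lemma dder_scaleR:
  assumes "smooth_on S f" "x \<in> S"
  shows "dder S (s *\<^sub>R v) f x = s *\<^sub>R dder S v f x"
  using has_derivative_linear[OF smooth_on_has_dder[OF assms]] by (rule linear_scale)

lemma dder_direction_0:
  assumes "smooth_on S f" "x \<in> S"
  shows "dder S 0 f x = 0"
  using has_derivative_linear[OF smooth_on_has_dder[OF assms]] by (rule linear_0)

lemma sum_Basis_prod:
  "sum f (Basis :: ('a::euclidean_space \<times> 'b::euclidean_space) set) =
    (\<Sum>i\<in>Basis. f (i, 0)) + (\<Sum>i\<in>Basis. f (0, i))"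
proof -
  have "inj_on (\<lambda>u. (u::'a, 0::'b)) Basis" "inj_on (\<lambda>u. (0::'a, u::'b)) Basis"
    by (auto intro!: inj_onI)
  then show ?thesis
    unfolding Basis_prod_def
    by (subst sum.union_disjoint) (auto simp: Basis_prod_def sum.reindex)
qed

lemma norm_vector_scalar_mult:
  "norm ((z::complex) *s (v :: complex ^ 'n)) = norm z * norm v"
  by (simp add: norm_vec_def norm_mult L2_set_right_distrib)

lemma bounded_bilinear_vector_scalar_mult:
  "bounded_bilinear (\<lambda>(z::complex) (v :: complex ^ 'n). z *s v)"
proof
  show "\<exists>K. \<forall>a b. norm ((a::complex) *s (b :: complex ^ 'n)) \<le> norm a * norm b * K"
    by (rule exI[of _ 1]) (simp add: norm_vector_scalar_mult)
qed (auto simp: vec_eq_iff algebra_simps)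

text \<open>Multiplication by \<open>z\<close> is a rotation scaled by \<open>norm z\<close> in
  every complex coordinate, so it scales real inner products by the square.\<close>

lemma inner_vector_scalar_mult:
  "((z::complex) *s (v :: complex ^ 'n)) \<bullet> (z *s w) = (norm z)\<^sup>2 * (v \<bullet> w)"
proof -
  have "(z * a) \<bullet> (z * b) = (norm z)\<^sup>2 * (a \<bullet> b)" for a b :: complex
    by (simp only: inner_complex_def cmod_power2) (simp add: power2_eq_square algebra_simps)
  then show ?thesis by (simp add: inner_vec_def sum_distrib_left)
qed

interpretation vsm: bounded_bilinear "\<lambda>(z::complex) (v :: complex ^ 'n). z *s v"
  by (rule bounded_bilinear_vector_scalar_mult)

text \<open>One patch of each factor with the data over which the warped metric is block diagonal;
  the coordinate computations of connection, Laplacian and energy take place here.\<close>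

locale warped_patches =
  fixes I :: "real set" and l1 l2 :: "real \<Rightarrow> real"
    and p :: "('e1::euclidean_space, 'm1) patch" and q :: "('e2::euclidean_space, 'm2) patch"
  assumes I: "dense_axes I" and dom: "open (pdom p)" "open (pdom q)"
    and met: "\<And>x. x \<in> pdom p \<Longrightarrow> metric_form (pmet p x)" "\<And>y. y \<in> pdom q \<Longrightarrow> metric_form (pmet q y)"
    and smooth_met: "\<And>v w. smooth_on (pdom p) (\<lambda>x. pmet p x v w)"
      "\<And>v w. smooth_on (pdom q) (\<lambda>y. pmet q y v w)"
    and smooth_l: "smooth_on I l1" "smooth_on I l2"
    and pos_l: "\<And>t. t \<in> I \<Longrightarrow> 0 < l1 t" "\<And>t. t \<in> I \<Longrightarrow> 0 < l2 t"
begin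

abbreviation (input) W :: "(real \<times> 'e1 \<times> 'e2, real \<times> 'm1 \<times> 'm2) patch" where
  "W \<equiv> warped_patch I l1 l2 p q"

abbreviation (input) P where "P \<equiv> I \<times> pdom p \<times> pdom q"

lemma dense_axes_P: "dense_axes P" "dense_axes (pdom p)" "dense_axes (pdom q)"
  by (intro dense_axes_Times[OF I dense_axes_Times[OF dense_axes_open dense_axes_open]]
      dense_axes_open dom)+

lemma pdom_W: "pdom W = P"
  by (simp add: warped_patch_def)

lemma pmet_W:
  "pmet W (t, x, y) (r, v, w) (r', v', w') =
     r * r' + (l1 t)\<^sup>2 * pmet p x v v' + (l2 t)\<^sup>2 * pmet q y w w'"
  by (simp add: warped_patch_def)

lemma metric_form_W:
  assumes "(t, x, y) \<in> P"
  shows "metric_form (pmet W (t, x, y))"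
proof -
  have g: "metric_form (pmet p x)" "metric_form (pmet q y)" and l: "l1 t > 0" "l2 t > 0"
    using assms met pos_l by auto
  note s = metric_form_simps[OF g(1)] metric_form_simps[OF g(2)]
  have "bilinear (pmet W (t, x, y))"
    unfolding bilinear_def
    by (intro conjI allI linearI) (auto simp: pmet_W s algebra_simps)
  moreover have "pmet W (t, x, y) v w = pmet W (t, x, y) w v" for v w
    using g by (cases v; cases w) (auto simp: pmet_W metric_form_def)
  moreover have "0 < pmet W (t, x, y) v v" if "v \<noteq> 0" for v
  proof -
    obtain a b c where v: "v = (a, b, c)" by (cases v)
    have "0 \<le> a * a" "0 \<le> (l1 t)\<^sup>2 * pmet p x b b" "0 \<le> (l2 t)\<^sup>2 * pmet q y c c"
      using g by (auto simp: metric_form_nonneg)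
    moreover have "a \<noteq> 0 \<Longrightarrow> 0 < a * a" "b \<noteq> 0 \<Longrightarrow> 0 < (l1 t)\<^sup>2 * pmet p x b b"
      "c \<noteq> 0 \<Longrightarrow> 0 < (l2 t)\<^sup>2 * pmet q y c c"
      using g l by (auto simp: metric_form_def zero_less_mult_iff)
    ultimately show ?thesis using that v by (fastforce simp: pmet_W zero_prod_def)
  qed
  ultimately show ?thesis by (simp add: metric_form_def)
qed

text \<open>The inverse of a block diagonal metric is block diagonal, and inverting the factor
  \<open>l\<^sup>2\<close> gives the weights.\<close>

lemma dual_vec_W:
  assumes "(t, x, y) \<in> P"
  shows "dual_vec W (t, x, y) (r, v, w) =
    (r, (1 / (l1 t)\<^sup>2) *\<^sub>R dual_vec p x v, (1 / (l2 t)\<^sup>2) *\<^sub>R dual_vec q y w)"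
proof (rule dual_vec_eqI[OF metric_form_W[OF assms]])
  have g: "metric_form (pmet p x)" "metric_form (pmet q y)" and l: "l1 t > 0" "l2 t > 0"
    using assms met pos_l by auto
  show "pmet W (t, x, y)
    (r, (1 / (l1 t)\<^sup>2) *\<^sub>R dual_vec p x v, (1 / (l2 t)\<^sup>2) *\<^sub>R dual_vec q y w) z = z \<bullet> (r, v, w)"
    for z
    using l by (cases z) (auto simp: pmet_W metric_form_simps[OF g(1)] metric_form_simps[OF g(2)]
        dual_vec_works[of p, OF g(1)] dual_vec_works[of q, OF g(2)] inner_prod_def)
qed

lemma dder_met_zero:
  "x \<in> pdom p \<Longrightarrow> dder (pdom p) \<xi> (\<lambda>x. pmet p x 0 v) x = 0"
  "x \<in> pdom p \<Longrightarrow> dder (pdom p) \<xi> (\<lambda>x. pmet p x v 0) x = 0"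
  "y \<in> pdom q \<Longrightarrow> dder (pdom q) \<eta> (\<lambda>x. pmet q x 0 w) y = 0"
  "y \<in> pdom q \<Longrightarrow> dder (pdom q) \<eta> (\<lambda>x. pmet q x w 0) y = 0"
proof -
  show "x \<in> pdom p \<Longrightarrow> dder (pdom p) \<xi> (\<lambda>x. pmet p x 0 v) x = 0"
    "x \<in> pdom p \<Longrightarrow> dder (pdom p) \<xi> (\<lambda>x. pmet p x v 0) x = 0"
    using met by (auto intro!: dder_zero dense_axes_P simp: metric_form_simps)
  show "y \<in> pdom q \<Longrightarrow> dder (pdom q) \<eta> (\<lambda>x. pmet q x 0 w) y = 0"
    "y \<in> pdom q \<Longrightarrow> dder (pdom q) \<eta> (\<lambda>x. pmet q x w 0) y = 0"
    using met by (auto intro!: dder_zero dense_axes_P simp: metric_form_simps)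
qed

lemma has_derivative_fst_P:
  assumes "(t, x, y) \<in> P" "(h has_derivative h') (at t within I)"
  shows "((\<lambda>z. h (fst z)) has_derivative (\<lambda>z. h' (fst z))) (at (t, x, y) within P)"
proof -
  have "(h has_derivative h') (at (fst (t, x, y)) within fst ` P)"
    using assms by (auto intro: has_derivative_subset)
  from diff_chain_within[OF has_derivative_fst[OF has_derivative_ident] this]
  show ?thesis by (simp add: o_def)
qed

lemma has_derivative_snd_P:
  assumes "(t, x, y) \<in> P" "(h has_derivative h') (at x within pdom p)"
  shows "((\<lambda>z. h (fst (snd z))) has_derivative (\<lambda>z. h' (fst (snd z)))) (at (t, x, y) within P)"
proof -
  have "(h has_derivative h') (at (fst (snd (t, x, y))) within (\<lambda>z. fst (snd z)) ` P)"
    using assms by (auto intro: has_derivative_subset)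
  from diff_chain_within[OF has_derivative_fst[OF has_derivative_snd[OF has_derivative_ident]] this]
  show ?thesis by (simp add: o_def)
qed

lemma has_derivative_thd_P:
  assumes "(t, x, y) \<in> P" "(h has_derivative h') (at y within pdom q)"
  shows "((\<lambda>z. h (snd (snd z))) has_derivative (\<lambda>z. h' (snd (snd z)))) (at (t, x, y) within P)"
proof -
  have "(h has_derivative h') (at (snd (snd (t, x, y))) within (\<lambda>z. snd (snd z)) ` P)"
    using assms by (auto intro: has_derivative_subset)
  from diff_chain_within[OF has_derivative_snd[OF has_derivative_snd[OF has_derivative_ident]] this]
  show ?thesis by (simp add: o_def)
qed

text \<open>Only the time direction differentiates the warps, and each spatial direction sees only
  the metric of its own factor. All Christoffel terms below come from this formula.\<close>

lemma dder_pmet_W: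
  assumes z: "(t, x, y) \<in> P"
  shows "dder P (\<rho>, \<xi>, \<eta>) (\<lambda>z. pmet W z (r, v, w) (r', v', w')) (t, x, y) =
    \<rho> * (2 * l1 t * cder I l1 t * pmet p x v v' + 2 * l2 t * cder I l2 t * pmet q y w w')
    + (l1 t)\<^sup>2 * dder (pdom p) \<xi> (\<lambda>x. pmet p x v v') x
    + (l2 t)\<^sup>2 * dder (pdom q) \<eta> (\<lambda>y. pmet q y w w') y"
proof -
  have t: "t \<in> I" and x: "x \<in> pdom p" and y: "y \<in> pdom q" using z by auto
  have l: "(l1 has_derivative (\<lambda>h. h * cder I l1 t)) (at t within I)"
    "(l2 has_derivative (\<lambda>h. h * cder I l2 t)) (at t within I)"
    using smooth_on_has_vector_derivative(1)[OF I smooth_l(1) t]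
      smooth_on_has_vector_derivative(1)[OF I smooth_l(2) t]
    by (simp_all add: has_vector_derivative_def)
  have g: "((\<lambda>x. pmet p x v v') has_derivative (\<lambda>\<xi>. dder (pdom p) \<xi> (\<lambda>x. pmet p x v v') x))
      (at x within pdom p)"
    "((\<lambda>y. pmet q y w w') has_derivative (\<lambda>\<eta>. dder (pdom q) \<eta> (\<lambda>y. pmet q y w w') y))
      (at y within pdom q)"
    using smooth_on_has_dder smooth_met x y by blast+
  note d = has_derivative_fst_P[OF z l(1)] has_derivative_fst_P[OF z l(2)]
    has_derivative_snd_P[OF z g(1)] has_derivative_thd_P[OF z g(2)]
  have "((\<lambda>z. r * r' + (l1 (fst z))\<^sup>2 * pmet p (fst (snd z)) v v'
       + (l2 (fst z))\<^sup>2 * pmet q (snd (snd z)) w w') has_derivative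
     (\<lambda>z. fst z * (2 * l1 t * cder I l1 t * pmet p x v v' + 2 * l2 t * cder I l2 t * pmet q y w w')
    + (l1 t)\<^sup>2 * dder (pdom p) (fst (snd z)) (\<lambda>x. pmet p x v v') x
    + (l2 t)\<^sup>2 * dder (pdom q) (snd (snd z)) (\<lambda>y. pmet q y w w') y)) (at (t, x, y) within P)"
    by (auto intro!: derivative_eq_intros d simp: fun_eq_iff algebra_simps)
  from dder_eqI[OF dense_axes_P(1) z this, of "(\<rho>, \<xi>, \<eta>)"]
  show ?thesis by (simp add: pmet_W warped_patch_def case_prod_beta)
qed

text \<open>In the trace of the Hessian the second argument is a dual vector, which
  \<open>dual_vec_W\<close> rescales by a function of time; \<open>hess_scale\<close> uses this
  homogeneity to pull the factor out.\<close>

lemma christoffel_scale: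
  assumes "x \<in> pdom p"
  shows "christoffel p x v (s *\<^sub>R w) = s *\<^sub>R christoffel p x v w"
proof -
  have d: "dder (pdom p) \<xi> (\<lambda>y. s * pmet p y a b) x = s * dder (pdom p) \<xi> (\<lambda>y. pmet p y a b) x" for \<xi> a b
    using dder_eqI[OF dense_axes_P(2) assms has_derivative_mult_right[OF smooth_on_has_dder
          [OF smooth_met(1) assms]]] .
  have c: "dder (pdom p) \<xi> (\<lambda>y. pmet p y (s *\<^sub>R a) b) x = s * dder (pdom p) \<xi> (\<lambda>y. pmet p y a b) x"
    "dder (pdom p) \<xi> (\<lambda>y. pmet p y a (s *\<^sub>R b)) x = s * dder (pdom p) \<xi> (\<lambda>y. pmet p y a b) x" for \<xi> a b
    unfolding d[symmetric] by (intro dder_cong; use assms in \<open>simp add: metric_form_simps met\<close>)+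
  show ?thesis
    unfolding christoffel_def c dder_scaleR[OF smooth_met(1) assms] scaleR_sum_right scaleR_scaleR
    by (intro sum.cong refl arg_cong2[of _ _ _ _ scaleR]) (simp add: field_simps)
qed

lemma christoffel_W_t:
  assumes z: "(t, x, y) \<in> P"
  shows "christoffel W (t, x, y) (1, 0, 0) (1, 0, 0) = 0"
proof -
  have "x \<in> pdom p" "y \<in> pdom q" using z by auto
  then show ?thesis
    by (simp add: christoffel_def pdom_W sum_Basis_prod dder_pmet_W[OF z] dder_met_zero
        metric_form_simps met zero_prod_def) (simp add: prod_eq_iff fst_sum snd_sum)
qed

text \<open>The time component comes from the second fundamental form of the slices, and its trace
  yields the term \<open>l1' / l1\<close> of the Laplacian. The dual of a basis vector lies in the
  same block, so the trace meets only such diagonal blocks.\<close>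

lemma christoffel_W_x:
  assumes z: "(t, x, y) \<in> P"
  shows "christoffel W (t, x, y) (0, v, 0) (0, v', 0) =
    (- (l1 t * cder I l1 t * pmet p x v v'), christoffel p x v v', 0)"
proof -
  have xy: "x \<in> pdom p" "y \<in> pdom q" and "0 < l1 t" using z pos_l by auto
  have s: "(((l1 t)\<^sup>2 * a e + (l1 t)\<^sup>2 * b e - (l1 t)\<^sup>2 * c e) / (2 * (l1 t)\<^sup>2)) = (a e + b e - c e) / 2"
    for a b c :: "'e1 \<Rightarrow> real" and e
    using \<open>0 < l1 t\<close> by (simp add: field_simps)
  have z0: "dual_vec p x 0 = 0" "dual_vec q y 0 = 0"
    using met xy by (auto intro!: dual_vec_eqI simp: metric_form_simps)
  show ?thesis
    by (simp add: christoffel_def pdom_W sum_Basis_prod dder_pmet_W[OF z] dder_met_zero xy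
        metric_form_simps met dual_vec_W[OF z] z0 zero_prod_def
        dder_direction_0[OF smooth_met(1)] dder_direction_0[OF smooth_met(2)])
      (simp add: s prod_eq_iff fst_sum snd_sum)
qed

lemma christoffel_W_y:
  assumes z: "(t, x, y) \<in> P"
  shows "christoffel W (t, x, y) (0, 0, v) (0, 0, v') =
    (- (l2 t * cder I l2 t * pmet q y v v'), 0, christoffel q y v v')"
proof -
  have xy: "x \<in> pdom p" "y \<in> pdom q" and "0 < l2 t" using z pos_l by auto
  have s: "(((l2 t)\<^sup>2 * a e + (l2 t)\<^sup>2 * b e - (l2 t)\<^sup>2 * c e) / (2 * (l2 t)\<^sup>2)) = (a e + b e - c e) / 2"
    for a b c :: "'e2 \<Rightarrow> real" and e
    using \<open>0 < l2 t\<close> by (simp add: field_simps)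
  have z0: "dual_vec p x 0 = 0" "dual_vec q y 0 = 0"
    using met xy by (auto intro!: dual_vec_eqI simp: metric_form_simps)
  show ?thesis
    by (simp add: christoffel_def pdom_W sum_Basis_prod dder_pmet_W[OF z] dder_met_zero xy
        metric_form_simps met dual_vec_W[OF z] z0 zero_prod_def
        dder_direction_0[OF smooth_met(1)] dder_direction_0[OF smooth_met(2)])
      (simp add: s prod_eq_iff fst_sum snd_sum)
qed

text \<open>The coefficient functions and the maps on the factors are arbitrary, so that second
  derivatives reuse the formula after a factor has been replaced by a derivative or by zero.\<close>

lemma dder_product:
  fixes \<phi>1 :: "'e1 \<Rightarrow> complex ^ 'n1" and \<phi>2 :: "'e2 \<Rightarrow> complex ^ 'n2"
  assumes z: "(t, x, y) \<in> P"
    and z1: "(z1 has_vector_derivative z1') (at t within I)"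
    and z2: "(z2 has_vector_derivative z2') (at t within I)"
    and \<phi>: "smooth_on (pdom p) \<phi>1" "smooth_on (pdom q) \<phi>2"
  shows "dder P (\<rho>, \<xi>, \<eta>) (\<lambda>(t, x, y). (z1 t *s \<phi>1 x, z2 t *s \<phi>2 y)) (t, x, y) =
    (\<rho> *\<^sub>R (z1' *s \<phi>1 x) + z1 t *s dder (pdom p) \<xi> \<phi>1 x,
     \<rho> *\<^sub>R (z2' *s \<phi>2 y) + z2 t *s dder (pdom q) \<eta> \<phi>2 y)"
proof -
  have x: "x \<in> pdom p" and y: "y \<in> pdom q" using z by auto
  note d = has_derivative_fst_P[OF z z1[unfolded has_vector_derivative_def]]
    has_derivative_fst_P[OF z z2[unfolded has_vector_derivative_def]]
    has_derivative_snd_P[OF z smooth_on_has_dder[OF \<phi>(1) x]]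
    has_derivative_thd_P[OF z smooth_on_has_dder[OF \<phi>(2) y]]
  have "((\<lambda>z. (z1 (fst z) *s \<phi>1 (fst (snd z)), z2 (fst z) *s \<phi>2 (snd (snd z)))) has_derivative
    (\<lambda>z. (z1 t *s dder (pdom p) (fst (snd z)) \<phi>1 x + (fst z *\<^sub>R z1') *s \<phi>1 x,
          z2 t *s dder (pdom q) (snd (snd z)) \<phi>2 y + (fst z *\<^sub>R z2') *s \<phi>2 y)))
      (at (t, x, y) within P)"
    using vsm.FDERIV[OF d(1,3)] vsm.FDERIV[OF d(2,4)] by (auto intro: has_derivative_Pair)
  from dder_eqI[OF dense_axes_P(1) z this, of "(\<rho>, \<xi>, \<eta>)"]
  show ?thesis by (simp add: case_prod_beta' vsm.scaleR_left add.commute)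
qed

end


section \<open>Harmonic products\<close>

lemma vector_smult_add:
  fixes v B :: "complex ^ 'n"
  shows "(A + of_real h * C) *s v + B = A *s v + B + h *\<^sub>R (C *s v)"
  by (simp add: vec_eq_iff vector_scaleR_component scaleR_conv_of_real[where 'a=complex] algebra_simps)

context warped_patches
begin

lemma hess_scale:
  assumes f: "smooth_on (pdom p) (f \<circ> pmap p)" and x: "x \<in> pdom p"
  shows "hess p f x v (s *\<^sub>R w) = s *\<^sub>R hess p f x v w"
proof -
  have "dder (pdom p) v (dder (pdom p) (s *\<^sub>R w) (f \<circ> pmap p)) x
      = dder (pdom p) v (\<lambda>x. s *\<^sub>R dder (pdom p) w (f \<circ> pmap p) x) x"
    using dder_scaleR[OF f] x by (intro dder_cong) auto
  also have "\<dots> = s *\<^sub>R dder (pdom p) v (dder (pdom p) w (f \<circ> pmap p)) x"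
    by (rule dder_eqI[OF dense_axes_P(2) x])
      (intro has_derivative_scaleR_right smooth_on_has_dder smooth_on_dder f x)
  finally show ?thesis
    using x by (simp add: hess_def christoffel_scale dder_scaleR[OF f] scaleR_diff_right)
qed

context
  fixes f1 :: "'m1 \<Rightarrow> complex ^ 'n1" and f2 :: "'m2 \<Rightarrow> complex ^ 'n2" and z1 z2 :: "real \<Rightarrow> complex"
  assumes f: "smooth_on (pdom p) (f1 \<circ> pmap p)" "smooth_on (pdom q) (f2 \<circ> pmap q)"
    and z: "smooth_on I z1" "smooth_on I z2"
begin

abbreviation (input) "u \<equiv> product_map z1 z2 f1 f2"

lemma product_map_pmap_W:
  "u \<circ> pmap W = (\<lambda>(t, x, y). (z1 t *s (f1 \<circ> pmap p) x, z2 t *s (f2 \<circ> pmap q) y))"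
  by (auto simp: product_map_def warped_patch_def)

lemma dder_u:
  assumes P: "(t, x, y) \<in> P"
  shows "dder P (\<rho>, \<xi>, \<eta>) (u \<circ> pmap W) (t, x, y) =
    (\<rho> *\<^sub>R (cder I z1 t *s f1 (pmap p x)) + z1 t *s dder (pdom p) \<xi> (f1 \<circ> pmap p) x,
     \<rho> *\<^sub>R (cder I z2 t *s f2 (pmap q y)) + z2 t *s dder (pdom q) \<eta> (f2 \<circ> pmap q) y)"
proof -
  have "t \<in> I" using P by auto
  from dder_product[OF P smooth_on_has_vector_derivative(1)[OF I z(1) this]
      smooth_on_has_vector_derivative(1)[OF I z(2) this] f]
  show ?thesis unfolding product_map_pmap_W by simp
qed

lemma hess_W_t:
  assumes P: "(t, x, y) \<in> P"
  shows "hess W u (t, x, y) (1, 0, 0) (1, 0, 0) =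
    (cder I (cder I z1) t *s f1 (pmap p x), cder I (cder I z2) t *s f2 (pmap q y))"
proof -
  have t: "t \<in> I" and xy: "x \<in> pdom p" "y \<in> pdom q" using P by auto
  note z' = smooth_on_has_vector_derivative(1)[OF I smooth_on_has_vector_derivative(2)[OF I z(1)] t]
    smooth_on_has_vector_derivative(1)[OF I smooth_on_has_vector_derivative(2)[OF I z(2)] t]
  have "dder P (1, 0, 0) (dder P (1, 0, 0) (u \<circ> pmap W)) (t, x, y) =
     dder P (1, 0, 0) (\<lambda>(t, x, y). (cder I z1 t *s (f1 \<circ> pmap p) x, cder I z2 t *s (f2 \<circ> pmap q) y)) (t, x, y)"
    using P by (intro dder_cong) (auto simp: dder_u dder_direction_0 f)
  also have "\<dots> = (cder I (cder I z1) t *s f1 (pmap p x), cder I (cder I z2) t *s f2 (pmap q y))"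
    using xy by (subst dder_product[OF P z' f]) (simp add: dder_direction_0[OF f(1)] dder_direction_0[OF f(2)])
  finally show ?thesis
    using xy by (simp add: hess_def pdom_W christoffel_W_t[OF P] zero_prod_def dder_u[OF P]
        dder_direction_0[OF f(1)] dder_direction_0[OF f(2)])
qed

lemma hess_W_x:
  assumes P: "(t, x, y) \<in> P"
  shows "hess W u (t, x, y) (0, v, 0) (0, v', 0) =
    (z1 t *s hess p f1 x v v', 0) + (l1 t * cder I l1 t * pmet p x v v') *\<^sub>R
      (cder I z1 t *s f1 (pmap p x), cder I z2 t *s f2 (pmap q y))"
proof -
  have t: "t \<in> I" and xy: "x \<in> pdom p" "y \<in> pdom q" using P by auto
  note z' = smooth_on_has_vector_derivative(1)[OF I z(1) t]
  \<comment> \<open>A derivative along the first factor kills the second component. It is written as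
    coefficient 0 times \<open>f2\<close>, which fits \<open>dder_product\<close>.\<close>
  have z0: "((\<lambda>_. 0) has_vector_derivative 0) (at t within I)" by simp
  have "dder P (0, v, 0) (dder P (0, v', 0) (u \<circ> pmap W)) (t, x, y) =
     dder P (0, v, 0) (\<lambda>(t, x, y). (z1 t *s dder (pdom p) v' (f1 \<circ> pmap p) x,
       (\<lambda>_. 0) t *s (f2 \<circ> pmap q) y)) (t, x, y)"
    using P by (intro dder_cong) (auto simp: dder_u dder_direction_0 f)
  also have "\<dots> = (z1 t *s dder (pdom p) v (dder (pdom p) v' (f1 \<circ> pmap p)) x, 0)"
    by (subst dder_product[OF P z' z0 smooth_on_dder[OF f(1)] f(2)]) simp
  finally show ?thesis
    using xy by (simp add: hess_def pdom_W christoffel_W_x[OF P] dder_u[OF P]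
        dder_direction_0[OF f(2)] vsm.diff_right)
qed

lemma hess_W_y:
  assumes P: "(t, x, y) \<in> P"
  shows "hess W u (t, x, y) (0, 0, v) (0, 0, v') =
    (0, z2 t *s hess q f2 y v v') + (l2 t * cder I l2 t * pmet q y v v') *\<^sub>R
      (cder I z1 t *s f1 (pmap p x), cder I z2 t *s f2 (pmap q y))"
proof -
  have t: "t \<in> I" and xy: "x \<in> pdom p" "y \<in> pdom q" using P by auto
  note z' = smooth_on_has_vector_derivative(1)[OF I z(2) t]
  have z0: "((\<lambda>_. 0) has_vector_derivative 0) (at t within I)" by simp
  have "dder P (0, 0, v) (dder P (0, 0, v') (u \<circ> pmap W)) (t, x, y) =
     dder P (0, 0, v) (\<lambda>(t, x, y). ((\<lambda>_. 0) t *s (f1 \<circ> pmap p) x,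
       z2 t *s dder (pdom q) v' (f2 \<circ> pmap q) y)) (t, x, y)"
    using P by (intro dder_cong) (auto simp: dder_u dder_direction_0 f)
  also have "\<dots> = (0, z2 t *s dder (pdom q) v (dder (pdom q) v' (f2 \<circ> pmap q)) y)"
    by (subst dder_product[OF P z0 z' f(1) smooth_on_dder[OF f(2)]]) simp
  finally show ?thesis
    using xy by (simp add: hess_def pdom_W christoffel_W_y[OF P] dder_u[OF P]
        dder_direction_0[OF f(1)] vsm.diff_right)
qed

text \<open>\<open>H\<close> is the logarithmic derivative of the volume factor
  \<open>l1 ^ k1 * l2 ^ k2\<close>: each of the \<open>k1\<close> directions of the first factor
  contributes \<open>l1' / l1\<close> through its Christoffel symbol, and similarly for the
  second.\<close>

lemma laplacian_W:
  assumes P: "(t, x, y) \<in> P"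
  defines "H \<equiv> real DIM('e1) * cder I l1 t / l1 t + real DIM('e2) * cder I l2 t / l2 t"
  shows "laplacian W u (t, x, y) =
    ((cder I (cder I z1) t + of_real H * cder I z1 t) *s f1 (pmap p x)
       + (1 / (l1 t)\<^sup>2) *\<^sub>R (z1 t *s laplacian p f1 x),
     (cder I (cder I z2) t + of_real H * cder I z2 t) *s f2 (pmap q y)
       + (1 / (l2 t)\<^sup>2) *\<^sub>R (z2 t *s laplacian q f2 y))"
proof -
  have t: "t \<in> I" and x: "x \<in> pdom p" and y: "y \<in> pdom q" and l: "l1 t > 0" "l2 t > 0"
    using P pos_l by auto
  \<comment> \<open>\<open>hess_scale\<close> is proved for the first factor; exchanging the factors
    supplies it for the second.\<close>
  interpret swap: warped_patches I l2 l1 q p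
    using I dom met smooth_met smooth_l pos_l by unfold_locales auto
  have d0: "dual_vec p x 0 = 0" "dual_vec q y 0 = 0"
    using met x y by (auto intro!: dual_vec_eqI simp: metric_form_simps)
  let ?D = "(cder I z1 t *s f1 (pmap p x), cder I z2 t *s f2 (pmap q y))"
  have g: "pmet p x v (dual_vec p x v) = 1" if "v \<in> Basis" for v
    using dual_vec_works[of p x v v] met(1)[OF x] that
    by (metis inner_Basis metric_form_def)
  have g': "pmet q y v (dual_vec q y v) = 1" if "v \<in> Basis" for v
    using dual_vec_works[of q y v v] met(2)[OF y] that
    by (metis inner_Basis metric_form_def)
  have "hess W u (t, x, y) (0, v, 0) (dual_vec W (t, x, y) (0, v, 0)) =
      (1 / (l1 t)\<^sup>2) *\<^sub>R (z1 t *s hess p f1 x v (dual_vec p x v), 0) + (cder I l1 t / l1 t) *\<^sub>R ?D"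
    if "v \<in> Basis" for v
    using l g[OF that]
    by (simp add: dual_vec_W[OF P] d0 hess_W_x[OF P] hess_scale[OF f(1) x] met x metric_form_simps vsm.scaleR_right)
      (simp add: power2_eq_square)
  moreover have "hess W u (t, x, y) (0, 0, v) (dual_vec W (t, x, y) (0, 0, v)) =
      (1 / (l2 t)\<^sup>2) *\<^sub>R (0, z2 t *s hess q f2 y v (dual_vec q y v)) + (cder I l2 t / l2 t) *\<^sub>R ?D"
    if "v \<in> Basis" for v
    using l g'[OF that]
    by (simp add: dual_vec_W[OF P] d0 hess_W_y[OF P] swap.hess_scale[OF f(2) y] met y metric_form_simps vsm.scaleR_right)
      (simp add: power2_eq_square)
  moreover have "hess W u (t, x, y) (1, 0, 0) (dual_vec W (t, x, y) (1, 0, 0)) =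
      (cder I (cder I z1) t *s f1 (pmap p x), cder I (cder I z2) t *s f2 (pmap q y))"
    by (simp add: dual_vec_W[OF P] d0 hess_W_t[OF P])
  ultimately have "laplacian W u (t, x, y) =
      (cder I (cder I z1) t *s f1 (pmap p x), cder I (cder I z2) t *s f2 (pmap q y))
      + (1 / (l1 t)\<^sup>2) *\<^sub>R (z1 t *s laplacian p f1 x, 0)
      + (1 / (l2 t)\<^sup>2) *\<^sub>R (0, z2 t *s laplacian q f2 y) + H *\<^sub>R ?D"
    unfolding H_def laplacian_def
    by (simp add: sum_Basis_prod zero_prod_def sum.distrib prod_eq_iff fst_sum snd_sum
        scaleR_sum_right vsm.sum_right algebra_simps sum_constant_scaleR
        del: sum_constant cong: sum.cong)
  then show ?thesis
    by (simp only: vector_smult_add add_Pair scaleR_Pair scaleR_zero_right add_0_right)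
qed

lemma energy_density_W:
  assumes P: "(t, x, y) \<in> P"
  shows "energy_density W u (t, x, y) =
    (norm (cder I z1 t))\<^sup>2 * (norm (f1 (pmap p x)))\<^sup>2 + (norm (cder I z2 t))\<^sup>2 * (norm (f2 (pmap q y)))\<^sup>2
    + (norm (z1 t))\<^sup>2 / (l1 t)\<^sup>2 * energy_density p f1 x
    + (norm (z2 t))\<^sup>2 / (l2 t)\<^sup>2 * energy_density q f2 y"
proof -
  have t: "t \<in> I" and x: "x \<in> pdom p" and y: "y \<in> pdom q" and l: "l1 t > 0" "l2 t > 0"
    using P pos_l by auto
  have d0: "dual_vec p x 0 = 0" "dual_vec q y 0 = 0"
    using met x y by (auto intro!: dual_vec_eqI simp: metric_form_simps)
  show ?thesis
    by (simp add: energy_density_def pdom_W sum_Basis_prod dual_vec_W[OF P] dder_u[OF P] d0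
        dder_direction_0[OF f(1) x] dder_direction_0[OF f(2) y] dder_scaleR[OF f(1) x]
        dder_scaleR[OF f(2) y] vsm.scaleR_right inner_vector_scalar_mult dot_square_norm
        sum_distrib_left norm_vector_scalar_mult power_mult_distrib zero_prod_def norm_Pair)
qed

lemma smooth_product_map: "smooth_on P (u \<circ> pmap W)"
proof -
  have "Ck_on n P (\<lambda>w. (z1 (fst w) *s (f1 \<circ> pmap p) (fst (snd w)),
      z2 (fst w) *s (f2 \<circ> pmap q) (snd (snd w))))" for n
  proof -
    have c: "Ck_on n I z1" "Ck_on n I z2" "Ck_on n (pdom p) (f1 \<circ> pmap p)" "Ck_on n (pdom q) (f2 \<circ> pmap q)"
      using f z by (auto simp only: smooth_on_def)
    have "Ck_on n P (\<lambda>w. z1 (fst w))" "Ck_on n P (\<lambda>w. z2 (fst w))"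
      by (rule Ck_on_comp_linear[OF dense_axes_P(1) _ _ c(1)] Ck_on_comp_linear[OF dense_axes_P(1) _ _ c(2)];
          auto intro: bounded_linear_fst)+
    moreover have "Ck_on n P (\<lambda>w. (f1 \<circ> pmap p) (fst (snd w)))"
      by (rule Ck_on_comp_linear[OF dense_axes_P(1) _ _ c(3)])
        (auto intro: bounded_linear_fst_comp bounded_linear_snd)
    moreover have "Ck_on n P (\<lambda>w. (f2 \<circ> pmap q) (snd (snd w)))"
      by (rule Ck_on_comp_linear[OF dense_axes_P(1) _ _ c(4)])
        (auto intro: bounded_linear_snd_comp bounded_linear_snd)
    ultimately show ?thesis
      by (intro Ck_on_Pair dense_axes_P Ck_on_bilinear[OF _ bounded_bilinear_vector_scalar_mult])
  qed
  moreover have "u \<circ> pmap W = (\<lambda>w. (z1 (fst w) *s (f1 \<circ> pmap p) (fst (snd w)),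
      z2 (fst w) *s (f2 \<circ> pmap q) (snd (snd w))))"
    by (auto simp: product_map_pmap_W fun_eq_iff)
  ultimately show ?thesis unfolding smooth_on_def by presburger
qed

end

end

section \<open>From single patches to manifolds\<close>

lemma riemannian_manifold_patchD:
  assumes "riemannian_manifold M" "p \<in> M"
  shows "open (pdom p)" "x \<in> pdom p \<Longrightarrow> metric_form (pmet p x)" "smooth_on (pdom p) (\<lambda>x. pmet p x v w)"
  using assms unfolding riemannian_manifold_def metric_form_def by blast+

lemma eigenmap_patchD:
  assumes "eigenmap M f d" "p \<in> M"
  shows "smooth_on (pdom p) (f \<circ> pmap p)" "x \<in> pdom p \<Longrightarrow> norm (f (pmap p x)) = 1"
    "x \<in> pdom p \<Longrightarrow> energy_density p f x = d"
    "x \<in> pdom p \<Longrightarrow> laplacian p f x = - (d *\<^sub>R f (pmap p x))"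
  using assms unfolding eigenmap_def sphere_map_def smooth_map_def carr_def by auto

lemma warped_patches_of_manifolds:
  assumes "riemannian_manifold M1" "riemannian_manifold M2" "p \<in> M1" "q \<in> M2" "dense_axes I"
    "smooth_on I l1" "smooth_on I l2" "\<forall>t\<in>I. 0 < l1 t \<and> 0 < l2 t"
  shows "warped_patches I l1 l2 p q"
  using assms by unfold_locales (auto intro: riemannian_manifold_patchD)

lemma carr_warped_product:
  fixes M1 :: "('e1, 'm1) riem" and M2 :: "('e2, 'm2) riem"
  shows "carr (warped_product I l1 l2 M1 M2) = I \<times> carr M1 \<times> carr M2"
proof -
  have im: "pmap (warped_patch I l1 l2 p q) ` pdom (warped_patch I l1 l2 p q) =
      I \<times> (pmap p ` pdom p) \<times> (pmap q ` pdom q)" (is "?A = ?B")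
    for p :: "('e1, 'm1) patch" and q :: "('e2, 'm2) patch"
  proof (intro subset_antisym subsetI)
    fix z assume "z \<in> ?A"
    then show "z \<in> ?B" by (auto simp: warped_patch_def)
  next
    fix z assume "z \<in> ?B"
    then obtain t x y where "t \<in> I" "x \<in> pdom p" "y \<in> pdom q" "z = (t, pmap p x, pmap q y)" by blast
    then show "z \<in> ?A"
      by (intro image_eqI[of _ _ "(t, x, y)"]) (simp_all add: warped_patch_def)
  qed
  have "carr (warped_product I l1 l2 M1 M2) = (\<Union>p\<in>M1. \<Union>q\<in>M2. I \<times> (pmap p ` pdom p) \<times> (pmap q ` pdom q))"
    unfolding carr_def warped_product_def im[symmetric] by blast
  then show ?thesis unfolding carr_def by auto
qed

lemma vector_combine_smult:
  fixes v :: "complex ^ 'n"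
  shows "A *s v + (1 / r) *\<^sub>R (z *s - (d *\<^sub>R v)) + E *\<^sub>R (z *s v) = (A + of_real (E - d / r) * z) *s v"
  by (simp add: vec_eq_iff vector_scaleR_component scaleR_conv_of_real[where 'a=complex] algebra_simps)

text \<open>The equations left after separating variables: \<open>H\<close> is the mean-curvature
  term of the Laplacian, and \<open>E\<close> is the energy density of the product map, into which
  the eigenmap conditions have been inserted.\<close>

definition harmonic_ode where
  "harmonic_ode I k1 k2 d1 d2 z1 z2 l1 l2 t \<longleftrightarrow>
    (let H = real k1 * cder I l1 t / l1 t + real k2 * cder I l2 t / l2 t;
         E = (norm (cder I z1 t))\<^sup>2 + (norm (cder I z2 t))\<^sup>2
             + d1 * (norm (z1 t))\<^sup>2 / (l1 t)\<^sup>2 + d2 * (norm (z2 t))\<^sup>2 / (l2 t)\<^sup>2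
     in cder I (cder I z1) t + complex_of_real H * cder I z1 t
          + complex_of_real (E - d1 / (l1 t)\<^sup>2) * z1 t = 0 \<and>
        cder I (cder I z2) t + complex_of_real H * cder I z2 t
          + complex_of_real (E - d2 / (l2 t)\<^sup>2) * z2 t = 0)"

text \<open>At each point the tension is a scalar times \<open>f1\<close> in one component and a
  scalar times \<open>f2\<close> in the other. Both maps have norm 1, so it vanishes exactly when
  the two scalars do, and these depend on time alone.\<close>

lemma harmonic_product_iff:
  fixes M1 :: "('e1::euclidean_space, 'm1::{t2_space, second_countable_topology}) riem"
    and M2 :: "('e2::euclidean_space, 'm2::{t2_space, second_countable_topology}) riem"
    and f1 :: "'m1 \<Rightarrow> complex ^ 'n1" and f2 :: "'m2 \<Rightarrow> complex ^ 'n2"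
  assumes M: "riemannian_manifold M1" "riemannian_manifold M2"
    and e: "eigenmap M1 f1 d1" "eigenmap M2 f2 d2" and I: "dense_axes I"
  shows "harmonic_product M1 M2 f1 f2 I z1 z2 l1 l2 \<longleftrightarrow>
    smooth_on I z1 \<and> smooth_on I z2 \<and> smooth_on I l1 \<and> smooth_on I l2 \<and>
    (\<forall>t\<in>I. 0 < l1 t \<and> 0 < l2 t \<and> (norm (z1 t))\<^sup>2 + (norm (z2 t))\<^sup>2 = 1 \<and>
      harmonic_ode I DIM('e1) DIM('e2) d1 d2 z1 z2 l1 l2 t)"
proof (cases "smooth_on I z1 \<and> smooth_on I z2 \<and> smooth_on I l1 \<and> smooth_on I l2 \<and>
    (\<forall>t\<in>I. 0 < l1 t \<and> 0 < l2 t \<and> (norm (z1 t))\<^sup>2 + (norm (z2 t))\<^sup>2 = 1)")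
  case False
  then show ?thesis unfolding harmonic_product_def by blast
next
  case True
  then have z: "smooth_on I z1" "smooth_on I z2" and l: "smooth_on I l1" "smooth_on I l2"
    "\<forall>t\<in>I. 0 < l1 t \<and> 0 < l2 t" and n: "\<forall>t\<in>I. (norm (z1 t))\<^sup>2 + (norm (z2 t))\<^sup>2 = 1"
    by auto
  note wp = warped_patches_of_manifolds[OF M _ _ I l]
  have f: "smooth_on (pdom p) (f1 \<circ> pmap p)" "smooth_on (pdom q) (f2 \<circ> pmap q)"
    "x \<in> pdom p \<Longrightarrow> norm (f1 (pmap p x)) = 1" "y \<in> pdom q \<Longrightarrow> norm (f2 (pmap q y)) = 1"
    "x \<in> pdom p \<Longrightarrow> energy_density p f1 x = d1" "y \<in> pdom q \<Longrightarrow> energy_density q f2 y = d2"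
    "x \<in> pdom p \<Longrightarrow> laplacian p f1 x = - (d1 *\<^sub>R f1 (pmap p x))"
    "y \<in> pdom q \<Longrightarrow> laplacian q f2 y = - (d2 *\<^sub>R f2 (pmap q y))"
    if "p \<in> M1" "q \<in> M2" for p q x y
    using eigenmap_patchD[OF e(1) that(1)] eigenmap_patchD[OF e(2) that(2)] by simp_all
  let ?H = "\<lambda>t. real DIM('e1) * cder I l1 t / l1 t + real DIM('e2) * cder I l2 t / l2 t"
  let ?E = "\<lambda>t. (norm (cder I z1 t))\<^sup>2 + (norm (cder I z2 t))\<^sup>2
             + d1 * (norm (z1 t))\<^sup>2 / (l1 t)\<^sup>2 + d2 * (norm (z2 t))\<^sup>2 / (l2 t)\<^sup>2"
  let ?A1 = "\<lambda>t. cder I (cder I z1) t + of_real (?H t) * cder I z1 t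
            + of_real (?E t - d1 / (l1 t)\<^sup>2) * z1 t"
  let ?A2 = "\<lambda>t. cder I (cder I z2) t + of_real (?H t) * cder I z2 t
            + of_real (?E t - d2 / (l2 t)\<^sup>2) * z2 t"
  let ?O = "harmonic_ode I DIM('e1) DIM('e2) d1 d2 z1 z2 l1 l2"
  let ?u = "product_map z1 z2 f1 f2" and ?N = "warped_product I l1 l2 M1 M2"
  have sphere: "sphere_map ?N ?u"
    unfolding sphere_map_def smooth_map_def
  proof (intro conjI ballI)
    fix W assume "W \<in> ?N"
    then obtain p q where pq: "p \<in> M1" "q \<in> M2" "W = warped_patch I l1 l2 p q"
      by (auto simp: warped_product_def)
    then show "smooth_on (pdom W) (?u \<circ> pmap W)"
      using warped_patches.smooth_product_map[OF wp[OF pq(1,2)] f(1,2)[OF pq(1,2)] z]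
      by (simp add: warped_patch_def)
  next
    fix x assume "x \<in> carr ?N"
    then obtain t x1 x2 where x: "x = (t, x1, x2)" "t \<in> I" "x1 \<in> carr M1" "x2 \<in> carr M2"
      by (auto simp: carr_warped_product)
    have "norm (f1 x1) = 1" "norm (f2 x2) = 1"
      using e x unfolding eigenmap_def sphere_map_def by auto
    then show "norm (?u x) = 1"
      using x n by (simp add: product_map_def norm_Pair norm_vector_scalar_mult)
  qed
  have key: "laplacian (warped_patch I l1 l2 p q) ?u (t, x, y)
      = - (energy_density (warped_patch I l1 l2 p q) ?u (t, x, y) *\<^sub>R
          ?u (pmap (warped_patch I l1 l2 p q) (t, x, y))) \<longleftrightarrow> ?O t"
    if pq: "p \<in> M1" "q \<in> M2" and xy: "t \<in> I" "x \<in> pdom p" "y \<in> pdom q" for p q t x y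
  proof -
    have P: "(t, x, y) \<in> I \<times> pdom p \<times> pdom q" using xy by simp
    note F = f[OF pq]
    have E: "energy_density (warped_patch I l1 l2 p q) ?u (t, x, y) = ?E t"
      using warped_patches.energy_density_W[OF wp[OF pq] F(1,2) z P] xy
      by (simp add: F mult.commute)
    have u: "?u (pmap (warped_patch I l1 l2 p q) (t, x, y)) = (z1 t *s f1 (pmap p x), z2 t *s f2 (pmap q y))"
      by (simp add: product_map_def warped_patch_def)
    note L = warped_patches.laplacian_W[OF wp[OF pq] F(1,2) z P]
    have "laplacian (warped_patch I l1 l2 p q) ?u (t, x, y)
      + energy_density (warped_patch I l1 l2 p q) ?u (t, x, y) *\<^sub>R
          ?u (pmap (warped_patch I l1 l2 p q) (t, x, y)) = (?A1 t *s f1 (pmap p x), ?A2 t *s f2 (pmap q y))"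
      unfolding L E F(7)[OF xy(2)] F(8)[OF xy(3)] u
      by (simp only: scaleR_Pair add_Pair vector_combine_smult)
    then have "laplacian (warped_patch I l1 l2 p q) ?u (t, x, y)
      = - (energy_density (warped_patch I l1 l2 p q) ?u (t, x, y) *\<^sub>R
          ?u (pmap (warped_patch I l1 l2 p q) (t, x, y))) \<longleftrightarrow> (?A1 t *s f1 (pmap p x), ?A2 t *s f2 (pmap q y)) = 0"
      by (simp only: eq_neg_iff_add_eq_0)
    also have "\<dots> \<longleftrightarrow> ?A1 t = 0 \<and> ?A2 t = 0"
      using F(3)[OF xy(2)] F(4)[OF xy(3)] norm_vector_scalar_mult[of "?A1 t" "f1 (pmap p x)"]
        norm_vector_scalar_mult[of "?A2 t" "f2 (pmap q y)"]
      by (auto simp: zero_prod_def)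
    also have "\<dots> \<longleftrightarrow> ?O t" by (simp only: harmonic_ode_def Let_def)
    finally show ?thesis .
  qed
  \<comment> \<open>A single point of each factor extracts the scalar equations, since they no
    longer contain \<open>x\<close> and \<open>y\<close>. Nonempty carriers provide it.\<close>
  obtain p q x y where pq: "p \<in> M1" "q \<in> M2" "x \<in> pdom p" "y \<in> pdom q"
  proof -
    have "carr M1 \<noteq> {}" "carr M2 \<noteq> {}" using M by (simp_all add: riemannian_manifold_def)
    then show ?thesis using that unfolding carr_def by auto
  qed
  have pd: "pdom (warped_patch I l1 l2 p q) = I \<times> pdom p \<times> pdom q" for p :: "('e1, 'm1) patch"
    and q :: "('e2, 'm2) patch"
    by (simp add: warped_patch_def)
  have "harmonic_sphere_map ?N ?u \<longleftrightarrow> (\<forall>t\<in>I. ?O t)"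
  proof
    assume "harmonic_sphere_map ?N ?u"
    then have "\<forall>x\<in>I \<times> pdom p \<times> pdom q. laplacian (warped_patch I l1 l2 p q) ?u x
      = - (energy_density (warped_patch I l1 l2 p q) ?u x *\<^sub>R ?u (pmap (warped_patch I l1 l2 p q) x))"
    proof -
      have "warped_patch I l1 l2 p q \<in> ?N" using pq unfolding warped_product_def by blast
      with \<open>harmonic_sphere_map ?N ?u\<close> show ?thesis
        unfolding harmonic_sphere_map_def using pd by metis
    qed
    then show "\<forall>t\<in>I. ?O t" using key[OF pq(1,2) _ pq(3,4)] pq by blast
  next
    assume A: "\<forall>t\<in>I. ?O t"
    show "harmonic_sphere_map ?N ?u"
      unfolding harmonic_sphere_map_def
    proof (intro conjI sphere ballI)
      fix W x assume "W \<in> ?N" and x: "x \<in> pdom W"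
      then obtain p q where pq: "p \<in> M1" "q \<in> M2" "W = warped_patch I l1 l2 p q"
        by (auto simp: warped_product_def)
      with x obtain t x1 x2 where "x = (t, x1, x2)" "t \<in> I" "x1 \<in> pdom p" "x2 \<in> pdom q"
        by (cases x) (auto simp: pd)
      with key[OF pq(1,2)] A pq(3) show "laplacian W ?u x = - (energy_density W ?u x *\<^sub>R ?u (pmap W x))"
        by blast
    qed
  qed
  then show ?thesis using True unfolding harmonic_product_def by blast
qed


section \<open>The pair of warps\<close>

text \<open>With the product fixed, a larger first warp forces a smaller second one, and both
  changes raise the difference \<open>d2 / l2\<^sup>2 - d1 / l1\<^sup>2\<close>. Hence it is
  strictly increasing in the first warp.\<close>

lemma warp_pair_unique:
  fixes l1 l2 m1 m2 d1 d2 :: real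
  assumes d: "0 < d1" "0 < d2" and k: "0 < k1" "0 < k2"
    and pos: "0 < l1" "0 < l2" "0 < m1" "0 < m2"
    and F: "l1 ^ k1 * l2 ^ k2 = m1 ^ k1 * m2 ^ k2"
    and T: "d2 / l2\<^sup>2 - d1 / l1\<^sup>2 = d2 / m2\<^sup>2 - d1 / m1\<^sup>2"
  shows "l1 = m1 \<and> l2 = m2"
proof -
  have no: "\<not> u1 < v1" if "0 < u1" "0 < u2" "0 < v1" "0 < v2"
    "u1 ^ k1 * u2 ^ k2 = v1 ^ k1 * v2 ^ k2"
    "d2 / u2\<^sup>2 - d1 / u1\<^sup>2 = d2 / v2\<^sup>2 - d1 / v1\<^sup>2" for u1 u2 v1 v2
  proof
    assume lt: "u1 < v1"
    have "u1 ^ k1 < v1 ^ k1" using lt that k by (intro power_strict_mono) auto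
    then have "u1 ^ k1 * u2 ^ k2 < v1 ^ k1 * u2 ^ k2"
      by (intro mult_strict_right_mono) (use that(2) in auto)
    then have "v1 ^ k1 * v2 ^ k2 < v1 ^ k1 * u2 ^ k2" by (simp only: that(5))
    moreover have "0 < v1 ^ k1" using that by simp
    ultimately have "v2 ^ k2 < u2 ^ k2" by (simp only: mult_less_cancel_left_pos)
    then have "v2 < u2" using that by (simp add: power_less_imp_less_base)
    then have "d2 / u2\<^sup>2 < d2 / v2\<^sup>2"
      using d that by (intro divide_strict_left_mono power_strict_mono mult_pos_pos) auto
    moreover have "d1 / v1\<^sup>2 < d1 / u1\<^sup>2"
      using lt d that by (intro divide_strict_left_mono power_strict_mono mult_pos_pos) auto
    ultimately show False using that(6) by linarith
  qed
  have "l1 = m1"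
    using no[OF pos F T] no[OF pos(3,4,1,2) F[symmetric] T[symmetric]] by linarith
  moreover from this F k have "l2 ^ k2 = m2 ^ k2" using pos by simp
  then have "l2 = m2" using pos k power_eq_imp_eq_base[of l2 k2 m2] by auto
  ultimately show ?thesis by simp
qed

text \<open>The product condition is solved for the second warp, which leaves a continuous function
  of the first that runs from very negative to very positive values; the intermediate value theorem
  applies.\<close>

lemma warp_pair_exists:
  fixes F T d1 d2 :: real
  assumes d: "0 < d1" "0 < d2" and k: "0 < k1" "0 < k2" and F: "0 < F"
  obtains l1 l2 where "0 < l1" "0 < l2" "l1 ^ k1 * l2 ^ k2 = F" "d2 / l2\<^sup>2 - d1 / l1\<^sup>2 = T"
proof -
  define m where "m l = root k2 (F / l ^ k1)" for l
  have m: "0 < m l" "l ^ k1 * m l ^ k2 = F" if "0 < l" for l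
    using that F k by (auto simp: m_def real_root_gt_zero)
  have m_mono: "m l' \<le> m l" if "0 < l" "l \<le> l'" for l l'
    unfolding m_def using that F k
    by (intro real_root_le_mono divide_left_mono power_mono mult_pos_pos) auto
  define \<psi> where "\<psi> l = d2 / (m l)\<^sup>2 - d1 / l\<^sup>2" for l
  have cont: "continuous_on {lo..hi} \<psi>" if "0 < lo" for lo hi
    unfolding \<psi>_def m_def using that F k
    by (intro continuous_intros) (auto simp: real_root_eq_0_iff)
  obtain lo where lo: "0 < lo" "lo \<le> 1" "\<psi> lo \<le> T"
  proof -
    \<comment> \<open>Makes \<open>d1 / lo\<^sup>2\<close> at least
      \<open>d2 / (m 1)\<^sup>2 + \<bar>T\<bar>\<close>, while \<open>lo \<le> 1\<close> keeps
      \<open>d2 / (m lo)\<^sup>2\<close> at most \<open>d2 / (m 1)\<^sup>2\<close>.\<close>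
    define lo where "lo = min 1 (sqrt (d1 / (d2 / (m 1)\<^sup>2 + \<bar>T\<bar>)))"
    have c: "0 < d2 / (m 1)\<^sup>2 + \<bar>T\<bar>" using d m(1)[of 1] by (intro add_pos_nonneg) auto
    have lo: "0 < lo" "lo \<le> 1" using c d by (auto simp: lo_def)
    have "lo\<^sup>2 \<le> (sqrt (d1 / (d2 / (m 1)\<^sup>2 + \<bar>T\<bar>)))\<^sup>2"
      using lo by (intro power_mono) (auto simp: lo_def)
    also have "\<dots> = d1 / (d2 / (m 1)\<^sup>2 + \<bar>T\<bar>)" using c d by simp
    finally have "d2 / (m 1)\<^sup>2 + \<bar>T\<bar> \<le> d1 / lo\<^sup>2"
      using c lo d by (simp add: pos_le_divide_eq mult.commute)
    moreover have "d2 / (m lo)\<^sup>2 \<le> d2 / (m 1)\<^sup>2"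
      using m_mono[OF lo] m(1)[OF lo(1)] m(1)[of 1] d
      by (intro divide_left_mono power_mono mult_pos_pos) auto
    ultimately have "\<psi> lo \<le> T" unfolding \<psi>_def by linarith
    with that lo show ?thesis by blast
  qed
  obtain hi where hi: "1 \<le> hi" "T \<le> \<psi> hi"
  proof -
    have "((\<lambda>l. F / l ^ k1) \<longlongrightarrow> 0) at_top"
      by (rule real_tendsto_divide_at_top[OF tendsto_const filterlim_pow_at_top[OF k(1) filterlim_ident]])
    then have "((\<lambda>l. root k2 (F / l ^ k1)) \<longlongrightarrow> root k2 0) at_top"
      by (intro tendsto_intros)
    then have m0: "(m \<longlongrightarrow> 0) at_top" by (simp add: m_def[abs_def])
    \<comment> \<open>For \<open>m hi\<close> below \<open>r\<close> the first term of
      \<open>\<psi> hi\<close> is at least \<open>d1 + \<bar>T\<bar>\<close>, while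
      \<open>hi \<ge> 1\<close> keeps the second at most \<open>d1\<close>.\<close>
    define r where "r = sqrt (d2 / (d1 + \<bar>T\<bar>))"
    have r: "r > 0" using d by (simp add: r_def add_pos_nonneg)
    have "eventually (\<lambda>l. m l < r) at_top" using order_tendstoD(2)[OF m0 r] .
    then obtain hi where hi: "1 \<le> hi" "m hi < r"
      using eventually_happens[OF eventually_conj[OF _ eventually_ge_at_top[of 1]]]
      by (metis trivial_limit_at_top_linorder)
    have mh: "0 < m hi" using hi m by simp
    have "(m hi)\<^sup>2 \<le> r\<^sup>2" using hi mh by (intro power_mono) auto
    also have "r\<^sup>2 = d2 / (d1 + \<bar>T\<bar>)" using d by (simp add: r_def add_nonneg_nonneg)
    finally have "d1 + \<bar>T\<bar> \<le> d2 / (m hi)\<^sup>2"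
      using mh d by (simp add: pos_le_divide_eq add_pos_nonneg mult.commute)
    moreover have "d1 / hi\<^sup>2 \<le> d1" using hi d by (simp add: divide_le_eq)
    ultimately have "T \<le> \<psi> hi" unfolding \<psi>_def by linarith
    with that hi show ?thesis by blast
  qed
  obtain l where l: "lo \<le> l" "l \<le> hi" "\<psi> l = T"
    using IVT'[of \<psi> lo T hi] lo hi cont[of lo hi] by auto
  then have "0 < l" using lo by linarith
  with m[of l] l(3) show ?thesis by (intro that[of l "m l"]) (auto simp: \<psi>_def)
qed

text \<open>Differentiability comes from the inverse of the map sending a pair of warps to \<^term>\<open>(F, T)\<close>;
  the resulting formulas for the derivatives of the warps are then bootstrapped.\<close>

lemma warp_pair_has_derivative:
  fixes l1 l2 F T :: "real \<Rightarrow> real" and d1 d2 F' T' :: real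
  assumes d: "0 < d1" "0 < d2" and k: "0 < k1" "0 < k2"
    and pos: "\<And>t. t \<in> I \<Longrightarrow> 0 < l1 t" "\<And>t. t \<in> I \<Longrightarrow> 0 < l2 t"
    and F: "\<And>t. t \<in> I \<Longrightarrow> l1 t ^ k1 * l2 t ^ k2 = F t"
    and T: "\<And>t. t \<in> I \<Longrightarrow> d2 / (l2 t)\<^sup>2 - d1 / (l1 t)\<^sup>2 = T t"
    and t: "t \<in> I"
    and F': "(F has_real_derivative F') (at t within I)"
    and T': "(T has_real_derivative T') (at t within I)"
  defines "D \<equiv> 2 * (real k1 * d2 / (l1 t * l2 t ^ 3) + real k2 * d1 / (l2 t * l1 t ^ 3))"
  shows "(l1 has_real_derivative (F' / F t * (2 * d2 / l2 t ^ 3) + real k2 / l2 t * T') / D) (at t within I)"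
    and "(l2 has_real_derivative (F' / F t * (2 * d1 / l1 t ^ 3) - real k1 / l1 t * T') / D) (at t within I)"
proof -
  define S where "S = {0::real<..} \<times> {0::real<..}"
  define \<Phi> where "\<Phi> = (\<lambda>(u, v). (u ^ k1 * v ^ k2, d2 / v\<^sup>2 - d1 / u\<^sup>2 :: real))"
  define g where "g = inv_into S \<Phi>"
  have "inj_on \<Phi> S"
  proof (rule inj_onI)
    fix x y assume xy: "x \<in> S" "y \<in> S" "\<Phi> x = \<Phi> y"
    show "x = y"
      using warp_pair_unique[OF d k, of "fst x" "snd x" "fst y" "snd y"] xy
      by (cases x; cases y) (simp add: S_def \<Phi>_def)
  qed
  then have g\<Phi>: "g (\<Phi> x) = x" if "x \<in> S" for x using that by (simp add: g_def)
  let ?u = "l1 t" and ?v = "l2 t"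
  have uv: "0 < ?u" "0 < ?v" using pos t by auto
  have Ft: "?u ^ k1 * ?v ^ k2 = F t" using F t by simp
  then have Fpos: "F t > 0" using uv by (metis mult_pos_pos zero_less_power)
  \<comment> \<open>\<open>A\<close>, \<open>B\<close> are the partial logarithmic derivatives of
    the volume and \<open>C\<close>, \<open>- E\<close> the partial derivatives of \<open>T\<close>.
    The Jacobian determinant is \<open>- F t * D\<close> with \<open>D\<close> a sum of positive
    terms; \<open>g'\<close> below is the inverse matrix by Cramer's rule.\<close>
  define A B C E where "A = real k1 / ?u" and "B = real k2 / ?v" and "C = 2 * d1 / ?u ^ 3"
    and "E = 2 * d2 / ?v ^ 3"
  have D: "D = A * E + B * C" unfolding D_def A_def B_def C_def E_def by (simp add: mult_ac)
  have Dpos: "D > 0" unfolding D A_def B_def C_def E_def using uv d k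
    by (intro add_pos_pos mult_pos_pos divide_pos_pos) auto
  define f' where "f' = (\<lambda>(h, j). (F t * (A * h + B * j), C * h - E * j))"
  define g' where "g' = (\<lambda>(\<alpha>, \<beta>). ((\<alpha> / F t * E + B * \<beta>) / D, (\<alpha> / F t * C - A * \<beta>) / D))"
  have "f' \<circ> g' = id"
  proof (rule ext, clarify)
    fix \<alpha> \<beta> :: real
    have 1: "A * ((x * E + B * \<beta>) / D) + B * ((x * C - A * \<beta>) / D) = x * (D / D)" for x
      by (simp only: D times_divide_eq_right add_divide_distrib[symmetric]) (simp add: algebra_simps)
    have 2: "C * ((x * E + B * \<beta>) / D) - E * ((x * C - A * \<beta>) / D) = \<beta> * (D / D)" for x
      by (simp only: D times_divide_eq_right diff_divide_distrib[symmetric]) (simp add: algebra_simps)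
    show "(f' \<circ> g') (\<alpha>, \<beta>) = id (\<alpha>, \<beta>)"
      unfolding f'_def g'_def o_def prod.case 1 2 using Dpos Fpos by simp
  qed
  have power': "real k * u ^ (k - 1) = u ^ k * (real k / u)" if "0 < u" "0 < k" for k and u :: real
    using that by (cases k) (auto simp: field_simps)
  have der\<Phi>: "(\<Phi> has_derivative f') (at (?u, ?v))"
  proof -
    have "((\<lambda>x. (fst x ^ k1 * snd x ^ k2, d2 / (snd x)\<^sup>2 - d1 / (fst x)\<^sup>2)) has_derivative
      (\<lambda>x. (?u ^ k1 * (real k2 * ?v ^ (k2 - 1) * snd x) + real k1 * ?u ^ (k1 - 1) * fst x * ?v ^ k2,
        2 * d1 / ?u ^ 3 * fst x - 2 * d2 / ?v ^ 3 * snd x))) (at (?u, ?v))"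
    proof (intro has_derivative_Pair)
      show "((\<lambda>x. fst x ^ k1 * snd x ^ k2) has_derivative
        (\<lambda>x. ?u ^ k1 * (real k2 * ?v ^ (k2 - 1) * snd x) + real k1 * ?u ^ (k1 - 1) * fst x * ?v ^ k2))
          (at (?u, ?v))"
        by (auto intro!: derivative_eq_intros simp: fun_eq_iff mult_ac)
      have i: "((\<lambda>x. d / x\<^sup>2) has_derivative (\<lambda>h. - (2 * d / w ^ 3) * h)) (at w)" if "0 < w" for d w :: real
        unfolding has_field_derivative_def[symmetric] using that
        by (auto intro!: derivative_eq_intros simp: field_simps power2_eq_square power3_eq_cube)
      from diff_chain_at[OF has_derivative_fst[OF has_derivative_ident, of "at (?u, ?v)"], of "\<lambda>x. d1 / x\<^sup>2"]
        diff_chain_at[OF has_derivative_snd[OF has_derivative_ident, of "at (?u, ?v)"], of "\<lambda>x. d2 / x\<^sup>2"]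
        i[OF uv(1)] i[OF uv(2)]
      have "((\<lambda>x. d1 / (fst x)\<^sup>2) has_derivative (\<lambda>x. - (2 * d1 / ?u ^ 3) * fst x)) (at (?u, ?v))"
        "((\<lambda>x. d2 / (snd x)\<^sup>2) has_derivative (\<lambda>x. - (2 * d2 / ?v ^ 3) * snd x)) (at (?u, ?v))"
        unfolding o_def by auto
      from has_derivative_diff[OF this(2,1)]
      show "((\<lambda>x. d2 / (snd x)\<^sup>2 - d1 / (fst x)\<^sup>2) has_derivative
        (\<lambda>x. 2 * d1 / ?u ^ 3 * fst x - 2 * d2 / ?v ^ 3 * snd x)) (at (?u, ?v))"
        by (rule has_derivative_eq_rhs) auto
    qed
    moreover have "(\<lambda>x. (?u ^ k1 * (real k2 * ?v ^ (k2 - 1) * snd x) + real k1 * ?u ^ (k1 - 1) * fst x * ?v ^ k2,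
        2 * d1 / ?u ^ 3 * fst x - 2 * d2 / ?v ^ 3 * snd x)) = f'"
      unfolding f'_def A_def B_def C_def E_def power'[OF uv(1) k(1)] power'[OF uv(2) k(2)] Ft[symmetric]
      by (auto simp: algebra_simps)
    ultimately show ?thesis by (simp add: \<Phi>_def case_prod_beta')
  qed
  have "(g has_derivative g') (at (\<Phi> (?u, ?v)))"
  proof (rule has_derivative_inverse_strong[OF _ _ _ g\<Phi> der\<Phi> \<open>f' \<circ> g' = id\<close>])
    show "open S" unfolding S_def by (intro open_Times) auto
    show "(?u, ?v) \<in> S" using uv by (simp add: S_def)
    show "continuous_on S \<Phi>"
      unfolding \<Phi>_def S_def case_prod_beta' by (intro continuous_intros) auto
  qed
  moreover have "\<Phi> (?u, ?v) = (F t, T t)" using F T t by (simp add: \<Phi>_def)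
  ultimately have g: "(g has_derivative g') (at (F t, T t))" by simp
  have "((\<lambda>s. (F s, T s)) has_derivative (\<lambda>h. (h * F', h * T'))) (at t within I)"
    using F' T' unfolding has_real_derivative_iff_has_vector_derivative has_vector_derivative_def
    by (intro has_derivative_Pair) simp_all
  from diff_chain_within[OF this has_derivative_at_withinI[OF g]]
  have c: "((\<lambda>s. g (F s, T s)) has_derivative (\<lambda>h. g' (h * F', h * T'))) (at t within I)"
    by (simp add: o_def)
  have gl: "g (F s, T s) = (l1 s, l2 s)" if "s \<in> I" for s
    using g\<Phi>[of "(l1 s, l2 s)"] pos[OF that] F[OF that] T[OF that] by (simp add: S_def \<Phi>_def)
  have l: "((\<lambda>s. (l1 s, l2 s)) has_derivative (\<lambda>h. g' (h * F', h * T'))) (at t within I)"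
    by (rule has_derivative_transform[OF t _ c]) (simp add: gl)
  have "((\<lambda>s. l1 s) has_real_derivative (F' / F t * E + B * T') / D) (at t within I)"
  proof -
    have "(\<lambda>x. fst (g' (x * F', x * T'))) = (*) ((F' / F t * E + B * T') / D)"
      by (simp add: g'_def fun_eq_iff add_divide_distrib algebra_simps)
    with has_derivative_fst[OF l] show ?thesis unfolding has_field_derivative_def by simp
  qed
  then show "(l1 has_real_derivative (F' / F t * (2 * d2 / l2 t ^ 3) + real k2 / l2 t * T') / D) (at t within I)"
    by (simp only: E_def B_def)
  have "((\<lambda>s. l2 s) has_real_derivative (F' / F t * C - A * T') / D) (at t within I)"
  proof -
    have "(\<lambda>x. snd (g' (x * F', x * T'))) = (*) ((F' / F t * C - A * T') / D)"
      by (simp add: g'_def fun_eq_iff diff_divide_distrib algebra_simps)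
    with has_derivative_snd[OF l] show ?thesis unfolding has_field_derivative_def by simp
  qed
  then show "(l2 has_real_derivative (F' / F t * (2 * d1 / l1 t ^ 3) - real k1 / l1 t * T') / D) (at t within I)"
    by (simp only: C_def A_def)
qed

lemma warp_pair_smooth:
  fixes l1 l2 F T :: "real \<Rightarrow> real" and d1 d2 :: real
  assumes d: "0 < d1" "0 < d2" and k: "0 < k1" "0 < k2" and I: "dense_axes I"
    and pos: "\<And>t. t \<in> I \<Longrightarrow> 0 < l1 t" "\<And>t. t \<in> I \<Longrightarrow> 0 < l2 t"
    and F: "\<And>t. t \<in> I \<Longrightarrow> l1 t ^ k1 * l2 t ^ k2 = F t"
    and T: "\<And>t. t \<in> I \<Longrightarrow> d2 / (l2 t)\<^sup>2 - d1 / (l1 t)\<^sup>2 = T t"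
    and FT: "smooth_on I F" "smooth_on I T"
  shows "smooth_on I l1" "smooth_on I l2"
proof -
  define D where "D t = 2 * (real k1 * d2 / (l1 t * l2 t ^ 3) + real k2 * d1 / (l2 t * l1 t ^ 3))" for t
  define l1' where "l1' t = (cder I F t / F t * (2 * d2 / l2 t ^ 3) + real k2 / l2 t * cder I T t) / D t" for t
  define l2' where "l2' t = (cder I F t / F t * (2 * d1 / l1 t ^ 3) - real k1 / l1 t * cder I T t) / D t" for t
  have der: "(l1 has_vector_derivative l1' t) (at t within I)" "(l2 has_vector_derivative l2' t) (at t within I)"
    if t: "t \<in> I" for t
    using warp_pair_has_derivative[OF d k pos F T t smooth_on_has_real_derivative[OF I FT(1) t]
        smooth_on_has_real_derivative[OF I FT(2) t]]
    unfolding l1'_def l2'_def D_def has_real_derivative_iff_has_vector_derivative by auto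
  have D0: "D t \<noteq> 0" if "t \<in> I" for t
    unfolding D_def using pos[OF that] d k by (intro less_imp_neq[symmetric] mult_pos_pos add_pos_pos divide_pos_pos) auto
  have F0: "F t \<noteq> 0" if "t \<in> I" for t
    using pos[OF that] F[OF that] by (metis less_irrefl mult_pos_pos zero_less_power)
  have pos0: "l1 t \<noteq> 0" "l2 t \<noteq> 0" if "t \<in> I" for t using pos[OF that] by auto
  have "Ck_on n I l1 \<and> Ck_on n I l2" for n
  proof (induction n)
    case 0
    show ?case
      using has_vector_derivative_continuous[OF der(1)] has_vector_derivative_continuous[OF der(2)]
      by (auto simp: continuous_on_eq_continuous_within)
  next
    case (Suc n)
    have c: "Ck_on n I F" "Ck_on n I (cder I F)" "Ck_on n I (cder I T)"
      using FT smooth_on_has_vector_derivative(2)[OF I] by (auto simp only: smooth_on_def)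
    have "Ck_on n I D"
      unfolding D_def[abs_def] using Suc pos0 by (intro Ck_intros I) auto
    then have "Ck_on n I l1'" "Ck_on n I l2'"
      unfolding l1'_def[abs_def] l2'_def[abs_def] using Suc c pos0 F0 D0
      by (intro Ck_intros I; auto)+
    then show ?case using Ck_on_vector_SucI[OF I der(1)] Ck_on_vector_SucI[OF I der(2)] by blast
  qed
  then show "smooth_on I l1" "smooth_on I l2" by (auto simp: smooth_on_def)
qed


section \<open>Radial equations\<close>

lemma smooth_onD: "smooth_on S f \<Longrightarrow> Ck_on n S f"
  by (simp add: smooth_on_def)

text \<open>Allows identities that hold on \<open>I\<close> to be differentiated, also at endpoints
  belonging to \<open>I\<close>.\<close>

lemma has_real_derivative_constant_unique:
  fixes g :: "real \<Rightarrow> real"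
  assumes "dense_axes I" "t \<in> I" "(g has_real_derivative g') (at t within I)" "\<And>s. s \<in> I \<Longrightarrow> g s = k"
  shows "g' = 0"
proof -
  have "((\<lambda>_. k) has_vector_derivative g') (at t within I)"
    by (rule has_vector_derivative_transform[OF assms(2)])
      (use assms in \<open>auto simp: has_real_derivative_iff_has_vector_derivative\<close>)
  then have "cder I (\<lambda>_. k) t = g'" by (rule cder_eqI[OF assms(1,2)])
  moreover have "cder I (\<lambda>_. k) t = 0"
    by (rule cder_eqI[OF assms(1,2)]) auto
  ultimately show ?thesis by simp
qed

text \<open>The amplitude is complex because the derivative of a polar curve already has amplitude
  \<open>Complex a' (a * s')\<close>. In this form the rule can be applied twice.\<close>

lemma has_vector_derivative_polar:
  fixes p r s :: "real \<Rightarrow> real"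
  assumes p: "(p has_real_derivative p') (at t within I)"
    and r: "(r has_real_derivative r') (at t within I)"
    and s: "(s has_real_derivative s') (at t within I)"
  shows "((\<lambda>t. Complex (p t) (r t) * cis (s t)) has_vector_derivative
    Complex (p' - r t * s') (r' + p t * s') * cis (s t)) (at t within I)"
proof -
  have "((\<lambda>t. Complex (p t) (r t) * cis (s t)) has_vector_derivative
    Complex (p' * cos (s t) - p t * sin (s t) * s' - (r' * sin (s t) + r t * cos (s t) * s'))
      (p' * sin (s t) + p t * cos (s t) * s' + (r' * cos (s t) - r t * sin (s t) * s'))) (at t within I)"
    unfolding has_vector_derivative_complex_iff
    by (auto intro!: derivative_eq_intros p r s simp: algebra_simps)
  moreover have "Complex (p' * cos (s t) - p t * sin (s t) * s' - (r' * sin (s t) + r t * cos (s t) * s'))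
      (p' * sin (s t) + p t * cos (s t) * s' + (r' * cos (s t) - r t * sin (s t) * s'))
    = Complex (p' - r t * s') (r' + p t * s') * cis (s t)"
    by (simp add: complex_eq_iff algebra_simps)
  ultimately show ?thesis by simp
qed

lemma polar_eq: "polar a s t = Complex (a t) 0 * cis (s t)"
  by (simp add: polar_def cis_conv_exp complex_of_real_def)

lemma norm_Complex_cis: "(norm (Complex x y * cis s))\<^sup>2 = x\<^sup>2 + y\<^sup>2"
  by (simp add: norm_mult cmod_power2)

lemma cder_polar:
  assumes I: "dense_axes I" and as: "smooth_on I a" "smooth_on I s" and t: "t \<in> I"
  shows "cder I (polar a s) t = Complex (cder I a t) (a t * cder I s t) * cis (s t)"
    and "cder I (cder I (polar a s)) t =
      Complex (cder I (cder I a) t - a t * (cder I s t)\<^sup>2)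
        (2 * cder I a t * cder I s t + a t * cder I (cder I s) t) * cis (s t)"
proof -
  note d = smooth_on_has_real_derivative[OF I as(1)] smooth_on_has_real_derivative[OF I as(2)]
    smooth_on_has_real_derivative[OF I smooth_on_has_vector_derivative(2)[OF I as(1)]]
    smooth_on_has_real_derivative[OF I smooth_on_has_vector_derivative(2)[OF I as(2)]]
  have 1: "cder I (polar a s) t = Complex (cder I a t) (a t * cder I s t) * cis (s t)" if t: "t \<in> I" for t
    using cder_eqI[OF I t has_vector_derivative_polar[OF d(1)[OF t] DERIV_const d(2)[OF t], of 0]]
    by (simp add: polar_eq[abs_def])
  show "cder I (polar a s) t = Complex (cder I a t) (a t * cder I s t) * cis (s t)" using 1 t .
  have "((\<lambda>t. a t * cder I s t) has_real_derivative
      a t * cder I (cder I s) t + cder I a t * cder I s t) (at t within I)"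
    by (auto intro!: derivative_eq_intros d[OF t])
  note h = has_vector_derivative_polar[OF d(3)[OF t] this d(2)[OF t]]
  have "(cder I (polar a s) has_vector_derivative
      Complex (cder I (cder I a) t - a t * cder I s t * cder I s t)
       (a t * cder I (cder I s) t + cder I a t * cder I s t + cder I a t * cder I s t) * cis (s t))
      (at t within I)"
    by (rule has_vector_derivative_transform[OF t _ h]) (simp add: 1)
  from cder_eqI[OF I t this]
  show "cder I (cder I (polar a s)) t =
      Complex (cder I (cder I a) t - a t * (cder I s t)\<^sup>2)
        (2 * cder I a t * cder I s t + a t * cder I (cder I s) t) * cis (s t)"
    by (simp add: power2_eq_square algebra_simps)
qed

lemma smooth_on_polar:
  assumes I: "dense_axes I" and as: "smooth_on I a" "smooth_on I s"
  shows "smooth_on I (polar a s)"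
proof -
  have "polar a s = (\<lambda>t. complex_of_real (a t) * cis (s t))"
    by (simp add: polar_def cis_conv_exp fun_eq_iff)
  then show ?thesis
    unfolding smooth_on_def by (auto intro!: Ck_intros I smooth_onD[OF as(1)] smooth_onD[OF as(2)])
qed

text \<open>Every term carries the nonzero factor \<open>cis\<close> of the phase. Cancelling it
  splits each complex equation into a radial real part and an angular imaginary part.\<close>

lemma harmonic_ode_polar:
  fixes a b s1 s2 l1 l2 :: "real \<Rightarrow> real" and k1 k2 :: nat and d1 d2 :: real
  assumes I: "dense_axes I" and sm: "smooth_on I a" "smooth_on I b" "smooth_on I s1" "smooth_on I s2"
    and t: "t \<in> I"
  defines "H \<equiv> real k1 * cder I l1 t / l1 t + real k2 * cder I l2 t / l2 t"
    and "E \<equiv> (cder I a t)\<^sup>2 + (a t * cder I s1 t)\<^sup>2 + ((cder I b t)\<^sup>2 + (b t * cder I s2 t)\<^sup>2)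
      + d1 / (l1 t)\<^sup>2 * (a t)\<^sup>2 + d2 / (l2 t)\<^sup>2 * (b t)\<^sup>2"
  shows "harmonic_ode I k1 k2 d1 d2 (polar a s1) (polar b s2) l1 l2 t \<longleftrightarrow>
    cder I (cder I a) t - a t * (cder I s1 t)\<^sup>2 + H * cder I a t + (E - d1 / (l1 t)\<^sup>2) * a t = 0 \<and>
    2 * cder I a t * cder I s1 t + a t * cder I (cder I s1) t + H * (a t * cder I s1 t) = 0 \<and>
    cder I (cder I b) t - b t * (cder I s2 t)\<^sup>2 + H * cder I b t + (E - d2 / (l2 t)\<^sup>2) * b t = 0 \<and>
    2 * cder I b t * cder I s2 t + b t * cder I (cder I s2) t + H * (b t * cder I s2 t) = 0"
proof -
  note d = cder_polar[OF I sm(1,3) t] cder_polar[OF I sm(2,4) t]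
  have n: "(norm (polar a s1 t))\<^sup>2 = (a t)\<^sup>2" "(norm (polar b s2 t))\<^sup>2 = (b t)\<^sup>2"
    by (simp_all add: polar_eq norm_Complex_cis del: norm_mult)
  have E: "(norm (cder I (polar a s1) t))\<^sup>2 + (norm (cder I (polar b s2) t))\<^sup>2
      + d1 * (norm (polar a s1 t))\<^sup>2 / (l1 t)\<^sup>2 + d2 * (norm (polar b s2 t))\<^sup>2 / (l2 t)\<^sup>2 = E"
    unfolding n d(1,3) norm_Complex_cis E_def by simp
  have c: "Complex x y * cis s + of_real h * (Complex x' y' * cis s) + of_real e * (Complex w 0 * cis s) = 0
    \<longleftrightarrow> x + h * x' + e * w = 0 \<and> y + h * y' = 0" for x y x' y' h e w s
  proof -
    have "Complex x y * cis s + of_real h * (Complex x' y' * cis s) + of_real e * (Complex w 0 * cis s)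
      = Complex (x + h * x' + e * w) (y + h * y') * cis s"
      by (simp add: complex_eq_iff algebra_simps)
    then show ?thesis by (simp add: complex_eq_iff[of "Complex _ _" 0])
  qed
  show ?thesis
    unfolding harmonic_ode_def Let_def E H_def[symmetric] unfolding d polar_eq c by blast
qed

lemma circle_derivatives:
  fixes a b :: "real \<Rightarrow> real"
  assumes I: "dense_axes I" and ab: "smooth_on I a" "smooth_on I b"
    and n: "\<And>t. t \<in> I \<Longrightarrow> (a t)\<^sup>2 + (b t)\<^sup>2 = 1" and t: "t \<in> I"
  shows "a t * cder I a t + b t * cder I b t = 0"
    and "(cder I a t)\<^sup>2 + a t * cder I (cder I a) t + (cder I b t)\<^sup>2 + b t * cder I (cder I b) t = 0"
proof -
  note d = smooth_on_has_real_derivative[OF I ab(1)] smooth_on_has_real_derivative[OF I ab(2)]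
    smooth_on_has_real_derivative[OF I smooth_on_has_vector_derivative(2)[OF I ab(1)]]
    smooth_on_has_real_derivative[OF I smooth_on_has_vector_derivative(2)[OF I ab(2)]]
  have 1: "a t * cder I a t + b t * cder I b t = 0" if t: "t \<in> I" for t
  proof -
    have "((\<lambda>t. (a t)\<^sup>2 + (b t)\<^sup>2) has_real_derivative 2 * (a t * cder I a t + b t * cder I b t)) (at t within I)"
      by (auto intro!: derivative_eq_intros d[OF t])
    from has_real_derivative_constant_unique[OF I t this n] show ?thesis by simp
  qed
  show "a t * cder I a t + b t * cder I b t = 0" using 1 t .
  have "((\<lambda>t. a t * cder I a t + b t * cder I b t) has_real_derivative
    (cder I a t)\<^sup>2 + a t * cder I (cder I a) t + ((cder I b t)\<^sup>2 + b t * cder I (cder I b) t)) (at t within I)"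
    by (auto intro!: derivative_eq_intros d[OF t] simp: power2_eq_square)
  from has_real_derivative_constant_unique[OF I t this 1]
  show "(cder I a t)\<^sup>2 + a t * cder I (cder I a) t + (cder I b t)\<^sup>2 + b t * cder I (cder I b) t = 0" by simp
qed

text \<open>The two radial equations are \<^term>\<open>X = 0\<close> and \<^term>\<open>Y = 0\<close>. The combination \<^term>\<open>a * X + b * Y\<close>
  vanishes identically, so only \<^term>\<open>b * X - a * Y = 0\<close> remains.\<close>

lemma radial_equations_iff:
  fixes a b a' b' a'' b'' p q \<epsilon> c H R Q V :: real
  assumes ab: "0 < a" "0 < b" "a\<^sup>2 + b\<^sup>2 = 1"
    and d: "a * a' + b * b' = 0" "a'\<^sup>2 + a * a'' + b'\<^sup>2 + b * b'' = 0"
    and R: "R = 1 - a\<^sup>2 - a'\<^sup>2" "0 < R" and Q: "Q = 1 + (c\<^sup>2 - 1) * a\<^sup>2"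
    and V: "0 < V" "V\<^sup>2 = \<epsilon> * Q / (a\<^sup>2 * R)"
    and pq: "V * a\<^sup>2 * p = S" "V * b\<^sup>2 * q = S * c" "S\<^sup>2 = \<epsilon>" and \<epsilon>: "0 < \<epsilon>"
    and H: "H = - a * a' * (1 / (a\<^sup>2 * Q) - (a + a'') / (a * R))"
    and E: "E = a'\<^sup>2 + (a * p)\<^sup>2 + (b'\<^sup>2 + (b * q)\<^sup>2) + L1 * a\<^sup>2 + L2 * b\<^sup>2"
  shows "(a'' - a * p\<^sup>2 + H * a' + (E - L1) * a = 0 \<and> b'' - b * q\<^sup>2 + H * b' + (E - L2) * b = 0)
    \<longleftrightarrow> L2 - L1 = 1 / (a\<^sup>2 * Q) - (a + a'') / (a * R)"
proof -
  define B where "B = b\<^sup>2"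
  have B: "B = 1 - a\<^sup>2" "0 < B" using ab by (auto simp: B_def)
  have QB: "Q = B + c\<^sup>2 * a\<^sup>2" using Q B by (simp add: algebra_simps)
  then have Q0: "0 < Q" using B by (simp add: add_pos_nonneg)
  define T where "T = 1 / (a\<^sup>2 * Q) - (a + a'') / (a * R)"
  define X where "X = a'' - a * p\<^sup>2 + H * a' + (E - L1) * a"
  define Y where "Y = b'' - b * q\<^sup>2 + H * b' + (E - L2) * b"
  have S2: "S\<^sup>2 = V\<^sup>2 * (a\<^sup>2 * R) / Q"
    using V(2) pq(3) Q0 R(2) ab(1) by simp
  have p2: "p\<^sup>2 = R / (Q * a\<^sup>2)"
  proof -
    have "V\<^sup>2 * (a ^ 4 * p\<^sup>2) = S\<^sup>2" unfolding pq(1)[symmetric] by algebra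
    then have "V\<^sup>2 * (a ^ 4 * p\<^sup>2) = V\<^sup>2 * (a\<^sup>2 * R / Q)" using S2 by simp
    then have "a ^ 4 * p\<^sup>2 = a\<^sup>2 * R / Q" unfolding mult_cancel_left using V(1) by simp
    then show ?thesis using ab(1) Q0 by (simp add: field_simps power4_eq_xxxx power2_eq_square)
  qed
  have q2: "q\<^sup>2 = c\<^sup>2 * a\<^sup>2 * R / (Q * B\<^sup>2)"
  proof -
    have "V\<^sup>2 * (B\<^sup>2 * q\<^sup>2) = (S * c)\<^sup>2" unfolding pq(2)[symmetric] B_def by algebra
    then have "V\<^sup>2 * (B\<^sup>2 * q\<^sup>2) = V\<^sup>2 * (a\<^sup>2 * R / Q * c\<^sup>2)" using S2 by (simp add: power_mult_distrib)
    then have "B\<^sup>2 * q\<^sup>2 = a\<^sup>2 * R / Q * c\<^sup>2" unfolding mult_cancel_left using V(1) by simp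
    then show ?thesis using B(2) Q0 by (simp add: field_simps)
  qed
  \<comment> \<open>The centrifugal and eigenvalue terms amount to
    \<open>a'\<^sup>2 + b'\<^sup>2 - E\<close>. What remains is half the second and half the first
    derivative of \<open>a\<^sup>2 + b\<^sup>2\<close>, and \<open>E\<close> times
    \<open>a\<^sup>2 + b\<^sup>2 - 1\<close>.\<close>
  have "a * X + b * Y = (a'\<^sup>2 + a * a'' + b'\<^sup>2 + b * b'') + H * (a * a' + b * b')
      + (a\<^sup>2 + b\<^sup>2 - 1) * E"
    unfolding X_def Y_def E by algebra
  then have XY: "a * X + b * Y = 0" using ab(3) d by simp
  have b'2: "B * b'\<^sup>2 = a\<^sup>2 * a'\<^sup>2"
  proof -
    have "b * b' = - (a * a')" using d(1) by linarith
    then have "(b * b')\<^sup>2 = (a * a')\<^sup>2" by simp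
    then show ?thesis by (simp add: B_def power_mult_distrib)
  qed
  \<comment> \<open>The extra factor \<open>b\<close> lets \<open>b\<close>, \<open>b'\<close> and
    \<open>b''\<close> enter only through \<open>b\<^sup>2\<close>, \<open>b'\<^sup>2\<close>,
    \<open>b * b'\<close> and \<open>b * b''\<close>, which the circle relations express by
    \<open>a\<close> and its derivatives.\<close>
  have 1: "b * (a'' * b - a * b'') = a'' + a * (a'\<^sup>2 / B)"
  proof -
    have "b * (a'' * b - a * b'') = a'' * (a\<^sup>2 + b\<^sup>2) + a * (a'\<^sup>2 + b'\<^sup>2)" using d(2) by algebra
    moreover have "a'\<^sup>2 + b'\<^sup>2 = a'\<^sup>2 / B"
    proof -
      have "B * (a'\<^sup>2 + b'\<^sup>2) = B * a'\<^sup>2 + a\<^sup>2 * a'\<^sup>2" unfolding distrib_left b'2 ..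
      also have "\<dots> = (B + a\<^sup>2) * a'\<^sup>2" by (simp only: distrib_right)
      also have "\<dots> = a'\<^sup>2" using B by simp
      finally have "(a'\<^sup>2 + b'\<^sup>2) * B = a'\<^sup>2" by (simp only: mult.commute)
      then show ?thesis using B(2) by (metis less_irrefl nonzero_eq_divide_eq)
    qed
    ultimately show ?thesis using ab(3) by simp
  qed
  have 2: "b * (a' * b - a * b') = a'"
  proof -
    have "b * (a' * b - a * b') = a' * (a\<^sup>2 + b\<^sup>2)" using d(1) by algebra
    then show ?thesis using ab(3) by simp
  qed
  have "b * (b * X - a * Y) = b * (a'' * b - a * b'') - a * B * (p\<^sup>2 - q\<^sup>2)
      + H * (b * (a' * b - a * b')) + a * B * (L2 - L1)"
    unfolding X_def Y_def B_def by algebra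
  also have "\<dots> = a * B * (L2 - L1 - T)"
  proof -
    have "a'' + a * (a'\<^sup>2 / B) - a * B * (p\<^sup>2 - q\<^sup>2) + H * a' + a * B * T = 0"
    proof -
      \<comment> \<open>Since \<open>H = - a * a' * T\<close>, the two terms combine to
        \<open>a * T * (B - a'\<^sup>2)\<close>, which is \<open>a * R * T\<close>. Here
        \<open>a'\<close> occurs only squared, so nothing is divided by it and turns are
        included.\<close>
      have "H * a' + a * B * T = a * R * T + a * T * (B - R - a'\<^sup>2)"
        unfolding H T_def[symmetric] by (simp add: algebra_simps power2_eq_square)
      also have "\<dots> = a * R * T" using R(1) B(1) by simp
      also have "\<dots> = R / (a * Q) - (a + a'')"
        unfolding T_def using ab(1) Q0 R(2) by (simp add: field_simps power2_eq_square)
      finally have h: "H * a' + a * B * T = R / (a * Q) - (a + a'')" .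
      have "a'\<^sup>2 = B - R" using R(1) B(1) by simp
      then have "a * (a'\<^sup>2 / B) = a * ((B - R) / B)" by (simp only:)
      then have e1: "a * (a'\<^sup>2 / B) = a - a * R / B"
        using B(2) by (simp add: diff_divide_distrib right_diff_distrib)
      have e2: "a * B * (p\<^sup>2 - q\<^sup>2) = R / (Q * a) * B - c\<^sup>2 * a ^ 3 * R / (Q * B)"
        unfolding p2 q2 using ab(1) B(2) Q0
        by (simp add: field_simps power2_eq_square power3_eq_cube)
      have "R / (Q * a) * (1 - B) = R * a / Q"
        unfolding B(1) using ab(1) Q0 by (simp add: power2_eq_square)
      moreover have "R * a / Q + c\<^sup>2 * a ^ 3 * R / (Q * B) - a * R / B = a * R * (B + c\<^sup>2 * a\<^sup>2 - Q) / (Q * B)"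
        using B(2) Q0 by (simp add: field_simps power2_eq_square power3_eq_cube)
      moreover have "B + c\<^sup>2 * a\<^sup>2 - Q = 0" using QB by simp
      ultimately have "R / (Q * a) - R / (Q * a) * B + c\<^sup>2 * a ^ 3 * R / (Q * B) - a * R / B = 0"
        by (simp only: right_diff_distrib mult_1_right)
      then show ?thesis using h e1 e2 by (simp add: mult.commute[of Q a])
    qed
    then show ?thesis unfolding 1 2 by (simp add: algebra_simps)
  qed
  finally have bXaY: "b * (b * X - a * Y) = a * B * (L2 - L1 - T)" .
  have "X = 0 \<and> Y = 0 \<longleftrightarrow> b * X - a * Y = 0"
  proof
    assume z: "b * X - a * Y = 0"
    have "(a\<^sup>2 + b\<^sup>2) * X = a * (a * X + b * Y) + b * (b * X - a * Y)"
      "(a\<^sup>2 + b\<^sup>2) * Y = b * (a * X + b * Y) - a * (b * X - a * Y)" by algebra+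
    then show "X = 0 \<and> Y = 0" unfolding ab(3) z XY by simp
  qed simp
  also have "\<dots> \<longleftrightarrow> b * (b * X - a * Y) = 0" using ab by simp
  also have "\<dots> \<longleftrightarrow> L2 - L1 - T = 0" unfolding bXaY using ab B by simp
  finally show ?thesis unfolding X_def Y_def T_def by simp
qed

text \<open>The momenta determine the angular speeds and \<open>b * b' = - a * a'\<close> determines
  \<open>b'\<close>. After multiplication by \<open>V\<^sup>2 * a\<^sup>2 * b\<^sup>2\<close>, unit
  speed becomes a polynomial relation between \<open>V\<close>, \<open>a\<close> and
  \<open>a'\<close>.\<close>

lemma unit_speed_iff:
  fixes a b a' b' p q \<epsilon> c V :: real
  assumes ab: "0 < a" "0 < b" "a\<^sup>2 + b\<^sup>2 = 1" and d: "a * a' + b * b' = 0"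
    and V: "0 < V" and pq: "V * a\<^sup>2 * p = S" "V * b\<^sup>2 * q = S * c" "S\<^sup>2 = \<epsilon>" and \<epsilon>: "0 < \<epsilon>"
  shows "a'\<^sup>2 + (a * p)\<^sup>2 + (b'\<^sup>2 + (b * q)\<^sup>2) = 1 \<longleftrightarrow>
    V\<^sup>2 * a\<^sup>2 * (1 - a\<^sup>2 - a'\<^sup>2) = \<epsilon> * (1 + (c\<^sup>2 - 1) * a\<^sup>2)"
proof -
  have b2: "b\<^sup>2 = 1 - a\<^sup>2" using ab by simp
  have b'2: "b\<^sup>2 * b'\<^sup>2 = a\<^sup>2 * a'\<^sup>2"
  proof -
    have "b * b' = - (a * a')" using d(1) by linarith
    then have "(b * b')\<^sup>2 = (a * a')\<^sup>2" by simp
    then show ?thesis by (simp add: power_mult_distrib)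
  qed
  have S: "\<epsilon> = V\<^sup>2 * a\<^sup>2 * (a * p)\<^sup>2" "\<epsilon> * c\<^sup>2 = V\<^sup>2 * b\<^sup>2 * (b * q)\<^sup>2"
    unfolding pq(3)[symmetric] power_mult_distrib[symmetric] pq(2)[symmetric]
    by (simp_all add: pq(1)[symmetric] power_mult_distrib algebra_simps power2_eq_square)
  have "V\<^sup>2 * a\<^sup>2 * b\<^sup>2 * (a'\<^sup>2 + (a * p)\<^sup>2 + (b'\<^sup>2 + (b * q)\<^sup>2) - 1)
     = V\<^sup>2 * a\<^sup>2 * (b\<^sup>2 * a'\<^sup>2 + b\<^sup>2 * b'\<^sup>2) + b\<^sup>2 * (V\<^sup>2 * a\<^sup>2 * (a * p)\<^sup>2)
       + a\<^sup>2 * (V\<^sup>2 * b\<^sup>2 * (b * q)\<^sup>2) - V\<^sup>2 * a\<^sup>2 * b\<^sup>2"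
    by (simp add: algebra_simps)
  also have "\<dots> = V\<^sup>2 * a\<^sup>2 * (b\<^sup>2 * a'\<^sup>2 + a\<^sup>2 * a'\<^sup>2) + b\<^sup>2 * \<epsilon> + a\<^sup>2 * (\<epsilon> * c\<^sup>2) - V\<^sup>2 * a\<^sup>2 * b\<^sup>2"
    by (simp only: S[symmetric] b'2)
  also have "\<dots> = \<epsilon> * (1 + (c\<^sup>2 - 1) * a\<^sup>2) - V\<^sup>2 * a\<^sup>2 * (1 - a\<^sup>2 - a'\<^sup>2)"
    unfolding b2 by (simp add: algebra_simps)
  finally have "V\<^sup>2 * a\<^sup>2 * b\<^sup>2 * (a'\<^sup>2 + (a * p)\<^sup>2 + (b'\<^sup>2 + (b * q)\<^sup>2) - 1)
     = \<epsilon> * (1 + (c\<^sup>2 - 1) * a\<^sup>2) - V\<^sup>2 * a\<^sup>2 * (1 - a\<^sup>2 - a'\<^sup>2)" .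
  moreover have "V\<^sup>2 * a\<^sup>2 * b\<^sup>2 \<noteq> 0" using V ab by simp
  ultimately show ?thesis by (metis eq_iff_diff_eq_0 mult_eq_0_iff)
qed


section \<open>Reconstruction from a magnitude\<close>

text \<open>The logarithmic derivative of \<open>Q / (a\<^sup>2 * R)\<close> is
  \<open>- 2 * a * a' * T\<close>. The function \<open>p\<close> stands for \<open>a'\<close> but is
  separate from it, so that the lemma serves both a given magnitude and the second coordinate of a
  phase-space solution.\<close>

lemma volume_square_has_derivative:
  fixes a p :: "real \<Rightarrow> real" and c \<epsilon> :: real
  assumes a': "(a has_real_derivative a1) (at t within I)" and p': "(p has_real_derivative a2) (at t within I)"
    and p: "p t = a1"
  defines "Q \<equiv> \<lambda>s. 1 + (c\<^sup>2 - 1) * (a s)\<^sup>2" and "R \<equiv> \<lambda>s. 1 - (a s)\<^sup>2 - (p s)\<^sup>2"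
  assumes pos: "0 < a t" "0 < Q t" "0 < R t"
  shows "((\<lambda>s. \<epsilon> * Q s / ((a s)\<^sup>2 * R s)) has_real_derivative - 2 * (\<epsilon> * Q t / ((a t)\<^sup>2 * R t)) *
      (a t * a1 * (1 / ((a t)\<^sup>2 * Q t) - (a t + a2) / (a t * R t)))) (at t within I)"
proof -
  define a0 Q0 R0 where "a0 = a t" and "Q0 = Q t" and "R0 = R t"
  note defs = a0_def Q0_def R0_def
  have p: "p t = a1" "0 < a0" "0 < Q0" "0 < R0" using p pos by (simp_all add: defs)
  have Q': "(Q has_real_derivative 2 * (c\<^sup>2 - 1) * a0 * a1) (at t within I)"
    unfolding Q_def a0_def by (auto intro!: derivative_eq_intros a')
  have R': "(R has_real_derivative - 2 * a1 * (a0 + a2)) (at t within I)"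
    unfolding R_def a0_def using p(1) by (auto intro!: derivative_eq_intros a' p' simp: algebra_simps)
  have N: "((\<lambda>s. (a s)\<^sup>2 * R s) has_real_derivative
      a0\<^sup>2 * (- 2 * a1 * (a0 + a2)) + 2 * a0 * a1 * R0) (at t within I)"
    unfolding defs by (auto intro!: derivative_eq_intros a' R'[unfolded defs])
  have "((\<lambda>s. \<epsilon> * Q s / ((a s)\<^sup>2 * R s)) has_real_derivative (\<epsilon> * (2 * (c\<^sup>2 - 1) * a0 * a1) * (a0\<^sup>2 * R0)
      - \<epsilon> * Q0 * (a0\<^sup>2 * (- 2 * a1 * (a0 + a2)) + 2 * a0 * a1 * R0)) / ((a0\<^sup>2 * R0) * (a0\<^sup>2 * R0))) (at t within I)"
    using DERIV_divide[OF DERIV_cmult[OF Q', of \<epsilon>] N] p by (simp add: defs)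
  moreover have "(\<epsilon> * (2 * (c\<^sup>2 - 1) * a0 * a1) * (a0\<^sup>2 * R0)
      - \<epsilon> * Q0 * (a0\<^sup>2 * (- 2 * a1 * (a0 + a2)) + 2 * a0 * a1 * R0)) / ((a0\<^sup>2 * R0) * (a0\<^sup>2 * R0))
    = - 2 * (\<epsilon> * Q0 / (a0\<^sup>2 * R0)) * (a0 * a1 * (1 / (a0\<^sup>2 * Q0) - (a0 + a2) / (a0 * R0)))"
  proof -
    \<comment> \<open>Replaces the last occurrence of \<open>c\<close> by \<open>Q0\<close>, so that
      a rational identity in \<open>a0\<close>, \<open>a1\<close>, \<open>a2\<close>,
      \<open>Q0\<close>, \<open>R0\<close> remains.\<close>
    have c: "(c\<^sup>2 - 1) * a0\<^sup>2 = Q0 - 1" by (simp add: defs Q_def)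
    have "\<epsilon> * (2 * k * a0 * a1) * (a0\<^sup>2 * R0) - \<epsilon> * Q0 * (a0\<^sup>2 * (- 2 * a1 * (a0 + a2)) + 2 * a0 * a1 * R0)
      = 2 * \<epsilon> * a0 * a1 * (R0 * (k * a0\<^sup>2 - Q0) + Q0 * a0 * (a0 + a2))" for k
      by (simp add: algebra_simps power2_eq_square)
    note n = this[of "c\<^sup>2 - 1", unfolded c]
    show ?thesis
      unfolding n using p by (simp add: field_simps power2_eq_square)
  qed
  ultimately show ?thesis by (simp add: defs)
qed

text \<open>The volume factor \<open>F\<close> as a function of the magnitude alone.\<close>

definition vol_of :: "real \<Rightarrow> real \<Rightarrow> real set \<Rightarrow> (real \<Rightarrow> real) \<Rightarrow> real \<Rightarrow> real" where
  "vol_of c \<epsilon> I a t = sqrt (\<epsilon> * Q_of c a t / ((a t)\<^sup>2 * R_of I a t))"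

section \<open>The functions Q, R, T and F of an admissible magnitude\<close>

context
  fixes I :: "real set" and a :: "real \<Rightarrow> real" and c :: real
  assumes I: "dense_axes I" and a: "admissible I a"
begin

lemma admissible_smooth: "smooth_on I a" "smooth_on I (cder I a)" "smooth_on I (cder I (cder I a))"
  using a smooth_on_has_vector_derivative(2)[OF I] by (auto simp: admissible_def)

lemma admissible_bounds: "t \<in> I \<Longrightarrow> 0 < a t" "t \<in> I \<Longrightarrow> a t < 1" "t \<in> I \<Longrightarrow> 0 < R_of I a t"
  "t \<in> I \<Longrightarrow> (a t)\<^sup>2 < 1"
  using a by (auto simp: admissible_def abs_square_less_1)

lemma Q_of_pos: "t \<in> I \<Longrightarrow> 0 < Q_of c a t"
proof -
  assume "t \<in> I"
  then have "0 < (1 - (a t)\<^sup>2) + c\<^sup>2 * (a t)\<^sup>2"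
    using admissible_bounds by (intro add_pos_nonneg) auto
  then show ?thesis by (simp add: Q_of_def algebra_simps)
qed

context
  fixes \<epsilon> :: real
  assumes \<epsilon>: "0 < \<epsilon>"
begin

lemma vol_of_pos: "t \<in> I \<Longrightarrow> 0 < vol_of c \<epsilon> I a t"
  and vol_of_square: "t \<in> I \<Longrightarrow> (vol_of c \<epsilon> I a t)\<^sup>2 = \<epsilon> * Q_of c a t / ((a t)\<^sup>2 * R_of I a t)"
proof -
  assume t: "t \<in> I"
  have "0 < \<epsilon> * Q_of c a t / ((a t)\<^sup>2 * R_of I a t)"
    using \<epsilon> Q_of_pos[OF t] admissible_bounds(1,3)[OF t] by simp
  then show "0 < vol_of c \<epsilon> I a t"
    "(vol_of c \<epsilon> I a t)\<^sup>2 = \<epsilon> * Q_of c a t / ((a t)\<^sup>2 * R_of I a t)"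
    by (simp_all add: vol_of_def)
qed

lemma smooth_QRT:
  "smooth_on I (Q_of c a)" "smooth_on I (R_of I a)" "smooth_on I (T_of c I a)" "smooth_on I (vol_of c \<epsilon> I a)"
proof -
  note s = admissible_smooth[THEN smooth_onD]
  have n: "a t \<noteq> 0" "R_of I a t \<noteq> 0" "Q_of c a t \<noteq> 0" if "t \<in> I" for t
    using admissible_bounds[OF that] Q_of_pos[OF that] by auto
  have Q: "Ck_on n I (Q_of c a)" and R: "Ck_on n I (R_of I a)" for n
    unfolding Q_of_def[abs_def] R_of_def[abs_def] by (intro Ck_intros I s)+
  have "Ck_on n I (T_of c I a)" for n
    unfolding T_of_def[abs_def] by (intro Ck_intros I s Q R) (auto simp: n)
  moreover have "Ck_on n I (vol_of c \<epsilon> I a)" for n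
    unfolding vol_of_def[abs_def]
  proof (intro Ck_intros I s Q R)
    fix t assume t: "t \<in> I"
    show "0 < \<epsilon> * Q_of c a t / ((a t)\<^sup>2 * R_of I a t)"
      using \<epsilon> Q_of_pos[OF t] admissible_bounds(1,3)[OF t] by simp
  qed (auto simp: n)
  ultimately show "smooth_on I (Q_of c a)" "smooth_on I (R_of I a)" "smooth_on I (T_of c I a)"
    "smooth_on I (vol_of c \<epsilon> I a)"
    using Q R by (simp_all add: smooth_on_def)
qed

lemma vol_of_has_derivative:
  assumes t: "t \<in> I"
  shows "(vol_of c \<epsilon> I a has_real_derivative
    - vol_of c \<epsilon> I a t * (a t * cder I a t * T_of c I a t)) (at t within I)"
proof -
  note d = smooth_on_has_real_derivative[OF I admissible_smooth(1) t]
    smooth_on_has_real_derivative[OF I admissible_smooth(2) t]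
  define w where "w t = \<epsilon> * Q_of c a t / ((a t)\<^sup>2 * R_of I a t)" for t
  have w0: "0 < w t"
    unfolding w_def using \<epsilon> Q_of_pos[OF t] admissible_bounds(1,3)[OF t] by simp
  have "(w has_real_derivative - 2 * w t * (a t * cder I a t * T_of c I a t)) (at t within I)"
    using volume_square_has_derivative[OF d(1) d(2) refl, of c \<epsilon>] admissible_bounds(1,3)[OF t] Q_of_pos[OF t]
    by (simp add: T_of_def w_def[abs_def] Q_of_def R_of_def)
  moreover have "(sqrt has_real_derivative inverse (sqrt (w t)) / 2) (at (w t))"
    using DERIV_real_sqrt[OF w0] .
  ultimately have "((\<lambda>t. sqrt (w t)) has_real_derivative
      inverse (sqrt (w t)) / 2 * (- 2 * w t * (a t * cder I a t * T_of c I a t))) (at t within I)"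
    by (rule DERIV_chain2[rotated])
  moreover have *: "inverse (sqrt (w t)) / 2 * (- 2 * w t * x) = - sqrt (w t) * x" for x
  proof -
    have "w t = sqrt (w t) * sqrt (w t)" using w0 by simp
    then have "inverse (sqrt (w t)) / 2 * (- 2 * w t * x) = inverse (sqrt (w t)) / 2 * (- 2 * (sqrt (w t) * sqrt (w t)) * x)"
      by simp
    then show ?thesis using w0 by (simp add: field_simps)
  qed
  moreover have "vol_of c \<epsilon> I a = (\<lambda>t. sqrt (w t))" by (simp add: vol_of_def w_def fun_eq_iff)
  ultimately show ?thesis unfolding * by simp
qed

end

end

lemma volume_factor_has_derivative:
  assumes "(l1 has_real_derivative l1') (at t within I)" "(l2 has_real_derivative l2') (at t within I)"
    "0 < l1 t" "0 < l2 t" "0 < k1" "0 < k2"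
  shows "(volume_factor k1 k2 l1 l2 has_real_derivative
    volume_factor k1 k2 l1 l2 t * (real k1 * l1' / l1 t + real k2 * l2' / l2 t)) (at t within I)"
proof -
  have p: "real k * u ^ (k - 1) = u ^ k * real k / u" if "0 < u" "0 < k" for k and u :: real
    using that by (cases k) (auto simp: field_simps)
  have "(volume_factor k1 k2 l1 l2 has_real_derivative
     (real k1 * l1 t ^ (k1 - 1)) * l1' * l2 t ^ k2 + l1 t ^ k1 * ((real k2 * l2 t ^ (k2 - 1)) * l2')) (at t within I)"
    unfolding volume_factor_def[abs_def] by (auto intro!: derivative_eq_intros assms simp: mult_ac)
  then show ?thesis
    unfolding p[OF assms(3,5)] p[OF assms(4,6)] by (simp add: volume_factor_def algebra_simps)
qed

text \<open>\<open>reconstruction\<close> itself imposes no regularity. The warps inherit it from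
  \<open>F\<close> and \<open>T\<close>, the phases as antiderivatives of smooth functions.\<close>

lemma reconstruction_smooth:
  assumes I: "dense_axes I" and a: "admissible I a" and \<epsilon>: "0 < \<epsilon>"
    and d: "0 < d1" "0 < d2" and k: "0 < k1" "0 < k2"
    and r: "reconstruction k1 k2 d1 d2 c \<epsilon> \<sigma> I a b s1 s2 l1 l2"
  shows "smooth_on I b" "smooth_on I l1" "smooth_on I l2" "smooth_on I s1" "smooth_on I s2"
    and "t \<in> I \<Longrightarrow> volume_factor k1 k2 l1 l2 t = vol_of c \<epsilon> I a t"
    and "t \<in> I \<Longrightarrow> 0 < b t \<and> (a t)\<^sup>2 + (b t)\<^sup>2 = 1"
proof -
  note r' = r[unfolded reconstruction_def, rule_format]
  note ab = admissible_bounds[OF I a]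
  show b: "0 < b t \<and> (a t)\<^sup>2 + (b t)\<^sup>2 = 1" if "t \<in> I" for t
    using r'[OF that] ab[OF that] by (auto simp: real_sqrt_gt_0_iff)
  have V: "volume_factor k1 k2 l1 l2 t = vol_of c \<epsilon> I a t" if "t \<in> I" for t
  proof (rule power2_eq_imp_eq)
    show "(volume_factor k1 k2 l1 l2 t)\<^sup>2 = (vol_of c \<epsilon> I a t)\<^sup>2"
      using r'[OF that] vol_of_square[OF I a \<epsilon> that] by simp
    show "0 \<le> volume_factor k1 k2 l1 l2 t" using r'[OF that] by (simp add: volume_factor_def)
    show "0 \<le> vol_of c \<epsilon> I a t" using vol_of_pos[OF I a \<epsilon> that, of c] by simp
  qed
  then show "t \<in> I \<Longrightarrow> volume_factor k1 k2 l1 l2 t = vol_of c \<epsilon> I a t" .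
  note sm = smooth_QRT(3,4)[OF I a \<epsilon>, of c]
  show l: "smooth_on I l1" "smooth_on I l2"
    using warp_pair_smooth[OF d k I _ _ _ _ sm(2,1), of l1 l2] r' V by (auto simp: volume_factor_def)
  have "Ck_on n I (\<lambda>t. sqrt (1 - (a t)\<^sup>2))" for n
    by (intro Ck_intros I smooth_onD admissible_smooth[OF I a]) (use ab in auto)
  then have "smooth_on I (\<lambda>t. sqrt (1 - (a t)\<^sup>2))" by (simp add: smooth_on_def)
  then show sb: "smooth_on I b" using smooth_on_cong[of I b "\<lambda>t. sqrt (1 - (a t)\<^sup>2)"] r' by simp
  have "Ck_on n I (\<lambda>t. \<sigma> * sqrt \<epsilon> / (vol_of c \<epsilon> I a t * (a t)\<^sup>2))"
    "Ck_on n I (\<lambda>t. \<sigma> * c * sqrt \<epsilon> / (vol_of c \<epsilon> I a t * (b t)\<^sup>2))" for n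
    using ab b vol_of_pos[OF I a \<epsilon>, of _ c]
    by (intro Ck_intros I smooth_onD[OF sm(2)] smooth_onD[OF admissible_smooth(1)[OF I a]]
        smooth_onD[OF sb]; force)+
  then have 1: "smooth_on I (\<lambda>t. \<sigma> * sqrt \<epsilon> / (vol_of c \<epsilon> I a t * (a t)\<^sup>2))"
    "smooth_on I (\<lambda>t. \<sigma> * c * sqrt \<epsilon> / (vol_of c \<epsilon> I a t * (b t)\<^sup>2))"
    by (simp_all add: smooth_on_def)
  have s: "(s1 has_real_derivative \<sigma> * sqrt \<epsilon> / (vol_of c \<epsilon> I a t * (a t)\<^sup>2)) (at t within I)"
    "(s2 has_real_derivative \<sigma> * c * sqrt \<epsilon> / (vol_of c \<epsilon> I a t * (b t)\<^sup>2)) (at t within I)"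
    if "t \<in> I" for t
    using r'[OF that] unfolding V[OF that] by blast+
  show "smooth_on I s1" "smooth_on I s2"
    by (rule smooth_on_vectorI[OF I s(1)[unfolded has_real_derivative_iff_has_vector_derivative] 1(1)]
        smooth_on_vectorI[OF I s(2)[unfolded has_real_derivative_iff_has_vector_derivative] 1(2)]; assumption)+
qed

text \<open>The warps are chosen separately at each time, which is harmless because the pair is
  unique. The phases are antiderivatives on \<open>I\<close>.\<close>

lemma reconstruction_exists:
  assumes I: "is_interval I" "interior I \<noteq> {}" and a: "admissible I a" and \<epsilon>: "0 < \<epsilon>"
    and d: "0 < d1" "0 < d2" and k: "0 < k1" "0 < k2"
  obtains b s1 s2 l1 l2 where "reconstruction k1 k2 d1 d2 c \<epsilon> \<sigma> I a b s1 s2 l1 l2"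
proof -
  note dI = dense_axes_interval[OF I]
  obtain t0 where t0: "t0 \<in> I" using I(2) interior_subset by blast
  have "\<exists>l1 l2. t \<in> I \<longrightarrow> 0 < l1 \<and> 0 < l2 \<and> l1 ^ k1 * l2 ^ k2 = vol_of c \<epsilon> I a t
      \<and> d2 / l2\<^sup>2 - d1 / l1\<^sup>2 = T_of c I a t" for t
    using warp_pair_exists[OF d k vol_of_pos[OF dI a \<epsilon>, of t c], of "T_of c I a t"] by metis
  then obtain l1 l2 where l: "\<And>t. t \<in> I \<Longrightarrow> 0 < l1 t \<and> 0 < l2 t \<and> l1 t ^ k1 * l2 t ^ k2 = vol_of c \<epsilon> I a t
      \<and> d2 / (l2 t)\<^sup>2 - d1 / (l1 t)\<^sup>2 = T_of c I a t" by metis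
  define b where "b t = sqrt (1 - (a t)\<^sup>2)" for t
  have b: "0 < b t" if "t \<in> I" for t
    using admissible_bounds(4)[OF dI a that] by (simp add: b_def)
  have ca: "continuous_on I a" "continuous_on I (vol_of c \<epsilon> I a)"
    using smooth_on_imp_continuous_on admissible_smooth(1)[OF dI a] smooth_QRT(4)[OF dI a \<epsilon>] by blast+
  have "continuous_on I (\<lambda>t. \<sigma> * sqrt \<epsilon> / (vol_of c \<epsilon> I a t * (a t)\<^sup>2))"
    using vol_of_pos[OF dI a \<epsilon>, of _ c] admissible_bounds[OF dI a] by (intro continuous_intros ca) force
  from continuous_antiderivative_interval[OF I(1) t0 this]
  obtain s1 where s1: "\<And>t. t \<in> I \<Longrightarrow> (s1 has_vector_derivative \<sigma> * sqrt \<epsilon> / (vol_of c \<epsilon> I a t * (a t)\<^sup>2)) (at t within I)"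
    by metis
  have "continuous_on I (\<lambda>t. \<sigma> * c * sqrt \<epsilon> / (vol_of c \<epsilon> I a t * (b t)\<^sup>2))"
    using vol_of_pos[OF dI a \<epsilon>, of _ c] b unfolding b_def by (intro continuous_intros ca) force
  from continuous_antiderivative_interval[OF I(1) t0 this]
  obtain s2 where s2: "\<And>t. t \<in> I \<Longrightarrow> (s2 has_vector_derivative \<sigma> * c * sqrt \<epsilon> / (vol_of c \<epsilon> I a t * (b t)\<^sup>2)) (at t within I)"
    by metis
  have "reconstruction k1 k2 d1 d2 c \<epsilon> \<sigma> I a b s1 s2 l1 l2"
    unfolding reconstruction_def
  proof (intro ballI)
    fix t assume t: "t \<in> I"
    have V: "volume_factor k1 k2 l1 l2 t = vol_of c \<epsilon> I a t" using l[OF t] by (simp add: volume_factor_def)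
    show "b t = sqrt (1 - (a t)\<^sup>2) \<and> 0 < l1 t \<and> 0 < l2 t \<and>
        (volume_factor k1 k2 l1 l2 t)\<^sup>2 = \<epsilon> * Q_of c a t / ((a t)\<^sup>2 * R_of I a t) \<and>
        d2 / (l2 t)\<^sup>2 - d1 / (l1 t)\<^sup>2 = T_of c I a t \<and>
        (s1 has_real_derivative \<sigma> * sqrt \<epsilon> / (volume_factor k1 k2 l1 l2 t * (a t)\<^sup>2)) (at t within I) \<and>
        (s2 has_real_derivative \<sigma> * c * sqrt \<epsilon> / (volume_factor k1 k2 l1 l2 t * (b t)\<^sup>2)) (at t within I)"
      unfolding V using l[OF t] s1[OF t] s2[OF t] vol_of_square[OF dI a \<epsilon> t]
      by (simp add: b_def has_real_derivative_iff_has_vector_derivative)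
  qed
  then show ?thesis by (rule that)
qed

lemma interval_same_derivative_imp_shift:
  fixes s s' :: "real \<Rightarrow> real"
  assumes I: "is_interval I" "t0 \<in> I"
    and d: "\<And>t. t \<in> I \<Longrightarrow> (s has_real_derivative w t) (at t within I)"
      "\<And>t. t \<in> I \<Longrightarrow> (s' has_real_derivative w t) (at t within I)"
  shows "\<forall>t\<in>I. s' t = s t + (s' t0 - s t0)"
proof -
  have "((\<lambda>t. s' t - s t) has_field_derivative 0) (at t within I)" if "t \<in> I" for t
    using DERIV_diff[OF d(2)[OF that] d(1)[OF that]] by simp
  then obtain k where "\<And>t. t \<in> I \<Longrightarrow> s' t - s t = k"
    using has_field_derivative_zero_constant[OF is_interval_convex[OF I(1)]] by metis
  then show ?thesis using I(2) by fastforce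
qed

lemma reconstruction_unique:
  assumes I: "is_interval I" "interior I \<noteq> {}" and a: "admissible I a" and \<epsilon>: "0 < \<epsilon>"
    and d: "0 < d1" "0 < d2" and k: "0 < k1" "0 < k2"
    and r: "reconstruction k1 k2 d1 d2 c \<epsilon> \<sigma> I a b s1 s2 l1 l2"
  shows "reconstruction k1 k2 d1 d2 c \<epsilon> \<sigma> I a b' s1' s2' l1' l2' \<longleftrightarrow>
     (\<forall>t\<in>I. b' t = b t \<and> l1' t = l1 t \<and> l2' t = l2 t) \<and>
     (\<exists>\<theta>1 \<theta>2. \<forall>t\<in>I. s1' t = s1 t + \<theta>1 \<and> s2' t = s2 t + \<theta>2)"
proof
  note dI = dense_axes_interval[OF I]
  obtain t0 where t0: "t0 \<in> I" using I(2) interior_subset by blast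
  note r0 = r[unfolded reconstruction_def, rule_format]
  note V = reconstruction_smooth(6)[OF dI a \<epsilon> d k r]
  assume r': "reconstruction k1 k2 d1 d2 c \<epsilon> \<sigma> I a b' s1' s2' l1' l2'"
  note r0' = r'[unfolded reconstruction_def, rule_format]
  note V' = reconstruction_smooth(6)[OF dI a \<epsilon> d k r']
  have eq: "b' t = b t \<and> l1' t = l1 t \<and> l2' t = l2 t" if t: "t \<in> I" for t
    using r0[OF t] r0'[OF t] V[OF t] V'[OF t] warp_pair_unique[OF d k, of "l1' t" "l2' t" "l1 t" "l2 t"]
    by (simp add: volume_factor_def)
  have s: "(s1' has_real_derivative \<sigma> * sqrt \<epsilon> / (vol_of c \<epsilon> I a t * (a t)\<^sup>2)) (at t within I)"
    "(s2' has_real_derivative \<sigma> * c * sqrt \<epsilon> / (vol_of c \<epsilon> I a t * (b t)\<^sup>2)) (at t within I)"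
    if t: "t \<in> I" for t
    using r0'[OF t] unfolding V'[OF t] conjunct1[OF eq[OF t]] by blast+
  have "\<forall>t\<in>I. s1' t = s1 t + (s1' t0 - s1 t0)"
    by (rule interval_same_derivative_imp_shift[OF I(1) t0,
          where w = "\<lambda>t. \<sigma> * sqrt \<epsilon> / (vol_of c \<epsilon> I a t * (a t)\<^sup>2)"]) (use r0 V s in simp_all)
  moreover have "\<forall>t\<in>I. s2' t = s2 t + (s2' t0 - s2 t0)"
    by (rule interval_same_derivative_imp_shift[OF I(1) t0,
          where w = "\<lambda>t. \<sigma> * c * sqrt \<epsilon> / (vol_of c \<epsilon> I a t * (b t)\<^sup>2)"])
      (use r0[THEN conjunct2, THEN conjunct2, THEN conjunct2, THEN conjunct2, THEN conjunct2] V s in simp_all)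
  ultimately show "(\<forall>t\<in>I. b' t = b t \<and> l1' t = l1 t \<and> l2' t = l2 t) \<and>
     (\<exists>\<theta>1 \<theta>2. \<forall>t\<in>I. s1' t = s1 t + \<theta>1 \<and> s2' t = s2 t + \<theta>2)"
    using eq by blast
next
  note r0 = r[unfolded reconstruction_def, rule_format]
  assume "(\<forall>t\<in>I. b' t = b t \<and> l1' t = l1 t \<and> l2' t = l2 t) \<and>
     (\<exists>\<theta>1 \<theta>2. \<forall>t\<in>I. s1' t = s1 t + \<theta>1 \<and> s2' t = s2 t + \<theta>2)"
  then obtain \<theta>1 \<theta>2 where eq: "\<And>t. t \<in> I \<Longrightarrow> b' t = b t \<and> l1' t = l1 t \<and> l2' t = l2 t"
    and s: "\<And>t. t \<in> I \<Longrightarrow> s1' t = s1 t + \<theta>1" "\<And>t. t \<in> I \<Longrightarrow> s2' t = s2 t + \<theta>2" by auto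
  have sh: "(s' has_real_derivative w) (at t within I)"
    if "t \<in> I" "(u has_real_derivative w) (at t within I)" "\<And>t. t \<in> I \<Longrightarrow> s' t = u t + \<theta>" for s' u w t \<theta>
  proof -
    have "((\<lambda>t. u t + \<theta>) has_vector_derivative w) (at t within I)"
      using that(2) by (auto simp flip: has_real_derivative_iff_has_vector_derivative intro!: derivative_eq_intros)
    from has_vector_derivative_transform[OF that(1) _ this, of s'] that(3)
    show ?thesis by (simp add: has_real_derivative_iff_has_vector_derivative)
  qed
  show "reconstruction k1 k2 d1 d2 c \<epsilon> \<sigma> I a b' s1' s2' l1' l2'"
    unfolding reconstruction_def
  proof (intro ballI)
    fix t assume t: "t \<in> I"
    have v: "volume_factor k1 k2 l1' l2' t = volume_factor k1 k2 l1 l2 t"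
      using eq[OF t] by (simp add: volume_factor_def)
    show "b' t = sqrt (1 - (a t)\<^sup>2) \<and> 0 < l1' t \<and> 0 < l2' t \<and>
        (volume_factor k1 k2 l1' l2' t)\<^sup>2 = \<epsilon> * Q_of c a t / ((a t)\<^sup>2 * R_of I a t) \<and>
        d2 / (l2' t)\<^sup>2 - d1 / (l1' t)\<^sup>2 = T_of c I a t \<and>
        (s1' has_real_derivative \<sigma> * sqrt \<epsilon> / (volume_factor k1 k2 l1' l2' t * (a t)\<^sup>2)) (at t within I) \<and>
        (s2' has_real_derivative \<sigma> * c * sqrt \<epsilon> / (volume_factor k1 k2 l1' l2' t * (b' t)\<^sup>2)) (at t within I)"
      unfolding v using eq[OF t] r0[OF t] sh[OF t _ s(1)] sh[OF t _ s(2)] by auto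
  qed
qed

section \<open>Normalized harmonic products coincide with reconstructions\<close>

context
  fixes M1 :: "('e1::euclidean_space, 'm1::{t2_space, second_countable_topology}) riem"
    and M2 :: "('e2::euclidean_space, 'm2::{t2_space, second_countable_topology}) riem"
    and f1 :: "'m1 \<Rightarrow> complex ^ 'n1" and f2 :: "'m2 \<Rightarrow> complex ^ 'n2"
    and d1 d2 c \<epsilon> \<sigma> :: real
  assumes M: "riemannian_manifold M1" "riemannian_manifold M2"
    and f: "eigenmap M1 f1 d1" "eigenmap M2 f2 d2" and \<epsilon>: "0 < \<epsilon>" and \<sigma>: "\<sigma> \<in> {-1, 1}"
begin

lemma eigenvalues_pos: "0 < d1" "0 < d2"
  using f by (auto simp: eigenmap_def)

lemma momentum_square: "(\<sigma> * sqrt \<epsilon>)\<^sup>2 = \<epsilon>"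
  using \<sigma> \<epsilon> by (auto simp: power_mult_distrib)

text \<open>Unit speed and the momenta give the volume formula in a form cleared of denominators,
  since the sign of \<open>R\<close> is not yet known. Positivity of \<open>Q\<close> then yields
  \<open>R > 0\<close>.\<close>

lemma normalized_product_vol:
  assumes I: "dense_axes I"
    and n: "normalized_product M1 M2 f1 f2 c \<epsilon> \<sigma> I a b s1 s2 l1 l2" and t: "t \<in> I"
  defines "V \<equiv> volume_factor DIM('e1) DIM('e2) l1 l2 t"
  shows "0 < V" "V\<^sup>2 * (a t)\<^sup>2 * R_of I a t = \<epsilon> * Q_of c a t" "0 < 1 + (c\<^sup>2 - 1) * (a t)\<^sup>2"
    "0 < R_of I a t" "a t < 1"
proof -
  have sm: "smooth_on I a" "smooth_on I b" "smooth_on I s1" "smooth_on I s2"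
    and ab: "\<And>t. t \<in> I \<Longrightarrow> 0 < a t" "\<And>t. t \<in> I \<Longrightarrow> 0 < b t" "\<And>t. t \<in> I \<Longrightarrow> (a t)\<^sup>2 + (b t)\<^sup>2 = 1"
    and hp: "harmonic_product M1 M2 f1 f2 I (polar a s1) (polar b s2) l1 l2"
    and us: "unit_speed I (polar a s1) (polar b s2)"
    and mom: "V * (a t)\<^sup>2 * cder I s1 t = \<sigma> * sqrt \<epsilon>" "V * (b t)\<^sup>2 * cder I s2 t = \<sigma> * sqrt \<epsilon> * c"
    using n t unfolding normalized_product_def V_def by auto
  have l: "0 < l1 t" "0 < l2 t" using hp t unfolding harmonic_product_def by auto
  then show V: "0 < V" by (simp add: V_def volume_factor_def)
  have "(cder I a t)\<^sup>2 + (a t * cder I s1 t)\<^sup>2 + ((cder I b t)\<^sup>2 + (b t * cder I s2 t)\<^sup>2) = 1"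
    using us t unfolding unit_speed_def cder_polar(1)[OF I sm(1,3) t, symmetric]
    by (metis cder_polar(1)[OF I sm(1,3) t] cder_polar(1)[OF I sm(2,4) t] norm_Complex_cis)
  then show VR: "V\<^sup>2 * (a t)\<^sup>2 * R_of I a t = \<epsilon> * Q_of c a t"
    using unit_speed_iff[OF ab(1-3)[OF t] circle_derivatives(1)[OF I sm(1,2) ab(3) t] V mom momentum_square \<epsilon>]
    by (simp add: R_of_def Q_of_def)
  have a1: "(a t)\<^sup>2 < 1" using ab[OF t] by (smt (verit) zero_less_power)
  then show "a t < 1" using ab(1)[OF t] by (simp add: abs_square_less_1)
  have "0 < (1 - (a t)\<^sup>2) + c\<^sup>2 * (a t)\<^sup>2" using a1 by (intro add_pos_nonneg) auto
  then show Q: "0 < 1 + (c\<^sup>2 - 1) * (a t)\<^sup>2" by (simp add: algebra_simps)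
  then have "0 < V\<^sup>2 * (a t)\<^sup>2 * R_of I a t" unfolding VR Q_of_def using \<epsilon> by simp
  moreover have "0 < V\<^sup>2 * (a t)\<^sup>2" using V ab(1)[OF t] by simp
  ultimately show "0 < R_of I a t" by (rule zero_less_mult_pos)
qed

lemma normalized_product_admissible:
  assumes I: "dense_axes I"
    and n: "normalized_product M1 M2 f1 f2 c \<epsilon> \<sigma> I a b s1 s2 l1 l2"
  shows "admissible I a"
  using n normalized_product_vol[OF I n] by (auto simp: admissible_def normalized_product_def)

text \<open>The derivative of the volume factor is computed twice, from the warps and from the
  formula in \<open>a\<close>. Comparison identifies \<open>H\<close> at every time, turns included,
  and \<open>radial_equations_iff\<close> turns the radial equations into the formula for
  \<open>T\<close>.\<close>

lemma normalized_imp_reconstruction: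
  assumes I: "dense_axes I"
    and n: "normalized_product M1 M2 f1 f2 c \<epsilon> \<sigma> I a b s1 s2 l1 l2"
  shows "reconstruction DIM('e1) DIM('e2) d1 d2 c \<epsilon> \<sigma> I a b s1 s2 l1 l2"
  unfolding reconstruction_def
proof (intro ballI)
  fix t assume t: "t \<in> I"
  let ?V = "volume_factor DIM('e1) DIM('e2) l1 l2"
  have sm: "smooth_on I a" "smooth_on I b" "smooth_on I s1" "smooth_on I s2"
    and ab: "\<And>t. t \<in> I \<Longrightarrow> 0 < a t" "\<And>t. t \<in> I \<Longrightarrow> 0 < b t" "\<And>t. t \<in> I \<Longrightarrow> (a t)\<^sup>2 + (b t)\<^sup>2 = 1"
    and hp: "harmonic_product M1 M2 f1 f2 I (polar a s1) (polar b s2) l1 l2"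
    and mom: "?V t * (a t)\<^sup>2 * cder I s1 t = \<sigma> * sqrt \<epsilon>" "?V t * (b t)\<^sup>2 * cder I s2 t = \<sigma> * sqrt \<epsilon> * c"
    using n t unfolding normalized_product_def by auto
  note adm = normalized_product_admissible[OF I n]
  note v = normalized_product_vol[OF I n]
  have V2: "(?V s)\<^sup>2 = \<epsilon> * Q_of c a s / ((a s)\<^sup>2 * R_of I a s)" if "s \<in> I" for s
    using v(2)[OF that] ab(1)[OF that] v(4)[OF that] by (simp add: field_simps)
  have hp': "smooth_on I l1" "smooth_on I l2" "0 < l1 t" "0 < l2 t"
    "harmonic_ode I DIM('e1) DIM('e2) d1 d2 (polar a s1) (polar b s2) l1 l2 t"
  proof -
    note h = hp[unfolded harmonic_product_iff[OF M f I]]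
    show "smooth_on I l1" "smooth_on I l2" using h by simp_all
    from h have "\<forall>t\<in>I. 0 < l1 t \<and> 0 < l2 t \<and> (norm (polar a s1 t))\<^sup>2 + (norm (polar b s2 t))\<^sup>2 = 1 \<and>
      harmonic_ode I DIM('e1) DIM('e2) d1 d2 (polar a s1) (polar b s2) l1 l2 t"
      by (elim conjE)
    from bspec[OF this t] show "0 < l1 t" "0 < l2 t"
      "harmonic_ode I DIM('e1) DIM('e2) d1 d2 (polar a s1) (polar b s2) l1 l2 t"
      by simp_all
  qed
  have V_eq: "?V s = vol_of c \<epsilon> I a s" if "s \<in> I" for s
  proof (rule power2_eq_imp_eq)
    show "(?V s)\<^sup>2 = (vol_of c \<epsilon> I a s)\<^sup>2"
      unfolding V2[OF that] vol_of_square[OF I adm \<epsilon> that, of c] ..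
    show "0 \<le> ?V s" using v(1)[OF that] by simp
    show "0 \<le> vol_of c \<epsilon> I a s" using vol_of_pos[OF I adm \<epsilon> that, of c] by simp
  qed
  define H where "H = real DIM('e1) * cder I l1 t / l1 t + real DIM('e2) * cder I l2 t / l2 t"
  have "(?V has_real_derivative ?V t * H) (at t within I)"
    unfolding H_def using hp' smooth_on_has_real_derivative[OF I _ t]
    by (intro volume_factor_has_derivative) auto
  moreover have "(?V has_real_derivative - ?V t * (a t * cder I a t * T_of c I a t)) (at t within I)"
    unfolding has_real_derivative_iff_has_vector_derivative
    by (rule has_vector_derivative_transform[OF t V_eq])
      (use vol_of_has_derivative[OF I adm \<epsilon> t, of c] V_eq[OF t] in
        \<open>auto simp: has_real_derivative_iff_has_vector_derivative\<close>)
  ultimately have "?V t * H = - ?V t * (a t * cder I a t * T_of c I a t)"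
    using cder_eqI[OF I t] by (metis has_real_derivative_iff_has_vector_derivative)
  then have "?V t * H = ?V t * - (a t * cder I a t * T_of c I a t)" by simp
  then have "H = - (a t * cder I a t * T_of c I a t)"
    unfolding mult_cancel_left using v(1)[OF t] by simp
  then have H: "H = - a t * cder I a t * (1 / ((a t)\<^sup>2 * Q_of c a t)
      - (a t + cder I (cder I a) t) / (a t * R_of I a t))"
    by (simp add: T_of_def mult_ac)
  note re = radial_equations_iff[OF ab(1-3)[OF t] circle_derivatives[OF I sm(1,2) ab(3) t]
      R_of_def v(4)[OF t] Q_of_def v(1)[OF t] V2[OF t] mom momentum_square \<epsilon> H refl,
      of "d1 / (l1 t)\<^sup>2" "d2 / (l2 t)\<^sup>2"]
  have T: "d2 / (l2 t)\<^sup>2 - d1 / (l1 t)\<^sup>2 = T_of c I a t"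
    using hp'(5)[unfolded harmonic_ode_polar[OF I sm t] H_def[symmetric]] re
    by (simp add: T_of_def)
  have "cder I s1 t = \<sigma> * sqrt \<epsilon> / (?V t * (a t)\<^sup>2)" "cder I s2 t = \<sigma> * c * sqrt \<epsilon> / (?V t * (b t)\<^sup>2)"
    using mom v(1)[OF t] ab[OF t] by (simp_all add: field_simps)
  moreover have "b t = sqrt (1 - (a t)\<^sup>2)"
    using ab(2,3)[OF t] by (metis add_diff_cancel_left' less_imp_le real_sqrt_unique)
  ultimately show "b t = sqrt (1 - (a t)\<^sup>2) \<and> 0 < l1 t \<and> 0 < l2 t \<and>
        (?V t)\<^sup>2 = \<epsilon> * Q_of c a t / ((a t)\<^sup>2 * R_of I a t) \<and>
        d2 / (l2 t)\<^sup>2 - d1 / (l1 t)\<^sup>2 = T_of c I a t \<and>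
        (s1 has_real_derivative \<sigma> * sqrt \<epsilon> / (?V t * (a t)\<^sup>2)) (at t within I) \<and>
        (s2 has_real_derivative \<sigma> * c * sqrt \<epsilon> / (?V t * (b t)\<^sup>2)) (at t within I)"
    using hp' V2[OF t] T smooth_on_has_real_derivative[OF I sm(3) t] smooth_on_has_real_derivative[OF I sm(4) t]
    by simp
qed

lemma reconstruction_imp_normalized:
  assumes I: "dense_axes I" and adm: "admissible I a"
    and r: "reconstruction DIM('e1) DIM('e2) d1 d2 c \<epsilon> \<sigma> I a b s1 s2 l1 l2"
  shows "normalized_product M1 M2 f1 f2 c \<epsilon> \<sigma> I a b s1 s2 l1 l2"
proof -
  let ?V = "volume_factor DIM('e1) DIM('e2) l1 l2"
  have k: "0 < DIM('e1)" "0 < DIM('e2)" by auto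
  note rs = reconstruction_smooth[OF I adm \<epsilon> eigenvalues_pos k r]
  note sm = admissible_smooth(1)[OF I adm] rs(1) rs(4,5)
  note r' = r[unfolded reconstruction_def, rule_format]
  have ab: "0 < a t" "0 < b t" "(a t)\<^sup>2 + (b t)\<^sup>2 = 1" if "t \<in> I" for t
    using admissible_bounds(1)[OF I adm that] rs(7)[OF that] by auto
  have V0: "0 < ?V t" if "t \<in> I" for t using rs(6)[OF that] vol_of_pos[OF I adm \<epsilon> that, of c] by simp
  have s': "cder I s1 t = \<sigma> * sqrt \<epsilon> / (?V t * (a t)\<^sup>2)" "cder I s2 t = \<sigma> * c * sqrt \<epsilon> / (?V t * (b t)\<^sup>2)"
    if "t \<in> I" for t
    using r'[OF that] cder_eqI[OF I that] by (auto simp: has_real_derivative_iff_has_vector_derivative)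
  have mom: "?V t * (a t)\<^sup>2 * cder I s1 t = \<sigma> * sqrt \<epsilon>" "?V t * (b t)\<^sup>2 * cder I s2 t = \<sigma> * sqrt \<epsilon> * c"
    if "t \<in> I" for t
    unfolding s'[OF that] using ab[OF that] V0[OF that] by (simp_all add: field_simps)
  define H where "H t = real DIM('e1) * cder I l1 t / l1 t + real DIM('e2) * cder I l2 t / l2 t" for t
  have V': "(?V has_real_derivative ?V t * H t) (at t within I)" if t: "t \<in> I" for t
    unfolding H_def using r'[OF t] smooth_on_has_real_derivative[OF I _ t] rs(2,3)
    by (intro volume_factor_has_derivative) auto
  have ode: "harmonic_ode I DIM('e1) DIM('e2) d1 d2 (polar a s1) (polar b s2) l1 l2 t"
    and unit: "(cder I a t)\<^sup>2 + (a t * cder I s1 t)\<^sup>2 + ((cder I b t)\<^sup>2 + (b t * cder I s2 t)\<^sup>2) = 1"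
    if t: "t \<in> I" for t
  proof -
    have R: "0 < R_of I a t" using admissible_bounds(3)[OF I adm t] .
    have V2: "(?V t)\<^sup>2 = \<epsilon> * Q_of c a t / ((a t)\<^sup>2 * R_of I a t)" using r'[OF t] by blast
    have "(?V t)\<^sup>2 * (a t)\<^sup>2 * R_of I a t = \<epsilon> * Q_of c a t"
      unfolding V2 using R ab(1)[OF t] by simp
    then show "(cder I a t)\<^sup>2 + (a t * cder I s1 t)\<^sup>2 + ((cder I b t)\<^sup>2 + (b t * cder I s2 t)\<^sup>2) = 1"
      using unit_speed_iff[OF ab(1-3)[OF t] circle_derivatives(1)[OF I sm(1,2) ab(3) t] V0[OF t]
          mom[OF t] momentum_square \<epsilon>]
      by (simp add: R_of_def Q_of_def)
    have "(?V has_real_derivative - ?V t * (a t * cder I a t * T_of c I a t)) (at t within I)"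
      unfolding has_real_derivative_iff_has_vector_derivative
      by (rule has_vector_derivative_transform[OF t rs(6)])
        (use vol_of_has_derivative[OF I adm \<epsilon> t, of c] rs(6)[OF t] in
          \<open>auto simp: has_real_derivative_iff_has_vector_derivative\<close>)
    then have "?V t * H t = - ?V t * (a t * cder I a t * T_of c I a t)"
      using cder_eqI[OF I t] V'[OF t] by (metis has_real_derivative_iff_has_vector_derivative)
    then have "?V t * H t = ?V t * - (a t * cder I a t * T_of c I a t)" by simp
    then have "H t = - (a t * cder I a t * T_of c I a t)"
      unfolding mult_cancel_left using V0[OF t] by simp
    then have H: "H t = - a t * cder I a t * (1 / ((a t)\<^sup>2 * Q_of c a t)
        - (a t + cder I (cder I a) t) / (a t * R_of I a t))"
      by (simp add: T_of_def mult_ac)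
    note re = radial_equations_iff[OF ab(1-3)[OF t] circle_derivatives[OF I sm(1,2) ab(3) t]
        R_of_def R Q_of_def V0[OF t] V2 mom[OF t] momentum_square \<epsilon> H refl,
        of "d1 / (l1 t)\<^sup>2" "d2 / (l2 t)\<^sup>2"]
    \<comment> \<open>The angular equations: differentiating the constant momentum
      \<open>?V t * (x t)\<^sup>2 * s t\<close> gives \<open>?V t * x t\<close> times the left-hand
      side.\<close>
    have im: "2 * x' * w + x t * cder I s t + H t * (x t * w) = 0"
      if x: "\<And>t. t \<in> I \<Longrightarrow> 0 < x t" "(x has_real_derivative x') (at t within I)" and s: "smooth_on I s"
        and w: "w = s t" and k: "\<And>t. t \<in> I \<Longrightarrow> ?V t * (x t)\<^sup>2 * s t = S" for x s x' w S
    proof -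
      have "((\<lambda>t. ?V t * (x t)\<^sup>2 * s t) has_real_derivative
        ?V t * x t * (2 * x' * w + x t * cder I s t + H t * (x t * w))) (at t within I)"
        unfolding w
        by (auto intro!: derivative_eq_intros V'[OF t] x(2) smooth_on_has_real_derivative[OF I s t]
            simp: algebra_simps power2_eq_square)
      from has_real_derivative_constant_unique[OF I t this k] show ?thesis
        using V0[OF t] x(1)[OF t] by simp
    qed
    have "2 * cder I a t * cder I s1 t + a t * cder I (cder I s1) t + H t * (a t * cder I s1 t) = 0"
      by (rule im[OF ab(1) smooth_on_has_real_derivative[OF I sm(1) t]
            smooth_on_has_vector_derivative(2)[OF I sm(3)] refl mom(1)])
    moreover have "2 * cder I b t * cder I s2 t + b t * cder I (cder I s2) t + H t * (b t * cder I s2 t) = 0"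
      by (rule im[OF ab(2) smooth_on_has_real_derivative[OF I sm(2) t]
            smooth_on_has_vector_derivative(2)[OF I sm(4)] refl mom(2)])
    ultimately show "harmonic_ode I DIM('e1) DIM('e2) d1 d2 (polar a s1) (polar b s2) l1 l2 t"
      unfolding harmonic_ode_polar[OF I sm t] H_def[symmetric]
      using re r'[OF t] by (simp add: T_of_def)
  qed
  have n: "(norm (polar a s1 t))\<^sup>2 = (a t)\<^sup>2" "(norm (polar b s2 t))\<^sup>2 = (b t)\<^sup>2" for t
    by (simp_all add: polar_eq norm_Complex_cis del: norm_mult)
  have "harmonic_product M1 M2 f1 f2 I (polar a s1) (polar b s2) l1 l2"
    unfolding harmonic_product_iff[OF M f I] n
    using smooth_on_polar[OF I sm(1,3)] smooth_on_polar[OF I sm(2,4)] rs(2,3) r' ab ode by blast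
  moreover have "unit_speed I (polar a s1) (polar b s2)"
    unfolding unit_speed_def
    using unit by (simp add: cder_polar(1)[OF I sm(1,3)] cder_polar(1)[OF I sm(2,4)] norm_Complex_cis
        del: norm_mult)
  ultimately show ?thesis
    unfolding normalized_product_def using sm ab mom by blast
qed

lemma normalized_product_iff_reconstruction:
  assumes I: "dense_axes I" and "admissible I a"
  shows "normalized_product M1 M2 f1 f2 c \<epsilon> \<sigma> I a b s1 s2 l1 l2 \<longleftrightarrow>
    reconstruction DIM('e1) DIM('e2) d1 d2 c \<epsilon> \<sigma> I a b s1 s2 l1 l2"
  using normalized_imp_reconstruction[OF I] reconstruction_imp_normalized[OF assms] by blast

lemma reconstruction_unique_up_to_rotations:
  assumes I: "is_interval I" "interior I \<noteq> {}" and a: "admissible I a"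
  shows "\<exists>b s1 s2 l1 l2.
     normalized_product M1 M2 f1 f2 c \<epsilon> \<sigma> I a b s1 s2 l1 l2 \<and>
     (\<forall>b' s1' s2' l1' l2'.
        normalized_product M1 M2 f1 f2 c \<epsilon> \<sigma> I a b' s1' s2' l1' l2' \<longleftrightarrow>
        (\<forall>t\<in>I. b' t = b t \<and> l1' t = l1 t \<and> l2' t = l2 t) \<and>
        (\<exists>\<theta>1 \<theta>2. \<forall>t\<in>I. s1' t = s1 t + \<theta>1 \<and> s2' t = s2 t + \<theta>2))"
proof -
  have k: "0 < DIM('e1)" "0 < DIM('e2)" by auto
  obtain b s1 s2 l1 l2 where r: "reconstruction DIM('e1) DIM('e2) d1 d2 c \<epsilon> \<sigma> I a b s1 s2 l1 l2"
    using reconstruction_exists[OF I a \<epsilon> eigenvalues_pos k] by blast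
  note u = reconstruction_unique[OF I a \<epsilon> eigenvalues_pos k r]
  show ?thesis
    unfolding normalized_product_iff_reconstruction[OF dense_axes_interval[OF I] a]
    using r u by blast
qed

end


section \<open>Completeness of warped products\<close>

definition speed :: "('e::euclidean_space, 'm) patch \<Rightarrow> (real \<Rightarrow> 'e) \<Rightarrow> real \<Rightarrow> real" where
  "speed p c s = sqrt (pmet p (c s) (cder {0..1} c s) (cder {0..1} c s))"

lemma complete_riemD:
  assumes "complete_riem M" "\<And>n. X n \<in> carr M"
    "\<And>e. 0 < e \<Longrightarrow> \<exists>n0. \<forall>m\<ge>n0. \<forall>n\<ge>n0. riem_dist M (X m) (X n) < ereal e"
  obtains x where "x \<in> carr M" "(\<lambda>n. riem_dist M (X n) x) \<longlonglongrightarrow> 0"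
  using assms(1)[unfolded complete_riem_def, rule_format, of X] assms(2,3) by auto

lemma path_length_segment:
  assumes "path_length M x (pmap p (c 0)) L" "p \<in> M" "smooth_on {0..1} c" "c ` {0..1} \<subseteq> pdom p"
  shows "path_length M x (pmap p (c 1)) (L + integral {0..1} (speed p c))"
  using path_length.segment[OF assms] by (simp add: speed_def[abs_def])

lemma path_length_trans:
  assumes "path_length M y z L'" "path_length M x y L"
  shows "path_length M x z (L + L')"
  using assms
proof (induction rule: path_length.induct)
  case (segment y p c L')
  from path_length_segment[OF segment.IH[OF segment.prems] segment.hyps(2-4)]
  show ?case by (simp add: add.assoc speed_def[abs_def])
qed simp

lemma dense_axes_unit_interval: "dense_axes {0..1::real}"
  by (rule dense_axes_interval) auto

text \<open>Smoothness of the metric is given for constant vectors only, so a varying vector is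
  expanded in the basis.\<close>

lemma continuous_on_metric:
  assumes M: "riemannian_manifold M" "p \<in> M" and c: "continuous_on S c" "c ` S \<subseteq> pdom p"
    and v: "continuous_on S v"
  shows "continuous_on S (\<lambda>s. pmet p (c s) (v s) (v s))"
proof -
  have g: "metric_form (pmet p (c s))" if "s \<in> S" for s
    using riemannian_manifold_patchD(2)[OF M] c(2) that by blast
  have "pmet p (c s) (v s) (v s) = (\<Sum>i\<in>Basis. (\<Sum>j\<in>Basis. (v s \<bullet> i) * ((v s \<bullet> j) * pmet p (c s) i j)))"
    if s: "s \<in> S" for s
  proof -
    have l: "linear (pmet p (c s) w)" "linear (\<lambda>w. pmet p (c s) w u)" for w u
      using g[OF s] by (auto simp: metric_form_def bilinear_def)
    have "pmet p (c s) (v s) (v s) = pmet p (c s) (\<Sum>i\<in>Basis. (v s \<bullet> i) *\<^sub>R i) (\<Sum>j\<in>Basis. (v s \<bullet> j) *\<^sub>R j)"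
      by (simp add: euclidean_representation)
    also have "\<dots> = (\<Sum>i\<in>Basis. (v s \<bullet> i) * pmet p (c s) i (\<Sum>j\<in>Basis. (v s \<bullet> j) *\<^sub>R j))"
      by (subst linear_sum[OF l(2)]) (simp add: linear_scale[OF l(2)])
    also have "\<dots> = (\<Sum>i\<in>Basis. (v s \<bullet> i) * (\<Sum>j\<in>Basis. (v s \<bullet> j) * pmet p (c s) i j))"
      by (subst linear_sum[OF l(1)]) (simp add: linear_scale[OF l(1)])
    finally show ?thesis by (simp add: sum_distrib_left)
  qed
  moreover have "continuous_on S (\<lambda>s. \<Sum>i\<in>Basis. (\<Sum>j\<in>Basis. (v s \<bullet> i) * ((v s \<bullet> j) * pmet p (c s) i j)))"
  proof (intro continuous_intros v)
    fix i j
    show "continuous_on S (\<lambda>s. pmet p (c s) i j)"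
      by (rule continuous_on_compose2[OF smooth_on_imp_continuous_on[OF riemannian_manifold_patchD(3)[OF M]] c])
  qed
  ultimately show ?thesis by (simp cong: continuous_on_cong)
qed

lemma continuous_on_speed:
  assumes M: "riemannian_manifold M" "p \<in> M" and c: "smooth_on {0..1} c" "c ` {0..1} \<subseteq> pdom p"
  shows "continuous_on {0..1} (speed p c)"
  unfolding speed_def[abs_def]
  using smooth_on_imp_continuous_on[OF c(1)]
    smooth_on_imp_continuous_on[OF smooth_on_has_vector_derivative(2)[OF dense_axes_unit_interval c(1)]]
  by (intro continuous_intros continuous_on_metric[OF M _ c(2)])

lemma speed_nonneg:
  assumes "riemannian_manifold M" "p \<in> M" "c ` {0..1} \<subseteq> pdom p" "s \<in> {0..1}"
  shows "0 \<le> speed p c s"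
  unfolding speed_def using metric_form_nonneg[OF riemannian_manifold_patchD(2)[OF assms(1,2)]] assms(3,4)
  by (intro real_sqrt_ge_zero) blast

lemma smooth_on_bounded_linear:
  assumes "dense_axes I" "bounded_linear h" "smooth_on I c"
  shows "smooth_on I (\<lambda>s. h (c s))"
  using Ck_on_bounded_linear[OF assms(1,2)] assms(3) by (simp add: smooth_on_def)

lemma cder_bounded_linear:
  assumes "dense_axes I" "bounded_linear h" "smooth_on I c" "s \<in> I"
  shows "cder I (\<lambda>s. h (c s)) s = h (cder I c s)"
  by (rule cder_eqI[OF assms(1,4) bounded_linear.has_vector_derivative[OF assms(2)
        smooth_on_has_vector_derivative(1)[OF assms(1,3,4)]]])

context
  fixes M1 :: "('e1::euclidean_space, 'm1::{t2_space, second_countable_topology}) riem"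
    and M2 :: "('e2::euclidean_space, 'm2::{t2_space, second_countable_topology}) riem"
    and l1 l2 :: "real \<Rightarrow> real"
  assumes M: "riemannian_manifold M1" "riemannian_manifold M2"
    and l: "continuous_on UNIV l1" "continuous_on UNIV l2" and pos: "\<And>t. 0 < l1 t" "\<And>t. 0 < l2 t"
begin

abbreviation (input) "warped \<equiv> warped_product UNIV l1 l2 M1 M2"

text \<open>The speed of a segment is the Pythagorean sum of its time speed and its warped speeds in
  the factors. In particular it dominates \<open>\<bar>c0'\<bar>\<close>, so the length bounds the
  displacement in time.\<close>

lemma warped_segment:
  assumes pq: "p \<in> M1" "q \<in> M2" and W: "W = warped_patch UNIV l1 l2 p q"
    and c: "smooth_on {0..1} c" "c ` {0..1} \<subseteq> pdom W"
    and cc: "\<And>s. c s = (c0 s, c1 s, c2 s)"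
  shows "smooth_on {0..1} c0" "smooth_on {0..1} c1" "smooth_on {0..1} c2"
    "c1 ` {0..1} \<subseteq> pdom p" "c2 ` {0..1} \<subseteq> pdom q"
    "pmap W (c s) = (c0 s, pmap p (c1 s), pmap q (c2 s))"
    "s \<in> {0..1} \<Longrightarrow> speed W c s =
      sqrt ((cder {0..1} c0 s)\<^sup>2 + (l1 (c0 s) * speed p c1 s)\<^sup>2 + (l2 (c0 s) * speed q c2 s)\<^sup>2)"
    "continuous_on {0..1} (speed W c)"
    "s \<in> {0..1} \<Longrightarrow> \<bar>c0 s - c0 0\<bar> \<le> integral {0..1} (speed W c)"
    "0 \<le> integral {0..1} (speed W c)"
proof -
  note I = dense_axes_unit_interval
  have c0_def: "c0 = (\<lambda>s. fst (c s))" and c1_def: "c1 = (\<lambda>s. fst (snd (c s)))"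
    and c2_def: "c2 = (\<lambda>s. snd (snd (c s)))"
    by (simp_all add: cc)
  have bl: "bounded_linear (\<lambda>x. fst (snd x) :: 'e1)" "bounded_linear (\<lambda>x. snd (snd x) :: 'e2)"
    for x :: "real \<times> 'e1 \<times> 'e2"
    by (intro bounded_linear_intros)+
  show s: "smooth_on {0..1} c0" "smooth_on {0..1} c1" "smooth_on {0..1} c2"
    unfolding c0_def c1_def c2_def
    by (intro smooth_on_bounded_linear[OF I _ c(1)] bl bounded_linear_fst)+
  show d: "c1 ` {0..1} \<subseteq> pdom p" "c2 ` {0..1} \<subseteq> pdom q"
    using c(2) unfolding c1_def c2_def W by (force simp: warped_patch_def)+
  show "pmap W (c s) = (c0 s, pmap p (c1 s), pmap q (c2 s))"
    unfolding W by (simp add: warped_patch_def case_prod_beta c0_def c1_def c2_def)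
  have cd: "cder {0..1} c s = (cder {0..1} c0 s, cder {0..1} c1 s, cder {0..1} c2 s)" if "s \<in> {0..1}" for s
    using cder_bounded_linear[OF I bounded_linear_fst c(1) that]
      cder_bounded_linear[OF I bl(1) c(1) that] cder_bounded_linear[OF I bl(2) c(1) that]
    by (simp add: c0_def c1_def c2_def)
  have nn: "0 \<le> pmet p (c1 s) v v" "0 \<le> pmet q (c2 s) w w" if "s \<in> {0..1}" for s v w
    using d that metric_form_nonneg[OF riemannian_manifold_patchD(2)[OF M(1) pq(1)]]
      metric_form_nonneg[OF riemannian_manifold_patchD(2)[OF M(2) pq(2)]] by blast+
  show sp: "speed W c s =
      sqrt ((cder {0..1} c0 s)\<^sup>2 + (l1 (c0 s) * speed p c1 s)\<^sup>2 + (l2 (c0 s) * speed q c2 s)\<^sup>2)"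
    if "s \<in> {0..1}" for s
  proof -
    show ?thesis
      unfolding speed_def cd[OF that] W cc using nn[OF that]
      by (simp add: warped_patch_def power_mult_distrib flip: power2_eq_square)
  qed
  have cont: "continuous_on {0..1} (\<lambda>s. sqrt ((cder {0..1} c0 s)\<^sup>2 + (l1 (c0 s) * speed p c1 s)\<^sup>2
      + (l2 (c0 s) * speed q c2 s)\<^sup>2))"
    using smooth_on_imp_continuous_on[OF s(1)]
    by (intro continuous_intros smooth_on_imp_continuous_on[OF smooth_on_has_vector_derivative(2)[OF I s(1)]]
        continuous_on_compose2[OF l(1)] continuous_on_compose2[OF l(2)]
        continuous_on_speed[OF M(1) pq(1) s(2) d(1)] continuous_on_speed[OF M(2) pq(2) s(3) d(2)]) auto
  show cs: "continuous_on {0..1} (speed W c)"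
    by (rule continuous_on_eq[OF cont]) (rule sp[symmetric])
  have nonneg: "0 \<le> speed W c s" if "s \<in> {0..1}" for s using sp[OF that] by simp
  show "0 \<le> integral {0..1} (speed W c)"
    using nonneg cs by (intro integral_nonneg integrable_continuous_real) auto
  have le: "\<bar>cder {0..1} c0 s\<bar> \<le> speed W c s" if "s \<in> {0..1}" for s
    unfolding sp[OF that] by (rule real_le_rsqrt) simp
  show "\<bar>c0 s - c0 0\<bar> \<le> integral {0..1} (speed W c)" if s1: "s \<in> {0..1}" for s
  proof -
    have sub: "{0..s} \<subseteq> {0..1}" using s1 by auto
    have ftc: "(cder {0..1} c0 has_integral (c0 s - c0 0)) {0..s}"
    proof (rule fundamental_theorem_of_calculus)
      fix x assume "x \<in> {0..s}"
      then have "x \<in> {0..1}" using sub by blast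
      from has_vector_derivative_within_subset[OF smooth_on_has_vector_derivative(1)[OF I s(1) this] sub]
      show "(c0 has_vector_derivative cder {0..1} c0 x) (at x within {0..s})" .
    qed (use s1 in simp)
    have i: "speed W c integrable_on {0..s}" "speed W c integrable_on {0..1}"
      using cs continuous_on_subset[OF cs sub] by (auto intro: integrable_continuous_real)
    have "norm (integral {0..s} (cder {0..1} c0)) \<le> integral {0..s} (speed W c)"
      using le sub ftc i by (intro integral_norm_bound_integral) auto
    also have "\<dots> \<le> integral {0..1} (speed W c)"
      using nonneg by (intro integral_subset_le sub i) auto
    finally show ?thesis using ftc by (simp add: integral_unique)
  qed
qed

text \<open>A path of length \<open>L\<close> stays within \<open>L\<close> of its initial time. If
  both warps are at least \<open>r\<close> on that range, its projections to the factors have length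
  at most \<open>L / r\<close>. The induction carries both facts because the second needs the
  first.\<close>

lemma path_length_project:
  assumes "path_length warped z z' L"
  shows "\<bar>fst z' - fst z\<bar> \<le> L"
    and "0 < r \<Longrightarrow> (\<And>s. \<bar>s - fst z\<bar> \<le> L \<Longrightarrow> r \<le> l1 s \<and> r \<le> l2 s) \<Longrightarrow>
      (\<exists>L1. path_length M1 (fst (snd z)) (fst (snd z')) L1 \<and> r * L1 \<le> L) \<and>
      (\<exists>L2. path_length M2 (snd (snd z)) (snd (snd z')) L2 \<and> r * L2 \<le> L)"
proof -
  have "\<bar>fst z' - fst z\<bar> \<le> L \<and> (0 < r \<longrightarrow> (\<forall>s. \<bar>s - fst z\<bar> \<le> L \<longrightarrow> r \<le> l1 s \<and> r \<le> l2 s) \<longrightarrow>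
      (\<exists>L1. path_length M1 (fst (snd z)) (fst (snd z')) L1 \<and> r * L1 \<le> L) \<and>
      (\<exists>L2. path_length M2 (snd (snd z)) (snd (snd z')) L2 \<and> r * L2 \<le> L))"
    using assms
  proof (induction rule: path_length.induct)
    case (start x)
    then have "fst (snd x) \<in> carr M1" "snd (snd x) \<in> carr M2" by (auto simp: carr_warped_product)
    then show ?case by (auto intro!: exI[of _ 0] path_length.start)
  next
    case (segment z W c L)
    obtain p q where pq: "p \<in> M1" "q \<in> M2" and W: "W = warped_patch UNIV l1 l2 p q"
      using segment.hyps by (auto simp: warped_product_def)
    define c0 c1 c2 where "c0 s = fst (c s)" and "c1 s = fst (snd (c s))" and "c2 s = snd (snd (c s))" for s
    have "c s = (c0 s, c1 s, c2 s)" for s by (simp add: c0_def c1_def c2_def)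
    note ws = warped_segment[OF pq W segment.hyps(3,4) this]
    define J where "J = integral {0..1} (speed W c)"
    have t: "\<bar>c0 s - fst z\<bar> \<le> L + J" if "s \<in> {0..1}" for s
    proof -
      have "\<bar>c0 0 - fst z\<bar> \<le> L" using segment.IH unfolding ws(6) by simp
      with ws(9)[OF that] show ?thesis unfolding J_def by linarith
    qed
    have proj: "(\<exists>L1. path_length M1 (fst (snd z)) (pmap p (c1 1)) L1 \<and> r * L1 \<le> L + J) \<and>
      (\<exists>L2. path_length M2 (snd (snd z)) (pmap q (c2 1)) L2 \<and> r * L2 \<le> L + J)"
      if r: "0 < r" and b: "\<forall>s. \<bar>s - fst z\<bar> \<le> L + J \<longrightarrow> r \<le> l1 s \<and> r \<le> l2 s"
    proof -
      have "0 \<le> J" using ws(10) by (simp add: J_def)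
      then have "\<forall>s. \<bar>s - fst z\<bar> \<le> L \<longrightarrow> r \<le> l1 s \<and> r \<le> l2 s" using b by force
      then obtain L1 L2 where L1: "path_length M1 (fst (snd z)) (pmap p (c1 0)) L1" "r * L1 \<le> L"
        and L2: "path_length M2 (snd (snd z)) (pmap q (c2 0)) L2" "r * L2 \<le> L"
        using segment.IH r unfolding ws(6) by auto
      have pw: "r * speed p c1 s \<le> speed W c s" "r * speed q c2 s \<le> speed W c s" if s: "s \<in> {0..1}" for s
      proof -
        have n: "0 \<le> speed p c1 s" "0 \<le> speed q c2 s"
          using speed_nonneg[OF M(1) pq(1) ws(4) s] speed_nonneg[OF M(2) pq(2) ws(5) s] by auto
        have "r \<le> l1 (c0 s)" "r \<le> l2 (c0 s)" using b t[OF s] by auto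
        then have "r * speed p c1 s \<le> l1 (c0 s) * speed p c1 s" "r * speed q c2 s \<le> l2 (c0 s) * speed q c2 s"
          using n by (auto intro: mult_right_mono)
        moreover have "l1 (c0 s) * speed p c1 s \<le> speed W c s" "l2 (c0 s) * speed q c2 s \<le> speed W c s"
          unfolding ws(7)[OF s] by (rule real_le_rsqrt; simp)+
        ultimately show "r * speed p c1 s \<le> speed W c s" "r * speed q c2 s \<le> speed W c s" by linarith+
      qed
      have i: "speed p c1 integrable_on {0..1}" "speed q c2 integrable_on {0..1}" "speed W c integrable_on {0..1}"
        using continuous_on_speed[OF M(1) pq(1) ws(2,4)] continuous_on_speed[OF M(2) pq(2) ws(3,5)] ws(8)
        by (auto intro: integrable_continuous_real)
      have "r * integral {0..1} (speed p c1) \<le> J" "r * integral {0..1} (speed q c2) \<le> J"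
        unfolding J_def integral_mult_right[symmetric]
        by (intro integral_le integrable_on_mult_right i pw; simp)+
      then have "r * (L1 + integral {0..1} (speed p c1)) \<le> L + J" "r * (L2 + integral {0..1} (speed q c2)) \<le> L + J"
        using L1(2) L2(2) by (auto simp: distrib_left)
      then show ?thesis
        using path_length_segment[of M1 _ p c1, OF L1(1) pq(1) ws(2,4)] path_length_segment[of M2 _ q c2, OF L2(1) pq(2) ws(3,5)]
        by blast
    qed
    show ?case
    proof -
      have "integral {0..1} (\<lambda>s. sqrt (pmet W (c s) (cder {0..1} c s) (cder {0..1} c s))) = J"
        by (simp add: J_def speed_def[abs_def])
      then show ?thesis using proj t[of 1] unfolding ws(6) by simp
    qed
  qed
  then show "\<bar>fst z' - fst z\<bar> \<le> L"
    and "0 < r \<Longrightarrow> (\<And>s. \<bar>s - fst z\<bar> \<le> L \<Longrightarrow> r \<le> l1 s \<and> r \<le> l2 s) \<Longrightarrow>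
      (\<exists>L1. path_length M1 (fst (snd z)) (fst (snd z')) L1 \<and> r * L1 \<le> L) \<and>
      (\<exists>L2. path_length M2 (snd (snd z)) (snd (snd z')) L2 \<and> r * L2 \<le> L)"
    by blast+
qed

section \<open>Lifting paths of the line and of the factors\<close>

lemma warped_patch_in_warped: "p \<in> M1 \<Longrightarrow> q \<in> M2 \<Longrightarrow> warped_patch UNIV l1 l2 p q \<in> warped"
  by (auto simp: warped_product_def)

lemma smooth_on_Pair_unit:
  assumes "smooth_on {0..1::real} f" "smooth_on {0..1} g"
  shows "smooth_on {0..1} (\<lambda>s. (f s, g s))"
  using assms unfolding smooth_on_def by (auto intro: Ck_on_Pair dense_axes_unit_interval)

lemma smooth_on_const_unit: "smooth_on {0..1::real} (\<lambda>s. k)"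
  unfolding smooth_on_def by (auto intro: Ck_on_const dense_axes_unit_interval)

lemma cder_const_unit: "s \<in> {0..1} \<Longrightarrow> cder {0..1} (\<lambda>s. k) s = 0"
  by (rule cder_eqI[OF dense_axes_unit_interval]) auto

lemma speed_const:
  assumes "riemannian_manifold A" "p \<in> A" "x \<in> pdom p" "s \<in> {0..1}"
  shows "speed p (\<lambda>s. x) s = 0"
  using metric_form_simps(5)[OF riemannian_manifold_patchD(2)[OF assms(1-3)]]
  by (simp add: speed_def cder_const_unit[OF assms(4)])

lemma lift_path_t:
  assumes x: "x \<in> carr M1" and y: "y \<in> carr M2"
  shows "path_length warped (t, x, y) (t', x, y) \<bar>t' - t\<bar>"
proof -
  obtain p x0 where p: "p \<in> M1" "x0 \<in> pdom p" "x = pmap p x0" using x by (auto simp: carr_def)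
  obtain q y0 where q: "q \<in> M2" "y0 \<in> pdom q" "y = pmap q y0" using y by (auto simp: carr_def)
  define c where "c s = (t + s * (t' - t), x0, y0)" for s :: real
  have d: "smooth_on {0..1} (\<lambda>s. t + s * (t' - t))"
    unfolding smooth_on_def by (intro allI Ck_intros dense_axes_unit_interval)
  have c: "smooth_on {0..1} c"
    unfolding c_def by (intro smooth_on_Pair_unit d smooth_on_const_unit)
  have im: "c ` {0..1} \<subseteq> pdom (warped_patch UNIV l1 l2 p q)"
    using p q by (auto simp: c_def warped_patch_def)
  have "cder {0..1} (\<lambda>s. t + s * (t' - t)) s = t' - t" if "s \<in> {0..1}" for s
    by (rule cder_eqI[OF dense_axes_unit_interval that])
      (auto intro!: derivative_eq_intros simp flip: has_real_derivative_iff_has_vector_derivative)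
  then have "speed (warped_patch UNIV l1 l2 p q) c s = \<bar>t' - t\<bar>" if "s \<in> {0..1}" for s
    using that warped_segment(7)[OF p(1) q(1) refl c im c_def that]
      speed_const[OF M(1) p(1,2) that] speed_const[OF M(2) q(1,2) that]
    by simp
  then have "integral {0..1} (speed (warped_patch UNIV l1 l2 p q) c) = \<bar>t' - t\<bar>"
    by (subst Henstock_Kurzweil_Integration.integral_cong[where g = "\<lambda>_. \<bar>t' - t\<bar>"]) auto
  moreover have "path_length warped (t, x, y) (pmap (warped_patch UNIV l1 l2 p q) (c 0)) 0"
    using path_length.start[of "(t, x, y)" warped] x y p q by (simp add: carr_warped_product c_def warped_patch_def)
  ultimately show ?thesis
    using path_length_segment[of warped "(t, x, y)" "warped_patch UNIV l1 l2 p q" c 0, OF _ warped_patch_in_warped[OF p(1) q(1)] c im] p q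
    by (simp add: c_def warped_patch_def)
qed

text \<open>A slice at fixed time is a copy of the factor scaled by the warp at that time. These
  lifts and \<open>lift_path_t\<close> bound distances in the warped product from above.\<close>

lemma lift_path_x:
  assumes "path_length M1 x x' L" and y: "y \<in> carr M2"
  shows "path_length warped (t, x, y) (t, x', y) (l1 t * L)"
  using assms(1)
proof (induction rule: path_length.induct)
  case (start x)
  then show ?case using y by (auto intro!: path_length.start simp: carr_warped_product)
next
  case (segment x p c1 L)
  obtain q y0 where q: "q \<in> M2" "y0 \<in> pdom q" "y = pmap q y0" using y by (auto simp: carr_def)
  let ?W = "warped_patch UNIV l1 l2 p q"
  define c where "c s = (t, c1 s, y0)" for s :: real
  have c: "smooth_on {0..1} c"
    unfolding c_def by (intro smooth_on_Pair_unit segment.hyps smooth_on_const_unit)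
  have im: "c ` {0..1} \<subseteq> pdom ?W"
    using segment.hyps q by (auto simp: c_def warped_patch_def)
  have "speed ?W c s = l1 t * speed p c1 s" if "s \<in> {0..1}" for s
    using warped_segment(7)[OF segment.hyps(2) q(1) refl c im c_def that]
      speed_const[OF M(2) q(1,2) that] pos(1)[of t]
      speed_nonneg[OF M(1) segment.hyps(2,4) that]
    by (simp add: cder_const_unit[OF that])
  then have "integral {0..1} (speed ?W c) = l1 t * integral {0..1} (speed p c1)"
    by (subst Henstock_Kurzweil_Integration.integral_cong[where g = "\<lambda>s. l1 t * speed p c1 s"]) auto
  then show ?case
    using path_length_segment[of warped "(t, x, y)" ?W c, OF _ warped_patch_in_warped[OF segment.hyps(2) q(1)] c im] q segment.IH
    by (simp add: c_def warped_patch_def speed_def[abs_def] distrib_left)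
qed

lemma lift_path_y:
  assumes "path_length M2 y y' L" and x: "x \<in> carr M1"
  shows "path_length warped (t, x, y) (t, x, y') (l2 t * L)"
  using assms(1)
proof (induction rule: path_length.induct)
  case (start y)
  then show ?case using x by (auto intro!: path_length.start simp: carr_warped_product)
next
  case (segment y q c2 L)
  obtain p x0 where p: "p \<in> M1" "x0 \<in> pdom p" "x = pmap p x0" using x by (auto simp: carr_def)
  let ?W = "warped_patch UNIV l1 l2 p q"
  define c where "c s = (t, x0, c2 s)" for s :: real
  have c: "smooth_on {0..1} c"
    unfolding c_def by (intro smooth_on_Pair_unit segment.hyps smooth_on_const_unit)
  have im: "c ` {0..1} \<subseteq> pdom ?W"
    using segment.hyps p by (auto simp: c_def warped_patch_def)
  have "speed ?W c s = l2 t * speed q c2 s" if "s \<in> {0..1}" for s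
    using warped_segment(7)[OF p(1) segment.hyps(2) refl c im c_def that]
      speed_const[OF M(1) p(1,2) that] pos(2)[of t]
      speed_nonneg[OF M(2) segment.hyps(2,4) that]
    by (simp add: cder_const_unit[OF that])
  then have "integral {0..1} (speed ?W c) = l2 t * integral {0..1} (speed q c2)"
    by (subst Henstock_Kurzweil_Integration.integral_cong[where g = "\<lambda>s. l2 t * speed q c2 s"]) auto
  then show ?case
    using path_length_segment[of warped "(t, x, y)" ?W c, OF _ warped_patch_in_warped[OF p(1) segment.hyps(2)] c im] p segment.IH
    by (simp add: c_def warped_patch_def speed_def[abs_def] distrib_left)
qed

section \<open>Cauchy sequences in the warped product\<close>

lemma riem_dist_less_iff: "riem_dist A x y < ereal e \<longleftrightarrow> (\<exists>L<e. path_length A x y L)"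
  unfolding riem_dist_def Inf_less_iff by auto

lemma riem_dist_warped_nonneg: "0 \<le> riem_dist warped z z'"
proof -
  have "0 \<le> L" if "path_length warped z z' L" for L
    using path_length_project(1)[OF that] by linarith
  then show ?thesis unfolding riem_dist_def by (intro Inf_greatest) auto
qed

text \<open>On a compact time interval the warps are bounded below, so a Cauchy sequence projects to
  Cauchy sequences in the line and in both factors. The limits are joined to the sequence by moving
  in time to \<open>t0\<close> first and then inside the slice at \<open>t0\<close>.\<close>

lemma complete_warped_product:
  assumes c: "complete_riem M1" "complete_riem M2"
  shows "complete_riem warped"
  unfolding complete_riem_def
proof (intro allI impI, elim conjE)
  fix X :: "nat \<Rightarrow> real \<times> 'm1 \<times> 'm2"
  assume X: "\<forall>n. X n \<in> carr warped"
    and Cauchy: "\<forall>e>0. \<exists>n0::nat. \<forall>m\<ge>n0. \<forall>n\<ge>n0. riem_dist warped (X m) (X n) < ereal e"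
  define t x y where "t n = fst (X n)" and "x n = fst (snd (X n))" and "y n = snd (snd (X n))" for n
  have Xn: "X n = (t n, x n, y n)" for n by (simp add: t_def x_def y_def)
  have carr: "x n \<in> carr M1" "y n \<in> carr M2" for n
    using X by (auto simp: carr_warped_product Xn)
  have C: "\<exists>n0. \<forall>m\<ge>n0. \<forall>n\<ge>n0. \<exists>L<e. path_length warped (X m) (X n) L" if "e > 0" for e
    using Cauchy that by (simp add: riem_dist_less_iff)
  obtain n1 where n1: "\<And>m n. m \<ge> n1 \<Longrightarrow> n \<ge> n1 \<Longrightarrow> \<exists>L<1. path_length warped (X m) (X n) L"
    using C[of 1] by auto
  have t1: "\<bar>t n - t n1\<bar> \<le> 1" if "n \<ge> n1" for n
    using n1[of n1 n] that path_length_project(1)[of "X n1" "X n"] by (force simp: t_def)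
  \<comment> \<open>Radius 2 is 1 for the distance of \<open>t n\<close> from \<open>t n1\<close>
    plus 1 for the time a path of length below 1 can travel.\<close>
  define K where "K = {t n1 - 2..t n1 + 2}"
  have K: "compact K" "K \<noteq> {}" by (auto simp: K_def)
  obtain r where r: "0 < r" "\<And>s. s \<in> K \<Longrightarrow> r \<le> l1 s \<and> r \<le> l2 s"
  proof -
    obtain s1 where s1: "\<forall>s\<in>K. l1 s1 \<le> l1 s"
      using continuous_attains_inf[OF K continuous_on_subset[OF l(1)]] by blast
    obtain s2 where s2: "\<forall>s\<in>K. l2 s2 \<le> l2 s"
      using continuous_attains_inf[OF K continuous_on_subset[OF l(2)]] by blast
    show ?thesis by (rule that[of "min (l1 s1) (l2 s2)"]) (use s1 s2 pos in auto)
  qed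
  have proj: "\<exists>n0. \<forall>m\<ge>n0. \<forall>n\<ge>n0. \<bar>t m - t n\<bar> < e \<and> riem_dist M1 (x m) (x n) < ereal e \<and> riem_dist M2 (y m) (y n) < ereal e"
    if e: "e > 0" for e
  proof -
    \<comment> \<open>The bound 1 keeps the joining path over \<open>K\<close>, and
      \<open>r * e\<close> brings the projected lengths below \<open>e\<close>.\<close>
    have "0 < min e (min 1 (r * e))" using e r by auto
    from C[OF this] obtain n0 where n0: "\<And>m n. m \<ge> n0 \<Longrightarrow> n \<ge> n0 \<Longrightarrow> \<exists>L<min e (min 1 (r * e)). path_length warped (X m) (X n) L"
      by blast
    have "\<bar>t m - t n\<bar> < e \<and> riem_dist M1 (x m) (x n) < ereal e \<and> riem_dist M2 (y m) (y n) < ereal e"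
      if mn: "m \<ge> max n0 n1" "n \<ge> max n0 n1" for m n
    proof -
      obtain L where L: "L < e" "L < 1" "L < r * e" "path_length warped (X m) (X n) L"
        using n0[of m n] mn by auto
      have "\<bar>t n - t m\<bar> \<le> L" using path_length_project(1)[OF L(4)] by (simp add: t_def)
      moreover have "r \<le> l1 s \<and> r \<le> l2 s" if "\<bar>s - fst (X m)\<bar> \<le> L" for s
        using that t1[of m] mn L(2) by (intro r(2)) (auto simp: K_def t_def)
      from path_length_project(2)[OF L(4) r(1) this]
      obtain L1 L2 where "path_length M1 (x m) (x n) L1" "r * L1 \<le> L" "path_length M2 (y m) (y n) L2" "r * L2 \<le> L"
        by (auto simp: x_def y_def)
      moreover from this L(3) have "r * L1 < r * e" "r * L2 < r * e" by linarith+
      then have "L1 < e" "L2 < e" using r(1) by auto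
      ultimately show ?thesis using L(1) unfolding riem_dist_less_iff by auto
    qed
    then show ?thesis by blast
  qed
  have "\<exists>n0. \<forall>m\<ge>n0. \<forall>n\<ge>n0. riem_dist M1 (x m) (x n) < ereal e" if "0 < e" for e
    using proj[OF that] by blast
  then obtain x0 where x0: "x0 \<in> carr M1" "(\<lambda>n. riem_dist M1 (x n) x0) \<longlonglongrightarrow> 0"
    by (rule complete_riemD[OF c(1) carr(1)])
  have "\<exists>n0. \<forall>m\<ge>n0. \<forall>n\<ge>n0. riem_dist M2 (y m) (y n) < ereal e" if "0 < e" for e
    using proj[OF that] by blast
  then obtain y0 where y0: "y0 \<in> carr M2" "(\<lambda>n. riem_dist M2 (y n) y0) \<longlonglongrightarrow> 0"
    by (rule complete_riemD[OF c(2) carr(2)])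
  have "Cauchy t"
    unfolding Cauchy_def dist_real_def
  proof (intro allI impI)
    fix e :: real assume "0 < e"
    from proj[OF this] show "\<exists>n0. \<forall>m\<ge>n0. \<forall>n\<ge>n0. \<bar>t m - t n\<bar> < e" by blast
  qed
  then obtain t0 where t0: "t \<longlonglongrightarrow> t0" using Cauchy_convergent convergent_def by blast
  have "(\<lambda>n. riem_dist warped (X n) (t0, x0, y0)) \<longlonglongrightarrow> 0"
  proof (rule order_tendstoI)
    fix a :: ereal assume "a < 0"
    then show "\<forall>\<^sub>F n in sequentially. a < riem_dist warped (X n) (t0, x0, y0)"
      by (intro always_eventually allI less_le_trans[OF _ riem_dist_warped_nonneg])
  next
    fix a :: ereal assume "0 < a"
    then obtain e where e: "0 < e" "ereal e < a" by (metis ereal_dense2 ereal_less(2) zero_ereal_def)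
    \<comment> \<open>The three legs cost less than \<open>e'\<close>, \<open>l1 t0 * e'\<close> and
      \<open>l2 t0 * e'\<close>, in total \<open>e\<close>.\<close>
    define e' where "e' = e / (1 + l1 t0 + l2 t0)"
    have den: "0 < 1 + l1 t0 + l2 t0" using pos by (simp add: add_pos_pos)
    then have e': "0 < e'" using e by (simp add: e'_def)
    have "\<forall>\<^sub>F n in sequentially. \<bar>t0 - t n\<bar> < e'"
      using tendstoD[OF t0 e'] by (auto simp: dist_real_def abs_minus_commute elim: eventually_mono)
    moreover have "\<forall>\<^sub>F n in sequentially. riem_dist M1 (x n) x0 < ereal e'"
      "\<forall>\<^sub>F n in sequentially. riem_dist M2 (y n) y0 < ereal e'"
      using order_tendstoD(2)[OF x0(2)] order_tendstoD(2)[OF y0(2)] e' by auto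
    ultimately show "\<forall>\<^sub>F n in sequentially. riem_dist warped (X n) (t0, x0, y0) < a"
    proof eventually_elim
      case (elim n)
      then obtain L1 L2 where L: "L1 < e'" "path_length M1 (x n) x0 L1" "L2 < e'" "path_length M2 (y n) y0 L2"
        by (auto simp: riem_dist_less_iff)
      have p: "path_length warped (X n) (t0, x0, y0) (\<bar>t0 - t n\<bar> + l1 t0 * L1 + l2 t0 * L2)"
        unfolding Xn
        by (rule path_length_trans[OF lift_path_y[OF L(4) x0(1)]
              path_length_trans[OF lift_path_x[OF L(2) carr(2)] lift_path_t[OF carr]]])
      have "l1 t0 * L1 \<le> l1 t0 * e'" "l2 t0 * L2 \<le> l2 t0 * e'"
        using L pos by (auto intro!: mult_left_mono simp: less_imp_le)
      then have "\<bar>t0 - t n\<bar> + l1 t0 * L1 + l2 t0 * L2 < e' * (1 + l1 t0 + l2 t0)"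
        using elim(1) by (simp add: algebra_simps)
      also have "\<dots> = e" using den by (simp add: e'_def)
      finally have lt: "\<bar>t0 - t n\<bar> + l1 t0 * L1 + l2 t0 * L2 < e" .
      have "riem_dist warped (X n) (t0, x0, y0) < ereal e"
        unfolding riem_dist_less_iff
        by (rule exI[of _ "\<bar>t0 - t n\<bar> + l1 t0 * L1 + l2 t0 * L2"]) (rule conjI[OF lt p])
      with e(2) show ?case by (rule less_trans[rotated])
    qed
  qed
  moreover have "(t0, x0, y0) \<in> carr warped" using x0 y0 by (simp add: carr_warped_product)
  ultimately show "\<exists>x\<in>carr warped. (\<lambda>n. riem_dist warped (X n) x) \<longlonglongrightarrow> 0" by blast
qed

end


section \<open>Prescribed warp\<close>

lemma dense_axes_UNIV: "dense_axes (UNIV :: real set)"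
  by (rule dense_axes_open) simp

text \<open>Bounds and Lipschitz constants, uniform in time, are carried together because the
  Lipschitz constant of a product depends on bounds for its factors.\<close>

definition lip_bdd :: "real set \<Rightarrow> 'b::metric_space set \<Rightarrow> (real \<Rightarrow> 'b \<Rightarrow> real) \<Rightarrow> bool" where
  "lip_bdd J S g \<longleftrightarrow> (\<exists>L M. 0 \<le> L \<and> 0 \<le> M \<and>
     (\<forall>t\<in>J. \<forall>x\<in>S. \<bar>g t x\<bar> \<le> M \<and> (\<forall>y\<in>S. \<bar>g t x - g t y\<bar> \<le> L * dist x y)))"

lemma lip_bddE:
  assumes "lip_bdd J S g"
  obtains L M where "0 \<le> L" "0 \<le> M" "\<And>t x. t \<in> J \<Longrightarrow> x \<in> S \<Longrightarrow> \<bar>g t x\<bar> \<le> M"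
    "\<And>t x y. t \<in> J \<Longrightarrow> x \<in> S \<Longrightarrow> y \<in> S \<Longrightarrow> \<bar>g t x - g t y\<bar> \<le> L * dist x y"
  using assms unfolding lip_bdd_def by blast

lemma lip_bddI:
  assumes "0 \<le> L" "0 \<le> M" "\<And>t x. t \<in> J \<Longrightarrow> x \<in> S \<Longrightarrow> \<bar>g t x\<bar> \<le> M"
    "\<And>t x y. t \<in> J \<Longrightarrow> x \<in> S \<Longrightarrow> y \<in> S \<Longrightarrow> \<bar>g t x - g t y\<bar> \<le> L * dist x y"
  shows "lip_bdd J S g"
  using assms unfolding lip_bdd_def by blast

lemma lip_bdd_time:
  assumes "compact J" "continuous_on J A"
  shows "lip_bdd J S (\<lambda>t x. A t)"
proof -
  have "bounded (A ` J)" using compact_continuous_image[OF assms(2,1)] compact_imp_bounded by blast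
  then obtain M where "0 < M" "\<forall>x\<in>A ` J. norm x \<le> M" using bounded_pos by blast
  then show ?thesis by (intro lip_bddI[of 0 M]) auto
qed

lemma lip_bdd_add:
  assumes "lip_bdd J S f" "lip_bdd J S g"
  shows "lip_bdd J S (\<lambda>t x. f t x + g t x)"
proof -
  obtain L M where f: "0 \<le> L" "0 \<le> M" "\<And>t x. t \<in> J \<Longrightarrow> x \<in> S \<Longrightarrow> \<bar>f t x\<bar> \<le> M"
    "\<And>t x y. t \<in> J \<Longrightarrow> x \<in> S \<Longrightarrow> y \<in> S \<Longrightarrow> \<bar>f t x - f t y\<bar> \<le> L * dist x y"
    using lip_bddE[OF assms(1)] by blast
  obtain L' M' where g: "0 \<le> L'" "0 \<le> M'" "\<And>t x. t \<in> J \<Longrightarrow> x \<in> S \<Longrightarrow> \<bar>g t x\<bar> \<le> M'"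
    "\<And>t x y. t \<in> J \<Longrightarrow> x \<in> S \<Longrightarrow> y \<in> S \<Longrightarrow> \<bar>g t x - g t y\<bar> \<le> L' * dist x y"
    using lip_bddE[OF assms(2)] by blast
  show ?thesis
  proof (rule lip_bddI[of "L + L'" "M + M'"])
    fix t x y assume t: "t \<in> J" "x \<in> S"
    show "\<bar>f t x + g t x\<bar> \<le> M + M'" using f(3)[OF t] g(3)[OF t] by linarith
    assume y: "y \<in> S"
    show "\<bar>f t x + g t x - (f t y + g t y)\<bar> \<le> (L + L') * dist x y"
      using f(4)[OF t y] g(4)[OF t y] by (simp add: distrib_right)
  qed (use f g in auto)
qed

lemma lip_bdd_mult:
  assumes "lip_bdd J S f" "lip_bdd J S g"
  shows "lip_bdd J S (\<lambda>t x. f t x * g t x)"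
proof -
  obtain L M where f: "0 \<le> L" "0 \<le> M" "\<And>t x. t \<in> J \<Longrightarrow> x \<in> S \<Longrightarrow> \<bar>f t x\<bar> \<le> M"
    "\<And>t x y. t \<in> J \<Longrightarrow> x \<in> S \<Longrightarrow> y \<in> S \<Longrightarrow> \<bar>f t x - f t y\<bar> \<le> L * dist x y"
    using lip_bddE[OF assms(1)] by blast
  obtain L' M' where g: "0 \<le> L'" "0 \<le> M'" "\<And>t x. t \<in> J \<Longrightarrow> x \<in> S \<Longrightarrow> \<bar>g t x\<bar> \<le> M'"
    "\<And>t x y. t \<in> J \<Longrightarrow> x \<in> S \<Longrightarrow> y \<in> S \<Longrightarrow> \<bar>g t x - g t y\<bar> \<le> L' * dist x y"
    using lip_bddE[OF assms(2)] by blast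
  show ?thesis
  proof (rule lip_bddI[of "M * L' + L * M'" "M * M'"])
    fix t x y assume t: "t \<in> J" "x \<in> S"
    show "\<bar>f t x * g t x\<bar> \<le> M * M'"
      unfolding abs_mult using f(2) f(3)[OF t] g(3)[OF t] by (intro mult_mono) auto
    assume y: "y \<in> S"
    have "f t x * g t x - f t y * g t y = f t x * (g t x - g t y) + (f t x - f t y) * g t y"
      by (simp add: algebra_simps)
    then have "\<bar>f t x * g t x - f t y * g t y\<bar> \<le> \<bar>f t x\<bar> * \<bar>g t x - g t y\<bar> + \<bar>f t x - f t y\<bar> * \<bar>g t y\<bar>"
      by (metis abs_mult abs_triangle_ineq)
    also have "\<dots> \<le> M * (L' * dist x y) + (L * dist x y) * M'"
      by (intro add_mono mult_mono) (use f g t y in auto)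
    finally show "\<bar>f t x * g t x - f t y * g t y\<bar> \<le> (M * L' + L * M') * dist x y"
      by (simp add: algebra_simps)
  qed (use f g in auto)
qed

lemma lip_bdd_minus: "lip_bdd J S g \<Longrightarrow> lip_bdd J S (\<lambda>t x. - g t x)"
  unfolding lip_bdd_def by (simp add: abs_minus_commute)

lemma lip_bdd_diff: "lip_bdd J S f \<Longrightarrow> lip_bdd J S g \<Longrightarrow> lip_bdd J S (\<lambda>t x. f t x - g t x)"
  using lip_bdd_add[OF _ lip_bdd_minus] by fastforce

text \<open>The values of \<open>g\<close> lie in a compact interval \<open>{m..M}\<close>, on which
  \<open>\<phi>\<close> and \<open>\<phi>'\<close> are bounded. The lower bound \<open>m\<close>
  keeps them away from a singularity of \<open>\<phi>\<close>.\<close>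

lemma lip_bdd_compose:
  fixes \<phi> \<phi>' :: "real \<Rightarrow> real"
  assumes g: "lip_bdd J S g" and m: "\<And>t x. t \<in> J \<Longrightarrow> x \<in> S \<Longrightarrow> m \<le> g t x"
    and \<phi>: "\<And>x. m \<le> x \<Longrightarrow> (\<phi> has_real_derivative \<phi>' x) (at x)" and c: "continuous_on {m..} \<phi>'"
  shows "lip_bdd J S (\<lambda>t x. \<phi> (g t x))"
proof -
  obtain L M where f: "0 \<le> L" "0 \<le> M" "\<And>t x. t \<in> J \<Longrightarrow> x \<in> S \<Longrightarrow> \<bar>g t x\<bar> \<le> M"
    "\<And>t x y. t \<in> J \<Longrightarrow> x \<in> S \<Longrightarrow> y \<in> S \<Longrightarrow> \<bar>g t x - g t y\<bar> \<le> L * dist x y"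
    using lip_bddE[OF g] by blast
  have "continuous_on {m..M} \<phi>'" by (rule continuous_on_subset[OF c]) auto
  moreover have "continuous_on {m..M} \<phi>"
    by (intro continuous_at_imp_continuous_on ballI DERIV_isCont[OF \<phi>]) auto
  ultimately have "bounded (\<phi>' ` {m..M})" "bounded (\<phi> ` {m..M})"
    using compact_continuous_image compact_imp_bounded by blast+
  then obtain C C' where C: "0 < C" "\<forall>x\<in>\<phi>' ` {m..M}. norm x \<le> C" "0 < C'" "\<forall>x\<in>\<phi> ` {m..M}. norm x \<le> C'"
    unfolding bounded_pos by blast
  have in_ivl: "g t x \<in> {m..M}" if "t \<in> J" "x \<in> S" for t x
    using m[OF that] f(3)[OF that] by auto
  show ?thesis
  proof (rule lip_bddI[of "C * L" C'])
    fix t x y assume t: "t \<in> J" "x \<in> S"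
    show "\<bar>\<phi> (g t x)\<bar> \<le> C'" using C(4) in_ivl[OF t] by auto
    assume y: "y \<in> S"
    have "norm (\<phi> (g t x) - \<phi> (g t y)) \<le> C * norm (g t x - g t y)"
    proof (rule field_differentiable_bound[where S = "{m..M}" and f' = \<phi>'])
      show "(\<phi> has_field_derivative \<phi>' z) (at z within {m..M})" if "z \<in> {m..M}" for z
        using \<phi>[of z] that by (auto intro: has_field_derivative_at_within)
    qed (use C(2) in_ivl t y in auto)
    also have "\<dots> \<le> C * (L * dist x y)" using C(1) f(4)[OF t y] by (intro mult_left_mono) auto
    finally show "\<bar>\<phi> (g t x) - \<phi> (g t y)\<bar> \<le> C * L * dist x y" by simp
  qed (use f C in auto)
qed

lemma lip_bdd_inverse:
  assumes "lip_bdd J S g" "0 < m" "\<And>t x. t \<in> J \<Longrightarrow> x \<in> S \<Longrightarrow> m \<le> g t x"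
  shows "lip_bdd J S (\<lambda>t x. inverse (g t x))"
  by (rule lip_bdd_compose[where \<phi>' = "\<lambda>x. - (inverse x * inverse x)", OF assms(1,3)])
    (use assms(2) in \<open>auto intro!: derivative_eq_intros continuous_intros\<close>)

lemma lip_bdd_powr:
  assumes "lip_bdd J S g" "0 < m" "\<And>t x. t \<in> J \<Longrightarrow> x \<in> S \<Longrightarrow> m \<le> g t x"
  shows "lip_bdd J S (\<lambda>t x. g t x powr r)"
  by (rule lip_bdd_compose[where \<phi>' = "\<lambda>x. r * x powr (r - 1)", OF assms(1,3)])
    (use assms(2) in \<open>auto intro!: derivative_eq_intros continuous_intros\<close>)

lemma lip_bdd_fst_snd:
  fixes S :: "(real \<times> real) set"
  assumes "bounded S"
  shows "lip_bdd J S (\<lambda>t x. fst x)" "lip_bdd J S (\<lambda>t x. snd x)"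
proof -
  obtain M where M: "0 < M" "\<forall>x\<in>S. norm x \<le> M" using assms bounded_pos by blast
  have b: "\<bar>fst x\<bar> \<le> norm x" "\<bar>snd x\<bar> \<le> norm x" for x :: "real \<times> real"
    using norm_fst_le[of "fst x" "snd x"] norm_snd_le[of "snd x" "fst x"] by simp_all
  show "lip_bdd J S (\<lambda>t x. fst x)"
  proof (rule lip_bddI[of 1 M])
    show "\<bar>fst x\<bar> \<le> M" if "x \<in> S" for x using M(2) that b(1)[of x] by force
    show "\<bar>fst x - fst y\<bar> \<le> 1 * dist x y" for x y :: "real \<times> real" using b(1)[of "x - y"] by (simp add: dist_norm)
  qed (use M in auto)
  show "lip_bdd J S (\<lambda>t x. snd x)"
  proof (rule lip_bddI[of 1 M])
    show "\<bar>snd x\<bar> \<le> M" if "x \<in> S" for x using M(2) that b(2)[of x] by force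
    show "\<bar>snd x - snd y\<bar> \<le> 1 * dist x y" for x y :: "real \<times> real" using b(2)[of "x - y"] by (simp add: dist_norm)
  qed (use M in auto)
qed

text \<open>Solutions on the windows of radius \<open>n\<close> agree where both are defined, by
  uniqueness, so reading each time in some window that contains it gives a global solution.\<close>

lemma ode_glue:
  fixes X :: "real \<Rightarrow> 'b::real_normed_vector \<Rightarrow> 'b" and D :: "'b set"
  assumes ex: "\<And>n::nat. \<exists>y. y t0 = y0 \<and> (\<forall>t\<in>{t0 - n..t0 + n}. y t \<in> D \<and> (y has_vector_derivative X t (y t)) (at t))"
    and uniq: "\<And>y z r t. 0 \<le> r \<Longrightarrow> y t0 = z t0 \<Longrightarrow>
      (\<And>t. t \<in> {t0 - r..t0 + r} \<Longrightarrow> y t \<in> D \<and> (y has_vector_derivative X t (y t)) (at t)) \<Longrightarrow>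
      (\<And>t. t \<in> {t0 - r..t0 + r} \<Longrightarrow> z t \<in> D \<and> (z has_vector_derivative X t (z t)) (at t)) \<Longrightarrow>
      t \<in> {t0 - r..t0 + r} \<Longrightarrow> y t = z t"
  obtains y where "y t0 = y0" "\<And>t. y t \<in> D" "\<And>t. (y has_vector_derivative X t (y t)) (at t)"
proof -
  obtain Y where Y0: "\<And>n. Y n t0 = y0"
    and Y: "\<And>n t. t \<in> {t0 - real n..t0 + real n} \<Longrightarrow> Y n t \<in> D \<and> (Y n has_vector_derivative X t (Y n t)) (at t)"
    using ex by metis
  \<comment> \<open>Adding 1 puts \<open>t\<close> strictly inside its window, which the derivative
    at \<open>t\<close> requires.\<close>
  define N where "N t = nat \<lceil>\<bar>t - t0\<bar>\<rceil> + 1" for t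
  have N: "\<bar>t - t0\<bar> < real (N t)" for t unfolding N_def by linarith
  define y where "y t = Y (N t) t" for t
  have eq: "y t = Y n t" if t: "\<bar>t - t0\<bar> \<le> real n" for t n
  proof (cases "N t \<le> n")
    case True
    then have sub: "{t0 - real (N t)..t0 + real (N t)} \<subseteq> {t0 - real n..t0 + real n}" by auto
    show ?thesis unfolding y_def
      by (rule uniq[of "real (N t)"]) (use Y0 Y sub N[of t] in \<open>auto simp: subset_iff abs_if split: if_splits\<close>)
  next
    case False
    then have sub: "{t0 - real n..t0 + real n} \<subseteq> {t0 - real (N t)..t0 + real (N t)}" by auto
    show ?thesis unfolding y_def
      by (rule uniq[of "real n"]) (use Y0 Y sub t in \<open>auto simp: subset_iff abs_if split: if_splits\<close>)
  qed
  have "(y has_vector_derivative X t (y t)) (at t)" for t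
  proof -
    have "t \<in> {t0 - real (N t)..t0 + real (N t)}" using N[of t] by (auto simp: abs_if split: if_splits)
    then have "(Y (N t) has_vector_derivative X t (y t)) (at t)" using Y unfolding y_def by blast
    then show ?thesis
    proof (rule has_vector_derivative_transform_within_open)
      show "open {t0 - real (N t)<..<t0 + real (N t)}" "t \<in> {t0 - real (N t)<..<t0 + real (N t)}"
        using N[of t] by (auto simp: abs_if split: if_splits)
      fix s assume "s \<in> {t0 - real (N t)<..<t0 + real (N t)}"
      then show "Y (N t) s = y s" by (subst eq[of s "N t"]) auto
    qed
  qed
  moreover have "y t \<in> D" for t
    unfolding y_def using Y[of t "N t"] N[of t] by (auto simp: abs_if split: if_splits)
  moreover have "y t0 = y0" by (simp add: y_def Y0)
  ultimately show ?thesis using that by blast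
qed

section \<open>The second-order equation for a magnitude as a field on the phase space\<close>

context
  fixes c \<epsilon> r :: real and A B :: "real \<Rightarrow> real"
  assumes c: "c \<noteq> 0" and \<epsilon>: "0 < \<epsilon>" and r: "0 < r" and AB: "smooth_on UNIV A" "smooth_on UNIV B"
begin

definition state_Q :: "real \<times> real \<Rightarrow> real" where "state_Q y = 1 + (c\<^sup>2 - 1) * (fst y)\<^sup>2"
definition state_R :: "real \<times> real \<Rightarrow> real" where "state_R y = 1 - (fst y)\<^sup>2 - (snd y)\<^sup>2"
definition state_volume2 :: "real \<times> real \<Rightarrow> real" where "state_volume2 y = \<epsilon> * state_Q y / ((fst y)\<^sup>2 * state_R y)"
text \<open>Prescribing one warp makes the other a power of \<open>F\<close> times a function of
  time, so \<open>T\<close> takes this form. The exponent \<open>r\<close> is the reciprocal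
  dimension of the factor whose warp is eliminated, and \<open>state_volume2\<close> is
  \<open>F\<^sup>2\<close>.\<close>

definition state_T :: "real \<Rightarrow> real \<times> real \<Rightarrow> real" where "state_T t y = A t + B t * state_volume2 y powr (- r)"
text \<open>The second component is the formula for \<open>T\<close> solved for \<open>a''\<close>,
  for states \<open>y = (a, a')\<close>.\<close>

definition magnitude_field :: "real \<Rightarrow> real \<times> real \<Rightarrow> real \<times> real" where
  "magnitude_field t y = (snd y, - fst y + fst y * state_R y * (1 / ((fst y)\<^sup>2 * state_Q y) - state_T t y))"
definition states :: "(real \<times> real) set" where "states = {y. 0 < fst y \<and> 0 < state_R y}"
definition core_states :: "real \<Rightarrow> (real \<times> real) set" where "core_states \<delta> = {y. \<delta> \<le> fst y \<and> \<delta> \<le> state_R y}"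

lemma state_R_norm: "state_R y = 1 - (norm y)\<^sup>2"
  by (cases y) (simp add: state_R_def norm_Pair)

text \<open>Since \<open>state_R y = 1 - (norm y)\<^sup>2\<close>, such a set is a half-plane
  intersected with a closed disc. Convexity is what the closest-point retraction asks for.\<close>

lemma core_states_props: "compact (core_states \<delta>)" "convex (core_states \<delta>)" "closed (core_states \<delta>)"
proof -
  have eq: "core_states \<delta> = {y. \<delta> \<le> fst y} \<inter> {y. (norm y)\<^sup>2 \<le> 1 - \<delta>}"
    by (auto simp: core_states_def state_R_norm)
  have "(norm y)\<^sup>2 \<le> 1 - \<delta> \<longleftrightarrow> norm y \<le> sqrt (1 - \<delta>)" for y :: "real \<times> real"
    by (metis real_sqrt_le_iff real_sqrt_abs abs_norm_cancel)
  then have "{y::real \<times> real. (norm y)\<^sup>2 \<le> 1 - \<delta>} = cball 0 (sqrt (1 - \<delta>))"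
    by (intro set_eqI) (simp only: mem_Collect_eq mem_cball_0)
  then have b: "compact {y::real \<times> real. (norm y)\<^sup>2 \<le> 1 - \<delta>}" "convex {y::real \<times> real. (norm y)\<^sup>2 \<le> 1 - \<delta>}"
    by auto
  have "closed {y::real \<times> real. \<delta> \<le> fst y}" by (intro closed_Collect_le continuous_intros)
  moreover have "convex (fst -` {\<delta>..} :: (real \<times> real) set)"
    by (intro convex_linear_vimage linear_fst) auto
  then have "convex {y::real \<times> real. \<delta> \<le> fst y}" by (simp add: vimage_def)
  ultimately show "compact (core_states \<delta>)" "convex (core_states \<delta>)" "closed (core_states \<delta>)"
    unfolding eq using b closed_Int_compact convex_Int compact_imp_closed closed_Int by blast+
qed

text \<open>A lower bound for \<open>state_Q\<close>, which is a convex combination of 1 and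
  \<open>c\<^sup>2\<close>. It is positive because \<open>c \<noteq> 0\<close>.\<close>

definition qmin :: real where "qmin = min 1 (c\<^sup>2)"

lemma qmin_pos: "0 < qmin"
  using c by (simp add: qmin_def)

lemma states_bounds:
  assumes "y \<in> states"
  shows "0 < fst y" "fst y < 1" "0 < state_R y" "state_R y \<le> 1" "qmin \<le> state_Q y" "\<bar>snd y\<bar> \<le> 1"
    "0 < state_volume2 y" "\<epsilon> * qmin \<le> state_volume2 y" "(fst y)\<^sup>2 < 1"
proof -
  show 1: "0 < fst y" "0 < state_R y" using assms by (auto simp: states_def)
  have "(fst y)\<^sup>2 + (snd y)\<^sup>2 < 1" using 1 by (simp add: state_R_def)
  then have 2: "(fst y)\<^sup>2 < 1" "(snd y)\<^sup>2 < 1" by (smt (verit) zero_le_power2)+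
  then show "fst y < 1" "\<bar>snd y\<bar> \<le> 1" "(fst y)\<^sup>2 < 1"
    using 1 by (auto simp: abs_square_less_1 abs_square_le_1)
  show R1: "state_R y \<le> 1" by (simp add: state_R_def)
  have "state_Q y = (1 - (fst y)\<^sup>2) * 1 + (fst y)\<^sup>2 * c\<^sup>2" by (simp add: state_Q_def algebra_simps)
  also have "\<dots> \<ge> (1 - (fst y)\<^sup>2) * qmin + (fst y)\<^sup>2 * qmin"
    using 2 by (intro add_mono mult_left_mono) (auto simp: qmin_def)
  finally show Q: "qmin \<le> state_Q y" by (simp add: algebra_simps)
  have p: "0 < (fst y)\<^sup>2 * state_R y" using 1 by simp
  have "(fst y)\<^sup>2 * state_R y \<le> 1 * 1" using 1 2 R1 by (intro mult_mono) auto
  then have "\<epsilon> * state_Q y \<le> state_volume2 y"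
    unfolding state_volume2_def using p \<epsilon> Q qmin_pos by (simp add: pos_le_divide_eq mult_left_le)
  then show "\<epsilon> * qmin \<le> state_volume2 y" using Q \<epsilon> by (smt (verit) mult_left_mono)
  then show "0 < state_volume2 y" using \<epsilon> qmin_pos by (smt (verit) mult_pos_pos)
qed

lemma core_states_subset_states: "0 < \<delta> \<Longrightarrow> core_states \<delta> \<subseteq> states"
  by (auto simp: core_states_def states_def)

lemma continuous_on_magnitude_field: "continuous_on (J \<times> states) (\<lambda>(t, y). magnitude_field t y)"
proof -
  have cAB: "continuous_on UNIV A" "continuous_on UNIV B" using AB smooth_on_imp_continuous_on by blast+
  have n: "fst y \<noteq> 0" "state_R y \<noteq> 0" "state_Q y \<noteq> 0" "state_volume2 y > 0" if "y \<in> states" for y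
    using states_bounds[OF that] qmin_pos by auto
  have cR: "continuous_on S (\<lambda>p. state_R (snd p))" and cQ: "continuous_on S (\<lambda>p. state_Q (snd p))" for S :: "(real \<times> (real \<times> real)) set"
    unfolding state_R_def state_Q_def by (intro continuous_intros)+
  have cW: "continuous_on (J \<times> states) (\<lambda>p. state_volume2 (snd p))"
    unfolding state_volume2_def by (intro continuous_intros cR cQ) (auto simp: n)
  show ?thesis
    unfolding magnitude_field_def state_T_def case_prod_beta
    by (intro continuous_intros cR cQ cW continuous_on_compose2[OF cAB(1)] continuous_on_compose2[OF cAB(2)])
      (auto simp: n, use n(4) in force)
qed

text \<open>On \<open>core_states \<delta>\<close> the two denominators are at least
  \<open>\<delta> ^ 3\<close> and \<open>\<delta>\<^sup>2 * qmin\<close>, and the squared volume is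
  at least \<open>\<epsilon> * qmin\<close>, so the closure rules for \<open>lip_bdd\<close>
  apply.\<close>

lemma Lipschitz_magnitude_field:
  assumes "0 < \<delta>"
  obtains L where "\<And>t x y. t \<in> {\<alpha>..\<beta>} \<Longrightarrow> x \<in> core_states \<delta> \<Longrightarrow> y \<in> core_states \<delta> \<Longrightarrow> norm (magnitude_field t x - magnitude_field t y) \<le> L * norm (x - y)"
proof -
  let ?J = "{\<alpha>..\<beta>}" and ?K = "core_states \<delta>"
  have b: "bounded ?K" using core_states_props compact_imp_bounded by blast
  note y = lip_bdd_fst_snd[OF b, of ?J]
  have cAB: "continuous_on ?J A" "continuous_on ?J B"
    using AB smooth_on_imp_continuous_on continuous_on_subset subset_UNIV by metis+
  have const: "lip_bdd ?J ?K (\<lambda>t x. k)" for k by (rule lip_bdd_time) auto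
  have R: "lip_bdd ?J ?K (\<lambda>t. state_R)"
    unfolding state_R_def power2_eq_square by (intro lip_bdd_diff lip_bdd_mult y const)
  have Q: "lip_bdd ?J ?K (\<lambda>t. state_Q)"
    unfolding state_Q_def power2_eq_square by (intro lip_bdd_add lip_bdd_mult y const)
  have D: "x \<in> states" if "x \<in> ?K" for x using core_states_subset_states[OF assms] that by blast
  have K: "\<delta> \<le> fst x" "\<delta> \<le> state_R x" if "x \<in> ?K" for x using that by (auto simp: core_states_def)
  have aR: "lip_bdd ?J ?K (\<lambda>t x. inverse ((fst x)\<^sup>2 * state_R x))"
  proof (rule lip_bdd_inverse[where m = "(\<delta> * \<delta>) * \<delta>"])
    show "lip_bdd ?J ?K (\<lambda>t x. (fst x)\<^sup>2 * state_R x)"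
      unfolding power2_eq_square by (intro lip_bdd_mult y R)
    show "\<delta> * \<delta> * \<delta> \<le> (fst x)\<^sup>2 * state_R x" if "x \<in> ?K" for x
      unfolding power2_eq_square using K[OF that] assms by (intro mult_mono) auto
  qed (use assms in auto)
  have aQ: "lip_bdd ?J ?K (\<lambda>t x. inverse ((fst x)\<^sup>2 * state_Q x))"
  proof (rule lip_bdd_inverse[where m = "(\<delta> * \<delta>) * qmin"])
    show "lip_bdd ?J ?K (\<lambda>t x. (fst x)\<^sup>2 * state_Q x)"
      unfolding power2_eq_square by (intro lip_bdd_mult y Q)
    show "\<delta> * \<delta> * qmin \<le> (fst x)\<^sup>2 * state_Q x" if "x \<in> ?K" for x
      unfolding power2_eq_square using K[OF that] assms qmin_pos states_bounds(5)[OF D[OF that]]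
      by (intro mult_mono) auto
  qed (use assms qmin_pos in auto)
  have W: "lip_bdd ?J ?K (\<lambda>t. state_volume2)"
    unfolding state_volume2_def divide_inverse by (intro lip_bdd_mult const Q aR)
  have P: "lip_bdd ?J ?K (\<lambda>t x. state_volume2 x powr (- r))"
    by (rule lip_bdd_powr[OF W, where m = "\<epsilon> * qmin"]) (use \<epsilon> qmin_pos states_bounds(8) D in auto)
  have "lip_bdd ?J ?K (\<lambda>t x. - fst x + fst x * state_R x * (1 / ((fst x)\<^sup>2 * state_Q x) - state_T t x))"
    unfolding state_T_def divide_inverse mult_1_left
    by (intro lip_bdd_add lip_bdd_minus lip_bdd_diff lip_bdd_mult y R aQ P lip_bdd_time cAB) auto
  then have "lip_bdd ?J ?K (\<lambda>t x. snd (magnitude_field t x))" by (simp add: magnitude_field_def)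
  from lip_bddE[OF this] obtain L where L: "0 \<le> L" "\<And>t x y. t \<in> ?J \<Longrightarrow> x \<in> ?K \<Longrightarrow> y \<in> ?K \<Longrightarrow>
     \<bar>snd (magnitude_field t x) - snd (magnitude_field t y)\<bar> \<le> L * dist x y"
    by metis
  show ?thesis
  proof (rule that[of "1 + L"])
    fix t x y assume h: "t \<in> ?J" "x \<in> ?K" "y \<in> ?K"
    have "norm (magnitude_field t x - magnitude_field t y) \<le> \<bar>snd x - snd y\<bar> + \<bar>snd (magnitude_field t x) - snd (magnitude_field t y)\<bar>"
      using norm_Pair_le[of "fst (magnitude_field t x - magnitude_field t y)" "snd (magnitude_field t x - magnitude_field t y)"] by (simp add: magnitude_field_def)
    also have "\<bar>snd x - snd y\<bar> \<le> norm (x - y)"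
      by (metis norm_snd_le prod.collapse real_norm_def snd_diff)
    finally show "norm (magnitude_field t x - magnitude_field t y) \<le> (1 + L) * norm (x - y)"
      using L(2)[OF h] by (simp add: dist_norm distrib_right)
  qed
qed

text \<open>By compactness each solution has a positive minimum of \<open>fst\<close> and of
  \<open>state_R\<close> on the interval. Both solutions thus lie in a common core, where one
  Lipschitz constant is valid.\<close>

lemma magnitude_field_unique:
  assumes y: "\<And>t. t \<in> {\<alpha>..\<beta>} \<Longrightarrow> y t \<in> states \<and> (y has_vector_derivative magnitude_field t (y t)) (at t)"
    and z: "\<And>t. t \<in> {\<alpha>..\<beta>} \<Longrightarrow> z t \<in> states \<and> (z has_vector_derivative magnitude_field t (z t)) (at t)"
    and t0: "t0 \<in> {\<alpha>..\<beta>}" "y t0 = z t0" and t: "t \<in> {\<alpha>..\<beta>}"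
  shows "y t = z t"
proof -
  have ex: "\<exists>\<delta>>0. \<forall>t\<in>{\<alpha>..\<beta>}. u t \<in> core_states \<delta>"
    if u: "\<And>t. t \<in> {\<alpha>..\<beta>} \<Longrightarrow> u t \<in> states \<and> (u has_vector_derivative magnitude_field t (u t)) (at t)" for u
  proof -
    have cu: "continuous_on {\<alpha>..\<beta>} u"
      using u has_vector_derivative_continuous by (blast intro: continuous_at_imp_continuous_on)
    have "continuous_on {\<alpha>..\<beta>} (\<lambda>t. fst (u t))" "continuous_on {\<alpha>..\<beta>} (\<lambda>t. state_R (u t))"
      unfolding state_R_def by (intro continuous_intros cu)+
    note cu' = this
    have ne: "{\<alpha>..\<beta>} \<noteq> {}" using t by auto
    obtain t1 where t1: "t1 \<in> {\<alpha>..\<beta>}" "\<forall>t\<in>{\<alpha>..\<beta>}. fst (u t1) \<le> fst (u t)"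
      using continuous_attains_inf[OF compact_Icc ne cu'(1)] by blast
    obtain t2 where t2: "t2 \<in> {\<alpha>..\<beta>}" "\<forall>t\<in>{\<alpha>..\<beta>}. state_R (u t2) \<le> state_R (u t)"
      using continuous_attains_inf[OF compact_Icc ne cu'(2)] by blast
    have "0 < fst (u t1)" "0 < state_R (u t2)" using u[OF t1(1)] u[OF t2(1)] by (auto simp: states_def)
    moreover have "u s \<in> core_states (min (fst (u t1)) (state_R (u t2)))" if "s \<in> {\<alpha>..\<beta>}" for s
      using t1(2) t2(2) that by (simp add: core_states_def min_le_iff_disj)
    ultimately show ?thesis
      by (intro exI[of _ "min (fst (u t1)) (state_R (u t2))"]) simp
  qed
  obtain \<delta>1 where \<delta>1: "\<delta>1 > 0" "\<forall>t\<in>{\<alpha>..\<beta>}. y t \<in> core_states \<delta>1" using ex[OF y] by blast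
  obtain \<delta>2 where \<delta>2: "\<delta>2 > 0" "\<forall>t\<in>{\<alpha>..\<beta>}. z t \<in> core_states \<delta>2" using ex[OF z] by blast
  define \<delta> where "\<delta> = min \<delta>1 \<delta>2"
  have \<delta>: "\<delta> > 0" "\<forall>t\<in>{\<alpha>..\<beta>}. y t \<in> core_states \<delta> \<and> z t \<in> core_states \<delta>" using \<delta>1 \<delta>2 by (auto simp: \<delta>_def core_states_def)
  obtain L where L: "\<And>t x y. t \<in> {\<alpha>..\<beta>} \<Longrightarrow> x \<in> core_states \<delta> \<Longrightarrow> y \<in> core_states \<delta> \<Longrightarrow> norm (magnitude_field t x - magnitude_field t y) \<le> L * norm (x - y)"
    using Lipschitz_magnitude_field[OF \<delta>(1), of \<alpha> \<beta>] by blast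
  show ?thesis
    by (rule ode_unique_Lipschitz[of \<alpha> \<beta> y "\<lambda>t. magnitude_field t (y t)" z "\<lambda>t. magnitude_field t (z t)" L t0 t])
      (use y z L \<delta> t0 t in auto)
qed

text \<open>Along a solution \<^term>\<open>ln (state_volume2 (y t))\<close> has derivative \<^term>\<open>- 2 * (fst (y t) * snd (y t) * state_T t (y t))\<close>, which is
  bounded on bounded time intervals because \<^term>\<open>state_volume2\<close> is bounded below. As \<^term>\<open>state_volume2\<close> is infinite on the
  boundary of \<^term>\<open>states\<close>, solutions stay in a compact part of \<^term>\<open>states\<close>.\<close>

lemma state_volume2_growth:
  assumes C: "\<And>s. s \<in> {\<alpha>..\<beta>} \<Longrightarrow> \<bar>A s\<bar> + \<bar>B s\<bar> * (\<epsilon> * qmin) powr (- r) \<le> C"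
    and t: "t0 \<in> {\<alpha>..\<beta>}" "t \<in> {\<alpha>..\<beta>}"
    and y: "\<And>s. s \<in> closed_segment t0 t \<Longrightarrow> y s \<in> states \<and> (y has_vector_derivative magnitude_field s (y s)) (at s)"
  shows "state_volume2 (y t) \<le> state_volume2 (y t0) * exp (2 * C * \<bar>t - t0\<bar>)"
proof -
  have "norm (ln (state_volume2 (y t)) - ln (state_volume2 (y t0))) \<le> (2 * C) * norm (t - t0)"
  proof (rule field_differentiable_bound[where S = "closed_segment t0 t"
        and f' = "\<lambda>s. - 2 * (fst (y s) * snd (y s) * state_T s (y s))"])
    fix s assume s: "s \<in> closed_segment t0 t"
    then have sJ: "s \<in> {\<alpha>..\<beta>}" using t by (auto simp: closed_segment_eq_real_ivl split: if_splits)
    have D: "y s \<in> states" and y': "(y has_vector_derivative magnitude_field s (y s)) (at s)" using y[OF s] by auto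
    note b = states_bounds[OF D]
    have Q0: "0 < state_Q (y s)" using b(5) qmin_pos by linarith
    have a': "((\<lambda>s. fst (y s)) has_real_derivative snd (y s)) (at s)"
      "((\<lambda>s. snd (y s)) has_real_derivative snd (magnitude_field s (y s))) (at s)"
      using has_derivative_fst[OF y'[unfolded has_vector_derivative_def]]
        has_derivative_snd[OF y'[unfolded has_vector_derivative_def]]
      by (simp_all add: has_real_derivative_iff_has_vector_derivative has_vector_derivative_def magnitude_field_def)
    have T: "1 / ((fst (y s))\<^sup>2 * state_Q (y s)) - (fst (y s) + snd (magnitude_field s (y s))) / (fst (y s) * state_R (y s)) = state_T s (y s)"
      using b(1,3) by (simp add: magnitude_field_def)
    have "((\<lambda>s. state_volume2 (y s)) has_real_derivative - 2 * state_volume2 (y s) * (fst (y s) * snd (y s) * state_T s (y s))) (at s)"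
      using volume_square_has_derivative[OF a' refl, of c \<epsilon>] b(1,3) Q0 T
      by (simp add: state_volume2_def state_Q_def state_R_def)
    from DERIV_chain2[OF DERIV_ln[OF b(7)] this]
    have "((\<lambda>s. ln (state_volume2 (y s))) has_real_derivative - 2 * (fst (y s) * snd (y s) * state_T s (y s))) (at s)"
      using b(7) by (simp add: field_simps)
    then show "((\<lambda>s. ln (state_volume2 (y s))) has_real_derivative - 2 * (fst (y s) * snd (y s) * state_T s (y s)))
      (at s within closed_segment t0 t)" by (rule has_field_derivative_at_within)
    have "state_volume2 (y s) powr (- r) \<le> (\<epsilon> * qmin) powr (- r)"
      using b(8) \<epsilon> qmin_pos r by (intro powr_mono2') auto
    then have "\<bar>state_T s (y s)\<bar> \<le> \<bar>A s\<bar> + \<bar>B s\<bar> * (\<epsilon> * qmin) powr (- r)"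
      unfolding state_T_def by (intro order_trans[OF abs_triangle_ineq] add_mono) (auto simp: abs_mult intro: mult_left_mono)
    then have "\<bar>state_T s (y s)\<bar> \<le> C" using C[OF sJ] by linarith
    moreover have "\<bar>fst (y s)\<bar> * \<bar>snd (y s)\<bar> \<le> 1 * 1" using b by (intro mult_mono) auto
    ultimately have "\<bar>fst (y s)\<bar> * \<bar>snd (y s)\<bar> * \<bar>state_T s (y s)\<bar> \<le> 1 * C" by (intro mult_mono) auto
    then show "norm (- 2 * (fst (y s) * snd (y s) * state_T s (y s))) \<le> 2 * C" by (simp add: abs_mult)
  qed auto
  then have "ln (state_volume2 (y t)) \<le> ln (state_volume2 (y t0)) + 2 * C * \<bar>t - t0\<bar>" by simp
  then have "exp (ln (state_volume2 (y t))) \<le> exp (ln (state_volume2 (y t0)) + 2 * C * \<bar>t - t0\<bar>)" by simp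
  then show ?thesis
    using states_bounds(7) y by (simp add: exp_add)
qed

text \<open>The field is extended off the core of margin \<open>\<eta> / 2\<close>. As long as the
  solution stays there, the growth bound for the volume puts it into the smaller core of margin
  \<open>\<eta>\<close>, so \<open>trapped\<close> shows that it never leaves.\<close>

lemma magnitude_field_local_solution:
  assumes y0: "y0 \<in> states" and N: "0 \<le> N"
  obtains y where "y t0 = y0" "\<And>t. t \<in> {t0 - N..t0 + N} \<Longrightarrow> y t \<in> states \<and> (y has_vector_derivative magnitude_field t (y t)) (at t)"
proof -
  let ?J = "{t0 - N..t0 + N}"
  have "continuous_on ?J (\<lambda>s. \<bar>A s\<bar> + \<bar>B s\<bar> * (\<epsilon> * qmin) powr (- r))"
    using AB[THEN smooth_on_imp_continuous_on] by (intro continuous_intros) (auto intro: continuous_on_subset)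
  moreover have "?J \<noteq> {}" using N by auto
  ultimately obtain s0 where s0: "\<forall>s\<in>?J. \<bar>A s\<bar> + \<bar>B s\<bar> * (\<epsilon> * qmin) powr (- r) \<le> \<bar>A s0\<bar> + \<bar>B s0\<bar> * (\<epsilon> * qmin) powr (- r)"
    using continuous_attains_sup[OF compact_Icc] by blast
  define C where "C = \<bar>A s0\<bar> + \<bar>B s0\<bar> * (\<epsilon> * qmin) powr (- r)"
  have C: "\<And>s. s \<in> ?J \<Longrightarrow> \<bar>A s\<bar> + \<bar>B s\<bar> * (\<epsilon> * qmin) powr (- r) \<le> C" "0 \<le> C" using s0 by (auto simp: C_def)
  \<comment> \<open>The largest squared volume reachable within time \<open>N\<close>.\<close>
  define Wm where "Wm = state_volume2 y0 * exp (2 * C * N)"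
  have W0: "0 < state_volume2 y0" using states_bounds(7)[OF y0] .
  have Wm: "0 < Wm" "state_volume2 y0 \<le> Wm" using W0 C(2) N by (simp_all add: Wm_def)
  \<comment> \<open>From \<open>\<epsilon> * qmin \<le> \<epsilon> * Q\<close> and \<open>\<epsilon>
    * Q = F\<^sup>2 * a\<^sup>2 * R \<le> Wm * a\<^sup>2 * R\<close> follows
    \<open>\<eta> \<le> a\<^sup>2 * R\<close>. Neither factor exceeds 1, so both \<open>a\<close>
    and \<open>R\<close> are at least \<open>\<eta>\<close>.\<close>
  define \<eta> where "\<eta> = \<epsilon> * qmin / Wm"
  have \<eta>: "0 < \<eta>" using \<epsilon> qmin_pos Wm by (simp add: \<eta>_def)
  have K': "y \<in> core_states \<eta>" if y: "y \<in> states" "state_volume2 y \<le> Wm" for y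
  proof -
    note b = states_bounds[OF y(1)]
    have "\<epsilon> * qmin \<le> \<epsilon> * state_Q y" using b \<epsilon> by (intro mult_left_mono) auto
    also have "\<dots> = state_volume2 y * ((fst y)\<^sup>2 * state_R y)" using b(1,3) by (simp add: state_volume2_def)
    also have "\<dots> \<le> Wm * ((fst y)\<^sup>2 * state_R y)" using y(2) b by (intro mult_right_mono) auto
    finally have "\<eta> \<le> (fst y)\<^sup>2 * state_R y" using Wm by (simp add: \<eta>_def pos_divide_le_eq mult.commute)
    moreover have "(fst y)\<^sup>2 * state_R y \<le> 1 * state_R y" "(fst y)\<^sup>2 * state_R y \<le> (fst y)\<^sup>2 * 1" "(fst y)\<^sup>2 \<le> fst y"
      using b by (auto intro!: mult_right_mono mult_left_mono simp: power2_eq_square mult_left_le)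
    ultimately show ?thesis unfolding core_states_def by auto
  qed
  \<comment> \<open>Halving the margin puts \<open>core_states \<eta>\<close> into the
    interior.\<close>
  define K where "K = core_states (\<eta> / 2)"
  have KD: "K \<subseteq> states" using core_states_subset_states \<eta> by (simp add: K_def)
  have y0K': "y0 \<in> core_states \<eta>" using K' y0 Wm by blast
  have K'K: "core_states \<eta> \<subseteq> interior K"
  proof (rule interiorI[THEN subsetI])
    show "open {y::real \<times> real. \<eta> / 2 < fst y \<and> \<eta> / 2 < state_R y}"
      unfolding state_R_def by (intro open_Collect_conj open_Collect_less continuous_intros)
    show "{y. \<eta> / 2 < fst y \<and> \<eta> / 2 < state_R y} \<subseteq> K" by (auto simp: K_def core_states_def)
  qed (use \<eta> in \<open>auto simp: core_states_def\<close>)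
  have y0K: "y0 \<in> K" using y0K' K'K interior_subset by blast
  obtain L where L: "\<And>t x y. t \<in> ?J \<Longrightarrow> x \<in> K \<Longrightarrow> y \<in> K \<Longrightarrow> norm (magnitude_field t x - magnitude_field t y) \<le> L * norm (x - y)"
    using Lipschitz_magnitude_field[of "\<eta> / 2"] \<eta> unfolding K_def by (metis half_gt_zero)
  have cX: "continuous_on (?J \<times> K) (\<lambda>(t, y). magnitude_field t y)"
    using continuous_on_magnitude_field KD continuous_on_subset by (metis Sigma_mono subset_refl)
  obtain y where y: "y t0 = y0" "continuous_on UNIV y"
    "\<And>t. t \<in> ?J \<Longrightarrow> y t \<in> K \<Longrightarrow> (y has_vector_derivative magnitude_field t (y t)) (at t)"
  proof (rule ode_solution_while_in_compact[where K = K and \<alpha> = "t0 - N" and \<beta> = "t0 + N" and X = magnitude_field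
        and L = L and ?t0.0 = t0 and ?y0.0 = y0])
    show "compact K" "convex K" unfolding K_def by (rule core_states_props)+
    show "K \<noteq> {}" using y0K by blast
  qed (use L N cX in auto)
  have "y t \<in> K" if t: "t \<in> ?J" for t
  proof (rule trapped[OF y(2) _ K'K _ _ _ t])
    show "closed K" unfolding K_def by (rule core_states_props)
    show "y t0 \<in> K" using y y0K by simp
    show "t0 \<in> ?J" using N by simp
    fix t assume t: "t \<in> ?J" and tr: "\<forall>s\<in>closed_segment t0 t. y s \<in> K"
    have sub: "closed_segment t0 t \<subseteq> ?J" using t N by (auto simp: closed_segment_eq_real_ivl)
    have "state_volume2 (y t) \<le> state_volume2 (y t0) * exp (2 * C * \<bar>t - t0\<bar>)"
      by (rule state_volume2_growth[OF C(1) _ t]) (use tr sub y(3) KD N in auto)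
    also have "\<dots> \<le> Wm"
      unfolding Wm_def y(1) using W0 C(2) t by (auto intro!: mult_left_mono simp: abs_if)
    finally show "y t \<in> core_states \<eta>" using K' tr KD by blast
  qed
  then show ?thesis using that[of y] y KD by blast
qed

lemma magnitude_field_global_solution:
  assumes y0: "y0 \<in> states"
  obtains y where "y t0 = y0" "\<And>t. y t \<in> states" "\<And>t. (y has_vector_derivative magnitude_field t (y t)) (at t)"
proof (rule ode_glue[where X = magnitude_field and D = states and ?t0.0 = t0 and ?y0.0 = y0])
  fix n :: nat
  show "\<exists>y. y t0 = y0 \<and> (\<forall>t\<in>{t0 - real n..t0 + real n}. y t \<in> states \<and> (y has_vector_derivative magnitude_field t (y t)) (at t))"
    using magnitude_field_local_solution[OF y0, of "real n" t0] by (metis of_nat_0_le_iff)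
next
  fix y z :: "real \<Rightarrow> real \<times> real" and b t :: real
  assume "0 \<le> b" "y t0 = z t0" "t \<in> {t0 - b..t0 + b}"
    "\<And>t. t \<in> {t0 - b..t0 + b} \<Longrightarrow> y t \<in> states \<and> (y has_vector_derivative magnitude_field t (y t)) (at t)"
    "\<And>t. t \<in> {t0 - b..t0 + b} \<Longrightarrow> z t \<in> states \<and> (z has_vector_derivative magnitude_field t (z t)) (at t)"
  then show "y t = z t" by (intro magnitude_field_unique[of "t0 - b" "t0 + b" y z t0 t]) auto
qed (use that in blast)

lemma magnitude_field_solution_smooth:
  assumes D: "\<And>t. y t \<in> states" and y: "\<And>t. (y has_vector_derivative magnitude_field t (y t)) (at t)"
  shows "smooth_on UNIV (\<lambda>t. fst (y t))" "smooth_on UNIV (\<lambda>t. snd (y t))"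
proof -
  note I = dense_axes_UNIV
  have n: "fst (y t) \<noteq> 0" "state_R (y t) \<noteq> 0" "state_Q (y t) \<noteq> 0" "0 < state_volume2 (y t)" for t
    using states_bounds[OF D[of t]] qmin_pos by auto
  have d: "((\<lambda>t. fst (y t)) has_vector_derivative snd (y t)) (at t)"
    "((\<lambda>t. snd (y t)) has_vector_derivative snd (magnitude_field t (y t))) (at t)" for t
    using bounded_linear.has_vector_derivative[OF bounded_linear_fst y[of t]]
      bounded_linear.has_vector_derivative[OF bounded_linear_snd y[of t]]
    by (simp_all add: magnitude_field_def)
  have "Ck_on n UNIV (\<lambda>t. fst (y t)) \<and> Ck_on n UNIV (\<lambda>t. snd (y t))" for n
  proof (induction n)
    case 0
    have "continuous_on UNIV y"
      using y has_vector_derivative_continuous by (blast intro: continuous_at_imp_continuous_on)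
    then show ?case by (auto intro: continuous_intros)
  next
    case (Suc n)
    have R: "Ck_on n UNIV (\<lambda>t. state_R (y t))" and Q: "Ck_on n UNIV (\<lambda>t. state_Q (y t))"
      unfolding state_R_def state_Q_def using Suc by (auto intro!: Ck_intros I)
    have W: "Ck_on n UNIV (\<lambda>t. state_volume2 (y t))"
      unfolding state_volume2_def using Suc by (intro Ck_intros I R Q) (auto simp: n)
    have "Ck_on n UNIV (\<lambda>t. snd (magnitude_field t (y t)))"
      unfolding magnitude_field_def state_T_def snd_conv using Suc
      by (intro Ck_intros I R Q W smooth_onD[OF AB(1)] smooth_onD[OF AB(2)]) (auto simp: n)
    then show ?case
      using Ck_on_vector_SucI[OF I d(1)] Ck_on_vector_SucI[OF I d(2)] Suc by blast
  qed
  then show "smooth_on UNIV (\<lambda>t. fst (y t))" "smooth_on UNIV (\<lambda>t. snd (y t))" by (auto simp: smooth_on_def)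
qed

text \<open>Serves uniqueness: any competing magnitude also traces a solution of the field.\<close>

lemma admissible_imp_magnitude_field_solution:
  assumes a: "admissible UNIV a"
    and T: "\<And>t. T_of c UNIV a t = A t + B t * (vol_of c \<epsilon> UNIV a t)\<^sup>2 powr (- r)"
  defines "y \<equiv> \<lambda>t. (a t, cder UNIV a t)"
  shows "y t \<in> states" "(y has_vector_derivative magnitude_field t (y t)) (at t)"
proof -
  note I = dense_axes_UNIV
  have b: "0 < a t" "0 < R_of UNIV a t" using admissible_bounds[OF I a] by auto
  have R: "state_R (y t) = R_of UNIV a t" by (simp add: state_R_def R_of_def y_def)
  show D: "y t \<in> states" using b R by (simp add: states_def y_def)
  have Q: "state_Q (y t) = Q_of c a t" by (simp add: state_Q_def Q_of_def y_def)
  have W: "state_volume2 (y t) = (vol_of c \<epsilon> UNIV a t)\<^sup>2"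
    using vol_of_square[OF I a \<epsilon>, of t c] unfolding state_volume2_def Q R by (simp add: y_def)
  have "T_of c UNIV a t = state_T t (y t)" unfolding state_T_def W T ..
  then have X: "snd (magnitude_field t (y t)) = cder UNIV (cder UNIV a) t"
    using b by (simp add: magnitude_field_def T_of_def Q[symmetric] R[symmetric]) (simp add: R y_def field_simps)
  have "(y has_vector_derivative (cder UNIV a t, cder UNIV (cder UNIV a) t)) (at t)"
    unfolding y_def has_vector_derivative_def scaleR_Pair
    using smooth_on_has_vector_derivative(1)[OF I admissible_smooth(1)[OF I a], of t]
      smooth_on_has_vector_derivative(1)[OF I admissible_smooth(2)[OF I a], of t]
    by (intro has_derivative_Pair) (simp_all add: has_vector_derivative_def)
  moreover have "magnitude_field t (y t) = (cder UNIV a t, cder UNIV (cder UNIV a) t)"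
    using X by (simp add: prod_eq_iff) (simp add: magnitude_field_def y_def)
  ultimately show "(y has_vector_derivative magnitude_field t (y t)) (at t)" by simp
qed

lemma unique_magnitude:
  assumes a0: "0 < a0" "0 < 1 - a0\<^sup>2 - p0\<^sup>2"
  shows "\<exists>!a. admissible UNIV a \<and> a t0 = a0 \<and> deriv a t0 = p0 \<and>
    (\<forall>t. T_of c UNIV a t = A t + B t * (vol_of c \<epsilon> UNIV a t)\<^sup>2 powr (- r))"
proof (rule ex_ex1I)
  note I = dense_axes_UNIV
  have "(a0, p0) \<in> states" using a0 by (simp add: states_def state_R_def)
  from magnitude_field_global_solution[OF this, of t0]
  obtain y where y: "y t0 = (a0, p0)" "\<And>t. y t \<in> states" "\<And>t. (y has_vector_derivative magnitude_field t (y t)) (at t)"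
    by metis
  define a where "a t = fst (y t)" for t
  note sm = magnitude_field_solution_smooth[OF y(2,3)]
  have d: "(a has_vector_derivative snd (y t)) (at t)"
    "((\<lambda>t. snd (y t)) has_vector_derivative snd (magnitude_field t (y t))) (at t)" for t
    using bounded_linear.has_vector_derivative[OF bounded_linear_fst y(3)[of t]]
      bounded_linear.has_vector_derivative[OF bounded_linear_snd y(3)[of t]]
    by (simp_all add: magnitude_field_def a_def[abs_def])
  have a': "cder UNIV a = (\<lambda>t. snd (y t))" using cder_eqI[OF I] d by (auto simp: fun_eq_iff)
  have a'': "cder UNIV (cder UNIV a) t = snd (magnitude_field t (y t))" for t
    unfolding a' using cder_eqI[OF I _ d(2)] by auto
  have R: "R_of UNIV a t = state_R (y t)" and Q: "Q_of c a t = state_Q (y t)" for t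
    by (simp_all add: R_of_def Q_of_def state_R_def state_Q_def a' a_def)
  have adm: "admissible UNIV a"
    unfolding admissible_def R using states_bounds[OF y(2)] sm(1) by (auto simp: a_def[abs_def])
  have W: "(vol_of c \<epsilon> UNIV a t)\<^sup>2 = state_volume2 (y t)" for t
    using vol_of_square[OF I adm \<epsilon>, of t c] by (simp add: state_volume2_def Q R a_def)
  have "T_of c UNIV a t = state_T t (y t)" for t
  proof -
    have p: "0 < fst (y t)" "0 < state_R (y t)" using states_bounds[OF y(2)[of t]] by auto
    show ?thesis
      unfolding T_of_def a'' R Q a_def magnitude_field_def snd_conv using p by simp
  qed
  moreover have "deriv a t0 = p0"
    using d(1)[of t0] y(1) by (intro DERIV_imp_deriv) (simp add: has_real_derivative_iff_has_vector_derivative)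
  ultimately show "\<exists>a. admissible UNIV a \<and> a t0 = a0 \<and> deriv a t0 = p0 \<and>
    (\<forall>t. T_of c UNIV a t = A t + B t * (vol_of c \<epsilon> UNIV a t)\<^sup>2 powr (- r))"
    using adm y(1) unfolding state_T_def W[symmetric] by (intro exI[of _ a]) (simp add: a_def[of t0])
next
  note I = dense_axes_UNIV
  fix a b
  assume a: "admissible UNIV a \<and> a t0 = a0 \<and> deriv a t0 = p0 \<and>
    (\<forall>t. T_of c UNIV a t = A t + B t * (vol_of c \<epsilon> UNIV a t)\<^sup>2 powr (- r))"
    and b: "admissible UNIV b \<and> b t0 = a0 \<and> deriv b t0 = p0 \<and>
    (\<forall>t. T_of c UNIV b t = A t + B t * (vol_of c \<epsilon> UNIV b t)\<^sup>2 powr (- r))"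
  have cd: "cder UNIV f t = deriv f t" if "admissible UNIV f" for f t
    using smooth_on_has_real_derivative[OF I admissible_smooth(1)[OF I that], of t] by (simp add: DERIV_imp_deriv)
  have "(a t, cder UNIV a t) = (b t, cder UNIV b t)" for t
    by (rule magnitude_field_unique[where y = "\<lambda>t. (a t, cder UNIV a t)" and z = "\<lambda>t. (b t, cder UNIV b t)"
          and \<alpha> = "min t t0" and \<beta> = "max t t0" and ?t0.0 = t0])
      (use a b cd admissible_imp_magnitude_field_solution in auto)
  then show "a = b" by auto
qed

end


section \<open>A prescribed warp as an equation for T\<close>

lemma smooth_UNIV_deriv:
  fixes F :: "real \<Rightarrow> real"
  assumes "smooth_on UNIV F"
  shows "cder UNIV F = deriv F" "(F has_real_derivative deriv F t) (at t)"
proof -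
  have h: "(F has_real_derivative cder UNIV F t) (at t)" for t
    using smooth_on_has_real_derivative[OF dense_axes_UNIV assms, of t] by simp
  show eq: "cder UNIV F = deriv F" using DERIV_imp_deriv[OF h] by (simp add: fun_eq_iff)
  show "(F has_real_derivative deriv F t) (at t)" using h[of t] by (simp add: eq)
qed

text \<open>Eliminates the second warp from the volume. The power is taken of
  \<open>V\<^sup>2\<close> because the phase-space field carries the squared volume.\<close>

lemma inverse_square_from_product:
  fixes u v V :: real
  assumes "0 < u" "0 < v" "0 < k" "u * v ^ k = V"
  shows "1 / v\<^sup>2 = u powr (2 / k) * V\<^sup>2 powr (- (1 / k))"
proof -
  have "0 < V" using assms by (metis mult_pos_pos zero_less_power)
  then have "V\<^sup>2 = V powr 2" by (simp add: powr_numeral)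
  then have "V\<^sup>2 powr (- (1 / k)) = (u * v ^ k) powr (- (2 / k))"
    by (simp only: powr_powr assms(4)) simp
  also have "v ^ k = v powr k" using assms by (simp add: powr_realpow)
  also have "(u * v powr k) powr (- (2 / k)) = u powr (- (2 / k)) * v powr (- 2)"
    using assms(1-3) by (simp add: powr_mult powr_powr)
  finally have "u powr (2 / k) * V\<^sup>2 powr (- (1 / k)) = (u powr (2 / k) * u powr (- (2 / k))) * v powr (- 2)"
    by (simp only: mult.assoc)
  also have "\<dots> = 1 / v\<^sup>2"
    using assms(1,2) by (simp add: powr_minus_divide powr_numeral)
  finally show ?thesis ..
qed

context
  fixes d1 d2 c \<epsilon> \<sigma> :: real and k1 k2 :: nat
  assumes d: "0 < d1" "0 < d2" and k: "0 < k1" "0 < k2" and \<epsilon>: "0 < \<epsilon>"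
begin

text \<open>If \<open>l\<close> is the first warp, the volume determines the second and the equation
  for \<open>T\<close> is the stated one. Conversely, the stated equation says that \<open>l\<close>
  with the second warp forced by the volume solves the same two equations as the reconstructed pair,
  which is unique.\<close>

lemma prescribed_first_warp_iff:
  assumes a: "admissible UNIV a" and l: "\<And>t. 0 < l t"
  shows "(\<exists>b s1 s2 l1 l2. reconstruction k1 k2 d1 d2 c \<epsilon> \<sigma> UNIV a b s1 s2 l1 l2 \<and> l = l1) \<longleftrightarrow>
    (\<forall>t. T_of c UNIV a t = - d1 / (l t)\<^sup>2 + d2 * (l t ^ k1) powr (2 / k2) * (vol_of c \<epsilon> UNIV a t)\<^sup>2 powr (- (1 / k2)))"
    (is "?L \<longleftrightarrow> ?R")
proof
  note I = dense_axes_UNIV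
  assume ?L
  then obtain b s1 s2 l2 where r: "reconstruction k1 k2 d1 d2 c \<epsilon> \<sigma> UNIV a b s1 s2 l l2" by blast
  show ?R
  proof
    fix t
    have p: "0 < l t" "0 < l2 t" and T: "d2 / (l2 t)\<^sup>2 - d1 / (l t)\<^sup>2 = T_of c UNIV a t"
      using r unfolding reconstruction_def by auto
    have "l t ^ k1 * l2 t ^ k2 = vol_of c \<epsilon> UNIV a t"
      using reconstruction_smooth(6)[OF I a \<epsilon> d k r, of t] by (simp add: volume_factor_def)
    from inverse_square_from_product[OF _ p(2) k(2) this]
    have "1 / (l2 t)\<^sup>2 = (l t ^ k1) powr (2 / k2) * (vol_of c \<epsilon> UNIV a t)\<^sup>2 powr (- (1 / k2))"
      using p by simp
    then have "d2 / (l2 t)\<^sup>2 = d2 * ((l t ^ k1) powr (2 / k2) * (vol_of c \<epsilon> UNIV a t)\<^sup>2 powr (- (1 / k2)))"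
      by (metis mult.right_neutral times_divide_eq_right)
    then show "T_of c UNIV a t = - d1 / (l t)\<^sup>2 + d2 * (l t ^ k1) powr (2 / k2) * (vol_of c \<epsilon> UNIV a t)\<^sup>2 powr (- (1 / k2))"
      using T by simp
  qed
next
  note I = dense_axes_UNIV
  assume R: ?R
  obtain b s1 s2 l1 l2 where r: "reconstruction k1 k2 d1 d2 c \<epsilon> \<sigma> UNIV a b s1 s2 l1 l2"
    using reconstruction_exists[OF is_interval_univ _ a \<epsilon> d k, of c \<sigma>] by (metis UNIV_not_empty interior_UNIV)
  have "l1 t = l t" for t
  proof -
    have p: "0 < l1 t" "0 < l2 t" and T: "d2 / (l2 t)\<^sup>2 - d1 / (l1 t)\<^sup>2 = T_of c UNIV a t"
      using r unfolding reconstruction_def by auto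
    have V: "l1 t ^ k1 * l2 t ^ k2 = vol_of c \<epsilon> UNIV a t"
      using reconstruction_smooth(6)[OF I a \<epsilon> d k r, of t] by (simp add: volume_factor_def)
    \<comment> \<open>The second warp that \<open>l\<close> and the volume force.\<close>
    define m where "m = root k2 (vol_of c \<epsilon> UNIV a t / l t ^ k1)"
    have m: "0 < m" "l t ^ k1 * m ^ k2 = vol_of c \<epsilon> UNIV a t"
      using vol_of_pos[OF I a \<epsilon>, of t c] l[of t] k by (auto simp: m_def)
    have "1 / m\<^sup>2 = (l t ^ k1) powr (2 / k2) * (vol_of c \<epsilon> UNIV a t)\<^sup>2 powr (- (1 / k2))"
      using inverse_square_from_product[OF _ m(1) k(2) m(2)] l by simp
    then have "d2 / m\<^sup>2 = d2 * ((l t ^ k1) powr (2 / k2) * (vol_of c \<epsilon> UNIV a t)\<^sup>2 powr (- (1 / k2)))"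
      by (metis mult.right_neutral times_divide_eq_right)
    then have "d2 / m\<^sup>2 - d1 / (l t)\<^sup>2 = T_of c UNIV a t" using R by simp
    then show ?thesis using warp_pair_unique[OF d k p l m(1)] V m(2) T by simp
  qed
  then have "l = l1" by auto
  then show ?L using r by blast
qed

text \<open>The elimination with the factors exchanged: the power of the volume now stems from the
  first warp and enters \<open>T\<close> with coefficient \<open>- d1\<close>.\<close>

lemma prescribed_second_warp_iff:
  assumes a: "admissible UNIV a" and l: "\<And>t. 0 < l t"
  shows "(\<exists>b s1 s2 l1 l2. reconstruction k1 k2 d1 d2 c \<epsilon> \<sigma> UNIV a b s1 s2 l1 l2 \<and> l = l2) \<longleftrightarrow>
    (\<forall>t. T_of c UNIV a t = d2 / (l t)\<^sup>2 + - d1 * (l t ^ k2) powr (2 / k1) * (vol_of c \<epsilon> UNIV a t)\<^sup>2 powr (- (1 / k1)))"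
    (is "?L \<longleftrightarrow> ?R")
proof
  note I = dense_axes_UNIV
  assume ?L
  then obtain b s1 s2 l1 where r: "reconstruction k1 k2 d1 d2 c \<epsilon> \<sigma> UNIV a b s1 s2 l1 l" by blast
  show ?R
  proof
    fix t
    have p: "0 < l t" "0 < l1 t" and T: "d2 / (l t)\<^sup>2 - d1 / (l1 t)\<^sup>2 = T_of c UNIV a t"
      using r unfolding reconstruction_def by auto
    have "l t ^ k2 * l1 t ^ k1 = vol_of c \<epsilon> UNIV a t"
      using reconstruction_smooth(6)[OF I a \<epsilon> d k r, of t] by (simp add: volume_factor_def mult.commute)
    from inverse_square_from_product[OF _ p(2) k(1) this]
    have "1 / (l1 t)\<^sup>2 = (l t ^ k2) powr (2 / k1) * (vol_of c \<epsilon> UNIV a t)\<^sup>2 powr (- (1 / k1))"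
      using p by simp
    then have "d1 / (l1 t)\<^sup>2 = d1 * ((l t ^ k2) powr (2 / k1) * (vol_of c \<epsilon> UNIV a t)\<^sup>2 powr (- (1 / k1)))"
      by (metis mult.right_neutral times_divide_eq_right)
    then show "T_of c UNIV a t = d2 / (l t)\<^sup>2 + - d1 * (l t ^ k2) powr (2 / k1) * (vol_of c \<epsilon> UNIV a t)\<^sup>2 powr (- (1 / k1))"
      using T by simp
  qed
next
  note I = dense_axes_UNIV
  assume R: ?R
  obtain b s1 s2 l1 l2 where r: "reconstruction k1 k2 d1 d2 c \<epsilon> \<sigma> UNIV a b s1 s2 l1 l2"
    using reconstruction_exists[OF is_interval_univ _ a \<epsilon> d k, of c \<sigma>] by (metis UNIV_not_empty interior_UNIV)
  have "l2 t = l t" for t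
  proof -
    have p: "0 < l1 t" "0 < l2 t" and T: "d2 / (l2 t)\<^sup>2 - d1 / (l1 t)\<^sup>2 = T_of c UNIV a t"
      using r unfolding reconstruction_def by auto
    have V: "l1 t ^ k1 * l2 t ^ k2 = vol_of c \<epsilon> UNIV a t"
      using reconstruction_smooth(6)[OF I a \<epsilon> d k r, of t] by (simp add: volume_factor_def)
    define m where "m = root k1 (vol_of c \<epsilon> UNIV a t / l t ^ k2)"
    have m: "0 < m" "l t ^ k2 * m ^ k1 = vol_of c \<epsilon> UNIV a t"
      using vol_of_pos[OF I a \<epsilon>, of t c] l[of t] k by (auto simp: m_def)
    have "1 / m\<^sup>2 = (l t ^ k2) powr (2 / k1) * (vol_of c \<epsilon> UNIV a t)\<^sup>2 powr (- (1 / k1))"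
      using inverse_square_from_product[OF _ m(1) k(1) m(2)] l by simp
    then have "d1 / m\<^sup>2 = d1 * ((l t ^ k2) powr (2 / k1) * (vol_of c \<epsilon> UNIV a t)\<^sup>2 powr (- (1 / k1)))"
      by (metis mult.right_neutral times_divide_eq_right)
    then have "d2 / (l t)\<^sup>2 - d1 / m\<^sup>2 = T_of c UNIV a t" using R by simp
    then show ?thesis using warp_pair_unique[OF d k p m(1) l] V m(2) T by (simp add: mult.commute)
  qed
  then have "l = l2" by auto
  then show ?L using r by blast
qed

lemma prescribed_warp_ex1:
  assumes j: "j \<in> {1, 2::nat}" and l: "smooth_on UNIV l" "\<And>t::real. 0 < l t" and c: "c \<noteq> 0"
    and a0: "0 < a0" "0 < 1 - a0\<^sup>2 - p0\<^sup>2"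
  shows "\<exists>!a. admissible UNIV a \<and> a t0 = a0 \<and> deriv a t0 = p0 \<and>
    (\<exists>b s1 s2 l1 l2. reconstruction k1 k2 d1 d2 c \<epsilon> \<sigma> UNIV a b s1 s2 l1 l2 \<and> l = (if j = 1 then l1 else l2))"
proof -
  note I = dense_axes_UNIV
  have n: "l t \<noteq> 0" for t using l(2)[of t] by simp
  have sm: "smooth_on UNIV (\<lambda>t. x / (l t)\<^sup>2)" "smooth_on UNIV (\<lambda>t. x * (l t ^ k) powr y)" for x y and k :: nat
    unfolding smooth_on_def using l(2) n by (auto intro!: Ck_intros I smooth_onD[OF l(1)])
  have r: "0 < 1 / real k1" "0 < 1 / real k2" using k by auto
  have ex1_cong: "\<exists>!a. P a \<and> Q a \<and> R a \<and> S a" if "\<exists>!a. P a \<and> Q a \<and> R a \<and> S' a" "\<And>a. P a \<Longrightarrow> S a \<longleftrightarrow> S' a"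
    for P Q R S S' :: "(real \<Rightarrow> real) \<Rightarrow> bool"
    using that by metis
  show ?thesis
  proof (cases "j = 1")
    case True
    show ?thesis
      by (rule ex1_cong[OF unique_magnitude[OF c \<epsilon> r(2) sm(1)[of "- d1"] sm(2)[of d2 k1 "2 / real k2"] a0]])
        (simp only: True refl if_True prescribed_first_warp_iff[OF _ l(2)])
  next
    case False
    show ?thesis
      by (rule ex1_cong[OF unique_magnitude[OF c \<epsilon> r(1) sm(1)[of d2] sm(2)[of "- d1" k2 "2 / real k1"] a0]])
        (simp only: False if_False prescribed_second_warp_iff[OF _ l(2)])
  qed
qed

end

section \<open>Prescribed volume\<close>

text \<open>After the last time at which \<open>D \<le> 0\<close>, \<open>D\<close> is positive and
  hence nonincreasing. Applied to a difference of solutions, this is a comparison principle for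
  fields that decrease in the state.\<close>

lemma nonpos_of_derivative_nonpos_where_pos:
  fixes D D' :: "real \<Rightarrow> real"
  assumes D: "\<And>t. t \<in> {\<alpha>..\<beta>} \<Longrightarrow> (D has_real_derivative D' t) (at t)"
    and D0: "D \<alpha> \<le> 0" and D': "\<And>t. t \<in> {\<alpha>..\<beta>} \<Longrightarrow> 0 < D t \<Longrightarrow> D' t \<le> 0"
    and t: "t \<in> {\<alpha>..\<beta>}"
  shows "D t \<le> 0"
proof (rule ccontr)
  assume "\<not> D t \<le> 0"
  then have pos: "0 < D t" by simp
  have cont: "continuous_on {\<alpha>..t} D"
    using t by (intro continuous_at_imp_continuous_on ballI DERIV_isCont[OF D]) auto
  define S where "S = {s \<in> {\<alpha>..t}. D s \<le> 0}"
  have "closed S" unfolding S_def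
    using continuous_closed_preimage[OF cont closed_atLeastAtMost, of "{..0}"]
    by (simp add: vimage_def Int_def)
  moreover have "bounded S" unfolding S_def by (rule bounded_subset[OF bounded_closed_interval[of \<alpha> t]]) auto
  moreover have "\<alpha> \<in> S" using D0 t by (simp add: S_def)
  ultimately obtain s where s: "s \<in> S" "\<forall>r\<in>S. r \<le> s"
    using compact_attains_sup[of S] by (auto simp: compact_eq_bounded_closed)
  then have st: "s \<le> t" "\<alpha> \<le> s" "D s \<le> 0" by (auto simp: S_def)
  have "D t \<le> D s"
  proof (rule DERIV_nonpos_imp_decreasing_open[OF st(1)])
    show "\<exists>y. (D has_real_derivative y) (at x) \<and> y \<le> 0" if "s < x" "x < t" for x
    proof -
      have "x \<notin> S" using s(2) that by force
      then have "0 < D x" using that st by (auto simp: S_def)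
      then show ?thesis using D[of x] D'[of x] that st t by auto
    qed
    show "continuous_on {s..t} D" using cont st by (auto intro: continuous_on_subset)
  qed
  then show False using st(3) pos by simp
qed

text \<open>At the first contact with \<open>\<eta>\<close> a positive derivative would put
  \<open>v\<close> below \<open>\<eta>\<close> just before. The derivative is tested only at the
  value \<open>\<eta>\<close>, where the speed of the truncated angle equation is known
  exactly.\<close>

lemma stays_above_of_derivative_pos_at:
  fixes v v' :: "real \<Rightarrow> real"
  assumes v: "continuous_on {\<alpha>..\<beta>} v" and v0: "\<eta> < v \<alpha>"
    and v': "\<And>t. t \<in> {\<alpha><..\<beta>} \<Longrightarrow> v t = \<eta> \<Longrightarrow> \<exists>d>0. (v has_real_derivative d) (at t)"
    and t: "t \<in> {\<alpha>..\<beta>}"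
  shows "\<eta> < v t"
proof (rule ccontr)
  assume "\<not> \<eta> < v t"
  define S where "S = {s \<in> {\<alpha>..t}. v s \<le> \<eta>}"
  have cont: "continuous_on {\<alpha>..t} v" using v t by (auto intro: continuous_on_subset)
  have "closed S" unfolding S_def
    using continuous_closed_preimage[OF cont closed_atLeastAtMost, of "{..\<eta>}"]
    by (simp add: vimage_def Int_def)
  moreover have "bounded S" unfolding S_def by (rule bounded_subset[OF bounded_closed_interval[of \<alpha> t]]) auto
  moreover have "t \<in> S" using \<open>\<not> \<eta> < v t\<close> t by (simp add: S_def)
  ultimately obtain s where s: "s \<in> S" "\<forall>r\<in>S. s \<le> r"
    using compact_attains_inf[of S] by (auto simp: compact_eq_bounded_closed)
  then have st: "\<alpha> \<le> s" "s \<le> t" "v s \<le> \<eta>" by (auto simp: S_def)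
  then have "\<alpha> < s" using v0 by (cases "s = \<alpha>") auto
  have above: "\<eta> < v r" if "\<alpha> \<le> r" "r < s" for r
    using s(2) that st by (force simp: S_def)
  have "v s = \<eta>"
  proof (rule ccontr)
    assume "v s \<noteq> \<eta>"
    then have "v s < \<eta>" using st by simp
    moreover have "continuous_on {\<alpha>..s} v" using cont st by (auto intro: continuous_on_subset)
    ultimately obtain r where "\<alpha> \<le> r" "r \<le> s" "v r = \<eta>"
      using IVT2'[of v s \<eta> \<alpha>] v0 st by auto
    then show False using above[of r] \<open>v s \<noteq> \<eta>\<close> by (cases "r = s") auto
  qed
  then obtain d where d: "0 < d" "(v has_real_derivative d) (at s)"
    using v'[of s] \<open>\<alpha> < s\<close> st t by auto
  obtain e where e: "0 < e" "\<And>h. 0 < h \<Longrightarrow> h < e \<Longrightarrow> v (s - h) < v s"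
    using DERIV_pos_inc_left[OF d(2,1)] by blast
  define h where "h = min (e / 2) (s - \<alpha>)"
  have "0 < h" "h < e" "\<alpha> \<le> s - h" using e \<open>\<alpha> < s\<close> by (auto simp: h_def min_def)
  then have "v (s - h) < v s" "\<eta> < v (s - h)" using e(2) above by auto
  then show False using \<open>v s = \<eta>\<close> by simp
qed

text \<open>With \<^term>\<open>x = \<epsilon> / F\<^sup>2\<close> and \<^term>\<open>a = cos \<theta>\<close>, the volume equation \<^term>\<open>F\<^sup>2 * a\<^sup>2 * R = \<epsilon> * Q\<close> reads
  \<^term>\<open>\<theta>'\<^sup>2 = 1 - x * angle_weight \<theta>\<close>, and \<^term>\<open>angle_weight\<close> attains its minimum \<^term>\<open>(1 + \<bar>c\<bar>)\<^sup>2\<close> at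
  \<^term>\<open>start_angle\<close>. A solution of \<^term>\<open>\<theta>' = sqrt (1 - x * angle_weight \<theta>)\<close> starting there at time \<^term>\<open>- n\<close> exists on
  \<^term>\<open>{- n..n}\<close>, because the decrease of \<^term>\<open>x\<close> keeps the radicand positive. These solutions increase with \<^term>\<open>n\<close>,
  and their limit is a global one.\<close>

context
  fixes c \<epsilon> :: real and x :: "real \<Rightarrow> real"
  assumes \<epsilon>: "0 < \<epsilon>" and x: "smooth_on UNIV x" "\<And>t. 0 < x t" "\<And>t. deriv x t < 0"
    and small: "\<And>t. x t * (1 + \<bar>c\<bar>)\<^sup>2 < 1"
begin

definition angle_weight :: "real \<Rightarrow> real" where "angle_weight \<theta> = 1 / (cos \<theta>)\<^sup>2 + c\<^sup>2 / (sin \<theta>)\<^sup>2"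
definition angle_weight' :: "real \<Rightarrow> real" where "angle_weight' \<theta> = 2 * sin \<theta> / cos \<theta> ^ 3 - 2 * c\<^sup>2 * cos \<theta> / sin \<theta> ^ 3"
text \<open>The critical point of the weight: \<open>angle_weight'\<close> vanishes where
  \<open>sin ^ 4\<close> equals \<open>c\<^sup>2 * cos ^ 4\<close>, that is where the squared
  tangent is \<open>\<bar>c\<bar>\<close>. For \<open>c = 0\<close> it is the endpoint 0.\<close>

definition start_angle :: real where "start_angle = arctan (sqrt \<bar>c\<bar>)"
definition angle_speed2 :: "real \<Rightarrow> real \<Rightarrow> real" where "angle_speed2 t \<theta> = 1 - x t * angle_weight \<theta>"

lemma start_angle_bounds: "0 \<le> start_angle" "start_angle < pi / 2" "c \<noteq> 0 \<Longrightarrow> 0 < start_angle"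
  using arctan_ubound by (auto simp: start_angle_def)

lemma start_angle_values: "(cos start_angle)\<^sup>2 = 1 / (1 + \<bar>c\<bar>)" "(sin start_angle)\<^sup>2 = \<bar>c\<bar> / (1 + \<bar>c\<bar>)"
  by (simp_all add: start_angle_def cos_arctan sin_arctan power_divide)

lemma trig_pos:
  assumes "start_angle \<le> \<theta>" "\<theta> < pi / 2"
  shows "0 < cos \<theta>" "0 \<le> sin \<theta>" "c \<noteq> 0 \<Longrightarrow> 0 < sin \<theta>" "\<bar>c\<bar> * (cos \<theta>)\<^sup>2 \<le> (sin \<theta>)\<^sup>2" "sin start_angle \<le> sin \<theta>"
proof -
  show "0 < cos \<theta>" using assms start_angle_bounds by (intro cos_gt_zero_pi) auto
  show "0 \<le> sin \<theta>" using assms start_angle_bounds by (intro sin_ge_zero) auto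
  show "0 < sin \<theta>" if "c \<noteq> 0" using assms start_angle_bounds(3)[OF that] by (intro sin_gt_zero) auto
  show s: "sin start_angle \<le> sin \<theta>" using assms start_angle_bounds by (intro sin_monotone_2pi_le) auto
  have "(sin start_angle)\<^sup>2 \<le> (sin \<theta>)\<^sup>2"
    using s start_angle_bounds by (intro power_mono sin_ge_zero) auto
  then have 1: "\<bar>c\<bar> / (1 + \<bar>c\<bar>) \<le> (sin \<theta>)\<^sup>2" by (simp add: start_angle_values)
  then have "\<bar>c\<bar> \<le> (sin \<theta>)\<^sup>2 * (1 + \<bar>c\<bar>)" by (simp add: pos_divide_le_eq)
  then show "\<bar>c\<bar> * (cos \<theta>)\<^sup>2 \<le> (sin \<theta>)\<^sup>2" by (simp add: cos_squared_eq algebra_simps)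
qed

lemma angle_weight_has_derivative:
  assumes "start_angle \<le> \<theta>" "\<theta> < pi / 2"
  shows "(angle_weight has_real_derivative angle_weight' \<theta>) (at \<theta>)"
proof (cases "c = 0")
  \<comment> \<open>With \<open>c = 0\<close> the angle may be 0, where \<open>sin \<theta>\<close>
    vanishes; the quotient containing it has numerator 0 and is identically 0.\<close>
  case True
  then show ?thesis using trig_pos[OF assms] unfolding angle_weight_def[abs_def] angle_weight'_def
    by (auto intro!: derivative_eq_intros simp: power2_eq_square power3_eq_cube field_simps)
next
  case False
  then show ?thesis using trig_pos[OF assms] unfolding angle_weight_def[abs_def] angle_weight'_def
    by (auto intro!: derivative_eq_intros simp: power2_eq_square power3_eq_cube field_simps)
qed

lemma angle_weight'_nonneg:
  assumes "start_angle \<le> \<theta>" "\<theta> < pi / 2"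
  shows "0 \<le> angle_weight' \<theta>"
proof (cases "c = 0")
  case True
  then show ?thesis unfolding angle_weight'_def using trig_pos(1,2)[OF assms] by simp
next
  case False
  note p = trig_pos[OF assms]
  have "(\<bar>c\<bar> * (cos \<theta>)\<^sup>2)\<^sup>2 \<le> ((sin \<theta>)\<^sup>2)\<^sup>2" using p(4) by (intro power_mono) auto
  then have "c\<^sup>2 * cos \<theta> ^ 4 \<le> sin \<theta> ^ 4" by (simp add: power_mult_distrib)
  then have "c\<^sup>2 * cos \<theta> / sin \<theta> ^ 3 \<le> sin \<theta> / cos \<theta> ^ 3"
    using p(1) p(3)[OF False] by (simp add: divide_simps) (simp add: power3_eq_cube power4_eq_xxxx mult_ac)
  then show ?thesis by (simp add: angle_weight'_def)
qed

lemma angle_weight_mono: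
  assumes "start_angle \<le> \<theta>" "\<theta> \<le> \<theta>'" "\<theta>' < pi / 2"
  shows "angle_weight \<theta> \<le> angle_weight \<theta>'"
  by (rule DERIV_nonneg_imp_nondecreasing[OF assms(2)])
    (use assms angle_weight_has_derivative angle_weight'_nonneg in \<open>meson le_less_trans order_trans\<close>)

lemma angle_weight_ge: "1 / (cos \<theta>)\<^sup>2 \<le> angle_weight \<theta>"
  by (simp add: angle_weight_def)

lemma angle_weight_pos: "start_angle \<le> \<theta> \<Longrightarrow> \<theta> < pi / 2 \<Longrightarrow> 0 < angle_weight \<theta>"
  using angle_weight_ge[of \<theta>] trig_pos(1)[of \<theta>] by (smt (verit) zero_less_power divide_pos_pos)

lemma angle_speed2_start_angle: "0 < angle_speed2 t start_angle"
proof -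
  have "angle_weight start_angle \<le> (1 + \<bar>c\<bar>)\<^sup>2"
  proof (cases "c = 0")
    case False
    then show ?thesis
      unfolding angle_weight_def start_angle_values by (simp add: field_simps power2_eq_square)
  next
    case True
    then show ?thesis unfolding angle_weight_def start_angle_values by simp
  qed
  then have "x t * angle_weight start_angle \<le> x t * (1 + \<bar>c\<bar>)\<^sup>2" using x(2)[of t] by (intro mult_left_mono) auto
  then show ?thesis using small[of t] by (simp add: angle_speed2_def)
qed

lemmas cder_x = smooth_UNIV_deriv(1)[OF x(1)]
lemmas x_derivative = smooth_UNIV_deriv(2)[OF x(1)]

lemma x_mono:
  assumes "s \<le> t"
  shows "x t \<le> x s"
proof (rule DERIV_nonpos_imp_nonincreasing[OF assms])
  show "\<exists>y. (x has_real_derivative y) (at r) \<and> y \<le> 0" for r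
    by (rule exI[of _ "deriv x r"]) (use x_derivative[of r] x(3)[of r] in simp)
qed

lemma x_less_1: "x t < 1"
proof -
  have "x t * 1 \<le> x t * (1 + \<bar>c\<bar>)\<^sup>2" using x(2)[of t] by (intro mult_left_mono) auto
  then show ?thesis using small[of t] by simp
qed

lemma angle_speed2_has_derivative:
  assumes y: "(y has_real_derivative y') (at t)" "start_angle \<le> y t" "y t < pi / 2"
  shows "((\<lambda>s. angle_speed2 s (y s)) has_real_derivative - (deriv x t * angle_weight (y t) + x t * (angle_weight' (y t) * y'))) (at t)"
  unfolding angle_speed2_def
  by (auto intro!: derivative_eq_intros x_derivative DERIV_chain2[OF angle_weight_has_derivative[OF y(2,3)] y(1)]
      simp: algebra_simps)

text \<open>A nonnegative radicand keeps the cosine away from 0 by an amount depending on time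
  alone. This bars the angle from \<open>pi / 2\<close> and survives passage to the limit.\<close>

lemma angle_speed2_pos_imp_less:
  assumes "start_angle \<le> \<theta>" "\<theta> < pi / 2" "0 \<le> angle_speed2 t \<theta>"
  shows "x t \<le> (cos \<theta>)\<^sup>2"
proof -
  have "x t * (1 / (cos \<theta>)\<^sup>2) \<le> x t * angle_weight \<theta>" using angle_weight_ge x(2)[of t] by (intro mult_left_mono) auto
  also have "\<dots> \<le> 1" using assms(3) by (simp add: angle_speed2_def)
  finally show ?thesis using trig_pos(1)[OF assms(1,2)] by (simp add: divide_le_eq)
qed

text \<open>The square root is not Lipschitz at 0, so the radicand is first truncated from below at
  \<open>\<eta>\<close> and the angle clamped to \<open>{start_angle..\<Theta>}\<close>. It is then
  shown that the radicand stays above \<open>\<eta>\<close> and the angle within the range, so that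
  the truncation has changed nothing along the solution.\<close>

lemma angle_local_solution:
  assumes ab: "\<alpha> \<le> \<beta>"
  obtains y where "y \<alpha> = start_angle" "\<And>t. t \<in> {\<alpha>..\<beta>} \<Longrightarrow> start_angle \<le> y t \<and> y t < pi / 2 \<and> 0 < angle_speed2 t (y t) \<and>
    (y has_real_derivative sqrt (angle_speed2 t (y t))) (at t)"
proof -
  have xb: "0 < x \<beta> / 2" "x \<beta> / 2 < 1" using x(2)[of \<beta>] x_less_1[of \<beta>] by auto
  \<comment> \<open>Chosen so that \<open>(cos \<Theta>)\<^sup>2 \<le> x \<beta> / 2 < x t\<close>
    on the whole interval, which makes the radicand negative at \<open>\<Theta>\<close>.\<close>
  define s where "s = sqrt (x \<beta> / 2)"
  have sq: "0 < s" "s < 1" "s\<^sup>2 = x \<beta> / 2" using xb by (simp_all add: s_def)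
  define \<Theta> where "\<Theta> = max start_angle (arccos s)"
  have acos: "0 \<le> arccos s" "arccos s < pi / 2"
  proof -
    show "0 \<le> arccos s"
      by (rule arccos_lbound; use sq in linarith)
    have "arccos s < arccos 0"
      by (rule arccos_less_arccos; use sq in linarith)
    then show "arccos s < pi / 2" by (simp only: arccos_0)
  qed
  have \<Theta>: "start_angle \<le> \<Theta>" "\<Theta> < pi / 2" using acos start_angle_bounds by (auto simp: \<Theta>_def)
  have cos\<Theta>: "(cos \<Theta>)\<^sup>2 \<le> x \<beta> / 2"
  proof -
    have "cos \<Theta> \<le> cos (arccos s)"
      using acos \<Theta> by (intro cos_monotone_0_pi_le) (auto simp: \<Theta>_def)
    also have "\<dots> = s" using sq by (intro cos_arccos) auto
    finally have "(cos \<Theta>)\<^sup>2 \<le> s\<^sup>2"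
      using trig_pos(1)[OF \<Theta>] by (intro power_mono) auto
    then show ?thesis using sq(3) by simp
  qed
  have V\<Theta>: "angle_speed2 t \<Theta> < 0" if "t \<in> {\<alpha>..\<beta>}" for t
  proof (rule ccontr)
    assume "\<not> angle_speed2 t \<Theta> < 0"
    then have "x t \<le> (cos \<Theta>)\<^sup>2" using angle_speed2_pos_imp_less[OF \<Theta>] by simp
    then show False using cos\<Theta> x_mono[of t \<beta>] that x(2)[of \<beta>] by simp
  qed
  define \<kappa> where "\<kappa> \<theta> = max start_angle (min \<Theta> \<theta>)" for \<theta>
  have \<kappa>: "start_angle \<le> \<kappa> \<theta>" "\<kappa> \<theta> \<le> \<Theta>" "\<kappa> \<theta> < pi / 2" for \<theta> using \<Theta> by (auto simp: \<kappa>_def)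
  define \<tau> where "\<tau> t = max \<alpha> (min \<beta> t)" for t
  have \<tau>: "\<tau> t \<in> {\<alpha>..\<beta>}" for t using ab by (auto simp: \<tau>_def)
  \<comment> \<open>A bound for \<open>angle_weight'\<close> on the clamped range. As
    \<open>angle_weight'\<close> is nonnegative there, it suffices to bound its positive summand, by
    the first term of \<open>H\<close>.\<close>
  define H where "H = 2 / cos \<Theta> ^ 3 + 2 * c\<^sup>2 / sin start_angle ^ 3"
  have H: "\<bar>angle_weight' \<theta>\<bar> \<le> H" if "start_angle \<le> \<theta>" "\<theta> \<le> \<Theta>" for \<theta>
  proof -
    have l: "\<theta> < pi / 2" using that \<Theta> by simp
    note p = trig_pos[OF that(1) l]
    have "cos \<Theta> \<le> cos \<theta>" using that start_angle_bounds \<Theta> by (intro cos_monotone_0_pi_le) auto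
    then have 1: "2 * sin \<theta> / cos \<theta> ^ 3 \<le> 2 / cos \<Theta> ^ 3"
      using trig_pos(1)[OF \<Theta>] p by (intro frac_le power_mono) (auto simp: sin_le_one)
    have 2: "0 \<le> 2 * c\<^sup>2 / sin start_angle ^ 3" using start_angle_bounds by (auto intro!: divide_nonneg_nonneg sin_ge_zero)
    have 3: "0 \<le> 2 * c\<^sup>2 * cos \<theta> / sin \<theta> ^ 3" using p by (auto intro!: divide_nonneg_nonneg)
    have "0 \<le> angle_weight' \<theta>" by (rule angle_weight'_nonneg[OF that(1) l])
    then show ?thesis using 1 2 3 unfolding H_def angle_weight'_def by linarith
  qed
  have H0: "0 \<le> H" using H[OF order_refl \<Theta>(1)] by linarith
  have hlip: "\<bar>angle_weight (\<kappa> \<theta>) - angle_weight (\<kappa> \<theta>')\<bar> \<le> H * \<bar>\<theta> - \<theta>'\<bar>" for \<theta> \<theta>'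
  proof -
    have "norm (angle_weight (\<kappa> \<theta>) - angle_weight (\<kappa> \<theta>')) \<le> H * norm (\<kappa> \<theta> - \<kappa> \<theta>')"
    proof (rule field_differentiable_bound[where S = "{start_angle..\<Theta>}" and f' = angle_weight'])
      show "(angle_weight has_real_derivative angle_weight' z) (at z within {start_angle..\<Theta>})" if "z \<in> {start_angle..\<Theta>}" for z
        using angle_weight_has_derivative[of z] that \<Theta> by (auto intro: has_field_derivative_at_within)
    qed (use H \<kappa> in auto)
    also have "\<dots> \<le> H * \<bar>\<theta> - \<theta>'\<bar>" using H0 by (intro mult_left_mono) (auto simp: \<kappa>_def)
    finally show ?thesis by simp
  qed
  have Vc: "continuous_on {\<alpha>..\<beta>} (\<lambda>t. angle_speed2 t (\<kappa> (y t)))" if "continuous_on UNIV y" for y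
  proof -
    have "continuous_on {start_angle..\<Theta>} angle_weight"
      by (intro continuous_at_imp_continuous_on ballI DERIV_isCont[OF angle_weight_has_derivative]) (use \<Theta> in auto)
    then have "continuous_on {\<alpha>..\<beta>} (\<lambda>t. angle_weight (\<kappa> (y t)))"
      by (rule continuous_on_compose2)
        (use that \<kappa> in \<open>auto simp: \<kappa>_def intro!: continuous_intros intro: continuous_on_subset\<close>)
    then show ?thesis
      unfolding angle_speed2_def using smooth_on_imp_continuous_on[OF x(1)]
      by (intro continuous_intros) (auto intro: continuous_on_subset)
  qed
  obtain m where m: "0 < m" "\<And>t. t \<in> {\<alpha>..\<beta>} \<Longrightarrow> m \<le> - deriv x t"
  proof -
    have "continuous_on UNIV (cder UNIV x)"
      using smooth_on_imp_continuous_on[OF smooth_on_has_vector_derivative(2)[OF dense_axes_UNIV x(1)]] .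
    then have "continuous_on {\<alpha>..\<beta>} (\<lambda>t. - deriv x t)"
      unfolding cder_x by (auto intro!: continuous_intros intro: continuous_on_subset)
    then obtain s where "s \<in> {\<alpha>..\<beta>}" "\<forall>t\<in>{\<alpha>..\<beta>}. - deriv x s \<le> - deriv x t"
      using continuous_attains_inf[OF compact_Icc, of \<alpha> \<beta> "\<lambda>t. - deriv x t"] ab
      by (metis atLeastatMost_empty_iff2 not_less order_less_le_trans linorder_not_le)
    with x(3)[of s] show ?thesis by (intro that[of "- deriv x s"]) auto
  qed
  \<comment> \<open>The first entry puts the initial radicand above \<open>r\<^sup>2\<close>. The
    second gives \<open>r * H < m\<close>, so that at speed \<open>r\<close> the decrease of
    \<open>x\<close> outweighs the growth of the weight.\<close>
  define r where "r = min (sqrt (angle_speed2 \<alpha> start_angle) / 2) (m / (2 * (H + 1)))"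
  have r: "0 < r" "r < sqrt (angle_speed2 \<alpha> start_angle)" "r * H < m"
  proof -
    show "0 < r" "r < sqrt (angle_speed2 \<alpha> start_angle)"
      using real_sqrt_gt_zero[OF angle_speed2_start_angle[of \<alpha>]] m(1) H0 unfolding r_def by (simp_all add: min_less_iff_disj)
    have "r * (H + 1) \<le> m / (2 * (H + 1)) * (H + 1)"
      using H0 by (intro mult_right_mono) (auto simp: r_def)
    also have "\<dots> = m / 2" using H0 by (simp add: field_simps)
    finally show "r * H < m" using m(1) \<open>0 < r\<close> by (simp add: distrib_left)
  qed
  define \<eta> where "\<eta> = r\<^sup>2"
  have \<eta>: "0 < \<eta>" "sqrt \<eta> = r" "\<eta> < angle_speed2 \<alpha> start_angle"
  proof -
    show "0 < \<eta>" "sqrt \<eta> = r" using r by (auto simp: \<eta>_def)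
    then show "\<eta> < angle_speed2 \<alpha> start_angle" using r(2) by (metis real_sqrt_less_iff)
  qed
  \<comment> \<open>Above \<open>\<eta> = r\<^sup>2\<close> the square root has Lipschitz constant
    \<open>1 / (2 * r)\<close>; together with \<open>H\<close> for the weight and
    \<open>x < 1\<close> this yields \<open>H / (2 * r)\<close>.\<close>
  define f where "f t \<theta> = sqrt (max \<eta> (angle_speed2 (\<tau> t) (\<kappa> \<theta>)))" for t \<theta>
  have V1: "angle_speed2 t (\<kappa> \<theta>) \<le> 1" for t \<theta>
    using x(2)[of t] angle_weight_pos[OF \<kappa>(1,3)] by (simp add: angle_speed2_def less_imp_le)
  have lip: "norm (f t \<theta> - f t \<theta>') \<le> H / (2 * r) * norm (\<theta> - \<theta>')" for t \<theta> \<theta>'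
  proof -
    define p q where "p = max \<eta> (angle_speed2 (\<tau> t) (\<kappa> \<theta>))" and "q = max \<eta> (angle_speed2 (\<tau> t) (\<kappa> \<theta>'))"
    have pq: "\<eta> \<le> p" "\<eta> \<le> q" by (auto simp: p_def q_def)
    have "r \<le> sqrt p" "r \<le> sqrt q" using pq \<eta>(2) real_sqrt_le_mono by metis+
    then have "2 * r \<le> sqrt p + sqrt q" by simp
    moreover have "(sqrt p - sqrt q) * (sqrt p + sqrt q) = p - q"
      using pq \<eta>(1) by (simp add: algebra_simps)
    moreover from calculation have "\<bar>sqrt p - sqrt q\<bar> * (sqrt p + sqrt q) = \<bar>p - q\<bar>"
      using r(1) by (metis abs_mult abs_of_nonneg order.trans less_imp_le zero_le_mult_iff zero_le_numeral)
    ultimately have "\<bar>sqrt p - sqrt q\<bar> * (2 * r) \<le> \<bar>p - q\<bar>"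
      by (metis abs_ge_zero mult_left_mono)
    moreover have "\<bar>p - q\<bar> \<le> \<bar>angle_speed2 (\<tau> t) (\<kappa> \<theta>) - angle_speed2 (\<tau> t) (\<kappa> \<theta>')\<bar>" by (auto simp: p_def q_def)
    moreover have "\<bar>angle_speed2 (\<tau> t) (\<kappa> \<theta>) - angle_speed2 (\<tau> t) (\<kappa> \<theta>')\<bar> \<le> H * \<bar>\<theta> - \<theta>'\<bar>"
    proof -
      have "\<bar>angle_speed2 (\<tau> t) (\<kappa> \<theta>) - angle_speed2 (\<tau> t) (\<kappa> \<theta>')\<bar> = x (\<tau> t) * \<bar>angle_weight (\<kappa> \<theta>) - angle_weight (\<kappa> \<theta>')\<bar>"
        using x(2)[of "\<tau> t"] by (simp add: angle_speed2_def abs_mult abs_minus_commute flip: right_diff_distrib)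
      also have "\<dots> \<le> 1 * \<bar>angle_weight (\<kappa> \<theta>) - angle_weight (\<kappa> \<theta>')\<bar>"
        using x_less_1[of "\<tau> t"] by (intro mult_right_mono) auto
      finally show ?thesis using hlip[of \<theta> \<theta>'] by simp
    qed
    ultimately have "\<bar>sqrt p - sqrt q\<bar> * (2 * r) \<le> H * \<bar>\<theta> - \<theta>'\<bar>" by linarith
    then show ?thesis using r(1) by (simp add: f_def p_def q_def pos_le_divide_eq mult_ac)
  qed
  have bdd: "norm (f t \<theta>) \<le> 1" for t \<theta>
  proof -
    have "\<eta> \<le> 1" using \<eta>(3) V1[of \<alpha> start_angle] \<kappa> \<Theta> by (simp add: \<kappa>_def)
    then show ?thesis using V1[of "\<tau> t" \<theta>] \<eta>(1) by (auto simp: f_def)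
  qed
  have cont: "continuous_on UNIV (\<lambda>(t, \<theta>). f t \<theta>)"
  proof -
    have "continuous_on {start_angle..\<Theta>} angle_weight"
      by (intro continuous_at_imp_continuous_on ballI DERIV_isCont[OF angle_weight_has_derivative]) (use \<Theta> in auto)
    then have "continuous_on UNIV (\<lambda>p::real \<times> real. angle_weight (\<kappa> (snd p)))"
      by (rule continuous_on_compose2) (use \<kappa> in \<open>auto simp: \<kappa>_def intro!: continuous_intros\<close>)
    moreover have "continuous_on UNIV (\<lambda>p::real \<times> real. x (\<tau> (fst p)))"
      by (rule continuous_on_compose2[OF smooth_on_imp_continuous_on[OF x(1)]])
        (auto simp: \<tau>_def intro!: continuous_intros)
    ultimately show ?thesis
      unfolding f_def angle_speed2_def case_prod_beta by (intro continuous_intros)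
  qed
  obtain y where y: "y \<alpha> = start_angle" "\<And>t. (y has_vector_derivative f t (y t)) (at t)"
    using ode_global_solution[OF cont bdd lip] by blast
  have yd: "(y has_real_derivative f t (y t)) (at t)" for t
    using y(2) by (simp add: has_real_derivative_iff_has_vector_derivative)
  have fpos: "0 < f t \<theta>" for t \<theta> using \<eta>(1) by (simp add: f_def less_max_iff_disj)
  have inc: "y s < y t" if "s < t" for s t
    using DERIV_pos_imp_increasing[OF that] yd fpos by blast
  have ge: "start_angle \<le> y t" if "\<alpha> \<le> t" for t using inc[of \<alpha> t] y(1) that by (cases "t = \<alpha>") auto
  have cy: "continuous_on UNIV y"
    using yd by (intro continuous_at_imp_continuous_on ballI DERIV_isCont)
  have less: "y t < \<Theta>" if "t \<in> {\<alpha>..\<beta>}" "0 < angle_speed2 t (\<kappa> (y t))" for t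
  proof (rule ccontr)
    assume "\<not> y t < \<Theta>"
    then have "\<kappa> (y t) = \<Theta>" using \<Theta> by (auto simp: \<kappa>_def)
    then show False using V\<Theta>[OF that(1)] that(2) by simp
  qed
  have main: "\<eta> < angle_speed2 t (\<kappa> (y t))" if t: "t \<in> {\<alpha>..\<beta>}" for t
  proof (rule stays_above_of_derivative_pos_at[OF Vc[OF cy] _ _ t])
    show "\<eta> < angle_speed2 \<alpha> (\<kappa> (y \<alpha>))" using \<eta>(3) \<Theta> y(1) by (simp add: \<kappa>_def)
    fix s assume s: "s \<in> {\<alpha><..\<beta>}" and eq: "angle_speed2 s (\<kappa> (y s)) = \<eta>"
    then have sJ: "s \<in> {\<alpha>..\<beta>}" by auto
    have yl: "y s < \<Theta>" using less[OF sJ] eq \<eta>(1) by simp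
    have yg: "start_angle < y s" using inc[of \<alpha> s] y(1) s by auto
    have \<kappa>y: "\<kappa> (y s) = y s" using yl yg by (auto simp: \<kappa>_def)
    have fs: "f s (y s) = r" using eq sJ \<eta> by (simp add: f_def \<tau>_def)
    have "((\<lambda>s. angle_speed2 s (y s)) has_real_derivative - (deriv x s * angle_weight (y s) + x s * (angle_weight' (y s) * r))) (at s)"
      using angle_speed2_has_derivative[OF yd] yg yl \<Theta> fs by auto
    then have "((\<lambda>s. angle_speed2 s (\<kappa> (y s))) has_real_derivative - (deriv x s * angle_weight (y s) + x s * (angle_weight' (y s) * r))) (at s)"
    proof (rule has_field_derivative_transform_within_open)
      show "open (y -` {start_angle<..<\<Theta>})" using cy by (intro open_vimage) (auto simp: continuous_on_eq_continuous_at)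
      show "s \<in> y -` {start_angle<..<\<Theta>}" using yl yg by simp
      show "angle_speed2 u (y u) = angle_speed2 u (\<kappa> (y u))" if "u \<in> y -` {start_angle<..<\<Theta>}" for u
      proof -
        have "\<kappa> (y u) = y u" using that by (auto simp: \<kappa>_def)
        then show ?thesis by simp
      qed
    qed
    \<comment> \<open>At radicand \<open>\<eta>\<close> the speed is exactly \<open>r\<close>. The
      weight is at least 1, so the first term contributes at least \<open>m\<close>, whereas the
      second costs at most \<open>H * r < m\<close>.\<close>
    moreover have "0 < - (deriv x s * angle_weight (y s) + x s * (angle_weight' (y s) * r))"
    proof -
      have "1 \<le> 1 / (cos (y s))\<^sup>2"
        using trig_pos(1)[of "y s"] yg yl \<Theta> by (simp add: abs_square_le_1)
      then have "1 \<le> angle_weight (y s)" using angle_weight_ge[of "y s"] by linarith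
      then have "m * 1 \<le> - deriv x s * angle_weight (y s)"
        using m(1) m(2)[OF sJ] by (intro mult_mono) auto
      moreover have h': "0 \<le> angle_weight' (y s)" "angle_weight' (y s) \<le> H"
        using angle_weight'_nonneg[of "y s"] H[of "y s"] yg yl \<Theta> by auto
      have "x s * (angle_weight' (y s) * r) \<le> 1 * (H * r)"
        using x_less_1[of s] h' r(1) x(2)[of s] H0 by (intro mult_mono) auto
      ultimately show ?thesis using r(3) by (simp add: mult.commute)
    qed
    ultimately show "\<exists>d>0. ((\<lambda>s. angle_speed2 s (\<kappa> (y s))) has_real_derivative d) (at s)" by blast
  qed
  show ?thesis
  proof (rule that[of y])
    show "y \<alpha> = start_angle" by (rule y(1))
    fix t assume t: "t \<in> {\<alpha>..\<beta>}"
    have V: "0 < angle_speed2 t (\<kappa> (y t))" using main[OF t] \<eta>(1) by simp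
    have b: "start_angle \<le> y t" "y t < \<Theta>" using ge t less[OF t V] by auto
    then have \<kappa>y: "\<kappa> (y t) = y t" by (auto simp: \<kappa>_def)
    have "f t (y t) = sqrt (angle_speed2 t (y t))"
      using main[OF t] \<kappa>y t by (simp add: f_def \<tau>_def)
    then show "start_angle \<le> y t \<and> y t < pi / 2 \<and> 0 < angle_speed2 t (y t) \<and> (y has_real_derivative sqrt (angle_speed2 t (y t))) (at t)"
      using yd[of t] b \<Theta> V \<kappa>y by simp
  qed
qed

lemma angle_speed_le_1: "start_angle \<le> \<theta> \<Longrightarrow> \<theta> < pi / 2 \<Longrightarrow> 0 < angle_speed2 t \<theta> \<Longrightarrow> norm (sqrt (angle_speed2 t \<theta>)) \<le> 1"
  using x(2)[of t] angle_weight_pos[of \<theta>] by (simp add: angle_speed2_def less_imp_le)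

lemma angle_global_solution:
  obtains \<theta> where "\<And>t. start_angle \<le> \<theta> t" "\<And>t. \<theta> t < pi / 2" "\<And>t. 0 < angle_speed2 t (\<theta> t)"
    "\<And>t. (\<theta> has_real_derivative sqrt (angle_speed2 t (\<theta> t))) (at t)"
proof -
  have "\<exists>y. y (- real n) = start_angle \<and> (\<forall>t\<in>{- real n..real n}. start_angle \<le> y t \<and> y t < pi / 2 \<and> 0 < angle_speed2 t (y t) \<and>
    (y has_real_derivative sqrt (angle_speed2 t (y t))) (at t))" for n
  proof -
    have "- real n \<le> real n" by simp
    from angle_local_solution[OF this] show ?thesis by metis
  qed
  then obtain Y where Y0: "\<And>n. Y n (- real n) = start_angle"
    and Y: "\<And>n t. t \<in> {- real n..real n} \<Longrightarrow> start_angle \<le> Y n t \<and> Y n t < pi / 2 \<and> 0 < angle_speed2 t (Y n t) \<and>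
      (Y n has_real_derivative sqrt (angle_speed2 t (Y n t))) (at t)"
    by metis
  \<comment> \<open>At time \<open>- n\<close> the solution that started earlier is at or above
    \<open>start_angle\<close>. The speed decreases as the angle grows, so \<open>Y n\<close> cannot
    overtake it.\<close>
  have mono: "Y n t \<le> Y (Suc n) t" if t: "t \<in> {- real n..real n}" for n t
  proof -
    have sub: "s \<in> {- real (Suc n)..real (Suc n)}" if "s \<in> {- real n..real n}" for s using that by auto
    have "Y n t - Y (Suc n) t \<le> 0"
    proof (rule nonpos_of_derivative_nonpos_where_pos[OF _ _ _ t, where D = "\<lambda>t. Y n t - Y (Suc n) t"
          and D' = "\<lambda>t. sqrt (angle_speed2 t (Y n t)) - sqrt (angle_speed2 t (Y (Suc n) t))"])
      fix s assume s: "s \<in> {- real n..real n}"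
      note Ys = Y[OF s] Y[OF sub[OF s]]
      show "((\<lambda>t. Y n t - Y (Suc n) t) has_real_derivative sqrt (angle_speed2 s (Y n s)) - sqrt (angle_speed2 s (Y (Suc n) s))) (at s)"
        using Ys by (auto intro: DERIV_diff)
      assume "0 < Y n s - Y (Suc n) s"
      then have "angle_weight (Y (Suc n) s) \<le> angle_weight (Y n s)" using Ys by (intro angle_weight_mono) auto
      then have "x s * angle_weight (Y (Suc n) s) \<le> x s * angle_weight (Y n s)" using x(2)[of s] by (intro mult_left_mono) auto
      then show "sqrt (angle_speed2 s (Y n s)) - sqrt (angle_speed2 s (Y (Suc n) s)) \<le> 0" by (simp add: angle_speed2_def)
    next
      have "- real n \<in> {- real (Suc n)..real (Suc n)}" by auto
      from Y[OF this] show "Y n (- real n) - Y (Suc n) (- real n) \<le> 0" by (simp add: Y0)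
    qed
    then show ?thesis by simp
  qed
  define m where "m t = nat \<lceil>\<bar>t\<bar>\<rceil>" for t :: real
  have m: "t \<in> {- real n..real n}" if "m t \<le> n" for t n
  proof -
    have "\<bar>t\<bar> \<le> real (m t)" unfolding m_def by linarith
    then show ?thesis using that by auto
  qed
  have "\<exists>L. (\<lambda>n. Y n t) \<longlonglongrightarrow> L" for t
  proof -
    have "incseq (\<lambda>k. Y (k + m t) t)"
    proof (rule incseq_SucI)
      show "Y (k + m t) t \<le> Y (Suc k + m t) t" for k using mono[OF m[of t "k + m t"]] by simp
    qed
    moreover have "\<forall>k. Y (k + m t) t \<le> pi / 2" using Y[OF m[of t "_ + m t"]] by (simp add: less_imp_le)
    ultimately obtain L where "(\<lambda>k. Y (k + m t) t) \<longlonglongrightarrow> L" using incseq_convergent by metis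
    then show ?thesis using LIMSEQ_offset[of "\<lambda>n. Y n t"] by blast
  qed
  then obtain \<theta> where lim: "\<And>t. (\<lambda>n. Y n t) \<longlonglongrightarrow> \<theta> t" by metis
  have ev: "\<forall>\<^sub>F n in sequentially. start_angle \<le> Y n t \<and> Y n t < pi / 2 \<and> 0 < angle_speed2 t (Y n t)" for t
    using eventually_ge_at_top[of "m t"] by eventually_elim (use Y m in blast)
  have ge: "start_angle \<le> \<theta> t" for t
    by (rule tendsto_lowerbound[OF lim]) (use ev[of t] in \<open>auto elim: eventually_mono\<close>)
  have le: "\<theta> t \<le> pi / 2" for t
    by (rule tendsto_upperbound[OF lim]) (use ev[of t] in \<open>auto elim: eventually_mono simp: less_imp_le\<close>)
  have less: "\<theta> t < pi / 2" for t
  proof -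
    \<comment> \<open>The strict inequality \<open>Y n t < pi / 2\<close> could be lost in the
      limit, but the bound \<open>x t \<le> (cos (Y n t))\<^sup>2\<close> is closed and excludes
      \<open>pi / 2\<close>.\<close>
    have "(\<lambda>n. (cos (Y n t))\<^sup>2) \<longlonglongrightarrow> (cos (\<theta> t))\<^sup>2" by (intro tendsto_intros lim)
    moreover have "\<forall>\<^sub>F n in sequentially. x t \<le> (cos (Y n t))\<^sup>2"
      using ev[of t] by eventually_elim (use angle_speed2_pos_imp_less in auto)
    ultimately have "x t \<le> (cos (\<theta> t))\<^sup>2" by (rule tendsto_lowerbound) simp
    then have "cos (\<theta> t) \<noteq> 0" using x(2)[of t] by auto
    then have "\<theta> t \<noteq> pi / 2" by (metis cos_pi_half)
    with le[of t] show ?thesis by simp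
  qed
  have Vlim: "(\<lambda>n. angle_speed2 t (Y n t)) \<longlonglongrightarrow> angle_speed2 t (\<theta> t)" for t
    unfolding angle_speed2_def
    by (intro tendsto_intros isCont_tendsto_compose[OF DERIV_isCont[OF angle_weight_has_derivative[OF ge less]] lim])
  have V0: "0 \<le> angle_speed2 t (\<theta> t)" for t
    by (rule tendsto_lowerbound[OF Vlim]) (use ev[of t] in \<open>auto elim: eventually_mono simp: less_imp_le\<close>)
  define g where "g s = sqrt (angle_speed2 s (\<theta> s))" for s
  \<comment> \<open>Only pointwise convergence is known, so the limit passes through the integral
    form of the equation, by dominated convergence with the speeds bounded by 1.\<close>
  have int: "g integrable_on {\<alpha>..\<beta>}" "\<theta> \<beta> - \<theta> \<alpha> = integral {\<alpha>..\<beta>} g" if ab: "\<alpha> \<le> \<beta>" for \<alpha> \<beta>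
  proof -
    define n0 where "n0 = max (m \<alpha>) (m \<beta>)"
    have sub: "s \<in> {- real (k + n0)..real (k + n0)}" if "s \<in> {\<alpha>..\<beta>}" for s k
      using m[of \<alpha> n0] m[of \<beta> n0] that by (auto simp: n0_def)
    have hi: "((\<lambda>s. sqrt (angle_speed2 s (Y (k + n0) s))) has_integral (Y (k + n0) \<beta> - Y (k + n0) \<alpha>)) {\<alpha>..\<beta>}" for k
    proof (rule fundamental_theorem_of_calculus[OF ab])
      fix s assume "s \<in> {\<alpha>..\<beta>}"
      then show "(Y (k + n0) has_vector_derivative sqrt (angle_speed2 s (Y (k + n0) s))) (at s within {\<alpha>..\<beta>})"
        using Y[OF sub] by (auto simp flip: has_real_derivative_iff_has_vector_derivative
            intro: has_field_derivative_at_within)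
    qed
    have dc: "norm (sqrt (angle_speed2 s (Y (k + n0) s))) \<le> (\<lambda>_. 1) s" "(\<lambda>k. sqrt (angle_speed2 s (Y (k + n0) s))) \<longlonglongrightarrow> g s"
      if s: "s \<in> {\<alpha>..\<beta>}" for s k
    proof -
      show "norm (sqrt (angle_speed2 s (Y (k + n0) s))) \<le> (\<lambda>_. 1) s" using Y[OF sub[OF s, of k]] angle_speed_le_1 by auto
      have "(\<lambda>n. sqrt (angle_speed2 s (Y n s))) \<longlonglongrightarrow> g s" unfolding g_def by (intro tendsto_intros Vlim)
      then show "(\<lambda>k. sqrt (angle_speed2 s (Y (k + n0) s))) \<longlonglongrightarrow> g s" by (rule LIMSEQ_ignore_initial_segment)
    qed
    note d = dominated_convergence[OF has_integral_integrable[OF hi] integrable_const_ivl[of 1 \<alpha> \<beta>] dc]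
    show "g integrable_on {\<alpha>..\<beta>}" using d(1) by simp
    have "(\<lambda>k. Y (k + n0) \<beta> - Y (k + n0) \<alpha>) \<longlonglongrightarrow> integral {\<alpha>..\<beta>} g"
      using d(2) integral_unique[OF hi] by simp
    moreover have "(\<lambda>k. Y (k + n0) \<beta> - Y (k + n0) \<alpha>) \<longlonglongrightarrow> \<theta> \<beta> - \<theta> \<alpha>"
      by (intro tendsto_diff LIMSEQ_ignore_initial_segment lim)
    ultimately show "\<theta> \<beta> - \<theta> \<alpha> = integral {\<alpha>..\<beta>} g" using LIMSEQ_unique by blast
  qed
  \<comment> \<open>The integral form makes \<open>\<theta>\<close> continuous, hence
    \<open>g\<close> continuous, and the fundamental theorem recovers the differential
    equation.\<close>
  have der: "(\<theta> has_real_derivative g t) (at t)" for t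
  proof -
    let ?J = "{t - 1..t + 1}"
    have eq: "\<theta> s = \<theta> (t - 1) + integral {t - 1..s} g" if "s \<in> ?J" for s
      using int(2)[of "t - 1" s] that by simp
    have "continuous_on ?J (\<lambda>s. \<theta> (t - 1) + integral {t - 1..s} g)"
      using int(1)[of "t - 1" "t + 1"] by (intro continuous_intros indefinite_integral_continuous_1) auto
    then have c\<theta>: "continuous_on ?J \<theta>" by (rule continuous_on_eq) (rule eq[symmetric])
    have "continuous_on {start_angle..<pi / 2} angle_weight"
      by (rule DERIV_continuous_on[where D = angle_weight', OF has_field_derivative_at_within[OF angle_weight_has_derivative]]) simp_all
    then have "continuous_on ?J (\<lambda>s. angle_weight (\<theta> s))"
      by (rule continuous_on_compose2[OF _ c\<theta>]) (use ge less in auto)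
    then have "continuous_on ?J g"
      unfolding g_def angle_speed2_def using continuous_on_subset[OF smooth_on_imp_continuous_on[OF x(1)] subset_UNIV]
      by (intro continuous_intros)
    from integral_has_real_derivative[OF this, of t]
    have "((\<lambda>s. \<theta> (t - 1) + integral {t - 1..s} g) has_real_derivative g t) (at t within ?J)"
      by (auto intro!: derivative_eq_intros)
    then have "(\<theta> has_vector_derivative g t) (at t within ?J)"
      unfolding has_real_derivative_iff_has_vector_derivative
      by (intro has_vector_derivative_transform[OF _ eq]) auto
    moreover have "at t within ?J = at t" by (rule at_within_interior) simp
    ultimately show ?thesis by (simp add: has_real_derivative_iff_has_vector_derivative)
  qed
  \<comment> \<open>If the radicand vanished, the angle would be momentarily at rest and the
    radicand would have derivative \<open>- deriv x t * angle_weight (\<theta> t) > 0\<close>. It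
    would then be negative just before, against \<open>V0\<close>.\<close>
  have "0 < angle_speed2 t (\<theta> t)" for t
  proof (rule ccontr)
    assume "\<not> 0 < angle_speed2 t (\<theta> t)"
    then have z: "angle_speed2 t (\<theta> t) = 0" using V0[of t] by simp
    have "g t = 0" by (simp add: g_def z)
    with angle_speed2_has_derivative[OF der ge less, of t]
    have "((\<lambda>s. angle_speed2 s (\<theta> s)) has_real_derivative - (deriv x t * angle_weight (\<theta> t))) (at t)" by simp
    moreover have "0 < - (deriv x t * angle_weight (\<theta> t))"
      using x(3)[of t] angle_weight_pos[OF ge less, of t] by (simp add: mult_neg_pos)
    ultimately have "\<exists>e>0. \<forall>h>0. h < e \<longrightarrow> angle_speed2 (t - h) (\<theta> (t - h)) < angle_speed2 t (\<theta> t)"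
      by (rule DERIV_pos_inc_left)
    then obtain e where e: "0 < e" "\<And>h. 0 < h \<Longrightarrow> h < e \<Longrightarrow> angle_speed2 (t - h) (\<theta> (t - h)) < angle_speed2 t (\<theta> t)"
      by auto
    from e(2)[of "e / 2"] e(1) show False using z V0[of "t - e / 2"] by simp
  qed
  then show ?thesis using that ge less der unfolding g_def by blast
qed

lemma magnitude_exists:
  obtains a where "admissible UNIV a" "\<And>t. R_of UNIV a t * (a t)\<^sup>2 = x t * Q_of c a t"
proof -
  note I = dense_axes_UNIV
  obtain \<theta> where \<theta>: "\<And>t. start_angle \<le> \<theta> t" "\<And>t. \<theta> t < pi / 2" "\<And>t. 0 < angle_speed2 t (\<theta> t)"
    "\<And>t. (\<theta> has_real_derivative sqrt (angle_speed2 t (\<theta> t))) (at t)"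
    using angle_global_solution by blast
  have pos: "0 < cos (\<theta> t)" "0 < sin (\<theta> t)" "cos (\<theta> t) < 1" for t
  proof -
    \<comment> \<open>Strict increase on the whole line lifts \<open>\<theta>\<close> strictly above
      \<open>start_angle\<close>. For \<open>c = 0\<close>, where that angle is 0, this is what
      gives \<open>sin (\<theta> t) > 0\<close> and a magnitude below 1.\<close>
    have "\<theta> (t - 1) < \<theta> t"
      by (rule DERIV_pos_imp_increasing) (use \<theta>(3,4) in \<open>auto intro!: exI\<close>)
    then have gt: "0 < \<theta> t" using \<theta>(1)[of "t - 1"] start_angle_bounds(1) by linarith
    then show "0 < sin (\<theta> t)" using \<theta>(2)[of t] by (intro sin_gt_zero) auto
    show "0 < cos (\<theta> t)" using trig_pos(1)[OF \<theta>(1,2)] .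
    show "cos (\<theta> t) < 1" using cos_monotone_0_pi[of 0 "\<theta> t"] gt \<theta>(2)[of t] pi_gt_zero by auto
  qed
  have n: "cos (\<theta> t) \<noteq> 0" "sin (\<theta> t) \<noteq> 0" for t using pos[of t] by auto
  have Ck: "Ck_on n UNIV \<theta>" for n
  proof (induction n)
    case 0
    show ?case using \<theta>(4) by (auto intro!: continuous_at_imp_continuous_on DERIV_isCont)
  next
    case (Suc n)
    have "Ck_on n UNIV (\<lambda>t. sqrt (1 - x t * (1 / (cos (\<theta> t))\<^sup>2 + c\<^sup>2 / (sin (\<theta> t))\<^sup>2)))"
      using \<theta>(3) by (intro Ck_intros I Suc smooth_onD[OF x(1)]) (auto simp: n angle_speed2_def angle_weight_def)
    then show ?case
      using \<theta>(4) by (intro Ck_on_vector_SucI[OF I])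
        (auto simp: angle_speed2_def angle_weight_def has_real_derivative_iff_has_vector_derivative)
  qed
  define a where "a t = cos (\<theta> t)" for t
  have sm: "smooth_on UNIV a"
    unfolding smooth_on_def a_def[abs_def] by (intro allI Ck_on_cos I Ck)
  have "(a has_vector_derivative - (sin (\<theta> t) * sqrt (angle_speed2 t (\<theta> t)))) (at t)" for t
    unfolding a_def[abs_def] has_real_derivative_iff_has_vector_derivative[symmetric]
    by (auto intro!: derivative_eq_intros \<theta>(4))
  then have a': "cder UNIV a t = - (sin (\<theta> t) * sqrt (angle_speed2 t (\<theta> t)))" for t
    using cder_eqI[OF I] by auto
  have R: "R_of UNIV a t = (sin (\<theta> t))\<^sup>2 * (x t * angle_weight (\<theta> t))" for t
  proof -
    have "R_of UNIV a t = (sin (\<theta> t))\<^sup>2 - (sin (\<theta> t))\<^sup>2 * angle_speed2 t (\<theta> t)"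
      using \<theta>(3)[of t] by (simp add: R_of_def a' a_def power_mult_distrib sin_squared_eq)
    then show ?thesis by (simp add: angle_speed2_def algebra_simps)
  qed
  have "R_of UNIV a t * (a t)\<^sup>2 = x t * Q_of c a t" for t
  proof -
    have "R_of UNIV a t * (a t)\<^sup>2 = x t * ((sin (\<theta> t))\<^sup>2 + c\<^sup>2 * (cos (\<theta> t))\<^sup>2)"
      unfolding R a_def angle_weight_def using n[of t] by (simp add: field_simps)
    then show ?thesis by (simp add: Q_of_def a_def sin_squared_eq algebra_simps)
  qed
  moreover have "admissible UNIV a"
    unfolding admissible_def using sm pos x(2) angle_weight_pos[OF \<theta>(1,2)] by (auto simp: R a_def[of "_::real"] n intro!: mult_pos_pos)
  ultimately show ?thesis using that by blast
qed

end

section \<open>From the angle back to the volume factor\<close>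

lemma vol_of_eqI:
  assumes a: "admissible UNIV a" and \<epsilon>: "0 < \<epsilon>" and F: "0 < F t"
    and e: "R_of UNIV a t * (a t)\<^sup>2 = \<epsilon> / (F t)\<^sup>2 * Q_of c a t"
  shows "vol_of c \<epsilon> UNIV a t = F t"
proof (rule power2_eq_imp_eq)
  note I = dense_axes_UNIV
  have "0 < Q_of c a t" by (rule Q_of_pos[OF I a UNIV_I])
  then show "(vol_of c \<epsilon> UNIV a t)\<^sup>2 = (F t)\<^sup>2"
    using vol_of_square[OF I a \<epsilon> UNIV_I, of c t] \<epsilon> F
    unfolding mult.commute[of "(a t)\<^sup>2"] e by simp
  show "0 \<le> vol_of c \<epsilon> UNIV a t" using vol_of_pos[OF I a \<epsilon> UNIV_I, of c t] by simp
qed (use F in simp)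

lemma magnitude_of_increasing_volume:
  assumes \<epsilon>: "0 < \<epsilon>" and F: "smooth_on UNIV F" "\<And>t. 0 < F t" "\<And>t. 0 < deriv F t"
    and big: "\<And>t. sqrt \<epsilon> * (1 + \<bar>c\<bar>) < F t"
  obtains a where "admissible UNIV a" "\<And>t. R_of UNIV a t * (a t)\<^sup>2 = \<epsilon> / (F t)\<^sup>2 * Q_of c a t"
proof (rule magnitude_exists[of \<epsilon> "\<lambda>t. \<epsilon> / (F t)\<^sup>2" c])
  note I = dense_axes_UNIV
  have n: "F t \<noteq> 0" for t using F(2)[of t] by simp
  show "smooth_on UNIV (\<lambda>t. \<epsilon> / (F t)\<^sup>2)"
    unfolding smooth_on_def by (intro allI Ck_intros I smooth_onD[OF F(1)]) (simp add: n)
  show "0 < \<epsilon> / (F t)\<^sup>2" for t using \<epsilon> F(2)[of t] by simp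
  note F' = smooth_UNIV_deriv(2)[OF F(1)]
  show "deriv (\<lambda>t. \<epsilon> / (F t)\<^sup>2) t < 0" for t
  proof -
    have "((\<lambda>t. \<epsilon> / (F t)\<^sup>2) has_real_derivative - (2 * \<epsilon> * deriv F t / F t ^ 3)) (at t)"
      using n by (auto intro!: derivative_eq_intros F' simp: power2_eq_square power3_eq_cube field_simps)
    then show ?thesis using \<epsilon> F(2)[of t] F(3)[of t] by (simp add: DERIV_imp_deriv)
  qed
  show "\<epsilon> / (F t)\<^sup>2 * (1 + \<bar>c\<bar>)\<^sup>2 < 1" for t
  proof -
    have "(sqrt \<epsilon> * (1 + \<bar>c\<bar>))\<^sup>2 < (F t)\<^sup>2" using big[of t] \<epsilon> by (intro power_strict_mono) auto
    then show ?thesis using \<epsilon> F(2)[of t] by (simp add: power_mult_distrib)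
  qed
qed (use \<epsilon> that in auto)

lemma magnitude_of_monotone_volume:
  assumes \<epsilon>: "0 < \<epsilon>" and F: "smooth_on UNIV F" "\<And>t. 0 < F t" "\<And>t. deriv F t \<noteq> 0"
    and big: "\<And>t. sqrt \<epsilon> * (1 + \<bar>c\<bar>) < F t"
  obtains a where "admissible UNIV a" "\<And>t. vol_of c \<epsilon> UNIV a t = F t"
proof -
  note I = dense_axes_UNIV
  note F' = smooth_UNIV_deriv(2)[OF F(1)]
  have cF': "continuous_on UNIV (deriv F)"
    using smooth_on_imp_continuous_on[OF smooth_on_has_vector_derivative(2)[OF I F(1)]]
    by (simp add: smooth_UNIV_deriv(1)[OF F(1)])
  consider "\<forall>t. 0 < deriv F t" | "\<forall>t. deriv F t < 0"
  proof (cases "\<exists>s. 0 < deriv F s")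
    case True
    then obtain s where s: "0 < deriv F s" by blast
    have "0 < deriv F t" for t
    proof (rule ccontr)
      assume "\<not> 0 < deriv F t"
      then have t: "deriv F t < 0" using F(3)[of t] by (simp add: not_less order_less_le)
      have "connected (deriv F ` UNIV)" by (rule connected_continuous_image[OF cF' connected_UNIV])
      then have "0 \<in> range (deriv F)"
        using s t unfolding connected_iff_interval by (meson less_imp_le rangeI)
      then show False using F(3) by force
    qed
    then show ?thesis using that by blast
  next
    case False
    then show ?thesis using that F(3) by (meson linorder_neqE)
  qed
  then show ?thesis
  proof cases
    case 1
    then obtain a where "admissible UNIV a" "\<And>t. R_of UNIV a t * (a t)\<^sup>2 = \<epsilon> / (F t)\<^sup>2 * Q_of c a t"
      using magnitude_of_increasing_volume[OF \<epsilon> F(1,2) _ big] by blast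
    then show ?thesis using that vol_of_eqI[where F = F, OF _ \<epsilon> F(2)] by blast
  next
    case 2
    have "smooth_on UNIV (\<lambda>t. F (- t))"
      unfolding smooth_on_def
      by (intro allI Ck_on_comp_linear[OF I _ _ smooth_onD[OF F(1)]]
          bounded_linear_minus[OF bounded_linear_ident]) auto
    moreover have "deriv (\<lambda>t. F (- t)) t = - deriv F (- t)" for t
      using DERIV_chain2[OF F'[of "- t"] DERIV_minus[OF DERIV_ident]] by (intro DERIV_imp_deriv) simp
    ultimately obtain b where b: "admissible UNIV b" "\<And>t. R_of UNIV b t * (b t)\<^sup>2 = \<epsilon> / (F (- t))\<^sup>2 * Q_of c b t"
      using magnitude_of_increasing_volume[of \<epsilon> "\<lambda>t. F (- t)" c] \<epsilon> F(2) 2 big by (metis neg_0_less_iff_less)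
    define a where "a t = b (- t)" for t
    have sa: "smooth_on UNIV a"
      unfolding smooth_on_def a_def[abs_def]
      by (intro allI Ck_on_comp_linear[OF I _ _ smooth_onD[OF admissible_smooth(1)[OF I b(1)]]]
          bounded_linear_minus[OF bounded_linear_ident]) auto
    have "(b has_real_derivative cder UNIV b t) (at t)" for t
      using smooth_on_has_real_derivative[OF I admissible_smooth(1)[OF I b(1)], of t] by simp
    from DERIV_chain2[OF this DERIV_minus[OF DERIV_ident]]
    have "(a has_vector_derivative - cder UNIV b (- t)) (at t)" for t
      by (simp add: a_def[abs_def] flip: has_real_derivative_iff_has_vector_derivative)
    then have "cder UNIV a t = - cder UNIV b (- t)" for t using cder_eqI[OF I] by auto
    \<comment> \<open>Reversal flips the sign of \<open>a'\<close>, which enters \<open>R\<close>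
      squared.\<close>
    then have R: "R_of UNIV a t = R_of UNIV b (- t)" for t by (simp add: R_of_def a_def)
    have adm: "admissible UNIV a"
      using b(1) sa by (simp add: admissible_def R a_def[of "_::real"])
    have "R_of UNIV a t * (a t)\<^sup>2 = \<epsilon> / (F t)\<^sup>2 * Q_of c a t" for t
      using b(2)[of "- t"] by (simp add: R a_def Q_of_def)
    then show ?thesis using that[OF adm] vol_of_eqI[where F = F, OF adm \<epsilon> F(2)] by blast
  qed
qed

section \<open>The lower bound for the volume factor and its sharpness\<close>

context
  fixes M1 :: "('e1::euclidean_space, 'm1::{t2_space, second_countable_topology}) riem"
    and M2 :: "('e2::euclidean_space, 'm2::{t2_space, second_countable_topology}) riem"
    and f1 :: "'m1 \<Rightarrow> complex ^ 'n1" and f2 :: "'m2 \<Rightarrow> complex ^ 'n2"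
    and d1 d2 c \<epsilon> \<sigma> :: real
  assumes M: "riemannian_manifold M1" "riemannian_manifold M2"
    and f: "eigenmap M1 f1 d1" "eigenmap M2 f2 d2" and \<epsilon>: "0 < \<epsilon>" and \<sigma>: "\<sigma> \<in> {-1, 1}"
begin

lemma normalized_product_volume_bound:
  assumes n: "normalized_product M1 M2 f1 f2 c \<epsilon> \<sigma> UNIV a b s1 s2 l1 l2"
  shows "sqrt \<epsilon> * (1 + \<bar>c\<bar>) \<le> volume_factor DIM('e1) DIM('e2) l1 l2 t"
proof -
  let ?V = "volume_factor DIM('e1) DIM('e2) l1 l2 t"
  define u v where "u = (a t)\<^sup>2" and "v = (b t)\<^sup>2"
  note nv = normalized_product_vol[OF M f \<epsilon> \<sigma> dense_axes_UNIV n UNIV_I, of t]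
  have "0 < a t" "0 < b t" "(a t)\<^sup>2 + (b t)\<^sup>2 = 1"
    using n unfolding normalized_product_def by auto
  then have ab: "0 < u" "0 < v" "u + v = 1" by (simp_all add: u_def v_def)
  have R: "R_of UNIV a t \<le> v"
    using ab(3) zero_le_power2[of "cder UNIV a t"] unfolding R_of_def u_def by linarith
  have Q: "Q_of c a t = v + c\<^sup>2 * u" using ab by (simp add: Q_of_def u_def[symmetric] algebra_simps)
  have "?V\<^sup>2 * u * R_of UNIV a t \<le> ?V\<^sup>2 * u * v" using R ab by (intro mult_left_mono) auto
  then have 1: "\<epsilon> * (v + c\<^sup>2 * u) \<le> ?V\<^sup>2 * (u * v)" using nv(2) by (simp add: u_def[symmetric] Q mult.assoc)
  \<comment> \<open>This square is the defect in the bound. It vanishes when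
    \<open>v = \<bar>c\<bar> * u\<close>, which is the magnitude \<open>cos start_angle\<close> of
    the construction.\<close>
  have "0 \<le> (v - \<bar>c\<bar> * u)\<^sup>2" by simp
  also have "\<dots> = (v + c\<^sup>2 * u) * (u + v) - (1 + \<bar>c\<bar>)\<^sup>2 * (u * v)"
    by (simp add: power2_eq_square algebra_simps)
  finally have "(1 + \<bar>c\<bar>)\<^sup>2 * (u * v) \<le> v + c\<^sup>2 * u" using ab(3) by simp
  then have "\<epsilon> * ((1 + \<bar>c\<bar>)\<^sup>2 * (u * v)) \<le> \<epsilon> * (v + c\<^sup>2 * u)" using \<epsilon> by (intro mult_left_mono) auto
  with 1 have "(\<epsilon> * (1 + \<bar>c\<bar>)\<^sup>2) * (u * v) \<le> ?V\<^sup>2 * (u * v)" by (simp add: mult.assoc)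
  then have "\<epsilon> * (1 + \<bar>c\<bar>)\<^sup>2 \<le> ?V\<^sup>2" using ab by (simp add: mult_le_cancel_right)
  then have "(sqrt \<epsilon> * (1 + \<bar>c\<bar>))\<^sup>2 \<le> ?V\<^sup>2" using \<epsilon> by (simp add: power_mult_distrib)
  then show ?thesis using nv(1) by (auto intro: power2_le_imp_le[OF _ less_imp_le])
qed

lemma prescribed_volume_iff:
  assumes F: "smooth_on UNIV F" "\<And>t::real. 0 < F t" "\<And>t. deriv F t \<noteq> 0"
  shows "(\<exists>a b s1 s2 l1 l2. normalized_product M1 M2 f1 f2 c \<epsilon> \<sigma> UNIV a b s1 s2 l1 l2 \<and>
            (\<forall>t. volume_factor DIM('e1) DIM('e2) l1 l2 t = F t))
         \<longleftrightarrow> sqrt \<epsilon> * (1 + \<bar>c\<bar>) \<le> (INF t. F t)"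
proof
  assume "\<exists>a b s1 s2 l1 l2. normalized_product M1 M2 f1 f2 c \<epsilon> \<sigma> UNIV a b s1 s2 l1 l2 \<and>
            (\<forall>t. volume_factor DIM('e1) DIM('e2) l1 l2 t = F t)"
  then have "sqrt \<epsilon> * (1 + \<bar>c\<bar>) \<le> F t" for t using normalized_product_volume_bound by metis
  then show "sqrt \<epsilon> * (1 + \<bar>c\<bar>) \<le> (INF t. F t)" by (intro cINF_greatest) auto
next
  note I = dense_axes_UNIV
  assume le: "sqrt \<epsilon> * (1 + \<bar>c\<bar>) \<le> (INF t. F t)"
  have bb: "bdd_below (range F)" using F(2) by (intro bdd_belowI[of _ 0]) (auto simp: less_imp_le)
  note F' = smooth_UNIV_deriv(2)[OF F(1)]
  \<comment> \<open>Equality would make \<open>t\<close> a minimum of \<open>F\<close>, hence a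
    critical point.\<close>
  have "sqrt \<epsilon> * (1 + \<bar>c\<bar>) < F t" for t
  proof (rule ccontr)
    assume "\<not> sqrt \<epsilon> * (1 + \<bar>c\<bar>) < F t"
    then have "F t \<le> F s" for s using le cINF_lower[OF bb, of s] by simp
    then have "deriv F t = 0" using DERIV_local_min[OF F', of 1 t] by simp
    then show False using F(3) by simp
  qed
  then obtain a where a: "admissible UNIV a" "\<And>t. vol_of c \<epsilon> UNIV a t = F t"
    using magnitude_of_monotone_volume[OF \<epsilon> F] by metis
  have k: "0 < DIM('e1)" "0 < DIM('e2)" by auto
  note d = eigenvalues_pos[OF M f \<epsilon> \<sigma>]
  obtain b s1 s2 l1 l2 where r: "reconstruction DIM('e1) DIM('e2) d1 d2 c \<epsilon> \<sigma> UNIV a b s1 s2 l1 l2"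
    using reconstruction_exists[OF is_interval_univ _ a(1) \<epsilon> d k, of c \<sigma>] by (metis UNIV_not_empty interior_UNIV)
  have "normalized_product M1 M2 f1 f2 c \<epsilon> \<sigma> UNIV a b s1 s2 l1 l2"
    using normalized_product_iff_reconstruction[OF M f \<epsilon> \<sigma> I a(1)] r by blast
  moreover have "volume_factor DIM('e1) DIM('e2) l1 l2 t = F t" for t
    using reconstruction_smooth(6)[OF I a(1) \<epsilon> d k r, of t] a(2) by simp
  ultimately show "\<exists>a b s1 s2 l1 l2. normalized_product M1 M2 f1 f2 c \<epsilon> \<sigma> UNIV a b s1 s2 l1 l2 \<and>
            (\<forall>t. volume_factor DIM('e1) DIM('e2) l1 l2 t = F t)" by blast
qed

end

theorem theoremB:
  fixes M1 :: "('e1::euclidean_space, 'm1::{t2_space, second_countable_topology}) riem"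
    and M2 :: "('e2::euclidean_space, 'm2::{t2_space, second_countable_topology}) riem"
    and f1 :: "'m1 \<Rightarrow> complex ^ 'n1" and f2 :: "'m2 \<Rightarrow> complex ^ 'n2"
    and d1 d2 c \<epsilon> \<sigma> :: real
  assumes "riemannian_manifold M1" and "riemannian_manifold M2"
    and "eigenmap M1 f1 d1" and "eigenmap M2 f2 d2"
    and "0 < \<epsilon>" and "\<sigma> \<in> {-1, 1}"
  shows
    "(\<forall>I a. is_interval I \<and> interior I \<noteq> {} \<and> admissible I a \<longrightarrow>
        (\<exists>b s1 s2 l1 l2.
           normalized_product M1 M2 f1 f2 c \<epsilon> \<sigma> I a b s1 s2 l1 l2 \<and>
           (\<forall>b' s1' s2' l1' l2'.
              normalized_product M1 M2 f1 f2 c \<epsilon> \<sigma> I a b' s1' s2' l1' l2' \<longleftrightarrow>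
              (\<forall>t\<in>I. b' t = b t \<and> l1' t = l1 t \<and> l2' t = l2 t) \<and>
              (\<exists>\<theta>1 \<theta>2. \<forall>t\<in>I. s1' t = s1 t + \<theta>1 \<and> s2' t = s2 t + \<theta>2))) \<and>
        (\<forall>b s1 s2 l1 l2.
           normalized_product M1 M2 f1 f2 c \<epsilon> \<sigma> I a b s1 s2 l1 l2 \<longleftrightarrow>
           reconstruction DIM('e1) DIM('e2) d1 d2 c \<epsilon> \<sigma> I a b s1 s2 l1 l2))
     \<and>
     (\<forall>(j::nat) l. j \<in> {1, 2} \<and> smooth_on UNIV l \<and> (\<forall>t::real. 0 < l t) \<and> c \<noteq> 0 \<longrightarrow>
        (\<forall>t0 a0 p0. 0 < a0 \<and> a0 < 1 \<and> 0 < 1 - a0\<^sup>2 - p0\<^sup>2 \<longrightarrow>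
           (\<exists>!a. admissible UNIV a \<and> a t0 = a0 \<and> deriv a t0 = p0 \<and>
              (\<exists>b s1 s2 l1 l2.
                 reconstruction DIM('e1) DIM('e2) d1 d2 c \<epsilon> \<sigma> UNIV a b s1 s2 l1 l2 \<and>
                 l = (if j = 1 then l1 else l2)))) \<and>
        (\<forall>a b s1 s2 l1 l2.
           admissible UNIV a \<and>
           reconstruction DIM('e1) DIM('e2) d1 d2 c \<epsilon> \<sigma> UNIV a b s1 s2 l1 l2 \<and>
           l = (if j = 1 then l1 else l2) \<and>
           complete_riem M1 \<and> complete_riem M2 \<longrightarrow>
           complete_riem (warped_product UNIV l1 l2 M1 M2)))
     \<and>
     (\<forall>F. smooth_on UNIV F \<and> (\<forall>t::real. 0 < F t) \<and> (\<forall>t. deriv F t \<noteq> 0) \<and> 0 < (INF t. F t) \<longrightarrow>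
        ((\<exists>a b s1 s2 l1 l2.
            normalized_product M1 M2 f1 f2 c \<epsilon> \<sigma> UNIV a b s1 s2 l1 l2 \<and>
            (\<forall>t. volume_factor DIM('e1) DIM('e2) l1 l2 t = F t))
         \<longleftrightarrow> sqrt \<epsilon> * (1 + \<bar>c\<bar>) \<le> (INF t. F t)))"
proof (intro conjI allI impI)
  note M = assms(1,2) and f = assms(3,4) and \<epsilon> = assms(5) and \<sigma> = assms(6)
  note d = eigenvalues_pos[OF M f \<epsilon> \<sigma>]
  have k: "0 < DIM('e1)" "0 < DIM('e2)" by auto
  fix I :: "real set" and a :: "real \<Rightarrow> real"
  assume "is_interval I \<and> interior I \<noteq> {} \<and> admissible I a"
  then have I: "is_interval I" "interior I \<noteq> {}" and a: "admissible I a" by auto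
  show "\<exists>b s1 s2 l1 l2. normalized_product M1 M2 f1 f2 c \<epsilon> \<sigma> I a b s1 s2 l1 l2 \<and>
      (\<forall>b' s1' s2' l1' l2'. normalized_product M1 M2 f1 f2 c \<epsilon> \<sigma> I a b' s1' s2' l1' l2' \<longleftrightarrow>
        (\<forall>t\<in>I. b' t = b t \<and> l1' t = l1 t \<and> l2' t = l2 t) \<and>
        (\<exists>\<theta>1 \<theta>2. \<forall>t\<in>I. s1' t = s1 t + \<theta>1 \<and> s2' t = s2 t + \<theta>2))"
    by (rule reconstruction_unique_up_to_rotations[OF M f \<epsilon> \<sigma> I a])
  show "normalized_product M1 M2 f1 f2 c \<epsilon> \<sigma> I a b s1 s2 l1 l2 \<longleftrightarrow>
      reconstruction DIM('e1) DIM('e2) d1 d2 c \<epsilon> \<sigma> I a b s1 s2 l1 l2" for b s1 s2 l1 l2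
    by (rule normalized_product_iff_reconstruction[OF M f \<epsilon> \<sigma> dense_axes_interval[OF I] a])
next
  note M = assms(1,2) and f = assms(3,4) and \<epsilon> = assms(5) and \<sigma> = assms(6)
  note d = eigenvalues_pos[OF M f \<epsilon> \<sigma>]
  have k: "0 < DIM('e1)" "0 < DIM('e2)" by auto
  fix j :: nat and l :: "real \<Rightarrow> real"
  assume "j \<in> {1, 2} \<and> smooth_on UNIV l \<and> (\<forall>t. 0 < l t) \<and> c \<noteq> 0"
  then have j: "j \<in> {1, 2}" and l: "smooth_on UNIV l" "\<And>t. 0 < l t" and c: "c \<noteq> 0" by auto
  show "\<exists>!a. admissible UNIV a \<and> a t0 = a0 \<and> deriv a t0 = p0 \<and>
      (\<exists>b s1 s2 l1 l2. reconstruction DIM('e1) DIM('e2) d1 d2 c \<epsilon> \<sigma> UNIV a b s1 s2 l1 l2 \<and>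
        l = (if j = 1 then l1 else l2))"
    if "0 < a0 \<and> a0 < 1 \<and> 0 < 1 - a0\<^sup>2 - p0\<^sup>2" for t0 a0 p0
    using prescribed_warp_ex1[OF d k \<epsilon> j l c] that by blast
  show "complete_riem (warped_product UNIV l1 l2 M1 M2)"
    if h: "admissible UNIV a \<and> reconstruction DIM('e1) DIM('e2) d1 d2 c \<epsilon> \<sigma> UNIV a b s1 s2 l1 l2 \<and>
      l = (if j = 1 then l1 else l2) \<and> complete_riem M1 \<and> complete_riem M2" for a b s1 s2 l1 l2
  proof -
    from h have a: "admissible UNIV a"
      and r: "reconstruction DIM('e1) DIM('e2) d1 d2 c \<epsilon> \<sigma> UNIV a b s1 s2 l1 l2"
      and cm: "complete_riem M1" "complete_riem M2" by auto
    note rs = reconstruction_smooth[OF dense_axes_UNIV a \<epsilon> d k r]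
    have "\<And>t. 0 < l1 t" "\<And>t. 0 < l2 t" using r unfolding reconstruction_def by auto
    from complete_warped_product[OF M smooth_on_imp_continuous_on[OF rs(2)] smooth_on_imp_continuous_on[OF rs(3)] this cm]
    show ?thesis .
  qed
next
  note M = assms(1,2) and f = assms(3,4) and \<epsilon> = assms(5) and \<sigma> = assms(6)
  fix F :: "real \<Rightarrow> real"
  assume "smooth_on UNIV F \<and> (\<forall>t. 0 < F t) \<and> (\<forall>t. deriv F t \<noteq> 0) \<and> 0 < (INF t. F t)"
  then have F: "smooth_on UNIV F" "\<And>t. 0 < F t" "\<And>t. deriv F t \<noteq> 0" by auto
  show "(\<exists>a b s1 s2 l1 l2. normalized_product M1 M2 f1 f2 c \<epsilon> \<sigma> UNIV a b s1 s2 l1 l2 \<and>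
            (\<forall>t. volume_factor DIM('e1) DIM('e2) l1 l2 t = F t))
         \<longleftrightarrow> sqrt \<epsilon> * (1 + \<bar>c\<bar>) \<le> (INF t. F t)"
    by (rule prescribed_volume_iff[OF M f \<epsilon> \<sigma> F])
qed

end
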